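(* Let $k$ be an algebraically closed field, let $m_1,\dots,m_n$ be a sequence of positive integers, and let $q=\{q_{ij}\in k^\times : 1\leq i<j\leq n\}$ be a collection of nonzero scalars. Let \[ A_q=k\langle x_1,\dots,x_n\rangle/\left(x_i^{m_i}\ (1\le i\le n),\ \ x_ix_j-q_{ij}x_jx_i\ (1\le i<j\le n)\right) \] be the corresponding quantum complete intersection with $n$ variables. Then $\mathrm{mt}\text{-}\mathrm{rank}(\mathrm{HH}^1(A_q))=n$.
   Context: For a finite dimensional $k$-algebra $A$, $\mathrm{HH}^1(A)=\mathrm{Der}(A)/\mathrm{Inn}(A)$ is the Lie algebra of $k$-linear derivations of $A$ modulo inner derivations. Tori and toral rank. If $\mathrm{char}\,k=0$: $\mathrm{HH}^1(A)$ is identified with the Lie algebra of the affine algebraic group $\mathrm{Out}(A)$ of outer automorphisms of $A$; a Lie subalgebra is a torus if it is the Lie algebra of a closed algebraic subgroup of $\mathrm{Out}(A)$ isomorphic to the group of invertible diagonal $r\times r$ matrices over $k$, for some $r$. If $\mathrm{char}\,k=p>0$: $\mathrm{HH}^1(A)$ is a restricted Lie algebra with $p$-power operation $x\mapsto x^{[p]}$ induced by $f\mapsto f^p$ on derivations; a torus is a restricted subalgebra that is abelian and each of whose elements $x$ is semisimple, i.e. $x$ lies in the restricted subalgebra generated by $x^{[p]}$. In both cases $\mathrm{mt}\text{-}\mathrm{rank}(\mathrm{HH}^1(A))$ is the maximal dimension of a torus in $\mathrm{HH}^1(A)$.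
   Formalization: The exponents m_i are required to be at least 2 rather than merely positive: if some m_i = 1 then x_i = 0 and the rank is the number of i with m_i ≥ 2, so the claim fails (n = 1, m_1 = 1 gives A = k and rank 0). *)

theory Defs
  imports
    "HOL-Algebra.QuotRing"
    "HOL-Algebra.Bij"
    "HOL-Library.Poly_Mapping"
    "Jordan_Normal_Form.VS_Connect"
begin

text \<open>
  A \<open>k\<close>-algebra is encoded as a record of type \<^typ>\<open>('k, 'a) module\<close>, with ring operations and
  a scalar multiplication; the ground field is the type \<^typ>\<open>'k\<close>, seen as a ring via
  \<^term>\<open>class_ring\<close>. (The locale \<^locale>\<open>algebra\<close> of HOL-Algebra is not used: it is
  restricted to commutative algebras.) Maps between carriers are extensional throughout, so that
  equality of maps is equality on the carrier.
\<close>

section \<open>Quantum complete intersections\<close>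

text \<open>A copy of \<^typ>\<open>nat list\<close> as a monoid under concatenation, so that \<open>fword \<Rightarrow>\<^sub>0 'k\<close> with
  the convolution product of \<^theory>\<open>HOL-Library.Poly_Mapping\<close> is a free associative algebra.\<close>

datatype fword = FWord (letters: "nat list")

instantiation fword :: monoid_add
begin
definition zero_fword :: fword where "0 = FWord []"
definition plus_fword :: "fword \<Rightarrow> fword \<Rightarrow> fword"
  where "u + v = FWord (letters u @ letters v)"
instance by standard (auto simp: zero_fword_def plus_fword_def)
end

definition free_algebra :: "nat \<Rightarrow> ('k::field, fword \<Rightarrow>\<^sub>0 'k) module"
  where "free_algebra n =
    \<lparr>carrier = {f. \<forall>w \<in> Poly_Mapping.keys f. set (letters w) \<subseteq> {1..n}},
     mult = (*), one = 1, zero = 0, add = (+),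
     smult = (\<lambda>c f. Poly_Mapping.single 0 c * f)\<rparr>"

definition free_gen :: "nat \<Rightarrow> fword \<Rightarrow>\<^sub>0 'k::field"
  where "free_gen i = Poly_Mapping.single (FWord [i]) 1"

text \<open>\<^term>\<open>M Quot I\<close> with the induced scalar multiplication.\<close>

definition quot_alg :: "('k::field, 'a) module \<Rightarrow> 'a set \<Rightarrow> ('k, 'a set) module"
  where "quot_alg M I =
    \<lparr>carrier = carrier (M Quot I), mult = mult (M Quot I), one = one (M Quot I),
     zero = zero (M Quot I), add = add (M Quot I),
     smult = (\<lambda>c X. \<Union>x\<in>X. I +>\<^bsub>M\<^esub> (c \<odot>\<^bsub>M\<^esub> x))\<rparr>"

definition qci_relations ::
  "nat \<Rightarrow> (nat \<Rightarrow> nat) \<Rightarrow> (nat \<Rightarrow> nat \<Rightarrow> 'k::field) \<Rightarrow> (fword \<Rightarrow>\<^sub>0 'k) set"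
  where "qci_relations n m q =
    {free_gen i ^ m i | i. 1 \<le> i \<and> i \<le> n} \<union>
    {free_gen i * free_gen j - q i j \<odot>\<^bsub>free_algebra n\<^esub> (free_gen j * free_gen i) | i j.
       1 \<le> i \<and> i < j \<and> j \<le> n}"

definition quantum_complete_intersection ::
  "nat \<Rightarrow> (nat \<Rightarrow> nat) \<Rightarrow> (nat \<Rightarrow> nat \<Rightarrow> 'k::field) \<Rightarrow> ('k, (fword \<Rightarrow>\<^sub>0 'k) set) module"
  where "quantum_complete_intersection n m q =
    quot_alg (free_algebra n) (Idl\<^bsub>free_algebra n\<^esub> (qci_relations n m q))"

section \<open>First Hochschild cohomology\<close>

definition derivations :: "('k::field, 'a) module \<Rightarrow> ('a \<Rightarrow> 'a) set"
  where "derivations A =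
    {f \<in> extensional (carrier A) \<inter> LinearCombinations.module_hom class_ring A A.
       \<forall>x \<in> carrier A. \<forall>y \<in> carrier A.
         f (x \<otimes>\<^bsub>A\<^esub> y) = (f x \<otimes>\<^bsub>A\<^esub> y) \<oplus>\<^bsub>A\<^esub> (x \<otimes>\<^bsub>A\<^esub> f y)}"

definition inner_derivations :: "('k::field, 'a) module \<Rightarrow> ('a \<Rightarrow> 'a) set"
  where "inner_derivations A =
    {\<lambda>x\<in>carrier A. (a \<otimes>\<^bsub>A\<^esub> x) \<ominus>\<^bsub>A\<^esub> (x \<otimes>\<^bsub>A\<^esub> a) | a. a \<in> carrier A}"

text \<open>Lie algebras use the same record type, with the Lie bracket as the \<^const>\<open>mult\<close> field; the
  field \<^const>\<open>one\<close> then carries no meaning.\<close>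

definition Der :: "('k::field, 'a) module \<Rightarrow> ('k, 'a \<Rightarrow> 'a) module"
  where "Der A =
    \<lparr>carrier = derivations A,
     mult = (\<lambda>f g. \<lambda>x\<in>carrier A. f (g x) \<ominus>\<^bsub>A\<^esub> g (f x)),
     one = (\<lambda>x\<in>carrier A. \<zero>\<^bsub>A\<^esub>),
     zero = (\<lambda>x\<in>carrier A. \<zero>\<^bsub>A\<^esub>),
     add = (\<lambda>f g. \<lambda>x\<in>carrier A. f x \<oplus>\<^bsub>A\<^esub> g x),
     smult = (\<lambda>c f. \<lambda>x\<in>carrier A. c \<odot>\<^bsub>A\<^esub> f x)\<rparr>"

definition HH1 :: "('k::field, 'a) module \<Rightarrow> ('k, ('a \<Rightarrow> 'a) set) module"
  where "HH1 A = quot_alg (Der A) (inner_derivations A)"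

section \<open>Tori in positive characteristic\<close>

text \<open>The class of \<open>f\<close> is sent to the class of the \<open>p\<close>-fold composite of \<open>f\<close>.\<close>

definition HH1_p_power ::
  "('k::field, 'a) module \<Rightarrow> ('a \<Rightarrow> 'a) set \<Rightarrow> ('a \<Rightarrow> 'a) set"
  where "HH1_p_power A X =
    (\<Union>f\<in>X. inner_derivations A +>\<^bsub>Der A\<^esub> (\<lambda>x\<in>carrier A. (f ^^ CHAR('k)) x))"

definition restricted_subalgebra ::
  "('k::field, 'a) module \<Rightarrow> ('a \<Rightarrow> 'a) set set \<Rightarrow> bool"
  where "restricted_subalgebra A T \<longleftrightarrow>
    LinearCombinations.submodule class_ring T (HH1 A) \<and>
    (\<forall>X\<in>T. \<forall>Y\<in>T. X \<otimes>\<^bsub>HH1 A\<^esub> Y \<in> T) \<and>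
    (\<forall>X\<in>T. HH1_p_power A X \<in> T)"

definition restricted_span ::
  "('k::field, 'a) module \<Rightarrow> ('a \<Rightarrow> 'a) set set \<Rightarrow> ('a \<Rightarrow> 'a) set set"
  where "restricted_span A S = \<Inter>{T. restricted_subalgebra A T \<and> S \<subseteq> T}"

definition torus_char_p :: "('k::field, 'a) module \<Rightarrow> ('a \<Rightarrow> 'a) set set \<Rightarrow> bool"
  where "torus_char_p A T \<longleftrightarrow>
    restricted_subalgebra A T \<and>
    (\<forall>X\<in>T. \<forall>Y\<in>T. X \<otimes>\<^bsub>HH1 A\<^esub> Y = \<zero>\<^bsub>HH1 A\<^esub>) \<and>
    (\<forall>X\<in>T. X \<in> restricted_span A {HH1_p_power A X})"

section \<open>Affine algebraic groups\<close>

text \<open>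
  An affine algebraic group (as a variety over an algebraically closed field) is given by its group
  of points together with its coordinate ring, a \<open>k\<close>-algebra of functions on the points.
\<close>

record ('g, 'k) alg_group = "'g monoid" +
  regular :: "('g \<Rightarrow> 'k) set"

text \<open>The \<open>k\<close>-algebra of functions on \<open>X\<close> generated by the restrictions to \<open>X\<close> of the
  functions in \<open>S\<close>.\<close>

inductive_set generated_functions :: "'g set \<Rightarrow> ('g \<Rightarrow> 'k::field) set \<Rightarrow> ('g \<Rightarrow> 'k) set"
  for X :: "'g set" and S :: "('g \<Rightarrow> 'k) set" where
  const: "(\<lambda>x\<in>X. c) \<in> generated_functions X S"
| gen: "f \<in> S \<Longrightarrow> restrict f X \<in> generated_functions X S"
| add: "f \<in> generated_functions X S \<Longrightarrow> g \<in> generated_functions X S \<Longrightarrow>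
    (\<lambda>x\<in>X. f x + g x) \<in> generated_functions X S"
| mult: "f \<in> generated_functions X S \<Longrightarrow> g \<in> generated_functions X S \<Longrightarrow>
    (\<lambda>x\<in>X. f x * g x) \<in> generated_functions X S"

definition closed_subgroup :: "'g set \<Rightarrow> ('g, 'k::field) alg_group \<Rightarrow> bool"
  where "closed_subgroup H G \<longleftrightarrow>
    subgroup H G \<and> (\<exists>S \<subseteq> regular G. H = {x \<in> carrier G. \<forall>f\<in>S. f x = 0})"

definition alg_subgroup :: "('g, 'k::field) alg_group \<Rightarrow> 'g set \<Rightarrow> ('g, 'k) alg_group"
  where "alg_subgroup G H =
    G\<lparr>carrier := H, regular := (\<lambda>f. restrict f H) ` regular G\<rparr>"

definition alg_group_isomorphic ::
  "('g, 'k::field) alg_group \<Rightarrow> ('h, 'k) alg_group \<Rightarrow> bool"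
  where "alg_group_isomorphic G H \<longleftrightarrow>
    (\<exists>\<phi> \<in> iso G H. \<forall>f \<in> extensional (carrier H).
       f \<in> regular H \<longleftrightarrow> compose (carrier G) f \<phi> \<in> regular G)"

definition diagonal_group :: "nat \<Rightarrow> ('k::field mat, 'k) alg_group"
  where "diagonal_group r =
    (let D = {M \<in> carrier_mat r r. diagonal_mat M \<and> invertible_mat M} in
     \<lparr>carrier = D, mult = (*), one = 1\<^sub>m r,
      regular = generated_functions D
        ({\<lambda>M. M $$ (i, j) | i j. i < r \<and> j < r} \<union> {\<lambda>M. inverse (det M)})\<rparr>)"

text \<open>The Lie algebra as the tangent space at the identity, i.e. the space of point derivations
  of the coordinate ring.\<close>

definition lie_algebra :: "('g, 'k::field) alg_group \<Rightarrow> (('g \<Rightarrow> 'k) \<Rightarrow> 'k) set"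
  where "lie_algebra G =
    {\<delta> \<in> extensional (regular G).
       (\<forall>c. \<forall>f \<in> regular G. \<delta> (\<lambda>x\<in>carrier G. c * f x) = c * \<delta> f) \<and>
       (\<forall>f \<in> regular G. \<forall>g \<in> regular G.
          \<delta> (\<lambda>x\<in>carrier G. f x + g x) = \<delta> f + \<delta> g \<and>
          \<delta> (\<lambda>x\<in>carrier G. f x * g x) = \<delta> f * g \<one>\<^bsub>G\<^esub> + f \<one>\<^bsub>G\<^esub> * \<delta> g)}"

text \<open>The Lie algebra of a closed subgroup \<open>H\<close>, as a subspace of the Lie algebra of \<open>G\<close>.\<close>

definition lie_subalgebra_of ::
  "('g, 'k::field) alg_group \<Rightarrow> 'g set \<Rightarrow> (('g \<Rightarrow> 'k) \<Rightarrow> 'k) set"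
  where "lie_subalgebra_of G H =
    {\<delta> \<in> lie_algebra G. \<forall>f \<in> regular G. (\<forall>x\<in>H. f x = 0) \<longrightarrow> \<delta> f = 0}"

section \<open>The groups of automorphisms and outer automorphisms\<close>

definition dual_space :: "('k::field, 'a) module \<Rightarrow> ('a \<Rightarrow> 'k) set"
  where "dual_space A =
    {l \<in> extensional (carrier A).
       (\<forall>x \<in> carrier A. \<forall>y \<in> carrier A. l (x \<oplus>\<^bsub>A\<^esub> y) = l x + l y) \<and>
       (\<forall>c. \<forall>x \<in> carrier A. l (c \<odot>\<^bsub>A\<^esub> x) = c * l x)}"

definition automorphisms :: "('k::field, 'a) module \<Rightarrow> ('a \<Rightarrow> 'a) set"
  where "automorphisms A =
    Bij (carrier A) \<inter> Ring.ring_hom A A \<inter> LinearCombinations.module_hom class_ring A A"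

text \<open>The coordinate ring of the closed subgroup \<open>Aut(A)\<close> of \<open>GL(A)\<close>: it is generated by the matrix
  coefficients of \<open>\<sigma>\<close> and of \<open>\<sigma>\<^sup>-\<^sup>1\<close>. Adjoining the latter amounts to adjoining the inverse of the
  determinant, and needs no choice of a basis.\<close>

definition Aut :: "('k::field, 'a) module \<Rightarrow> ('a \<Rightarrow> 'a, 'k) alg_group"
  where "Aut A =
    (let B = BijGroup (carrier A) in
     \<lparr>carrier = automorphisms A, mult = mult B, one = one B,
      regular = generated_functions (automorphisms A)
        ({\<lambda>\<sigma>. l (\<sigma> a) | l a. l \<in> dual_space A \<and> a \<in> carrier A} \<union>
         {\<lambda>\<sigma>. l ((inv\<^bsub>B\<^esub> \<sigma>) a) | l a. l \<in> dual_space A \<and> a \<in> carrier A})\<rparr>)"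

definition inner_automorphisms :: "('k::field, 'a) module \<Rightarrow> ('a \<Rightarrow> 'a) set"
  where "inner_automorphisms A =
    {\<lambda>x\<in>carrier A. u \<otimes>\<^bsub>A\<^esub> x \<otimes>\<^bsub>A\<^esub> inv\<^bsub>A\<^esub> u | u. u \<in> Units A}"

definition out_class :: "('k::field, 'a) module \<Rightarrow> ('a \<Rightarrow> 'a) \<Rightarrow> ('a \<Rightarrow> 'a) set"
  where "out_class A \<sigma> = inner_automorphisms A #>\<^bsub>Aut A\<^esub> \<sigma>"

text \<open>The quotient of \<open>Aut(A)\<close> by the closed normal subgroup \<open>Inn(A)\<close>: the regular functions on
  \<open>Out(A)\<close> are those whose pullback to \<open>Aut(A)\<close> is regular.\<close>

definition Out :: "('k::field, 'a) module \<Rightarrow> (('a \<Rightarrow> 'a) set, 'k) alg_group"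
  where "Out A =
    (let Q = Aut A Mod inner_automorphisms A in
     \<lparr>carrier = carrier Q, mult = mult Q, one = one Q,
      regular = {f \<in> extensional (carrier Q).
        compose (carrier (Aut A)) f (out_class A) \<in> regular (Aut A)}\<rparr>)"

section \<open>Tori in characteristic zero\<close>

text \<open>A tangent vector \<open>\<delta>\<close> of \<open>Aut(A)\<close> at the identity corresponds to the derivation \<open>D\<close> of \<open>A\<close>
  with \<open>\<delta>(\<sigma> \<mapsto> l(\<sigma>(a))) = l(D(a))\<close>; in characteristic zero this is a bijection onto
  the derivations.\<close>

definition tangent_derivation ::
  "('k::field, 'a) module \<Rightarrow> ((('a \<Rightarrow> 'a) \<Rightarrow> 'k) \<Rightarrow> 'k) \<Rightarrow> ('a \<Rightarrow> 'a) \<Rightarrow> bool"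
  where "tangent_derivation A \<delta> D \<longleftrightarrow>
    \<delta> \<in> lie_algebra (Aut A) \<and> D \<in> derivations A \<and>
    (\<forall>l \<in> dual_space A. \<forall>a \<in> carrier A.
       \<delta> (\<lambda>\<sigma>\<in>carrier (Aut A). l (\<sigma> a)) = l (D a))"

text \<open>The differential at the identity of the projection from \<open>Aut(A)\<close> to \<open>Out(A)\<close>.\<close>

definition out_differential ::
  "('k::field, 'a) module \<Rightarrow> ((('a \<Rightarrow> 'a) \<Rightarrow> 'k) \<Rightarrow> 'k) \<Rightarrow> ((('a \<Rightarrow> 'a) set \<Rightarrow> 'k) \<Rightarrow> 'k)"
  where "out_differential A \<delta> =
    (\<lambda>f\<in>regular (Out A). \<delta> (compose (carrier (Aut A)) f (out_class A)))"

text \<open>The Lie algebra of the closed subgroup \<open>H\<close> of \<open>Out(A)\<close> as a subset of \<open>HH\<^sup>1(A)\<close>. The class of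
  a derivation \<open>D\<close> is identified with the image under the differential of \<open>Aut(A) \<rightarrow> Out(A)\<close> of the
  tangent vector corresponding to \<open>D\<close>.\<close>

definition lie_in_HH1 ::
  "('k::field, 'a) module \<Rightarrow> ('a \<Rightarrow> 'a) set set \<Rightarrow> ('a \<Rightarrow> 'a) set set"
  where "lie_in_HH1 A H =
    {inner_derivations A +>\<^bsub>Der A\<^esub> D | D.
       \<exists>\<delta>. tangent_derivation A \<delta> D \<and> out_differential A \<delta> \<in> lie_subalgebra_of (Out A) H}"

definition torus_char_0 :: "('k::field, 'a) module \<Rightarrow> ('a \<Rightarrow> 'a) set set \<Rightarrow> bool"
  where "torus_char_0 A T \<longleftrightarrow>
    (\<exists>H r. closed_subgroup H (Out A) \<and>
       alg_group_isomorphic (alg_subgroup (Out A) H) (diagonal_group r :: ('k mat, 'k) alg_group) \<and>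
       T = lie_in_HH1 A H)"

section \<open>The maximal toral rank\<close>

definition HH1_torus :: "('k::field, 'a) module \<Rightarrow> ('a \<Rightarrow> 'a) set set \<Rightarrow> bool"
  where "HH1_torus A T \<longleftrightarrow>
    (if CHAR('k) = 0 then torus_char_0 A T else torus_char_p A T)"

text \<open>For a finite dimensional algebra, the dimensions of tori are bounded by the dimension of
  \<open>HH\<^sup>1(A)\<close>, and the maximum is over a finite nonempty set.\<close>

definition mt_rank_HH1 :: "('k::field, 'a) module \<Rightarrow> nat"
  where "mt_rank_HH1 A =
    Max {vectorspace.dim class_ring (HH1 A\<lparr>carrier := T\<rparr>) | T. HH1_torus A T}"

end

theory Submission
  imports Defs "HOL-Library.Function_Algebras" "HOL-Computational_Algebra.Polynomial"
begin

text \<open>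
  Write elements in the basis of monomials \<open>x\<^sup>a\<close>, so that the product is twisted by a bicharacter, and let
  \<open>J\<close> be the radical; \<open>J/J\<^sup>2\<close> has dimension \<open>n\<close> because all \<open>m\<^sub>i \<ge> 2\<close>. The derivations
  \<open>x\<^sup>a \<mapsto> c(a) x\<^sup>a\<close>, with \<open>c\<close> additive, span a torus of dimension \<open>n\<close> (in characteristic zero it is the Lie
  algebra of the group of diagonal automorphisms \<open>x\<^sub>i \<mapsto> t\<^sub>i x\<^sub>i\<close>).

  Upper bound in characteristic \<open>p\<close>: elements of a torus lift to commuting diagonalisable derivations. These have
  common eigenvectors, \<open>n\<close> of which generate \<open>A\<close>, so \<open>n + 1\<close> of the derivations are linearly dependent.

  Upper bound in characteristic zero: the kernel of \<open>Out(A) \<rightarrow> GL(J/J\<^sup>2)\<close> contains no involution, and an elementary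
  abelian \<open>2\<close>-group acting faithfully on \<open>J/J\<^sup>2\<close> has rank at most \<open>n\<close>; so a torus of rank \<open>r\<close> in \<open>Out(A)\<close>, which
  contains \<open>2\<^sup>r\<close> elements of order at most \<open>2\<close>, satisfies \<open>r \<le> n\<close>. Its Lie algebra has dimension at most \<open>r\<close>, and the
  differential of \<open>Aut(A) \<rightarrow> Out(A)\<close> only kills inner derivations: a slice for the action of \<open>Inn(A)\<close> on tuples of
  generators provides enough regular functions on \<open>Out(A)\<close> to detect the other derivations.
\<close>

section \<open>Linear algebra on function spaces\<close>

text \<open>A torus in \<open>HH1\<close> is commutative and semisimple only modulo inner
  derivations; in characteristic p this has to be lifted. Each class of a torus is, for every s, a
  combination of its own p^j-th powers with j >= s, while for a suitable s the power t^(p^s) of a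
  representative t is killed by an additive polynomial with linear coefficient 1. Such a polynomial
  is separable, so t^(p^s) is diagonalisable, and dividing the polynomial by the variable gives a
  polynomial in ad t^(p^s) that turns any other representative of a class of the torus into one
  commuting with t^(p^s), at the cost of an inner derivation. In characteristic zero the obstacle is
  that the functions on \<open>Out(A)\<close> are the regular functions on \<open>Aut(A)\<close>
  constant on cosets of \<open>Inn(A)\<close>, so invariants must be constructed; the slice does
  this polynomially because inverses in 1 + J are finite geometric series. Its equations also show
  that the diagonal torus is closed in \<open>Out(A)\<close>. Involutions bound the rank through the
  eigenvalues 1 and -1 and the radical filtration alone.\<close>

definition sc :: "'k::field \<Rightarrow> ('i \<Rightarrow> 'k) \<Rightarrow> 'i \<Rightarrow> 'k"
  where "sc c f = (\<lambda>i. c * f i)"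

declare plus_fun_apply [simp del] zero_fun_apply [simp del] times_fun_apply [simp del]
  one_fun_apply [simp del] minus_apply [simp del] uminus_apply [simp del] One_nat_def [simp del]

lemma sc_apply: "sc c f i = c * f i"
  by (simp add: sc_def)

lemma sum_fun_apply: "(\<Sum>x\<in>S. f x) i = (\<Sum>x\<in>S. f x i)"
  by (induction S rule: infinite_finite_induct) (auto simp: plus_fun_apply zero_fun_apply)

lemmas fapply = plus_fun_apply zero_fun_apply minus_apply uminus_apply sc_apply sum_fun_apply
lemmas fext = fun_eq_iff fapply

interpretation fv: vector_space sc
  by unfold_locales (auto simp: fext algebra_simps)

interpretation fvp: vector_space_pair sc sc ..

abbreviation lin :: "(('i \<Rightarrow> 'k::field) \<Rightarrow> 'j \<Rightarrow> 'k) \<Rightarrow> bool"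
  where "lin \<equiv> Vector_Spaces.linear sc sc"

lemma linI:
  assumes "\<And>x y. f (x + y) = f x + f y" "\<And>c x. f (sc c x) = sc c (f x)"
  shows "lin f"
  using assms by (simp add: Vector_Spaces.linear_iff fv.vector_space_axioms)

lemmas lin_add = fvp.linear_add
lemmas lin_sc = fvp.linear_scale
lemmas lin_0 = fvp.linear_0
lemmas lin_diff = fvp.linear_diff
lemmas lin_sum = fvp.linear_sum

lemma lin_id: "lin (\<lambda>x. x)"
  by (rule linI) auto

lemma lin_funpow:
  fixes f :: "('i \<Rightarrow> 'k::field) \<Rightarrow> 'i \<Rightarrow> 'k"
  shows "lin f \<Longrightarrow> lin (f ^^ k)"
proof (induction k)
  case 0
  show ?case by (rule linI) auto
next
  case (Suc k)
  then show ?case by (intro linI) (simp_all add: lin_add lin_sc)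
qed

text \<open>Gaussian elimination, one equation at a time, with unknowns indexed by \<open>B\<close>
  and equations by \<open>I\<close>. It supplies the linear dependences used below: more operators
  than matrix entries, more derivations than eigenvectors.\<close>

lemma homogeneous_system_solution:
  fixes v :: "'b \<Rightarrow> 'i \<Rightarrow> 'k::field"
  assumes "finite I" "finite B" "card I < card B"
  shows "\<exists>c. (\<exists>b\<in>B. c b \<noteq> 0) \<and> (\<forall>i\<in>I. (\<Sum>b\<in>B. c b * v b i) = 0)"
  using assms
proof (induction I arbitrary: B v rule: finite_induct)
  case empty
  then have "B \<noteq> {}" by auto
  then show ?case by (auto intro!: exI[of _ "\<lambda>_. 1"])
next
  case (insert i0 I)
  show ?case
  proof (cases "\<forall>b\<in>B. v b i0 = 0")
    case True
    have "card I < card B" using insert by simp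
    from insert.IH[OF insert.prems(1) this, of v] True show ?thesis
      by (auto intro!: exI)
  next
    case False
    then obtain b0 where b0: "b0 \<in> B" "v b0 i0 \<noteq> 0" by auto
    define B' where "B' = B - {b0}"
    have fB': "finite B'" "card I < card B'"
      using insert b0 by (auto simp: B'_def)
    \<comment> \<open>Pivot at \<open>b0\<close>: equation \<open>i0\<close> determines its
      coefficient, and subtracting \<open>r b\<close> times the pivot column leaves a system in
      which \<open>i0\<close> no longer occurs.\<close>
    define r where "r b = v b i0 / v b0 i0" for b
    obtain c where c: "\<exists>b\<in>B'. c b \<noteq> 0"
      "\<And>i. i \<in> I \<Longrightarrow> (\<Sum>b\<in>B'. c b * (v b i - r b * v b0 i)) = 0"
      using insert.IH[OF fB', of "\<lambda>b i. v b i - r b * v b0 i"] by auto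
    define c' where "c' b = (if b = b0 then - (\<Sum>b\<in>B'. c b * r b) else c b)" for b
    have split: "(\<Sum>b\<in>B. c' b * v b i) = (\<Sum>b\<in>B'. c b * (v b i - r b * v b0 i))" for i
    proof -
      have "(\<Sum>b\<in>B. c' b * v b i) = c' b0 * v b0 i + (\<Sum>b\<in>B'. c' b * v b i)"
        using b0 insert.prems by (simp add: B'_def sum.remove)
      also have "(\<Sum>b\<in>B'. c' b * v b i) = (\<Sum>b\<in>B'. c b * v b i)"
        by (rule sum.cong) (auto simp: c'_def B'_def)
      also have "c' b0 * v b0 i + (\<Sum>b\<in>B'. c b * v b i) = - (\<Sum>b\<in>B'. c b * r b) * v b0 i + (\<Sum>b\<in>B'. c b * v b i)"
        by (simp add: c'_def)
      also have "- (\<Sum>b\<in>B'. c b * r b) * v b0 i + (\<Sum>b\<in>B'. c b * v b i)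
          = (\<Sum>b\<in>B'. c b * v b i) - (\<Sum>b\<in>B'. c b * r b * v b0 i)"
        by (simp add: sum_distrib_right)
      also have "\<dots> = (\<Sum>b\<in>B'. c b * (v b i - r b * v b0 i))"
        unfolding sum_subtractf[symmetric] by (rule sum.cong) (auto simp: algebra_simps)
      finally show ?thesis .
    qed
    have "(\<Sum>b\<in>B. c' b * v b i) = 0" if "i \<in> insert i0 I" for i
    proof (cases "i = i0")
      case True
      have "v b i0 - r b * v b0 i0 = 0" for b using b0 by (simp add: r_def)
      then show ?thesis unfolding split True by (simp only: mult_zero_right sum.neutral_const)
    next
      case False
      with that c(2) show ?thesis by (simp add: split)
    qed
    moreover have "\<exists>b\<in>B. c' b \<noteq> 0" using c(1) by (auto simp: B'_def c'_def)
    ultimately show ?thesis by blast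
  qed
qed

text \<open>Selecting members of \<open>S\<close> itself, not of its span, matters: \<open>S\<close>
  will consist of common eigenvectors, and at most \<open>card I\<close> of them are kept whose
  images span the same space.\<close>

lemma finite_spanning_subset:
  fixes f :: "'v \<Rightarrow> 'i \<Rightarrow> 'k::field"
  assumes I: "finite I" and supp: "\<And>s i. s \<in> S \<Longrightarrow> i \<notin> I \<Longrightarrow> f s i = 0"
  shows "\<exists>S0\<subseteq>S. finite S0 \<and> card S0 \<le> card I \<and> f ` S \<subseteq> fv.span (f ` S0)"
proof -
  obtain B where B: "B \<subseteq> f ` S" "fv.independent B" "f ` S \<subseteq> fv.span B"
    using fv.maximal_independent_subset by blast
  define e where "e j = (\<lambda>i. if i = j then 1 else (0::'k))" for j :: 'i
  have *: "f ` S \<subseteq> fv.span (e ` I)"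
  proof
    fix x assume "x \<in> f ` S"
    then have x0: "x i = 0" if "i \<notin> I" for i using supp that by auto
    have "x = (\<Sum>j\<in>I. sc (x j) (e j))"
    proof
      fix i
      have "(\<Sum>j\<in>I. sc (x j) (e j)) i = (\<Sum>j\<in>I. if i = j then x j else 0)"
        unfolding sum_fun_apply by (rule sum.cong) (auto simp: e_def sc_apply)
      then show "x i = (\<Sum>j\<in>I. sc (x j) (e j)) i" using I x0 by auto
    qed
    moreover have "(\<Sum>j\<in>I. sc (x j) (e j)) \<in> fv.span (e ` I)"
      by (intro fv.span_sum fv.span_scale fv.span_base) auto
    ultimately show "x \<in> fv.span (e ` I)" by simp
  qed
  have b: "finite B \<and> card B \<le> card (e ` I)"
    using fv.independent_span_bound[of "e ` I" B] I B * by (meson finite_imageI order_trans)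
  obtain S0 where S0: "S0 \<subseteq> S" "f ` S0 = B" "inj_on f S0"
    using B(1) by (metis subset_image_inj)
  have "finite S0" using b S0 finite_image_iff by blast
  moreover have "card S0 \<le> card I"
    using b S0 card_image card_image_le[OF I, of e] by (metis order_trans)
  ultimately show ?thesis using S0 B by auto
qed

subsection \<open>Iterated Leibniz rule\<close>

text \<open>Three operators let one formula cover derivations (\<open>f1 = f2 = f3\<close>),
  connections on a product, and the evaluation of an operator at a vector, where \<open>f1\<close>
  is the commutator with \<open>f2 = f3\<close>.\<close>

lemma leibniz_funpow:
  fixes B :: "'a \<Rightarrow> 'b \<Rightarrow> 'i \<Rightarrow> 'k::field"
  assumes lin: "lin f3"
    and L: "\<And>x y. f3 (B x y) = B (f1 x) y + B x (f2 y)"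
  shows "(f3 ^^ N) (B x y) =
    (\<Sum>i\<le>N. sc (of_nat (N choose i)) (B ((f1 ^^ i) x) ((f2 ^^ (N - i)) y)))"
proof (induction N)
  case 0
  show ?case by simp
next
  case (Suc N)
  define b where "b i j = B ((f1 ^^ i) x) ((f2 ^^ j) y)" for i j
  have "(f3 ^^ Suc N) (B x y) = (\<Sum>i\<le>N. sc (of_nat (N choose i)) (f3 (b i (N - i))))"
    using Suc by (simp add: lin_sum[OF lin] lin_sc[OF lin] b_def)
  also have "\<dots> = (\<Sum>i\<le>N. sc (of_nat (N choose i)) (b (Suc i) (N - i)))
      + (\<Sum>i\<le>N. sc (of_nat (N choose i)) (b i (Suc (N - i))))"
    unfolding sum.distrib[symmetric]
    by (rule sum.cong) (auto simp: b_def L fv.scale_right_distrib)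
  also have "(\<Sum>i\<le>N. sc (of_nat (N choose i)) (b (Suc i) (N - i)))
      = (\<Sum>i\<in>{1..Suc N}. sc (of_nat (N choose (i - 1))) (b i (Suc N - i)))"
    by (rule sum.reindex_bij_witness[of _ "\<lambda>i. i - 1" Suc]) auto
  also have "\<dots> = (\<Sum>i\<le>Suc N. sc (if i = 0 then 0 else of_nat (N choose (i - 1))) (b i (Suc N - i)))"
    by (rule sum.mono_neutral_cong_left) (auto simp: fext)
  also have "(\<Sum>i\<le>N. sc (of_nat (N choose i)) (b i (Suc (N - i))))
      = (\<Sum>i\<le>Suc N. sc (of_nat (N choose i)) (b i (Suc N - i)))"
    by (simp add: Suc_diff_le binomial_eq_0)
  also have "(\<Sum>i\<le>Suc N. sc (if i = 0 then 0 else of_nat (N choose (i - 1))) (b i (Suc N - i)))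
      + (\<Sum>i\<le>Suc N. sc (of_nat (N choose i)) (b i (Suc N - i)))
      = (\<Sum>i\<le>Suc N. sc (of_nat (Suc N choose i)) (b i (Suc N - i)))"
    unfolding sum.distrib[symmetric] fv.scale_left_distrib[symmetric]
    by (rule sum.cong) (auto simp: choose_reduce_nat add.commute simp flip: of_nat_add)
  finally show ?case by (simp only: b_def)
qed

text \<open>For exponent p the inner binomial coefficients are divisible by p, so only the two outer
  terms survive; higher powers follow by applying this to the p^j-th iterates.\<close>

lemma leibniz_char:
  fixes B :: "'a \<Rightarrow> 'b \<Rightarrow> 'i \<Rightarrow> 'k::field"
  assumes lin: "lin f3" and p: "CHAR('k) > 0"
    and L: "\<And>x y. f3 (B x y) = B (f1 x) y + B x (f2 y)"
  shows "(f3 ^^ (CHAR('k) ^ j)) (B x y) =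
    B ((f1 ^^ (CHAR('k) ^ j)) x) y + B x ((f2 ^^ (CHAR('k) ^ j)) y)"
proof (induction j arbitrary: x y)
  case 0
  show ?case by (simp add: L One_nat_def)
next
  case (Suc j)
  define p where "p = CHAR('k)"
  have pp: "prime p" using p by (simp add: p_def prime_CHAR_semidom)
  define g1 where "g1 = f1 ^^ (p ^ j)"
  define g2 where "g2 = f2 ^^ (p ^ j)"
  define g3 where "g3 = f3 ^^ (p ^ j)"
  have "(g3 ^^ p) (B x y)
      = (\<Sum>i\<le>p. sc (of_nat (p choose i)) (B ((g1 ^^ i) x) ((g2 ^^ (p - i)) y)))"
    using Suc.IH by (intro leibniz_funpow) (auto simp: g1_def g2_def g3_def p_def lin lin_funpow)
  also have "\<dots> = (\<Sum>i\<in>{0,p}. sc (of_nat (p choose i)) (B ((g1 ^^ i) x) ((g2 ^^ (p - i)) y)))"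
  proof (rule sum.mono_neutral_right)
    show "\<forall>i\<in>{..p} - {0, p}. sc (of_nat (p choose i)) (B ((g1 ^^ i) x) ((g2 ^^ (p - i)) y)) = 0"
    proof
      fix i assume "i \<in> {..p} - {0, p}"
      then have "p dvd p choose i" using pp by (intro dvd_choose_prime) auto
      then have "(of_nat (p choose i) :: 'k) = 0" unfolding p_def by (simp add: of_nat_eq_0_iff_char_dvd)
      then show "sc (of_nat (p choose i)) (B ((g1 ^^ i) x) ((g2 ^^ (p - i)) y)) = 0"
        by (simp add: fext)
    qed
  qed auto
  also have "\<dots> = B ((g1 ^^ p) x) y + B x ((g2 ^^ p) y)"
    using pp prime_gt_0_nat[OF pp] by (auto simp: fext)
  finally show ?case
    by (simp add: g1_def g2_def g3_def p_def funpow_mult mult.commute)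
qed

subsection \<open>Polynomials in an operator\<close>

definition pact :: "(('i \<Rightarrow> 'k::field) \<Rightarrow> 'i \<Rightarrow> 'k) \<Rightarrow> 'k poly \<Rightarrow> ('i \<Rightarrow> 'k) \<Rightarrow> 'i \<Rightarrow> 'k"
  where "pact h P v = (\<Sum>i\<le>degree P. sc (coeff P i) ((h ^^ i) v))"

lemma pact_bound: "degree P \<le> N \<Longrightarrow> pact h P v = (\<Sum>i\<le>N. sc (coeff P i) ((h ^^ i) v))"
  unfolding pact_def
  by (rule sum.mono_neutral_left) (auto simp: coeff_eq_0 fext)

lemma pact_0 [simp]: "pact h 0 v = 0"
  by (simp add: pact_def fext)

lemma pact_add: "pact h (P + Q) v = pact h P v + pact h Q v"
proof -
  define N where "N = max (degree P) (degree Q)"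
  have "degree (P + Q) \<le> N" by (simp add: N_def degree_add_le_max)
  then show ?thesis
    by (simp add: pact_bound[of _ N] N_def sum.distrib fv.scale_left_distrib)
qed

lemma pact_smult: "pact h (Polynomial.smult c P) v = sc c (pact h P v)"
  by (simp add: pact_bound[of _ "degree P"] degree_smult_le fv.scale_sum_right fext mult.assoc)

lemma pact_pCons:
  assumes "lin h"
  shows "pact h (pCons a P) v = sc a v + h (pact h P v)"
proof -
  have "pact h (pCons a P) v = (\<Sum>i\<le>Suc (degree P). sc (coeff (pCons a P) i) ((h ^^ i) v))"
    by (rule pact_bound) (rule degree_pCons_le)
  also have "\<dots> = sc a v + (\<Sum>i\<le>degree P. sc (coeff P i) ((h ^^ Suc i) v))"
    by (subst sum.atMost_Suc_shift) simp
  also have "\<dots> = sc a v + h (pact h P v)"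
    by (simp add: pact_def lin_sum[OF assms] lin_sc[OF assms])
  finally show ?thesis .
qed

lemma pact_mult:
  assumes "lin h"
  shows "pact h (P * Q) v = pact h P (pact h Q v)"
proof (induction P)
  case 0
  show ?case by simp
next
  case (pCons a P)
  then show ?case
    by (simp add: mult_pCons_left pact_add pact_smult pact_pCons[OF assms])
qed

lemma pact_1 [simp]: "pact h 1 v = v"
  by (simp add: pact_def fext)

lemma pact_power: "lin h \<Longrightarrow> pact h (P ^ k) = (pact h P) ^^ k"
proof (induction k)
  case 0
  show ?case by (simp add: fext)
next
  case (Suc k)
  then show ?case by (intro ext) (simp add: pact_mult)
qed

lemma pact_monom: "pact h (monom c k) v = sc c ((h ^^ k) v)"
proof -
  have "pact h (monom c k) v = (\<Sum>i\<le>k. sc (coeff (monom c k) i) ((h ^^ i) v))"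
    by (rule pact_bound) (rule degree_monom_le)
  also have "\<dots> = (\<Sum>i\<in>{k}. sc (coeff (monom c k) i) ((h ^^ i) v))"
    by (rule sum.mono_neutral_right) (auto simp: fext)
  finally show ?thesis by simp
qed

lemma pact_linear_factor: "lin h \<Longrightarrow> pact h [:- l, 1:] v = h v - sc l v"
  by (simp add: pact_pCons lin_0)

subsection \<open>Common eigenvectors\<close>

text \<open>Induction on the number of roots: \<open>u = (h - l0) v\<close> is a sum of eigenvectors
  with eigenvalues in \<open>L\<close>, and \<open>h - l0\<close> is onto their span because
  \<open>l0\<close> is not in \<open>L\<close>. Removing a preimage \<open>u'\<close> of
  \<open>u\<close> from \<open>v\<close> leaves an eigenvector for \<open>l0\<close>.\<close>

lemma eigenvector_decomposition:
  assumes h: "lin h" and W: "fv.subspace W" "\<And>w. w \<in> W \<Longrightarrow> h w \<in> W"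
    and "finite L" "v \<in> W" "pact h (\<Prod>l\<in>L. [:- l, 1:]) v = 0"
  shows "v \<in> fv.span {w \<in> W. \<exists>l\<in>L. h w = sc l w}"
  using assms(4-6)
proof (induction L arbitrary: v rule: finite_induct)
  case empty
  then show ?case by (simp add: fv.span_zero)
next
  case (insert l0 L)
  define u where "u = h v - sc l0 v"
  define S where "S = {w \<in> W. \<exists>l\<in>L. h w = sc l w}"
  have uW: "u \<in> W" unfolding u_def
    using W insert.prems by (intro fv.subspace_diff fv.subspace_scale) auto
  have "pact h ((\<Prod>l\<in>L. [:- l, 1:]) * [:- l0, 1:]) v = 0"
    using insert by (simp add: mult.commute)
  then have "pact h (\<Prod>l\<in>L. [:- l, 1:]) u = 0"
    unfolding pact_mult[OF h] u_def pact_linear_factor[OF h] .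
  then have u: "u \<in> fv.span S" using insert.IH uW by (simp add: S_def)
  have "\<exists>u'\<in>fv.span S. h u' - sc l0 u' = u"
    using u
  proof (induction rule: fv.span_induct_alt)
    case base
    then show ?case using lin_0[OF h] by (intro bexI[of _ 0]) (auto simp: fv.span_zero)
  next
    case (step c x y)
    then obtain y' where y': "y' \<in> fv.span S" "h y' - sc l0 y' = y" by auto
    from step obtain l where l: "l \<in> L" "h x = sc l x" by (auto simp: S_def)
    then have "l \<noteq> l0" using insert by auto
    define x' where "x' = sc (c / (l - l0)) x + y'"
    have "x' \<in> fv.span S" unfolding x'_def
      by (intro fv.span_add fv.span_scale y'(1) fv.span_base[OF step.hyps(1)])
    moreover have "h x' - sc l0 x' = sc c x + y"
    proof -
      have "h x' - sc l0 x' = sc (c / (l - l0) * (l - l0)) x + (h y' - sc l0 y')"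
        by (simp add: x'_def lin_add[OF h] lin_sc[OF h] l(2) fext diff_divide_distrib right_diff_distrib algebra_simps)
      then show ?thesis using \<open>l \<noteq> l0\<close> y' by simp
    qed
    ultimately show ?case by auto
  qed
  then obtain u' where u': "u' \<in> fv.span S" "h u' - sc l0 u' = u" by auto
  have "fv.span S \<subseteq> W" using W by (intro fv.span_minimal) (auto simp: S_def)
  then have u'W: "u' \<in> W" using u' by auto
  let ?S = "{w \<in> W. \<exists>l\<in>insert l0 L. h w = sc l w}"
  have "h (v - u') = sc l0 (v - u')"
    using u'(2) by (simp add: u_def lin_diff[OF h] fext algebra_simps)
  moreover have "v - u' \<in> W" using W u'W insert.prems by (intro fv.subspace_diff)
  ultimately have "v - u' \<in> fv.span ?S" by (intro fv.span_base) auto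
  moreover have "u' \<in> fv.span ?S"
    using u'(1) fv.span_mono[of S ?S] by (auto simp: S_def)
  ultimately have "(v - u') + u' \<in> fv.span ?S" by (rule fv.span_add)
  then show ?case by simp
qed

text \<open>A joint eigenspace of \<open>H\<close> is stable under an operator commuting with
  \<open>H\<close>, so the decomposition for a single operator can be carried out inside it.\<close>

lemma common_eigenvector_decomposition:
  assumes "finite H" and "\<And>h. h \<in> H \<Longrightarrow> lin h"
    and "\<And>h g v. h \<in> H \<Longrightarrow> g \<in> H \<Longrightarrow> h (g v) = g (h v)"
    and "fv.subspace W" "\<And>h w. h \<in> H \<Longrightarrow> w \<in> W \<Longrightarrow> h w \<in> W"
    and "\<And>h. h \<in> H \<Longrightarrow> \<exists>L. finite L \<and> (\<forall>v\<in>W. pact h (\<Prod>l\<in>L. [:- l, 1:]) v = 0)"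
    and "v \<in> W"
  shows "v \<in> fv.span {w \<in> W. \<forall>h\<in>H. \<exists>l. h w = sc l w}"
  using assms
proof (induction H arbitrary: v rule: finite_induct)
  case empty
  then show ?case by (auto intro: fv.span_base)
next
  case (insert h H)
  let ?S = "{w \<in> W. \<forall>h\<in>H. \<exists>l. h w = sc l w}"
  let ?T = "{w \<in> W. \<forall>h\<in>insert h H. \<exists>l. h w = sc l w}"
  have "v \<in> fv.span ?S"
    by (rule insert.IH) (use insert.prems in auto)
  moreover have "?S \<subseteq> fv.span ?T"
  proof
    fix w assume w: "w \<in> ?S"
    then obtain lam where lam: "\<And>g. g \<in> H \<Longrightarrow> g w = sc (lam g) w" by (auto; metis)
    define W' where "W' = {u \<in> W. \<forall>g\<in>H. g u = sc (lam g) u}"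
    have W': "fv.subspace W'"
    proof (rule fv.subspaceI)
      show "0 \<in> W'" using insert.prems(1,3) by (auto simp: W'_def lin_0 fv.subspace_0)
      show "x + y \<in> W'" if "x \<in> W'" "y \<in> W'" for x y
        using that insert.prems(1,3)
        by (auto simp: W'_def lin_add fv.subspace_add fv.scale_right_distrib)
      show "sc c x \<in> W'" if "x \<in> W'" for c x
        using that insert.prems(1,3)
        by (auto simp: W'_def lin_sc fv.subspace_scale fv.scale_scale mult.commute)
    qed
    have st: "h u \<in> W'" if "u \<in> W'" for u
    proof -
      have "g (h u) = sc (lam g) (h u)" if "g \<in> H" for g
      proof -
        have "g (h u) = h (g u)" using insert.prems(2) that by blast
        also have "g u = sc (lam g) u" using \<open>u \<in> W'\<close> that by (simp add: W'_def)
        also have "h \<dots> = sc (lam g) (h u)" using insert.prems(1) by (simp add: lin_sc)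
        finally show ?thesis .
      qed
      then show ?thesis using \<open>u \<in> W'\<close> insert.prems(4) by (simp add: W'_def)
    qed
    obtain L where L: "finite L" "\<forall>v\<in>W. pact h (\<Prod>l\<in>L. [:- l, 1:]) v = 0"
      using insert.prems(5) by blast
    have "w \<in> fv.span {u \<in> W'. \<exists>l\<in>L. h u = sc l u}"
      by (rule eigenvector_decomposition[OF insert.prems(1) W' st L(1)]) (use w lam L(2) in \<open>auto simp: W'_def\<close>)
    also have "\<dots> \<subseteq> fv.span ?T" by (rule fv.span_mono) (auto simp: W'_def)
    finally show "w \<in> fv.span ?T" .
  qed
  ultimately show ?case using fv.span_minimal[OF _ fv.subspace_span] by blast
qed

section \<open>The quantum complete intersection in monomial coordinates\<close>

type_synonym 'k coords = "(nat \<Rightarrow> nat) \<Rightarrow> 'k"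
type_synonym 'k coords_map = "'k coords \<Rightarrow> 'k coords"

text \<open>With \<open>\<gamma>\<close> the bicharacter for which \<open>x\<^sup>a x\<^sup>b = \<gamma>(a,b) x\<^sup>a\<^sup>+\<^sup>b\<close>, elements are coefficient functions on
  exponent vectors; \<open>mul\<close> ignores coefficients at exponent vectors outside \<open>M\<close>.\<close>

locale qcoord =
  fixes n :: nat and m :: "nat \<Rightarrow> nat"
    and \<gamma> :: "(nat \<Rightarrow> nat) \<Rightarrow> (nat \<Rightarrow> nat) \<Rightarrow> 'k::alg_closed_field"
  assumes m2: "\<And>i. i \<in> {1..n} \<Longrightarrow> m i \<ge> 2"
    and \<gamma>_add_left: "\<And>a b c. \<gamma> (a + b) c = \<gamma> a c * \<gamma> b c"
    and \<gamma>_add_right: "\<And>a b c. \<gamma> a (b + c) = \<gamma> a b * \<gamma> a c"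
    and \<gamma>_nz: "\<And>a b. \<gamma> a b \<noteq> 0"
begin

lemma \<gamma>_0_left [simp]: "\<gamma> 0 c = 1"
  using \<gamma>_add_left[of 0 0 c] \<gamma>_nz[of 0 c] by simp

lemma \<gamma>_0_right [simp]: "\<gamma> c 0 = 1"
  using \<gamma>_add_right[of c 0 0] \<gamma>_nz[of c 0] by simp

definition M :: "(nat \<Rightarrow> nat) set"
  where "M = {a. (\<forall>i\<in>{1..n}. a i < m i) \<and> (\<forall>i. i \<notin> {1..n} \<longrightarrow> a i = 0)}"

definition deg :: "(nat \<Rightarrow> nat) \<Rightarrow> nat"
  where "deg a = (\<Sum>i\<in>{1..n}. a i)"

text \<open>Larger than the degree of every monomial in \<open>M\<close>, so \<open>F k\<close>
  vanishes from \<open>k = Dmax\<close> on; this ends every induction along the radical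
  filtration.\<close>

definition Dmax :: nat
  where "Dmax = Suc (\<Sum>i\<in>{1..n}. m i)"

definition VM :: "'k coords set"
  where "VM = {v. \<forall>a. a \<notin> M \<longrightarrow> v a = 0}"

definition proj :: "'k coords_map"
  where "proj v = (\<lambda>a. if a \<in> M then v a else 0)"

definition ev :: "(nat \<Rightarrow> nat) \<Rightarrow> 'k coords"
  where "ev a = (\<lambda>b. if b = a then 1 else 0)"

definition ux :: "nat \<Rightarrow> nat \<Rightarrow> nat"
  where "ux i = (\<lambda>j. if j = i then 1 else 0)"

abbreviation X :: "nat \<Rightarrow> 'k coords"
  where "X i \<equiv> ev (ux i)"

abbreviation un :: "'k coords"
  where "un \<equiv> ev 0"

definition mul :: "'k coords \<Rightarrow> 'k coords_map"
  where "mul u v = (\<lambda>c. if c \<in> M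
    then (\<Sum>a\<in>M. \<Sum>b\<in>M. if a + b = c then \<gamma> a b * u a * v b else 0) else 0)"

definition ad :: "'k coords \<Rightarrow> 'k coords_map"
  where "ad b v = mul b v - mul v b"

text \<open>The \<open>k\<close>-th power of the radical \<open>J\<close>.\<close>

definition F :: "nat \<Rightarrow> 'k coords set"
  where "F k = {v \<in> VM. \<forall>a. deg a < k \<longrightarrow> v a = 0}"

lemma finite_M: "finite M"
proof (rule finite_subset)
  let ?B = "{..<Suc (\<Sum>i\<in>{1..n}. m i)}"
  show "finite {f. \<forall>x. (x \<in> {1..n} \<longrightarrow> f x \<in> ?B) \<and> (x \<notin> {1..n} \<longrightarrow> f x = (0::nat))}"
    by (rule finite_set_of_finite_funs) auto
  show "M \<subseteq> {f. \<forall>x. (x \<in> {1..n} \<longrightarrow> f x \<in> ?B) \<and> (x \<notin> {1..n} \<longrightarrow> f x = (0::nat))}"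
  proof (clarsimp simp: M_def)
    fix a :: "nat \<Rightarrow> nat" and x
    assume a: "\<forall>i\<in>{1..n}. a i < m i" and x: "1 \<le> x" "x \<le> n"
    have "m x \<le> (\<Sum>i\<in>{1..n}. m i)" using x by (intro member_le_sum) auto
    moreover have "a x < m x" using a x by auto
    ultimately show "a x < Suc (\<Sum>i\<in>{1..n}. m i)" by simp
  qed
qed

lemma M_0 [simp]: "0 \<in> M"
  using m2 by (force simp: M_def zero_fun_apply)

lemma M_ux [simp]: "i \<in> {1..n} \<Longrightarrow> ux i \<in> M"
  using m2 by (force simp: M_def ux_def)

lemma M_addD: "a + b \<in> M \<Longrightarrow> a \<in> M \<and> b \<in> M"
  by (auto simp: M_def plus_fun_apply)

lemma deg_add: "deg (a + b) = deg a + deg b"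
  by (simp add: deg_def plus_fun_apply sum.distrib)

lemma deg_0 [simp]: "deg 0 = 0"
  by (simp add: deg_def zero_fun_apply)

lemma deg_ux [simp]: "i \<in> {1..n} \<Longrightarrow> deg (ux i) = 1"
  by (simp add: deg_def ux_def)

lemma deg_eq_0: "a \<in> M \<Longrightarrow> deg a = 0 \<Longrightarrow> a = 0"
  by (auto simp: deg_def M_def fun_eq_iff zero_fun_apply)

lemma deg_less_Dmax: "a \<in> M \<Longrightarrow> deg a < Dmax"
  unfolding deg_def Dmax_def by (intro le_imp_less_Suc sum_mono) (auto simp: M_def less_imp_le)

lemma ux_inj: "ux i = ux j \<Longrightarrow> i = j"
  by (drule fun_cong[of _ _ i]) (simp add: ux_def split: if_splits)

lemma M_decomp:
  assumes "a \<in> M" "a \<noteq> 0"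
  shows "\<exists>i\<in>{1..n}. \<exists>b\<in>M. a = ux i + b"
proof -
  obtain i where i: "a i \<noteq> 0" using assms(2) by (auto simp: fun_eq_iff zero_fun_apply)
  then have iI: "i \<in> {1..n}" using assms(1) by (auto simp: M_def)
  define b where "b = (\<lambda>j. if j = i then a i - 1 else a j)"
  have "a = ux i + b" using i by (auto simp: b_def ux_def fun_eq_iff plus_fun_apply)
  then show ?thesis using iI M_addD assms(1) by blast
qed

lemma deg_1_ux: "a \<in> M \<Longrightarrow> deg a = 1 \<Longrightarrow> \<exists>i\<in>{1..n}. a = ux i"
proof -
  assume a: "a \<in> M" "deg a = 1"
  then have "a \<noteq> 0" by auto
  then obtain i b where ib: "i \<in> {1..n}" "b \<in> M" "a = ux i + b" using M_decomp a by blast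
  then have "deg b = 0" using a deg_add[of "ux i" b] by simp
  then show ?thesis using ib deg_eq_0[of b] by auto
qed

lemma VM_subspace: "fv.subspace VM"
  by (auto simp: fv.subspace_def VM_def fapply)

lemma VM_add [simp]: "u \<in> VM \<Longrightarrow> v \<in> VM \<Longrightarrow> u + v \<in> VM"
  and VM_diff [simp]: "u \<in> VM \<Longrightarrow> v \<in> VM \<Longrightarrow> u - v \<in> VM"
  and VM_uminus [simp]: "u \<in> VM \<Longrightarrow> - u \<in> VM"
  and VM_sc [simp]: "u \<in> VM \<Longrightarrow> sc c u \<in> VM"
  and VM_0 [simp]: "0 \<in> VM"
  by (auto simp: VM_def fapply)

lemma VM_sum: "(\<And>x. x \<in> S \<Longrightarrow> f x \<in> VM) \<Longrightarrow> sum f S \<in> VM"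
  by (auto simp: VM_def fapply intro!: sum.neutral)

lemma VM_ev [simp]: "a \<in> M \<Longrightarrow> ev a \<in> VM"
  by (auto simp: VM_def ev_def)

lemma VM_mul [simp]: "mul u v \<in> VM"
  by (auto simp: VM_def mul_def)

lemma VM_ad [simp]: "ad u v \<in> VM"
  by (simp add: ad_def)

lemma VM_proj [simp]: "proj v \<in> VM"
  by (auto simp: VM_def proj_def)

lemma proj_VM: "v \<in> VM \<Longrightarrow> proj v = v"
  by (auto simp: VM_def proj_def fun_eq_iff)

lemma proj_expand: "proj v = (\<Sum>a\<in>M. sc (v a) (ev a))"
proof
  fix b
  have "(\<Sum>a\<in>M. sc (v a) (ev a)) b = (\<Sum>a\<in>M. if b = a then v a else 0)"
    unfolding sum_fun_apply by (rule sum.cong) (auto simp: ev_def sc_apply)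
  then show "proj v b = (\<Sum>a\<in>M. sc (v a) (ev a)) b"
    using finite_M by (simp add: proj_def)
qed

lemma VM_expand: "v \<in> VM \<Longrightarrow> v = (\<Sum>a\<in>M. sc (v a) (ev a))"
  using proj_expand proj_VM by metis

lemma lin_proj: "lin proj"
  by (rule linI) (auto simp: proj_def fext)

lemma lin_mul_right: "lin (mul u)"
proof (rule linI)
  show "mul u (x + y) = mul u x + mul u y" for x y
  proof
    fix c
    have "(\<Sum>a\<in>M. \<Sum>b\<in>M. if a + b = c then \<gamma> a b * u a * (x + y) b else 0) =
      (\<Sum>a\<in>M. \<Sum>b\<in>M. (if a + b = c then \<gamma> a b * u a * x b else 0) +
        (if a + b = c then \<gamma> a b * u a * y b else 0))"
      by (intro sum.cong refl) (simp add: fapply distrib_left)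
    then show "mul u (x + y) c = (mul u x + mul u y) c"
      by (simp add: mul_def plus_fun_apply[of "\<lambda>c. if c \<in> M then _ c else _ c"] sum.distrib)
  qed
  show "mul u (sc c x) = sc c (mul u x)" for c x
    by (rule ext) (auto simp add: mul_def fapply sum_distrib_left intro!: sum.cong)
qed

lemma lin_mul_left: "lin (\<lambda>u. mul u v)"
proof (rule linI)
  show "mul (x + y) v = mul x v + mul y v" for x y
  proof
    fix c
    have "(\<Sum>a\<in>M. \<Sum>b\<in>M. if a + b = c then \<gamma> a b * (x + y) a * v b else 0) =
      (\<Sum>a\<in>M. \<Sum>b\<in>M. (if a + b = c then \<gamma> a b * x a * v b else 0) +
        (if a + b = c then \<gamma> a b * y a * v b else 0))"
      by (intro sum.cong refl) (simp add: fapply distrib_left distrib_right)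
    then show "mul (x + y) v c = (mul x v + mul y v) c"
      by (simp add: mul_def plus_fun_apply[of "\<lambda>c. if c \<in> M then _ c else _ c"] sum.distrib)
  qed
  show "mul (sc c x) v = sc c (mul x v)" for c x
    by (rule ext) (auto simp add: mul_def fapply sum_distrib_left intro!: sum.cong)
qed

lemmas mul_add_right = lin_add[OF lin_mul_right]
lemmas mul_add_left = lin_add[OF lin_mul_left]
lemmas mul_diff_right = lin_diff[OF lin_mul_right]
lemmas mul_diff_left = lin_diff[OF lin_mul_left]
lemmas mul_sc_right = lin_sc[OF lin_mul_right]
lemmas mul_sc_left = lin_sc[OF lin_mul_left]
lemmas mul_0_right [simp] = lin_0[OF lin_mul_right]
lemmas mul_0_left [simp] = lin_0[OF lin_mul_left]
lemmas mul_sum_right = lin_sum[OF lin_mul_right]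
lemmas mul_sum_left = lin_sum[OF lin_mul_left]
lemmas mul_neg_right = fvp.linear_neg[OF lin_mul_right]
lemmas mul_neg_left = fvp.linear_neg[OF lin_mul_left]
lemmas mul_distribs = mul_add_right mul_add_left mul_diff_right mul_diff_left mul_sc_right mul_sc_left
  mul_neg_right mul_neg_left

lemma mul_proj_left [simp]: "mul (proj u) v = mul u v"
  by (rule ext) (auto simp: mul_def proj_def intro!: sum.cong)

lemma mul_proj_right [simp]: "mul u (proj v) = mul u v"
  by (rule ext) (auto simp: mul_def proj_def intro!: sum.cong)

lemma proj_mul [simp]: "proj (mul u v) = mul u v"
  by (simp add: proj_VM)

lemma mul_ev:
  assumes "a \<in> M" "b \<in> M"
  shows "mul (ev a) (ev b) = (if a + b \<in> M then sc (\<gamma> a b) (ev (a + b)) else 0)"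
proof
  fix c
  have *: "(\<Sum>x\<in>M. \<Sum>y\<in>M. if x + y = c then \<gamma> x y * ev a x * ev b y else 0)
      = (\<Sum>x\<in>M. if x = a then (\<Sum>y\<in>M. if y = b then (if x + y = c then \<gamma> x y else 0) else 0) else 0)"
    by (auto intro!: sum.cong simp: ev_def)
  have **: "\<dots> = (if a + b = c then \<gamma> a b else 0)"
    using assms finite_M by simp
  show "mul (ev a) (ev b) c = (if a + b \<in> M then sc (\<gamma> a b) (ev (a + b)) else 0) c"
    unfolding mul_def * ** by (auto simp: fapply) (auto simp: ev_def)
qed

lemma lin_extend_proj:
  assumes "lin f" "lin g" "\<And>a. a \<in> M \<Longrightarrow> f (ev a) = g (ev a)"
  shows "f (proj v) = g (proj v)"
  unfolding proj_expand by (simp add: lin_sum[OF assms(1)] lin_sum[OF assms(2)]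
      lin_sc[OF assms(1)] lin_sc[OF assms(2)] assms(3))

lemma lin_comp: "lin f \<Longrightarrow> lin g \<Longrightarrow> lin (\<lambda>x. f (g x))"
  by (rule linI) (simp_all add: lin_add lin_sc)

lemma mul_assoc_ev:
  assumes "a \<in> M" "b \<in> M" "c \<in> M"
  shows "mul (mul (ev a) (ev b)) (ev c) = mul (ev a) (mul (ev b) (ev c))"
  using assms M_addD[of "a + b" c] M_addD[of a "b + c"]
  by (auto simp: mul_ev mul_sc_left mul_sc_right \<gamma>_add_left \<gamma>_add_right add.assoc fv.scale_scale mult_ac)

lemma mul_assoc: "mul (mul u v) w = mul u (mul v w)"
proof -
  have 1: "mul (mul (ev a) (ev b)) w = mul (ev a) (mul (ev b) w)" if "a \<in> M" "b \<in> M" for a b w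
    using lin_extend_proj[where f="mul (mul (ev a) (ev b))" and g="\<lambda>w. mul (ev a) (mul (ev b) w)" and v=w]
      lin_mul_right lin_comp[OF lin_mul_right lin_mul_right] mul_assoc_ev that by simp
  have 2: "mul (mul (ev a) v) w = mul (ev a) (mul v w)" if "a \<in> M" for a v w
    using lin_extend_proj[where f="\<lambda>v. mul (mul (ev a) v) w" and g="\<lambda>v. mul (ev a) (mul v w)" and v=v]
      lin_comp[OF lin_mul_left lin_mul_right] lin_comp[OF lin_mul_right lin_mul_left] 1 that by simp
  show ?thesis
    using lin_extend_proj[where f="\<lambda>u. mul (mul u v) w" and g="\<lambda>u. mul u (mul v w)" and v=u]
      lin_comp[OF lin_mul_left lin_mul_left] lin_mul_left 2 by simp
qed

lemma un_mul: "mul un v = proj v"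
  using lin_extend_proj[OF lin_mul_right lin_id, of un v] by (simp add: mul_ev)

lemma mul_un: "mul v un = proj v"
  using lin_extend_proj[OF lin_mul_left lin_id, of un v] by (simp add: mul_ev)

lemma un_mul_VM [simp]: "v \<in> VM \<Longrightarrow> mul un v = v"
  by (simp add: un_mul proj_VM)

lemma mul_un_VM [simp]: "v \<in> VM \<Longrightarrow> mul v un = v"
  by (simp add: mul_un proj_VM)

lemma mul_0_coeff: "mul u v 0 = u 0 * v 0"
proof -
  have "a + b = 0 \<longleftrightarrow> a = 0 \<and> b = 0" for a b :: "nat \<Rightarrow> nat"
    by (auto simp: fun_eq_iff plus_fun_apply zero_fun_apply)
  then have "mul u v 0 = (\<Sum>a\<in>M. \<Sum>b\<in>M. if a = 0 \<and> b = 0 then u 0 * v 0 else 0)"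
    by (auto simp: mul_def intro!: sum.cong)
  also have "\<dots> = (\<Sum>a\<in>M. if a = 0 then u 0 * v 0 else 0)"
    using finite_M by (intro sum.cong) (auto simp: sum.delta)
  finally show ?thesis using finite_M by simp
qed

lemma F_VM: "v \<in> F k \<Longrightarrow> v \<in> VM"
  by (simp add: F_def)

lemma F_0 [simp]: "0 \<in> F k" and F_add: "u \<in> F k \<Longrightarrow> v \<in> F k \<Longrightarrow> u + v \<in> F k"
  and F_diff: "u \<in> F k \<Longrightarrow> v \<in> F k \<Longrightarrow> u - v \<in> F k"
  and F_sc: "u \<in> F k \<Longrightarrow> sc c u \<in> F k"
  and F_neg: "u \<in> F k \<Longrightarrow> - u \<in> F k"
  by (auto simp: F_def fapply)

lemma F_sum: "(\<And>x. x \<in> S \<Longrightarrow> f x \<in> F k) \<Longrightarrow> sum f S \<in> F k"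
  by (auto simp: F_def VM_def fapply intro!: sum.neutral)

lemma F_mono: "k \<le> l \<Longrightarrow> v \<in> F l \<Longrightarrow> v \<in> F k"
  by (auto simp: F_def)

lemma F_0_VM: "F 0 = VM"
  by (simp add: F_def)

lemma F_Dmax: "Dmax \<le> k \<Longrightarrow> v \<in> F k \<Longrightarrow> v = 0"
  using deg_less_Dmax by (fastforce simp: F_def VM_def fun_eq_iff zero_fun_apply)

lemma F_ev: "a \<in> M \<Longrightarrow> k \<le> deg a \<Longrightarrow> ev a \<in> F k"
  by (auto simp: F_def) (auto simp: ev_def)

lemma F_X [simp]: "i \<in> {1..n} \<Longrightarrow> X i \<in> F 1"
  by (rule F_ev) auto

lemma F_1_iff: "v \<in> F 1 \<longleftrightarrow> v \<in> VM \<and> v 0 = 0"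
proof
  assume v: "v \<in> VM \<and> v 0 = 0"
  have "v a = 0" if "deg a < 1" for a
    using v that deg_eq_0[of a] by (cases "a \<in> M") (auto simp: VM_def)
  then show "v \<in> F 1" using v by (simp add: F_def)
qed (auto simp: F_def)

lemma F_mul:
  assumes "u \<in> F k" "v \<in> F l"
  shows "mul u v \<in> F (k + l)"
proof -
  have "mul u v c = 0" if "deg c < k + l" for c
  proof -
    have "(if a + b = c then \<gamma> a b * u a * v b else 0) = 0" for a b
    proof (cases "a + b = c")
      case True
      then have "deg a < k \<or> deg b < l" using that deg_add[of a b] by auto
      then show ?thesis using assms by (auto simp: F_def)
    qed auto
    then show ?thesis by (simp add: mul_def)
  qed
  then show ?thesis by (simp add: F_def)
qed

lemma F_mul_left: "u \<in> F k \<Longrightarrow> mul u v \<in> F k"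
  using F_mul[of u k "proj v" 0] by (simp add: F_0_VM)

lemma F_mul_right: "v \<in> F k \<Longrightarrow> mul u v \<in> F k"
  using F_mul[of "proj u" 0 v k] by (simp add: F_0_VM)

lemma X_mul_ev: "ux i + b \<in> M \<Longrightarrow> mul (X i) (ev b) = sc (\<gamma> (ux i) b) (ev (ux i + b))"
  using M_addD[of "ux i" b] by (simp add: mul_ev)

text \<open>Every nontrivial monomial is a nonzero multiple of some \<open>x_i\<close> times a
  shorter one, so the unit and left multiplication by generators reach the whole algebra.\<close>

lemma generator_induct:
  assumes "v \<in> VM" and "fv.subspace W" and un: "un \<in> W"
    and X: "\<And>i v. i \<in> {1..n} \<Longrightarrow> v \<in> VM \<Longrightarrow> v \<in> W \<Longrightarrow> mul (X i) v \<in> W"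
  shows "v \<in> W"
proof -
  have "ev a \<in> W" if "a \<in> M" for a
    using that
  proof (induction "deg a" arbitrary: a rule: less_induct)
    case less
    show ?case
    proof (cases "a = 0")
      case True
      then show ?thesis using un by simp
    next
      case False
      then obtain i b where ib: "i \<in> {1..n}" "b \<in> M" "a = ux i + b" using M_decomp less by blast
      then have "ev b \<in> W" using less deg_add[of "ux i" b] by simp
      then have "mul (X i) (ev b) \<in> W" using X ib by simp
      then have "sc (inverse (\<gamma> (ux i) b)) (sc (\<gamma> (ux i) b) (ev a)) \<in> W"
        using X_mul_ev[of i b] ib less.prems by (metis fv.subspace_scale[OF assms(2)])
      then show ?thesis using \<gamma>_nz by simp
    qed
  qed
  then show ?thesis
    using VM_expand[OF assms(1)] assms(2) by (metis (no_types, lifting) fv.subspace_scale fv.subspace_sum)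
qed

subsection \<open>Derivations and homomorphisms\<close>

text \<open>The condition \<open>f (proj v) = f v\<close> makes the representing function unique:
  two functions agreeing on \<open>VM\<close> could otherwise differ elsewhere. \<open>chom\<close>
  follows the same convention.\<close>

definition cder :: "'k coords_map \<Rightarrow> bool"
  where "cder f \<longleftrightarrow> lin f \<and> (\<forall>v. f v \<in> VM) \<and> (\<forall>v. f (proj v) = f v) \<and>
    (\<forall>u v. f (mul u v) = mul (f u) v + mul u (f v))"

definition chom :: "'k coords_map \<Rightarrow> bool"
  where "chom s \<longleftrightarrow> lin s \<and> (\<forall>v. s v \<in> VM) \<and> (\<forall>v. s (proj v) = s v) \<and>
    (\<forall>u v. s (mul u v) = mul (s u) (s v)) \<and> s un = un"

lemma cder_lin: "cder f \<Longrightarrow> lin f" and cder_VM: "cder f \<Longrightarrow> f v \<in> VM"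
  and cder_proj: "cder f \<Longrightarrow> f (proj v) = f v"
  and cder_mul: "cder f \<Longrightarrow> f (mul u v) = mul (f u) v + mul u (f v)"
  by (auto simp: cder_def)

lemma chom_lin: "chom f \<Longrightarrow> lin f" and chom_VM: "chom f \<Longrightarrow> f v \<in> VM"
  and chom_proj: "chom f \<Longrightarrow> f (proj v) = f v"
  and chom_mul: "chom f \<Longrightarrow> f (mul u v) = mul (f u) (f v)"
  and chom_un: "chom f \<Longrightarrow> f un = un"
  by (auto simp: chom_def)

lemma cder_un: "cder f \<Longrightarrow> f un = 0"
  using cder_mul[of f un un] cder_VM[of f un] by (simp add: mul_ev)

lemma lin_fun_add: "lin f \<Longrightarrow> lin g \<Longrightarrow> lin (f + g)"
  by (rule linI) (auto simp: plus_fun_apply lin_add lin_sc fv.scale_right_distrib)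

lemma lin_fun_diff: "lin f \<Longrightarrow> lin g \<Longrightarrow> lin (f - g)"
  by (rule linI) (auto simp: minus_apply lin_add lin_sc fv.scale_right_diff_distrib)

lemma cder_add: "cder f \<Longrightarrow> cder g \<Longrightarrow> cder (f + g)"
  by (auto simp: cder_def lin_fun_add) (auto simp: plus_fun_apply mul_distribs)

lemma cder_diff: "cder f \<Longrightarrow> cder g \<Longrightarrow> cder (f - g)"
  by (auto simp: cder_def lin_fun_diff) (auto simp: minus_apply mul_distribs)

lemma cder_sc: "cder f \<Longrightarrow> cder (\<lambda>v. sc c (f v))"
  by (auto simp: cder_def mul_distribs fv.scale_right_distrib lin_add lin_sc mult.commute intro!: linI)

lemma cder_0: "cder (\<lambda>v. 0)"
  by (auto simp: cder_def intro!: linI)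

lemma cder_sum: "(\<And>x. x \<in> S \<Longrightarrow> cder (f x)) \<Longrightarrow> cder (\<lambda>v. \<Sum>x\<in>S. sc (c x) (f x v))"
proof (induction S rule: infinite_finite_induct)
  case (insert x S)
  have "cder ((\<lambda>v. sc (c x) (f x v)) + (\<lambda>v. \<Sum>x\<in>S. sc (c x) (f x v)))"
    using insert by (intro cder_add cder_sc) auto
  then show ?case using insert by (simp add: plus_fun_def)
qed (auto simp: cder_0)

lemma cder_bracket: "cder f \<Longrightarrow> cder g \<Longrightarrow> cder (\<lambda>v. f (g v) - g (f v))"
  unfolding cder_def
  by (intro conjI linI allI) (auto simp: lin_add lin_sc lin_diff mul_distribs fv.scale_right_diff_distrib algebra_simps)

lemma cder_ad: "cder (ad b)"
  unfolding cder_def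
proof (intro conjI allI)
  show "lin (ad b)"
    by (rule linI) (auto simp: ad_def mul_distribs fv.scale_right_diff_distrib)
  show "ad b (mul u v) = mul (ad b u) v + mul u (ad b v)" for u v
    by (simp add: ad_def mul_distribs mul_assoc)
qed (auto simp: ad_def)

lemma cder_zeroI:
  assumes f: "cder f" and X: "\<And>i. i \<in> {1..n} \<Longrightarrow> f (X i) = 0"
  shows "f v = 0"
proof -
  have "fv.subspace {v. f v = 0}"
    using cder_lin[OF f] by (auto simp: fv.subspace_def lin_add lin_sc lin_0)
  then have "proj v \<in> {v. f v = 0}"
    by (rule generator_induct[rotated]) (auto simp: cder_un[OF f] cder_mul[OF f] X)
  then show ?thesis by (simp add: cder_proj[OF f])
qed

lemma cder_eqI:
  assumes "cder f" "cder g" and "\<And>i. i \<in> {1..n} \<Longrightarrow> f (X i) = g (X i)"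
  shows "f = g"
  using cder_zeroI[OF cder_diff[OF assms(1,2)]] assms(3) by (force simp: minus_apply)

lemma chom_eqI:
  assumes f: "chom f" and g: "chom g" and X: "\<And>i. i \<in> {1..n} \<Longrightarrow> f (X i) = g (X i)"
  shows "f = g"
proof
  fix v
  have "fv.subspace {v. f v = g v}"
    using chom_lin[OF f] chom_lin[OF g] by (auto simp: fv.subspace_def lin_add lin_sc lin_0)
  then have "proj v \<in> {v. f v = g v}"
    by (rule generator_induct[rotated]) (auto simp: chom_un[OF f] chom_un[OF g] chom_mul[OF f] chom_mul[OF g] X)
  then show "f v = g v" by (simp add: chom_proj[OF f] chom_proj[OF g])
qed

lemma central_if_commutes_X:
  assumes "\<And>i. i \<in> {1..n} \<Longrightarrow> mul b (X i) = mul (X i) b"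
  shows "mul b v = mul v b"
  using cder_zeroI[OF cder_ad, of b v] assms by (simp add: ad_def)

text \<open>This holds because \<open>x\<^sub>i\<close>, and with it its image, is nilpotent.\<close>

lemma chom_X:
  assumes s: "chom s" and i: "i \<in> {1..n}"
  shows "s (X i) \<in> F 1"
proof -
  have 1: "((\<lambda>w. mul (X i) w) ^^ k) un \<in> F k" for k
  proof (induction k)
    case (Suc k)
    then show ?case using F_mul[OF F_X[OF i] Suc] by (simp add: plus_1_eq_Suc)
  qed (simp add: F_0_VM)
  have 2: "s (((\<lambda>w. mul (X i) w) ^^ k) un) 0 = (s (X i) 0) ^ k" for k
  proof (induction k)
    case 0
    show ?case by (simp add: chom_un[OF s]) (simp add: ev_def)
  qed (simp add: chom_mul[OF s] mul_0_coeff)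
  have "((\<lambda>w. mul (X i) w) ^^ Dmax) un = 0" using F_Dmax 1 by blast
  then have "(s (X i) 0) ^ Dmax = 0" using 2[of Dmax] by (simp add: lin_0[OF chom_lin[OF s]] zero_fun_apply)
  then show ?thesis by (simp add: F_1_iff chom_VM[OF s])
qed

text \<open>Generators are mapped into the radical, so a product of k of them lands in its k-th
  power.\<close>

lemma chom_F:
  assumes s: "chom s" and v: "v \<in> F k"
  shows "s v \<in> F k"
proof -
  have "s (ev a) \<in> F (deg a)" if "a \<in> M" for a
    using that
  proof (induction "deg a" arbitrary: a rule: less_induct)
    case less
    show ?case
    proof (cases "a = 0")
      case True
      then show ?thesis by (simp add: chom_un[OF s] F_0_VM)
    next
      case False
      then obtain i b where ib: "i \<in> {1..n}" "b \<in> M" "a = ux i + b" using M_decomp less by blast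
      then have "s (ev b) \<in> F (deg b)" using less deg_add[of "ux i" b] by simp
      then have "mul (s (X i)) (s (ev b)) \<in> F (deg a)"
        using F_mul[OF chom_X[OF s ib(1)]] ib deg_add[of "ux i" b] by simp
      then have "s (sc (\<gamma> (ux i) b) (ev a)) \<in> F (deg a)"
        using X_mul_ev[of i b] ib less.prems by (simp flip: chom_mul[OF s])
      then have "sc (inverse (\<gamma> (ux i) b)) (sc (\<gamma> (ux i) b) (s (ev a))) \<in> F (deg a)"
        unfolding lin_sc[OF chom_lin[OF s]] by (rule F_sc)
      then show ?thesis using \<gamma>_nz by simp
    qed
  qed
  moreover have "s v = (\<Sum>a\<in>M. sc (v a) (s (ev a)))"
    by (subst VM_expand[OF F_VM[OF v]]) (simp add: lin_sum[OF chom_lin[OF s]] lin_sc[OF chom_lin[OF s]])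
  moreover have "sc (v a) (s (ev a)) \<in> F k" if "a \<in> M" "s (ev a) \<in> F (deg a)" for a
  proof (cases "deg a < k")
    case True
    then have "v a = 0" using v by (simp add: F_def)
    then show ?thesis by simp
  next
    case False
    then show ?thesis using F_mono[OF _ that(2), of k] by (intro F_sc) auto
  qed
  ultimately show ?thesis by (auto intro!: F_sum)
qed

subsection \<open>Conjugation by elements of \<open>1 + J\<close>\<close>

fun pw :: "'k coords \<Rightarrow> nat \<Rightarrow> 'k coords"
  where "pw v 0 = un" | "pw v (Suc k) = mul v (pw v k)"

text \<open>The inverse of \<open>1 - a\<close> as a geometric series, complete after
  \<open>Dmax\<close> terms when \<open>a\<close> is in the radical. Being polynomial in
  \<open>a\<close>, it keeps the later normalisation regular.\<close>

definition geo :: "'k coords_map"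
  where "geo a = (\<Sum>k<Dmax. pw a k)"

lemma VM_pw [simp]: "pw a k \<in> VM"
  by (cases k) auto

lemma VM_geo [simp]: "geo a \<in> VM"
  by (simp add: geo_def VM_sum)

lemma pw_F: "a \<in> F 1 \<Longrightarrow> pw a k \<in> F k"
proof (induction k)
  case (Suc k)
  then show ?case using F_mul[of a 1 "pw a k" k] by (simp add: plus_1_eq_Suc)
qed (simp add: F_0_VM)

lemma pw_commute: "a \<in> VM \<Longrightarrow> mul (pw a k) a = mul a (pw a k)"
  by (induction k) (auto simp: mul_assoc)

lemma
  assumes "a \<in> F 1"
  shows one_minus_mul_geo: "mul (un - a) (geo a) = un"
    and geo_mul_one_minus: "mul (geo a) (un - a) = un"
proof -
  have "(\<Sum>k<N. pw a k) - mul a (\<Sum>k<N. pw a k) = un - pw a N" for N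
  proof (induction N)
    case (Suc N)
    have "(\<Sum>k<Suc N. pw a k) - mul a (\<Sum>k<Suc N. pw a k) =
        ((\<Sum>k<N. pw a k) - mul a (\<Sum>k<N. pw a k)) + (pw a N - mul a (pw a N))"
      by (simp add: mul_distribs)
    then show ?case by (simp add: Suc)
  qed simp
  moreover have z: "pw a Dmax = 0" using pw_F[OF assms] F_Dmax by blast
  ultimately have "geo a - mul a (geo a) = un" by (simp add: geo_def)
  then show 1: "mul (un - a) (geo a) = un" by (simp add: mul_distribs)
  have "mul (geo a) a = mul a (geo a)"
    using pw_commute[OF F_VM[OF assms]] by (simp add: geo_def mul_sum_left mul_sum_right)
  then show "mul (geo a) (un - a) = un" using 1 by (simp add: mul_distribs)
qed

end

lemma op_apply:
  fixes f g :: "('i \<Rightarrow> 'k::field) \<Rightarrow> 'j \<Rightarrow> 'k"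
  shows "(f + g) v = f v + g v" "(f - g) v = f v - g v" "(- f) v = - f v"
    "(0 :: ('i \<Rightarrow> 'k) \<Rightarrow> 'j \<Rightarrow> 'k) v = 0"
  by (simp_all add: fapply)

section \<open>Algebras with monomial coordinates\<close>

text \<open>An algebra with an isomorphism \<open>co\<close> onto the coordinate model.
  \<open>HH1\<close>, \<open>Aut\<close> and \<open>Out\<close> are all computed at this level; the
  presentation by generators and relations enters only when the locale is interpreted.\<close>

locale qalg = qcoord n m \<gamma>
  for n m and \<gamma> :: "(nat \<Rightarrow> nat) \<Rightarrow> (nat \<Rightarrow> nat) \<Rightarrow> 'k::alg_closed_field" +
  fixes A :: "('k, 'a) module" and co :: "'a \<Rightarrow> 'k coords"
  assumes co_inj: "inj_on co (carrier A)"
    and co_image: "co ` carrier A = VM"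
    and add_closed: "\<And>x y. x \<in> carrier A \<Longrightarrow> y \<in> carrier A \<Longrightarrow> x \<oplus>\<^bsub>A\<^esub> y \<in> carrier A"
    and mult_closed: "\<And>x y. x \<in> carrier A \<Longrightarrow> y \<in> carrier A \<Longrightarrow> x \<otimes>\<^bsub>A\<^esub> y \<in> carrier A"
    and smult_closed: "\<And>c x. x \<in> carrier A \<Longrightarrow> c \<odot>\<^bsub>A\<^esub> x \<in> carrier A"
    and zero_closed: "\<zero>\<^bsub>A\<^esub> \<in> carrier A"
    and one_closed: "\<one>\<^bsub>A\<^esub> \<in> carrier A"
    and co_add: "\<And>x y. x \<in> carrier A \<Longrightarrow> y \<in> carrier A \<Longrightarrow> co (x \<oplus>\<^bsub>A\<^esub> y) = co x + co y"
    and co_mult: "\<And>x y. x \<in> carrier A \<Longrightarrow> y \<in> carrier A \<Longrightarrow> co (x \<otimes>\<^bsub>A\<^esub> y) = mul (co x) (co y)"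
    and co_smult: "\<And>c x. x \<in> carrier A \<Longrightarrow> co (c \<odot>\<^bsub>A\<^esub> x) = sc c (co x)"
    and co_zero: "co \<zero>\<^bsub>A\<^esub> = 0"
    and co_one: "co \<one>\<^bsub>A\<^esub> = un"
begin

definition ve :: "'k coords \<Rightarrow> 'a"
  where "ve v = inv_into (carrier A) co v"

lemma co_VM [simp]: "x \<in> carrier A \<Longrightarrow> co x \<in> VM"
  using co_image by blast

lemma ve_closed [simp]: "v \<in> VM \<Longrightarrow> ve v \<in> carrier A"
  unfolding ve_def using co_image by (metis inv_into_into)

lemma co_ve [simp]: "v \<in> VM \<Longrightarrow> co (ve v) = v"
  unfolding ve_def using co_image by (metis f_inv_into_f)

lemma ve_co [simp]: "x \<in> carrier A \<Longrightarrow> ve (co x) = x"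
  unfolding ve_def using co_inj by simp

lemma co_eqI: "x \<in> carrier A \<Longrightarrow> y \<in> carrier A \<Longrightarrow> co x = co y \<Longrightarrow> x = y"
  using co_inj by (auto dest: inj_onD)

lemma ring_A: "ring A"
proof (rule ringI)
  show "abelian_group A"
  proof (rule abelian_groupI)
    fix x assume x: "x \<in> carrier A"
    show "\<exists>y\<in>carrier A. y \<oplus>\<^bsub>A\<^esub> x = \<zero>\<^bsub>A\<^esub>"
      using x by (intro bexI[of _ "ve (- co x)"] co_eqI) (auto simp: add_closed zero_closed co_add co_zero)
  qed (auto intro!: co_eqI simp: add_closed zero_closed co_add co_zero add_ac)
  show "Group.monoid A"
    by (rule monoidI) (auto intro!: co_eqI simp: mult_closed one_closed co_mult co_one mul_assoc)
qed (auto intro!: co_eqI simp: add_closed mult_closed co_add co_mult mul_distribs)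

lemma minus_A:
  assumes "x \<in> carrier A" "y \<in> carrier A"
  shows "x \<ominus>\<^bsub>A\<^esub> y \<in> carrier A" "co (x \<ominus>\<^bsub>A\<^esub> y) = co x - co y"
proof -
  interpret ring A by (rule ring_A)
  show c: "x \<ominus>\<^bsub>A\<^esub> y \<in> carrier A" using assms by simp
  have "(x \<ominus>\<^bsub>A\<^esub> y) \<oplus>\<^bsub>A\<^esub> y = x" using assms
    by (simp add: a_minus_def a_assoc l_neg)
  then have "co (x \<ominus>\<^bsub>A\<^esub> y) + co y = co x" using co_add[OF c assms(2)] by simp
  then show "co (x \<ominus>\<^bsub>A\<^esub> y) = co x - co y" by (simp add: eq_diff_eq)
qed

lemmas A_simps = add_closed mult_closed smult_closed zero_closed one_closed co_add co_mult co_smult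
  co_zero co_one minus_A

subsection \<open>Maps in coordinates\<close>

text \<open>\<open>up\<close> inserts \<open>proj\<close> and \<open>low\<close> restricts to the
  carrier: these are the extensionality conventions of the two sides, and they make the two
  transports mutually inverse on linear maps.\<close>

definition up :: "('a \<Rightarrow> 'a) \<Rightarrow> 'k coords_map"
  where "up D v = co (D (ve (proj v)))"

definition low :: "'k coords_map \<Rightarrow> 'a \<Rightarrow> 'a"
  where "low f = (\<lambda>x\<in>carrier A. ve (f (co x)))"

lemma low_apply [simp]: "x \<in> carrier A \<Longrightarrow> low f x = ve (f (co x))"
  by (simp add: low_def)

lemma low_extensional [simp]: "low f \<in> extensional (carrier A)"
  by (simp add: low_def)

lemma low_up:
  assumes "D \<in> extensional (carrier A)" "\<And>x. x \<in> carrier A \<Longrightarrow> D x \<in> carrier A"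
  shows "low (up D) = D"
proof
  fix x
  show "low (up D) x = D x"
    using assms by (cases "x \<in> carrier A") (auto simp: low_def up_def proj_VM extensional_def)
qed

lemma up_low:
  assumes "\<And>v. f v \<in> VM" "\<And>v. f (proj v) = f v"
  shows "up (low f) = f"
  by (rule ext) (simp add: up_def assms)

lemma low_eqD:
  assumes "low f = low g" and "\<And>v. f v \<in> VM" "\<And>v. g v \<in> VM"
    and "\<And>v. f (proj v) = f v" "\<And>v. g (proj v) = g v"
  shows "f = g"
  using up_low[of f] up_low[of g] assms by metis

lemma cder_low_eqD: "low f = low g \<Longrightarrow> cder f \<Longrightarrow> cder g \<Longrightarrow> f = g"
  by (erule low_eqD) (auto simp: cder_VM cder_proj)

lemma up_module_hom:
  assumes "D \<in> LinearCombinations.module_hom class_ring A A"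
  shows "lin (up D)" "up D v \<in> VM" "up D (proj v) = up D v" "x \<in> carrier A \<Longrightarrow> co (D x) = up D (co x)"
proof -
  have Dc: "D x \<in> carrier A" if "x \<in> carrier A" for x
    using assms that by (auto simp: LinearCombinations.module_hom_def)
  have D_add: "D (x \<oplus>\<^bsub>A\<^esub> y) = D x \<oplus>\<^bsub>A\<^esub> D y" if "x \<in> carrier A" "y \<in> carrier A" for x y
    using assms that by (auto simp: LinearCombinations.module_hom_def)
  have D_smult: "D (c \<odot>\<^bsub>A\<^esub> x) = c \<odot>\<^bsub>A\<^esub> D x" if "x \<in> carrier A" for x c
    using assms that by (auto simp: LinearCombinations.module_hom_def)
  show "up D v \<in> VM" "up D (proj v) = up D v"
    using Dc by (simp_all add: up_def proj_VM)
  show "x \<in> carrier A \<Longrightarrow> co (D x) = up D (co x)" by (simp add: up_def proj_VM)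
  show "lin (up D)"
  proof (rule linI)
    fix u v c
    have "ve (proj (u + v)) = ve (proj u) \<oplus>\<^bsub>A\<^esub> ve (proj v)"
      by (rule co_eqI) (auto simp: A_simps lin_add[OF lin_proj])
    then show "up D (u + v) = up D u + up D v"
      by (simp add: up_def A_simps Dc D_add)
    have "ve (proj (sc c v)) = c \<odot>\<^bsub>A\<^esub> ve (proj v)"
      by (rule co_eqI) (auto simp: A_simps lin_sc[OF lin_proj])
    then show "up D (sc c v) = sc c (up D v)" by (simp add: up_def A_simps Dc D_smult)
  qed
qed

lemma low_module_hom:
  assumes "lin f" "\<And>v. f v \<in> VM"
  shows "low f \<in> LinearCombinations.module_hom class_ring A A"
  unfolding LinearCombinations.module_hom_def
  using assms by (auto intro!: co_eqI simp: A_simps lin_add lin_sc)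

lemma low_derivations: "cder f \<Longrightarrow> low f \<in> derivations A"
  unfolding derivations_def
  by (auto intro!: low_module_hom co_eqI simp: cder_lin cder_VM A_simps cder_mul)

lemma up_derivations:
  assumes "D \<in> derivations A"
  shows "cder (up D)" "low (up D) = D"
proof -
  from assms have D: "D \<in> LinearCombinations.module_hom class_ring A A" "D \<in> extensional (carrier A)"
    "\<And>x y. x \<in> carrier A \<Longrightarrow> y \<in> carrier A \<Longrightarrow> D (x \<otimes>\<^bsub>A\<^esub> y) = (D x \<otimes>\<^bsub>A\<^esub> y) \<oplus>\<^bsub>A\<^esub> (x \<otimes>\<^bsub>A\<^esub> D y)"
    by (auto simp: derivations_def)
  have Dc: "D x \<in> carrier A" if "x \<in> carrier A" for x
    using D(1) that by (auto simp: LinearCombinations.module_hom_def)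
  show "low (up D) = D" by (rule low_up[OF D(2) Dc])
  have "up D (mul u v) = mul (up D u) v + mul u (up D v)" for u v
  proof -
    have "ve (mul u v) = ve (proj u) \<otimes>\<^bsub>A\<^esub> ve (proj v)" by (rule co_eqI) (auto simp: A_simps)
    then have "co (D (ve (mul u v))) = mul (co (D (ve (proj u)))) (proj v) + mul (proj u) (co (D (ve (proj v))))"
      by (simp add: D(3) A_simps Dc)
    then show ?thesis by (simp add: up_def)
  qed
  then show "cder (up D)" using up_module_hom[OF D(1)] by (simp add: cder_def)
qed

lemma derivations_eq: "derivations A = low ` {f. cder f}"
  using low_derivations up_derivations by (force simp: image_iff)

definition cInn :: "'k coords_map set"
  where "cInn = range ad"

lemma ad_proj_left [simp]: "ad (proj b) = ad b"
  by (rule ext) (simp add: ad_def)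

lemma cInn_cder: "f \<in> cInn \<Longrightarrow> cder f"
  by (auto simp: cInn_def cder_ad)

lemma cInn_add: "f \<in> cInn \<Longrightarrow> g \<in> cInn \<Longrightarrow> f + g \<in> cInn"
proof -
  have "ad b + ad c = ad (b + c)" for b c by (rule ext) (simp add: ad_def mul_distribs op_apply)
  then show "f \<in> cInn \<Longrightarrow> g \<in> cInn \<Longrightarrow> f + g \<in> cInn" by (auto simp: cInn_def)
qed

lemma cInn_sc: "f \<in> cInn \<Longrightarrow> (\<lambda>v. sc c (f v)) \<in> cInn"
proof -
  have "(\<lambda>v. sc c (ad b v)) = ad (sc c b)" for b
    by (rule ext) (simp add: ad_def mul_distribs fv.scale_right_diff_distrib)
  then show "f \<in> cInn \<Longrightarrow> (\<lambda>v. sc c (f v)) \<in> cInn" by (auto simp: cInn_def)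
qed

lemma cInn_neg: "f \<in> cInn \<Longrightarrow> - f \<in> cInn"
proof -
  have "- ad b = ad (- b)" for b by (rule ext) (simp add: ad_def mul_distribs op_apply)
  then show "f \<in> cInn \<Longrightarrow> - f \<in> cInn" by (auto simp: cInn_def)
qed

lemma cInn_diff: "f \<in> cInn \<Longrightarrow> g \<in> cInn \<Longrightarrow> f - g \<in> cInn"
  using cInn_add[of f "- g"] cInn_neg[of g] by simp

lemma cInn_0: "0 \<in> cInn"
proof -
  have "0 = ad 0" by (rule ext) (simp add: ad_def op_apply)
  then show ?thesis by (simp add: cInn_def)
qed

lemma cInn_bracket: "cder f \<Longrightarrow> (\<lambda>v. f (ad b v) - ad b (f v)) = ad (f b)"
  by (rule ext) (simp add: ad_def lin_diff[OF cder_lin] cder_mul)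

lemma inner_derivations_eq: "inner_derivations A = low ` cInn"
proof -
  have *: "(\<lambda>x\<in>carrier A. (a \<otimes>\<^bsub>A\<^esub> x) \<ominus>\<^bsub>A\<^esub> (x \<otimes>\<^bsub>A\<^esub> a)) = low (ad (co a))" if "a \<in> carrier A" for a
    unfolding low_def by (rule restrict_ext) (rule co_eqI, auto simp: A_simps that ad_def)
  have "inner_derivations A = (\<lambda>a. \<lambda>x\<in>carrier A. (a \<otimes>\<^bsub>A\<^esub> x) \<ominus>\<^bsub>A\<^esub> (x \<otimes>\<^bsub>A\<^esub> a)) ` carrier A"
    unfolding inner_derivations_def by (rule Setcompr_eq_image)
  also have "\<dots> = (\<lambda>a. low (ad (co a))) ` carrier A"
    by (intro image_cong refl *)
  also have "\<dots> = (\<lambda>b. low (ad b)) ` VM"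
    by (simp only: co_image[symmetric] image_image)
  also have "\<dots> = low ` cInn"
    unfolding cInn_def image_image
  proof (intro equalityI subsetI)
    fix x assume "x \<in> range (\<lambda>b. low (ad b))"
    then obtain b where "x = low (ad b)" by blast
    then have "x = low (ad (proj b))" by simp
    then show "x \<in> (\<lambda>b. low (ad b)) ` VM" using VM_proj[of b] by (rule image_eqI)
  next
    fix x assume "x \<in> (\<lambda>b. low (ad b)) ` VM"
    then show "x \<in> range (\<lambda>b. low (ad b))" by blast
  qed
  finally show ?thesis .
qed

subsection \<open>The Lie algebra \<open>HH\<^sup>1\<close> in coordinates\<close>

lemma Der_add: "cder f \<Longrightarrow> cder g \<Longrightarrow> low f \<oplus>\<^bsub>Der A\<^esub> low g = low (f + g)"
  by (auto simp: Der_def low_def intro!: co_eqI)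
    (auto simp: fun_eq_iff restrict_def cder_VM A_simps op_apply intro!: co_eqI)

lemma Der_smult: "cder f \<Longrightarrow> c \<odot>\<^bsub>Der A\<^esub> low f = low (\<lambda>v. sc c (f v))"
  by (auto simp: Der_def low_def fun_eq_iff restrict_def cder_VM A_simps intro!: co_eqI)

lemma Der_mult: "cder f \<Longrightarrow> cder g \<Longrightarrow> low f \<otimes>\<^bsub>Der A\<^esub> low g = low (\<lambda>v. f (g v) - g (f v))"
  by (auto simp: Der_def low_def fun_eq_iff restrict_def cder_VM A_simps intro!: co_eqI)

definition cls :: "'k coords_map \<Rightarrow> ('a \<Rightarrow> 'a) set"
  where "cls f = inner_derivations A +>\<^bsub>Der A\<^esub> low f"

lemma cls_eq: "cder f \<Longrightarrow> cls f = {low g | g. cder g \<and> g - f \<in> cInn}"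
proof -
  assume f: "cder f"
  have "cls f = (\<lambda>h. low h \<oplus>\<^bsub>Der A\<^esub> low f) ` cInn"
    by (auto simp: cls_def a_r_coset_def r_coset_def inner_derivations_eq)
  also have "\<dots> = (\<lambda>h. low (h + f)) ` cInn"
    using f cInn_cder Der_add by (intro image_cong) auto
  also have "\<dots> = {low g | g. cder g \<and> g - f \<in> cInn}"
  proof (intro equalityI subsetI)
    fix x assume "x \<in> {low g | g. cder g \<and> g - f \<in> cInn}"
    then obtain g where "x = low ((g - f) + f)" "g - f \<in> cInn" by auto
    then show "x \<in> (\<lambda>h. low (h + f)) ` cInn" by blast
  next
    fix x assume "x \<in> (\<lambda>h. low (h + f)) ` cInn"
    then obtain h where h: "h \<in> cInn" "x = low (h + f)" by auto
    then have "cder (h + f)" "(h + f) - f \<in> cInn" using f cInn_cder cder_add by auto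
    then show "x \<in> {low g | g. cder g \<and> g - f \<in> cInn}" using h by blast
  qed
  finally show ?thesis .
qed

lemma cls_eq_iff:
  assumes f: "cder f" and g: "cder g"
  shows "cls f = cls g \<longleftrightarrow> f - g \<in> cInn"
proof
  assume "cls f = cls g"
  moreover have "low f \<in> cls f" using f cInn_0 by (auto simp: cls_eq)
  ultimately have "low f \<in> cls g" by simp
  then obtain h where h: "cder h" "h - g \<in> cInn" "low f = low h" using g by (auto simp: cls_eq)
  then have "f = h" using cder_low_eqD f by blast
  then show "f - g \<in> cInn" using h by simp
next
  assume fg: "f - g \<in> cInn"
  have "h - f \<in> cInn \<longleftrightarrow> h - g \<in> cInn" for h
    using cInn_add[OF _ fg, of "h - f"] cInn_diff[OF _ fg, of "h - g"] by auto
  then show "cls f = cls g" using f g by (simp add: cls_eq)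
qed

lemma cls_mem: "x \<in> cls f \<Longrightarrow> cder f \<Longrightarrow> \<exists>g. cder g \<and> g - f \<in> cInn \<and> x = low g"
  by (auto simp: cls_eq)

lemma low_mem_cls: "cder f \<Longrightarrow> low f \<in> cls f"
  using cInn_0 by (auto simp: cls_eq)

text \<open>Operations on the quotient are unions over all representatives. Compatibility with
  \<open>cInn\<close> makes the members of the union equal, so it collapses to a single
  coset.\<close>

lemma UN_cls:
  assumes f: "cder f" and h: "\<And>g. cder g \<Longrightarrow> g - f \<in> cInn \<Longrightarrow> cder (T g) \<and> T g - T f \<in> cInn"
  shows "(\<Union>g\<in>{g. cder g \<and> g - f \<in> cInn}. cls (T g)) = cls (T f)"
proof -
  have Tf: "cder (T f)" using h[of f] f cInn_0 by simp
  have "cls (T g) = cls (T f)" if "cder g" "g - f \<in> cInn" for g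
    using h[OF that] Tf by (simp add: cls_eq_iff)
  moreover have "f \<in> {g. cder g \<and> g - f \<in> cInn}" using f cInn_0 by simp
  ultimately show ?thesis by (intro UN_constant_eq[of f]) blast+
qed

lemma HH1_carrier: "carrier (HH1 A) = cls ` {f. cder f}"
  by (auto simp: HH1_def quot_alg_def FactRing_def A_RCOSETS_def RCOSETS_def cls_def a_r_coset_def
      Der_def derivations_eq)

lemma HH1_zero: "\<zero>\<^bsub>HH1 A\<^esub> = cls (\<lambda>v. 0)"
proof -
  have "cls (\<lambda>v. 0) = low ` cInn"
    using cInn_cder by (subst cls_eq[OF cder_0]) (auto simp flip: zero_fun_def)
  then show ?thesis by (simp add: HH1_def quot_alg_def FactRing_def inner_derivations_eq)
qed

lemma HH1_add:
  assumes f: "cder f" and g: "cder g"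
  shows "cls f \<oplus>\<^bsub>HH1 A\<^esub> cls g = cls (f + g)"
proof -
  have "cls f \<oplus>\<^bsub>HH1 A\<^esub> cls g = {x \<oplus>\<^bsub>Der A\<^esub> y | x y. x \<in> cls f \<and> y \<in> cls g}"
    by (auto simp: HH1_def quot_alg_def FactRing_def set_add_def set_mult_def)
  also have "\<dots> = {low (f' + g') | f' g'. cder f' \<and> f' - f \<in> cInn \<and> cder g' \<and> g' - g \<in> cInn}"
    unfolding cls_eq[OF f] cls_eq[OF g] using Der_add by (auto; metis)
  also have "\<dots> = {low h | h. cder h \<and> h - (f + g) \<in> cInn}"
  proof (intro equalityI subsetI)
    fix x assume "x \<in> {low (f' + g') | f' g'. cder f' \<and> f' - f \<in> cInn \<and> cder g' \<and> g' - g \<in> cInn}"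
    then obtain f' g' where *: "x = low (f' + g')" "cder f'" "f' - f \<in> cInn" "cder g'" "g' - g \<in> cInn" by auto
    then have "(f' - f) + (g' - g) \<in> cInn" using cInn_add by blast
    then have "(f' + g') - (f + g) \<in> cInn" by (simp add: algebra_simps)
    then show "x \<in> {low h | h. cder h \<and> h - (f + g) \<in> cInn}" using * cder_add by blast
  next
    fix x assume "x \<in> {low h | h. cder h \<and> h - (f + g) \<in> cInn}"
    then obtain h where h: "x = low h" "cder h" "h - (f + g) \<in> cInn" by auto
    have "x = low ((h - g) + g)" "cder (h - g)" "(h - g) - f \<in> cInn" "g - g \<in> cInn"
      using h g cder_diff cInn_0 by (auto simp: diff_diff_eq add.commute)
    then show "x \<in> {low (f' + g') | f' g'. cder f' \<and> f' - f \<in> cInn \<and> cder g' \<and> g' - g \<in> cInn}"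
      using g by blast
  qed
  also have "\<dots> = cls (f + g)" using cls_eq[OF cder_add[OF f g]] by simp
  finally show ?thesis .
qed

lemma HH1_smult:
  assumes f: "cder f"
  shows "c \<odot>\<^bsub>HH1 A\<^esub> cls f = cls (\<lambda>v. sc c (f v))"
proof -
  have "c \<odot>\<^bsub>HH1 A\<^esub> cls f = (\<Union>x\<in>cls f. inner_derivations A +>\<^bsub>Der A\<^esub> (c \<odot>\<^bsub>Der A\<^esub> x))"
    by (simp add: HH1_def quot_alg_def)
  also have "\<dots> = (\<Union>g\<in>{g. cder g \<and> g - f \<in> cInn}. cls (\<lambda>v. sc c (g v)))"
    unfolding cls_eq[OF f] by (auto simp: Der_smult cls_def)
  also have "\<dots> = cls (\<lambda>v. sc c (f v))"
  proof (rule UN_cls[OF f])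
    fix g assume g: "cder g" "g - f \<in> cInn"
    have "(\<lambda>v. sc c (g v)) - (\<lambda>v. sc c (f v)) = (\<lambda>v. sc c ((g - f) v))"
      by (rule ext) (simp add: op_apply fv.scale_right_diff_distrib)
    then show "cder (\<lambda>v. sc c (g v)) \<and> (\<lambda>v. sc c (g v)) - (\<lambda>v. sc c (f v)) \<in> cInn"
      using g cInn_sc cder_sc by simp
  qed
  finally show ?thesis .
qed

text \<open>With f' = f + ad b and g' = g + ad c the difference is [f', ad c] - [g, ad b], and the
  bracket of a derivation with an inner one is inner.\<close>

lemma bracket_mod_inner:
  assumes "cder f" "cder g" "cder f'" "cder g'" "f' - f \<in> cInn" "g' - g \<in> cInn"
  shows "(\<lambda>v. f' (g' v) - g' (f' v)) - (\<lambda>v. f (g v) - g (f v)) \<in> cInn"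
proof -
  obtain b where b: "f' - f = ad b" using assms by (auto simp: cInn_def)
  obtain c where c: "g' - g = ad c" using assms by (auto simp: cInn_def)
  have f': "f' v = f v + ad b v" for v using fun_cong[OF b, of v] by (simp add: op_apply algebra_simps)
  have g': "g' v = g v + ad c v" for v using fun_cong[OF c, of v] by (simp add: op_apply algebra_simps)
  have "(\<lambda>v. f' (g' v) - g' (f' v)) - (\<lambda>v. f (g v) - g (f v)) =
      (\<lambda>v. f' (ad c v) - ad c (f' v)) - (\<lambda>v. g (ad b v) - ad b (g v))"
    by (rule ext) (simp add: op_apply g' f' lin_add[OF cder_lin[OF assms(1)]]
        lin_add[OF cder_lin[OF assms(2)]] lin_add[OF cder_lin[OF cder_ad]])
  then show ?thesis using cInn_bracket[OF assms(3)] cInn_bracket[OF assms(2)] cInn_diff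
    by (auto simp: cInn_def)
qed

lemma HH1_mult:
  assumes f: "cder f" and g: "cder g"
  shows "cls f \<otimes>\<^bsub>HH1 A\<^esub> cls g = cls (\<lambda>v. f (g v) - g (f v))"
proof -
  have "cls f \<otimes>\<^bsub>HH1 A\<^esub> cls g =
      (\<Union>x\<in>cls f. \<Union>y\<in>cls g. inner_derivations A +>\<^bsub>Der A\<^esub> (x \<otimes>\<^bsub>Der A\<^esub> y))"
    by (simp add: HH1_def quot_alg_def FactRing_def rcoset_mult_def)
  also have "\<dots> = cls (\<lambda>v. f (g v) - g (f v))"
  proof -
    have "inner_derivations A +>\<^bsub>Der A\<^esub> (x \<otimes>\<^bsub>Der A\<^esub> y) = cls (\<lambda>v. f (g v) - g (f v))"
      if xy: "x \<in> cls f" "y \<in> cls g" for x y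
    proof -
      obtain f' g' where *: "cder f'" "f' - f \<in> cInn" "x = low f'" "cder g'" "g' - g \<in> cInn" "y = low g'"
        using cls_mem xy f g by metis
      then have "inner_derivations A +>\<^bsub>Der A\<^esub> (x \<otimes>\<^bsub>Der A\<^esub> y) = cls (\<lambda>v. f' (g' v) - g' (f' v))"
        by (simp add: Der_mult cls_def)
      also have "\<dots> = cls (\<lambda>v. f (g v) - g (f v))"
        using bracket_mod_inner[OF f g] * f g by (simp add: cls_eq_iff cder_bracket)
      finally show ?thesis .
    qed
    then show ?thesis using low_mem_cls f g by (intro UN_constant_eq; blast)
  qed
  finally show ?thesis .
qed

lemma vectorspace_HH1: "vectorspace class_ring (HH1 A)"
proof (rule vs_criteria)
  show "field (class_ring :: 'k ring)" by (rule VS_Connect.class_field)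
  show "\<forall>v\<in>carrier (HH1 A). \<exists>w\<in>carrier (HH1 A). v \<oplus>\<^bsub>HH1 A\<^esub> w = \<zero>\<^bsub>HH1 A\<^esub>"
  proof
    fix v assume "v \<in> carrier (HH1 A)"
    then obtain f where f: "cder f" "v = cls f" by (auto simp: HH1_carrier)
    have "f + (\<lambda>v. sc (- 1) (f v)) = (\<lambda>v. 0)" by (rule ext) (simp add: op_apply)
    then have "v \<oplus>\<^bsub>HH1 A\<^esub> cls (\<lambda>v. sc (- 1) (f v)) = \<zero>\<^bsub>HH1 A\<^esub>"
      unfolding f(2) HH1_add[OF f(1) cder_sc[OF f(1)]] HH1_zero by (rule arg_cong)
    then show "\<exists>w\<in>carrier (HH1 A). v \<oplus>\<^bsub>HH1 A\<^esub> w = \<zero>\<^bsub>HH1 A\<^esub>"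
      using cder_sc[OF f(1)] unfolding HH1_carrier by blast
  qed
  have *: "(\<lambda>v. sc a (f v)) + (\<lambda>v. sc b (g v)) = (\<lambda>v. sc a (f v) + sc b (g v))"
    "f + (\<lambda>v. 0) = f" for a b :: 'k and f g :: "'k coords_map"
    by (rule ext, simp add: op_apply)+
  show "\<forall>v\<in>carrier (HH1 A). v \<oplus>\<^bsub>HH1 A\<^esub> \<zero>\<^bsub>HH1 A\<^esub> = v"
    by (auto simp: HH1_carrier HH1_zero HH1_add cder_0 *)
  show "\<forall>a b v. a \<in> carrier (class_ring :: 'k ring) \<and> b \<in> carrier (class_ring :: 'k ring) \<and> v \<in> carrier (HH1 A) \<longrightarrow>
      (a \<oplus>\<^bsub>class_ring\<^esub> b) \<odot>\<^bsub>HH1 A\<^esub> v = (a \<odot>\<^bsub>HH1 A\<^esub> v) \<oplus>\<^bsub>HH1 A\<^esub> (b \<odot>\<^bsub>HH1 A\<^esub> v)"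
    by (auto simp: HH1_carrier HH1_add HH1_smult cder_sc * fv.scale_left_distrib)
  show "\<forall>a v w. a \<in> carrier (class_ring :: 'k ring) \<and> v \<in> carrier (HH1 A) \<and> w \<in> carrier (HH1 A) \<longrightarrow>
      a \<odot>\<^bsub>HH1 A\<^esub> (v \<oplus>\<^bsub>HH1 A\<^esub> w) = (a \<odot>\<^bsub>HH1 A\<^esub> v) \<oplus>\<^bsub>HH1 A\<^esub> (a \<odot>\<^bsub>HH1 A\<^esub> w)"
    by (auto simp: HH1_carrier HH1_add HH1_smult cder_sc cder_add * op_apply fv.scale_right_distrib)
qed (auto simp: HH1_carrier HH1_zero HH1_add HH1_smult cder_0 cder_add cder_sc add_ac)

end

context qalg
begin

subsection \<open>Diagonal derivations\<close>

text \<open>The additive weight of \<open>x^a\<close> with weight \<open>c i\<close> on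
  \<open>x_i\<close>; additivity in \<open>a\<close> is what makes \<open>dg c\<close> a
  derivation.\<close>

definition wt :: "(nat \<Rightarrow> 'k) \<Rightarrow> 'k coords"
  where "wt c a = (\<Sum>i\<in>{1..n}. c i * of_nat (a i))"

definition dg :: "(nat \<Rightarrow> 'k) \<Rightarrow> 'k coords_map"
  where "dg c v = (\<lambda>a. wt c a * proj v a)"

definition unit_fun :: "nat \<Rightarrow> nat \<Rightarrow> 'k"
  where "unit_fun i = (\<lambda>j. if j = i then 1 else 0)"

lemma wt_add: "wt c (a + b) = wt c a + wt c b"
  by (simp add: wt_def plus_fun_apply distrib_left sum.distrib)

lemma wt_ux: "i \<in> {1..n} \<Longrightarrow> wt c (ux i) = c i"
  by (simp add: wt_def ux_def if_distrib[of of_nat] if_distrib[of "\<lambda>x. c _ * x"] cong: if_cong)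

lemma cder_dg: "cder (dg c)"
  unfolding cder_def
proof (intro conjI allI)
  show "lin (dg c)" by (rule linI) (auto simp: dg_def proj_def fext algebra_simps)
  show "dg c v \<in> VM" for v by (auto simp: dg_def VM_def proj_def)
  show "dg c (proj v) = dg c v" for v by (simp add: dg_def proj_VM)
  fix u v
  show "dg c (mul u v) = mul (dg c u) v + mul u (dg c v)"
  proof
    fix d
    show "dg c (mul u v) d = (mul (dg c u) v + mul u (dg c v)) d"
    proof (cases "d \<in> M")
      case True
      have "wt c d * (\<Sum>a\<in>M. \<Sum>b\<in>M. if a + b = d then \<gamma> a b * u a * v b else 0) =
        (\<Sum>a\<in>M. \<Sum>b\<in>M. (if a + b = d then \<gamma> a b * dg c u a * v b else 0) +
          (if a + b = d then \<gamma> a b * u a * dg c v b else 0))"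
        unfolding sum_distrib_left
        by (intro sum.cong refl) (auto simp: dg_def proj_def wt_add algebra_simps)
      moreover have "dg c (mul u v) d = wt c d * mul u v d" by (simp add: dg_def)
      ultimately show ?thesis using True by (simp add: plus_fun_apply mul_def sum.distrib)
    qed (simp add: dg_def[of c "mul u v"] plus_fun_apply, simp add: mul_def)
  qed
qed

lemma dg_sum: "(\<lambda>v. \<Sum>x\<in>S. sc (b x) (dg (c x) v)) = dg (\<lambda>i. \<Sum>x\<in>S. b x * c x i)"
proof (intro ext)
  fix v a
  have "wt (\<lambda>i. \<Sum>x\<in>S. b x * c x i) a = (\<Sum>x\<in>S. b x * wt (c x) a)"
    unfolding wt_def sum_distrib_right sum_distrib_left by (subst sum.swap) (simp add: mult.assoc)
  then show "(\<Sum>x\<in>S. sc (b x) (dg (c x) v)) a = dg (\<lambda>i. \<Sum>x\<in>S. b x * c x i) v a"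
    by (simp add: dg_def fapply sum_distrib_right mult.assoc)
qed

text \<open>The constant term of \<open>b\<close> is a multiple of the unit and commutes with
  everything, so \<open>b\<close> may be replaced by its part in the radical.\<close>

lemma ad_F:
  assumes "v \<in> F k"
  shows "ad b v \<in> F (k + 1)"
proof -
  define b' where "b' = proj b - sc (b 0) un"
  have "b' \<in> F 1" by (simp add: b'_def F_1_iff) (simp add: fapply proj_def ev_def)
  then have "ad b' v \<in> F (k + 1)"
    unfolding ad_def using F_mul[of b' 1 v k] F_mul[of v k b' 1] assms
    by (intro F_diff) (simp_all add: add.commute)
  moreover have "ad b' v = ad b v"
    using F_VM[OF assms] by (simp add: ad_def b'_def mul_distribs)
  ultimately show ?thesis by simp
qed

text \<open>An inner derivation maps \<open>x_i\<close> into the square of the radical, whereas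
  \<open>dg c\<close> multiplies it by \<open>c i\<close>. Hence diagonal derivations stay
  independent in \<open>HH1\<close>.\<close>

lemma dg_inner:
  assumes "dg c \<in> cInn" "i \<in> {1..n}"
  shows "c i = 0"
proof -
  obtain b where "dg c = ad b" using assms by (auto simp: cInn_def)
  then have "dg c (X i) \<in> F (1 + 1)" using ad_F[OF F_X[OF assms(2)], of b] by simp
  then have "dg c (X i) (ux i) = 0" using assms(2) by (simp add: F_def)
  then show ?thesis using assms(2) by (simp add: dg_def proj_def wt_ux) (simp add: ev_def)
qed

lemma cder_zero: "cder 0"
  using cder_0 by (simp add: zero_fun_def)

subsection \<open>Dimension of subspaces of \<open>HH\<^sup>1\<close>\<close>

lemma cls_sum_mem:
  assumes T: "LinearCombinations.submodule class_ring T (HH1 A)"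
    and f: "finite S" "\<And>x. x \<in> S \<Longrightarrow> cder (f x) \<and> cls (f x) \<in> T"
  shows "cls (\<lambda>v. \<Sum>x\<in>S. sc (c x) (f x v)) \<in> T"
  using f
proof (induction S rule: finite_induct)
  case empty
  then show ?case using submodule.zero_closed[OF T] by (simp add: HH1_zero)
next
  case (insert x S)
  have "cls (\<lambda>v. \<Sum>x\<in>insert x S. sc (c x) (f x v)) = cls ((\<lambda>v. sc (c x) (f x v)) + (\<lambda>v. \<Sum>x\<in>S. sc (c x) (f x v)))"
    using insert by (simp add: plus_fun_def[where 'a = "'k coords"])
  also have "\<dots> = cls (\<lambda>v. sc (c x) (f x v)) \<oplus>\<^bsub>HH1 A\<^esub> cls (\<lambda>v. \<Sum>x\<in>S. sc (c x) (f x v))"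
    using insert by (intro HH1_add[symmetric] cder_sc cder_sum) auto
  also have "\<dots> \<in> T"
    using insert HH1_smult[of "f x" "c x"] submodule.smult_closed[OF T, of "c x" "cls (f x)"]
    by (intro submodule.m_closed[OF T]) auto
  finally show ?case .
qed

text \<open>Passage from abstract dimension to derivations. \<open>bound\<close> concerns the
  \<open>n + 1\<close> indices from 0 to n, so it excludes independent sets with more than n
  elements; conversely the n unit diagonal classes are independent whenever they lie in
  \<open>T\<close>.\<close>

lemma dim_HH1_subspace:
  assumes T: "LinearCombinations.submodule class_ring T (HH1 A)"
    and bound: "\<And>f. (\<And>i. i \<le> n \<Longrightarrow> cder (f i) \<and> cls (f i) \<in> T) \<Longrightarrow>
      \<exists>c. (\<exists>i\<le>n. c i \<noteq> 0) \<and> (\<lambda>v. \<Sum>i\<le>n. sc (c i) (f i v)) \<in> cInn"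
  shows "vectorspace.dim class_ring (HH1 A\<lparr>carrier := T\<rparr>) \<le> n"
    and "(\<And>c. cls (dg c) \<in> T) \<Longrightarrow> vectorspace.dim class_ring (HH1 A\<lparr>carrier := T\<rparr>) = n"
proof -
  interpret H: vectorspace "class_ring :: 'k ring" "HH1 A" by (rule vectorspace_HH1)
  have "VectorSpace.subspace class_ring T (HH1 A)"
    unfolding VectorSpace.subspace_def using T H.vectorspace_axioms by blast
  then interpret V: vectorspace "class_ring :: 'k ring" "HH1 A\<lparr>carrier := T\<rparr>"
    by (rule H.subspace_is_vs)
  have TH: "T \<subseteq> carrier (HH1 A)" using submodule.subset[OF T] .
  define r where "r b = (SOME f. cder f \<and> cls f = b)" for b
  have r: "cder (r b)" "cls (r b) = b" if "b \<in> T" for b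
  proof -
    have "\<exists>f. cder f \<and> cls f = b" using TH that by (auto simp: HH1_carrier)
    then show "cder (r b)" "cls (r b) = b" unfolding r_def by (metis (mono_tags, lifting) someI_ex)+
  qed
  have lincomb: "V.lincomb a B = cls (\<lambda>v. \<Sum>b\<in>B. sc (a b) (r b v))" if "finite B" "B \<subseteq> T" for a B
    using that
  proof (induction B rule: finite_induct)
    case empty
    then show ?case by (simp add: V.lincomb_def HH1_zero)
  next
    case (insert b B)
    have "V.lincomb a (insert b B) = (a b \<odot>\<^bsub>HH1 A\<^esub> b) \<oplus>\<^bsub>HH1 A\<^esub> V.lincomb a B"
      unfolding V.lincomb_def using insert submodule.smult_closed[OF T]
      by (subst V.M.finsum_insert) auto
    also have "\<dots> = cls (\<lambda>v. sc (a b) (r b v)) \<oplus>\<^bsub>HH1 A\<^esub> cls (\<lambda>v. \<Sum>b\<in>B. sc (a b) (r b v))"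
      using insert r HH1_smult[of "r b" "a b"] by simp
    also have "\<dots> = cls ((\<lambda>v. sc (a b) (r b v)) + (\<lambda>v. \<Sum>b\<in>B. sc (a b) (r b v)))"
      using insert r by (intro HH1_add cder_sc cder_sum) auto
    also have "\<dots> = cls (\<lambda>v. \<Sum>b\<in>insert b B. sc (a b) (r b v))"
      using insert by (simp add: plus_fun_def[where 'a = "'k coords"])
    finally show ?case .
  qed
  have li_bound: "finite S \<and> card S \<le> n" if S: "S \<subseteq> T" "V.lin_indpt S" for S
  proof (rule ccontr)
    assume "\<not> (finite S \<and> card S \<le> n)"
    then obtain B where B: "B \<subseteq> S" "finite B" "card B = Suc n"
      by (metis infinite_arbitrarily_large not_less_eq_eq obtain_subset_with_card_n)
    then obtain h where h: "bij_betw h {..n} B"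
      using ex_bij_betw_nat_finite[of B] by (auto simp: atLeast0LessThan lessThan_Suc_atMost)
    then have hT: "h i \<in> T" if "i \<le> n" for i using B S that by (auto dest!: bij_betw_apply)
    obtain c where c: "\<exists>i\<le>n. c i \<noteq> 0" "(\<lambda>v. \<Sum>i\<le>n. sc (c i) (r (h i) v)) \<in> cInn"
      using bound[of "\<lambda>i. r (h i)"] hT r by auto
    define a where "a b = c (inv_into {..n} h b)" for b
    have ah: "a (h i) = c i" if "i \<le> n" for i
      using h that by (simp add: a_def bij_betw_inv_into_left)
    have "(\<lambda>v. \<Sum>b\<in>B. sc (a b) (r b v)) = (\<lambda>v. \<Sum>i\<le>n. sc (c i) (r (h i) v))"
      by (rule ext, rule sum.reindex_bij_betw[OF h, symmetric, THEN trans]) (simp add: ah)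
    then have "V.lincomb a B = cls (\<lambda>v. \<Sum>i\<le>n. sc (c i) (r (h i) v))"
      using lincomb[of B a] B S by auto
    also have "\<dots> = cls (\<lambda>v. 0)"
      using c(2) hT r by (subst cls_eq_iff) (auto simp: cder_zero intro!: cder_sum simp flip: zero_fun_def)
    finally have z: "V.lincomb a B = \<zero>\<^bsub>HH1 A\<^esub>" by (simp add: HH1_zero)
    obtain i where i: "i \<le> n" "c i \<noteq> 0" using c by auto
    then have "h i \<in> B" "a (h i) \<noteq> 0" using h ah by (auto dest!: bij_betw_apply)
    then have "V.lin_dep S" unfolding V.lin_dep_def using B z
      by (intro exI[of _ B] exI[of _ a] exI[of _ "h i"]) auto
    then show False using S by simp
  qed
  have "V.lin_indpt {}" by (auto simp: V.lin_dep_def)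
  \<comment> \<open>The uniform bound on independent sets yields a maximal one, and with it a finite
    basis.\<close>
  then obtain B where B: "finite B" "maximal B (\<lambda>S. S \<subseteq> carrier (HH1 A\<lparr>carrier := T\<rparr>) \<and> V.lin_indpt S)"
    using maximal_exists[of "\<lambda>S. S \<subseteq> carrier (HH1 A\<lparr>carrier := T\<rparr>) \<and> V.lin_indpt S" n "{}"] li_bound
    by auto
  have bas: "V.basis B" by (rule V.max_li_is_basis[OF B(2)])
  have dimB: "V.dim = card B" by (rule V.dim_basis[OF B(1) bas])
  have BT: "B \<subseteq> T" "V.lin_indpt B" using bas by (auto simp: V.basis_def)
  show le: "V.dim \<le> n" using li_bound[OF BT] dimB by simp
  have fd: "V.fin_dim" unfolding V.fin_dim_def using bas B(1) by (auto simp: V.basis_def)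
  assume dgT: "\<And>c. cls (dg c) \<in> T"
  have ker: "(\<Sum>x\<in>S. b x * c x i) = 0"
    if "cls (\<lambda>v. \<Sum>x\<in>S. sc (b x) (dg (c x) v)) = \<zero>\<^bsub>HH1 A\<^esub>" "i \<in> {1..n}" for S :: "nat set" and b c i
  proof -
    have "cls (dg (\<lambda>i. \<Sum>x\<in>S. b x * c x i)) = cls (\<lambda>v. 0)" using that by (simp add: dg_sum HH1_zero)
    then have "dg (\<lambda>i. \<Sum>x\<in>S. b x * c x i) \<in> cInn"
      by (subst (asm) cls_eq_iff) (auto simp: cder_zero cder_dg simp flip: zero_fun_def)
    then show ?thesis using dg_inner that by blast
  qed
  define E where "E = (\<lambda>i. cls (dg (unit_fun i))) ` {1..n}"
  have inj: "inj_on (\<lambda>i. cls (dg (unit_fun i))) {1..n}"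
  proof (rule inj_onI, rule ccontr)
    fix i j assume ij: "i \<in> {1..n}" "j \<in> {1..n}" "cls (dg (unit_fun i)) = cls (dg (unit_fun j))" "i \<noteq> j"
    have "dg (unit_fun i) - dg (unit_fun j) \<in> cInn" using ij by (simp add: cls_eq_iff cder_dg)
    moreover have "dg (unit_fun i) - dg (unit_fun j) = dg (\<lambda>l. unit_fun i l - unit_fun j l)"
      by (rule ext)+ (simp add: op_apply dg_def fapply wt_def left_diff_distrib sum_subtractf)
    ultimately have "unit_fun i i - unit_fun j i = 0" using dg_inner[of "\<lambda>l. unit_fun i l - unit_fun j l" i] ij(1) by simp
    then show False using ij by (simp add: unit_fun_def)
  qed
  have "V.lin_indpt E"
  proof
    assume "V.lin_dep E"
    then obtain B a v where B: "finite B" "B \<subseteq> E" "V.lincomb a B = \<zero>\<^bsub>HH1 A\<^esub>" "v \<in> B" "a v \<noteq> 0"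
      by (auto simp: V.lin_dep_def)
    \<comment> \<open>The dependence is pulled back to indices, so that the representatives
      \<open>r\<close> can be exchanged for the diagonal derivations, from which they differ by
      inner ones.\<close>
    define I where "I = {i \<in> {1..n}. cls (dg (unit_fun i)) \<in> B}"
    define g where "g i = cls (dg (unit_fun i))" for i
    have gI: "bij_betw g I B"
      unfolding bij_betw_def
    proof (intro conjI equalityI subsetI)
      show "inj_on g I" unfolding g_def by (rule inj_on_subset[OF inj]) (auto simp: I_def)
      show "x \<in> g ` I" if xB: "x \<in> B" for x
      proof -
        obtain i where "i \<in> {1..n}" "x = g i" using B(2) xB unfolding E_def g_def by blast
        then show ?thesis using xB unfolding I_def g_def by blast
      qed
    qed (auto simp: I_def g_def)
    have "V.lincomb a B = cls (\<lambda>v. \<Sum>i\<in>I. sc (a (g i)) (r (g i) v))"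
    proof -
      have "B \<subseteq> T" using B(2) dgT by (auto simp: E_def)
      moreover have "(\<Sum>i\<in>I. sc (a (g i)) (r (g i) v)) = (\<Sum>b\<in>B. sc (a b) (r b v))" for v
        by (rule sum.reindex_bij_betw[OF gI])
      ultimately show ?thesis using lincomb[OF B(1)] by simp
    qed
    also have "\<dots> = cls (\<lambda>v. \<Sum>i\<in>I. sc (a (g i)) (dg (unit_fun i) v))"
    proof -
      have "(\<lambda>v. \<Sum>i\<in>I. sc (a (g i)) (r (g i) v)) - (\<lambda>v. \<Sum>i\<in>I. sc (a (g i)) (dg (unit_fun i) v)) \<in> cInn"
      proof -
        have e: "r (g i) - dg (unit_fun i) \<in> cInn" for i
          using r[of "g i"] dgT[of "unit_fun i"] by (auto simp: g_def simp flip: cls_eq_iff[OF _ cder_dg])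
        have "finite I" by (simp add: I_def)
        then have "(\<lambda>v. \<Sum>i\<in>I. sc (a (g i)) ((r (g i) - dg (unit_fun i)) v)) \<in> cInn"
        proof (induction I rule: finite_induct)
          case empty
          then show ?case using cInn_0 by (simp flip: zero_fun_def)
        next
          case (insert i I)
          then show ?case using cInn_add[OF cInn_sc[OF e[of i], of "a (g i)"] insert.IH]
            by (simp add: plus_fun_def[where 'a = "'k coords"])
        qed
        moreover have "(\<lambda>v. \<Sum>i\<in>I. sc (a (g i)) ((r (g i) - dg (unit_fun i)) v)) =
            (\<lambda>v. \<Sum>i\<in>I. sc (a (g i)) (r (g i) v)) - (\<lambda>v. \<Sum>i\<in>I. sc (a (g i)) (dg (unit_fun i) v))"
          by (rule ext) (simp add: op_apply fv.scale_right_diff_distrib sum_subtractf)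
        ultimately show ?thesis by simp
      qed
      then show ?thesis using r[of "g _"] dgT by (subst cls_eq_iff) (auto intro!: cder_sum simp: g_def cder_dg)
    qed
    finally have "cls (\<lambda>v. \<Sum>i\<in>I. sc (a (g i)) (dg (unit_fun i) v)) = \<zero>\<^bsub>HH1 A\<^esub>" using B by simp
    note k = ker[OF this]
    obtain j where j: "j \<in> I" "v = g j" using gI B(4) by (auto simp: bij_betw_def)
    have "(\<Sum>x\<in>I. a (g x) * unit_fun x j) = (\<Sum>x\<in>I. if x = j then a (g x) else 0)"
      by (rule sum.cong) (auto simp: unit_fun_def)
    also have "\<dots> = a (g j)" using j by (simp add: I_def)
    finally show False using k[of j] j B(5) by (simp add: I_def)
  qed
  moreover have "E \<subseteq> T" using dgT by (auto simp: E_def)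
  ultimately have "card E \<le> V.dim" using V.li_le_dim(2)[OF fd, of E] by simp
  then show "V.dim = n" using le inj by (simp add: E_def card_image)
qed

subsection \<open>The \<open>p\<close>-power operation\<close>

lemma cder_funpow_VM: "cder f \<Longrightarrow> N > 0 \<Longrightarrow> (f ^^ N) v \<in> VM"
  by (cases N) (auto simp: cder_VM)

lemma cder_funpow_proj: "cder f \<Longrightarrow> N > 0 \<Longrightarrow> (f ^^ N) (proj v) = (f ^^ N) v"
proof -
  assume "cder f" "N > 0"
  then obtain K where "N = Suc K" by (cases N) auto
  then show ?thesis using \<open>cder f\<close> by (simp add: funpow_Suc_right cder_proj del: funpow.simps)
qed

lemma cder_p_power:
  assumes f: "cder f" and p: "CHAR('k) > 0"
  shows "cder (f ^^ (CHAR('k) ^ j))"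
proof -
  have "CHAR('k) ^ j > 0" using p by simp
  then show ?thesis
    unfolding cder_def
    using leibniz_char[of f mul f f, OF cder_lin[OF f] p cder_mul[OF f]] lin_funpow[OF cder_lin[OF f]]
      cder_funpow_VM[OF f] cder_funpow_proj[OF f] by blast
qed

text \<open>Both \<open>f\<close> and \<open>g = f + ad b\<close> control the connection \<open>N = f + L\<^sub>b\<close> through a Leibniz rule:
  \<open>N(uv) = N(u)v + u f(v)\<close> and \<open>N(uv) = g(u)v + u N(v)\<close>. Comparing \<open>p\<close>-th powers at \<open>u = 1\<close> and \<open>v = 1\<close>
  shows that \<open>g\<^sup>p\<close> and \<open>f\<^sup>p\<close> differ by \<open>ad (N\<^sup>p 1)\<close>.\<close>

lemma p_power_mod_inner:
  assumes f: "cder f" and g: "cder g" and fg: "g - f \<in> cInn" and p: "CHAR('k) > 0"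
  shows "g ^^ (CHAR('k) ^ j) - f ^^ (CHAR('k) ^ j) \<in> cInn"
proof -
  define P where "P = CHAR('k) ^ j"
  have P: "P > 0" using p by (simp add: P_def)
  obtain b where b: "g - f = ad b" using fg by (auto simp: cInn_def)
  have g': "g v = f v + ad b v" for v using fun_cong[OF b, of v] by (simp add: op_apply algebra_simps)
  define N where "N v = f v + mul b v" for v
  have N: "lin N" unfolding N_def
    by (rule linI) (simp_all add: lin_add[OF cder_lin[OF f]] lin_sc[OF cder_lin[OF f]] mul_distribs
      fv.scale_right_distrib)
  have 1: "N (mul u v) = mul (N u) v + mul u (f v)" for u v
    by (simp add: N_def cder_mul[OF f] mul_distribs mul_assoc)
  have 2: "N (mul u v) = mul (g u) v + mul u (N v)" for u v
    by (simp add: N_def g' ad_def cder_mul[OF f] mul_distribs mul_assoc)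
  define B where "B = (N ^^ P) un"
  have e1: "(N ^^ P) (mul u v) = mul ((N ^^ P) u) v + mul u ((f ^^ P) v)" for u v
    unfolding P_def by (rule leibniz_char[where B = mul, OF N p 1])
  have e2: "(N ^^ P) (mul u v) = mul ((g ^^ P) u) v + mul u ((N ^^ P) v)" for u v
    unfolding P_def by (rule leibniz_char[where B = mul, OF N p 2])
  have "(g ^^ P) v - (f ^^ P) v = ad B v" for v
  proof -
    have "mul B v + proj ((f ^^ P) v) = proj ((g ^^ P) v) + mul v B"
      using e1[of un "proj v"] e2[of "proj v" un] cder_funpow_proj[OF f P] cder_funpow_proj[OF g P]
      by (simp add: B_def un_mul mul_un proj_VM)
    then show ?thesis
      using proj_VM[OF cder_funpow_VM[OF f P]] proj_VM[OF cder_funpow_VM[OF g P]]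
      by (simp add: ad_def algebra_simps)
  qed
  then have "g ^^ P - f ^^ P = ad B" by (intro ext) (simp add: op_apply)
  then show ?thesis by (simp add: P_def cInn_def)
qed

lemma HH1_p_power_cls:
  assumes f: "cder f" and p: "CHAR('k) > 0"
  shows "HH1_p_power A (cls f) = cls (f ^^ CHAR('k))"
proof -
  have eq: "(\<lambda>x\<in>carrier A. (low g ^^ N) x) = low (g ^^ N)" if g: "cder g" for g N
  proof -
    have "(low g ^^ N) x = ve ((g ^^ N) (co x)) \<and> (g ^^ N) (co x) \<in> VM" if "x \<in> carrier A" for x
      by (induction N) (use g that in \<open>auto simp: cder_VM\<close>)
    then show ?thesis unfolding low_def by (intro restrict_ext) (simp add: low_def)
  qed
  have "HH1_p_power A (cls f) = (\<Union>g\<in>{g. cder g \<and> g - f \<in> cInn}. cls (g ^^ CHAR('k)))"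
    unfolding HH1_p_power_def cls_eq[OF f] by (auto simp: eq cls_def)
  also have "\<dots> = cls (f ^^ CHAR('k))"
    using UN_cls[OF f, of "\<lambda>g. g ^^ CHAR('k)"] cder_p_power[OF _ p, of _ 1]
      p_power_mod_inner[OF f _ _ p, of _ 1] by simp
  finally show ?thesis .
qed

subsection \<open>The diagonal torus in positive characteristic\<close>

lemma of_nat_power_CHAR:
  assumes "CHAR('k) > 0"
  shows "(of_nat k :: 'k) ^ CHAR('k) = of_nat k"
proof (induction k)
  case 0
  then show ?case using assms by (simp add: power_0_left)
next
  case (Suc k)
  then show ?case using freshmans_dream[OF prime_CHAR_semidom[OF assms] refl, of 1 "of_nat k"] by simp
qed

text \<open>The eigenvalue on \<open>x^a\<close> is raised to the p-th power; the exponents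
  \<open>a i\<close> lie in the prime field and are fixed by Frobenius.\<close>

lemma dg_p_power:
  assumes p: "CHAR('k) > 0"
  shows "dg c ^^ CHAR('k) = dg (\<lambda>i. c i ^ CHAR('k))"
proof (intro ext)
  fix v a
  have "(dg c ^^ N) v a = wt c a ^ N * proj v a" if "N > 0" for N
    using that
  proof (induction N)
    case (Suc N)
    then show ?case by (cases "N = 0") (auto simp: dg_def proj_def)
  qed simp
  moreover have "wt c a ^ CHAR('k) = wt (\<lambda>i. c i ^ CHAR('k)) a"
    by (simp add: wt_def freshmans_dream_sum[OF prime_CHAR_semidom[OF p]] power_mult_distrib
        of_nat_power_CHAR[OF p])
  ultimately show "(dg c ^^ CHAR('k)) v a = dg (\<lambda>i. c i ^ CHAR('k)) v a"
    using p by (simp add: dg_def)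
qed

lemma dg_torus:
  assumes p: "CHAR('k) > 0"
  shows "torus_char_p A (range (\<lambda>c. cls (dg c)))"
proof -
  define p' where "p' = CHAR('k)"
  have pp: "prime p'" "p' > 0" using p by (auto simp: p'_def prime_CHAR_semidom)
  let ?T = "range (\<lambda>c. cls (dg c))"
  have vs: "Module.module (class_ring :: 'k ring) (HH1 A)"
    using vectorspace_HH1 by (simp add: vectorspace_def)
  have add: "dg c + dg d = dg (\<lambda>i. c i + d i)" for c d
    by (rule ext)+ (simp add: op_apply dg_def fapply wt_def distrib_right sum.distrib)
  have sm: "(\<lambda>v. sc b (dg c v)) = dg (\<lambda>i. b * c i)" for b c
    by (rule ext)+ (simp add: dg_def fapply wt_def sum_distrib_left sum_distrib_right mult.assoc)
  have z: "dg (\<lambda>_. 0) = (\<lambda>v. 0)"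
    by (rule ext)+ (simp add: dg_def wt_def fapply)
  have sub: "LinearCombinations.submodule class_ring ?T (HH1 A)"
  proof (rule submodule.intro)
    show "\<zero>\<^bsub>HH1 A\<^esub> \<in> ?T" unfolding HH1_zero z[symmetric] by blast
  qed (auto simp: vs HH1_carrier cder_dg HH1_add HH1_smult add sm)
  have br: "cls (dg c) \<otimes>\<^bsub>HH1 A\<^esub> cls (dg d) = \<zero>\<^bsub>HH1 A\<^esub>" for c d
  proof -
    have "(\<lambda>v. dg c (dg d v) - dg d (dg c v)) = (\<lambda>v. 0)"
      by (rule ext)+ (auto simp: dg_def fapply proj_def)
    then show ?thesis by (simp add: HH1_mult cder_dg HH1_zero)
  qed
  have pw: "HH1_p_power A (cls (dg c)) = cls (dg (\<lambda>i. c i ^ p'))" for c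
    by (simp add: HH1_p_power_cls[OF cder_dg p] dg_p_power[OF p] p'_def)
  have rs: "restricted_subalgebra A ?T"
    unfolding restricted_subalgebra_def using sub br pw submodule.zero_closed[OF sub] by auto
  have ss: "cls (dg c) \<in> restricted_span A {HH1_p_power A (cls (dg c))}" for c
    unfolding restricted_span_def
  proof (rule InterI, clarify)
    fix U assume U: "restricted_subalgebra A U" "{HH1_p_power A (cls (dg c))} \<subseteq> U"
    have Upow: "cls (dg (\<lambda>i. c i ^ (p' ^ Suc j))) \<in> U" for j
    proof (induction j)
      case (Suc j)
      then have "HH1_p_power A (cls (dg (\<lambda>i. c i ^ (p' ^ Suc j)))) \<in> U"
        using U by (simp add: restricted_subalgebra_def)
      then show ?case by (simp add: pw power_mult[symmetric] mult.commute)
    qed (use U pw in simp)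
    \<comment> \<open>The n + 1 vectors of entries \<open>c i ^ (p' ^ j)\<close>, for j from 0 to n,
      have only n coordinates and are therefore dependent.\<close>
    obtain b where b: "\<exists>j\<in>{..n}. b j \<noteq> 0" "\<forall>i\<in>{1..n}. (\<Sum>j\<in>{..n}. b j * c i ^ (p' ^ j)) = 0"
      using homogeneous_system_solution[of "{1..n}" "{..n}" "\<lambda>j i. c i ^ (p' ^ j)"] by auto
    define s where "s = (LEAST j. b j \<noteq> 0)"
    obtain j0 where j0: "j0 \<le> n" "b j0 \<noteq> 0" using b by auto
    have bs: "b s \<noteq> 0" unfolding s_def by (rule LeastI[of _ j0]) (rule j0)
    have sn: "s \<le> n" using Least_le[of "\<lambda>j. b j \<noteq> 0" j0] j0 by (simp add: s_def)
    have lt: "b j = 0" if "j < s" for j using that not_less_Least by (auto simp: s_def)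
    \<comment> \<open>Extracting p^s-th roots of the coefficients, possible over an algebraically
      closed field, strips s Frobenius powers from the relation. It then starts with
      \<open>c i\<close> itself, which is thus a combination of its proper p-powers.\<close>
    have "\<exists>y. y ^ (p' ^ s) = b j" for j using nth_root_exists[of "p' ^ s" "b j"] pp by simp
    then obtain y where y: "\<And>j. y j ^ (p' ^ s) = b j" by metis
    have ys: "y s \<noteq> 0" using y[of s] bs pp by (auto simp: power_0_left)
    have rel: "(\<Sum>j\<in>{s..n}. y j * c i ^ (p' ^ (j - s))) = 0" if i: "i \<in> {1..n}" for i
    proof -
      have "(\<Sum>j\<in>{s..n}. y j * c i ^ (p' ^ (j - s))) ^ (p' ^ s) = (\<Sum>j\<in>{s..n}. b j * c i ^ (p' ^ j))"
        unfolding p'_def freshmans_dream_sum'[OF prime_CHAR_semidom[OF p] refl]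
        by (rule sum.cong) (auto simp: power_mult_distrib y[unfolded p'_def] power_mult[symmetric] power_add[symmetric])
      also have "\<dots> = (\<Sum>j\<in>{..n}. b j * c i ^ (p' ^ j))"
        by (rule sum.mono_neutral_left) (auto simp: lt)
      also have "\<dots> = 0" using b i by simp
      finally show ?thesis by simp
    qed
    define S where "S = {Suc s..n}"
    have ci: "c i = (\<Sum>j\<in>S. (- y j / y s) * c i ^ (p' ^ (j - s)))" if i: "i \<in> {1..n}" for i
    proof -
      have "{s..n} = insert s S" using sn by (auto simp: S_def)
      then have "y s * c i = - (\<Sum>j\<in>S. y j * c i ^ (p' ^ (j - s)))"
        using rel[OF i] by (simp add: S_def eq_neg_iff_add_eq_0)
      then have "c i = - (\<Sum>j\<in>S. y j * c i ^ (p' ^ (j - s))) / y s"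
        using ys by (simp add: field_simps)
      then show ?thesis by (simp add: sum_divide_distrib sum_negf[symmetric])
    qed
    have "wt c a = wt (\<lambda>i. \<Sum>j\<in>S. (- y j / y s) * c i ^ (p' ^ (j - s))) a" for a
      unfolding wt_def by (rule sum.cong) (use ci in auto)
    then have "dg c = dg (\<lambda>i. \<Sum>j\<in>S. (- y j / y s) * c i ^ (p' ^ (j - s)))"
      unfolding dg_def by simp
    also have "\<dots> = (\<lambda>v. \<Sum>j\<in>S. sc (- y j / y s) (dg (\<lambda>i. c i ^ (p' ^ (j - s))) v))"
      by (simp only: dg_sum)
    finally have e: "dg c = (\<lambda>v. \<Sum>j\<in>S. sc (- y j / y s) (dg (\<lambda>i. c i ^ (p' ^ (j - s))) v))" .
    show "cls (dg c) \<in> U" unfolding e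
    proof (rule cls_sum_mem)
      show "LinearCombinations.submodule class_ring U (HH1 A)" using U by (simp add: restricted_subalgebra_def)
      fix j assume "j \<in> S"
      \<comment> \<open>On \<open>S\<close> one has \<open>j > s\<close>, so only proper p-powers
        occur; \<open>Upow\<close> is indexed with this shift by one.\<close>
      then have "j - s = Suc (j - s - 1)" by (auto simp: S_def)
      then show "cder (dg (\<lambda>i. c i ^ (p' ^ (j - s)))) \<and> cls (dg (\<lambda>i. c i ^ (p' ^ (j - s)))) \<in> U"
        using Upow[of "j - s - 1"] cder_dg by metis
    qed (simp add: S_def)
  qed
  show ?thesis unfolding torus_char_p_def using rs br ss by blast
qed

end

lemma pact_sum: "pact h (\<Sum>x\<in>S. f x) v = (\<Sum>x\<in>S. pact h (f x) v)"
  by (induction S rule: infinite_finite_induct) (auto simp: pact_add)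

subsection \<open>Additive polynomials\<close>

text \<open>Additive polynomials, combinations of X^(p^j) with j >= s. They carry derivations to
  derivations, and s records how many Frobenius powers each term contains at least.\<close>

definition p_polys :: "nat \<Rightarrow> 'k::field poly set"
  where "p_polys s = {P. \<forall>i. coeff P i \<noteq> 0 \<longrightarrow> (\<exists>j\<ge>s. i = CHAR('k) ^ j)}"

lemma p_polys_add: "P \<in> p_polys s \<Longrightarrow> Q \<in> p_polys s \<Longrightarrow> P + Q \<in> p_polys s"
  unfolding p_polys_def by (auto; metis add_0 add_0_right)

lemma p_polys_smult: "P \<in> p_polys s \<Longrightarrow> Polynomial.smult c P \<in> p_polys s"
  by (auto simp: p_polys_def)

lemma p_polys_0: "0 \<in> p_polys s"
  by (auto simp: p_polys_def)

lemma p_polys_sum: "(\<And>x. x \<in> S \<Longrightarrow> f x \<in> p_polys s) \<Longrightarrow> sum f S \<in> p_polys s"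
  by (induction S rule: infinite_finite_induct) (auto simp: p_polys_0 p_polys_add)

lemma p_polys_mono: "s \<le> s' \<Longrightarrow> P \<in> p_polys s' \<Longrightarrow> P \<in> p_polys s"
  unfolding p_polys_def by (auto; meson order_trans)

lemma p_polys_monom: "s \<le> j \<Longrightarrow> monom c (CHAR('k) ^ j) \<in> (p_polys s :: 'k::field poly set)"
  by (auto simp: p_polys_def)

text \<open>Frobenius is additive on polynomials, so it shifts each exponent p^l to p^(l+1) and only
  changes coefficients.\<close>

lemma p_polys_power:
  fixes P :: "'k::field poly"
  assumes p: "CHAR('k) > 0" and P: "P \<in> p_polys s"
  shows "P ^ (CHAR('k) ^ j) \<in> p_polys (s + j)"
proof (induction j)
  case (Suc j)
  define Q where "Q = P ^ (CHAR('k) ^ j)"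
  have pr: "prime CHAR('k poly)" using prime_CHAR_semidom[OF p] by simp
  have "Q ^ CHAR('k) = (\<Sum>i\<le>degree Q. monom (coeff Q i) i) ^ CHAR('k)"
    by (simp add: poly_as_sum_of_monoms)
  also have "\<dots> = (\<Sum>i\<le>degree Q. monom (coeff Q i ^ CHAR('k)) (i * CHAR('k)))"
    by (subst freshmans_dream_sum[OF pr]) (simp_all add: monom_power mult.commute)
  also have "\<dots> \<in> p_polys (s + Suc j)"
  proof (rule p_polys_sum)
    fix i
    show "monom (coeff Q i ^ CHAR('k)) (i * CHAR('k)) \<in> p_polys (s + Suc j)"
    proof (cases "coeff Q i = 0")
      case True
      then show ?thesis using p by (simp add: power_0_left p_polys_0)
    next
      case False
      then obtain l where "l \<ge> s + j" "i = CHAR('k) ^ l"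
        using Suc by (auto simp: p_polys_def Q_def)
      then show ?thesis
        using p_polys_monom[of "s + Suc j" "Suc l" "coeff Q i ^ CHAR('k)"] by (simp add: mult.commute)
    qed
  qed
  finally show ?case by (simp add: Q_def power_mult[symmetric] mult.commute)
qed (use P in simp)

text \<open>Exponents p^j with j > 0 are zero in the field, so only the linear term survives
  differentiation.\<close>

lemma p_polys_pderiv:
  fixes P :: "'k::field poly"
  assumes p: "CHAR('k) > 0" and P: "P \<in> p_polys 0" and 1: "coeff P 1 = 1"
  shows "pderiv P = 1"
proof (rule poly_eqI)
  fix i
  show "coeff (pderiv P) i = coeff 1 i"
  proof (cases "i = 0")
    case True
    then show ?thesis using 1 by (simp add: coeff_pderiv One_nat_def)
  next
    case False
    have "of_nat (Suc i) * coeff P (Suc i) = 0"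
    proof (cases "coeff P (Suc i) = 0")
      case F: False
      then obtain j where j: "Suc i = CHAR('k) ^ j" using P by (auto simp: p_polys_def)
      have "j \<noteq> 0"
      proof
        assume "j = 0"
        then show False using j False by (simp add: One_nat_def)
      qed
      then have "CHAR('k) dvd Suc i" unfolding j by simp
      then have "of_nat (Suc i) = (0 :: 'k)" by (simp only: of_nat_eq_0_iff_char_dvd)
      then show ?thesis by simp
    qed simp
    then show ?thesis using False by (simp add: coeff_pderiv)
  qed
qed

text \<open>A repeated root would be a root of the derivative, which is the constant 1.\<close>

lemma separable_split:
  fixes R :: "'k::alg_closed_field poly"
  assumes "pderiv R = 1"
  shows "\<exists>L c. finite L \<and> c \<noteq> 0 \<and> R = Polynomial.smult c (\<Prod>l\<in>L. [:- l, 1:])"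
proof -
  have R0: "R \<noteq> 0" using assms by auto
  obtain B where B: "R = Polynomial.smult (lead_coeff R) (\<Prod>x\<in>#B. [:- x, 1:])"
    using alg_closed_imp_factorization[OF R0] by blast
  have "count B x \<le> 1" for x
  proof (rule ccontr)
    assume "\<not> count B x \<le> 1"
    then have "count B x = Suc (Suc (count B x - 2))" by simp
    then have "{#x, x#} \<subseteq># B" by (auto simp: subseteq_mset_def)
    then obtain C where "B = {#x, x#} + C" by (metis mset_subset_eq_exists_conv)
    then have "R = [:- x, 1:] * ([:- x, 1:] * Polynomial.smult (lead_coeff R) (\<Prod>x\<in>#C. [:- x, 1:]))"
      by (subst B) simp
    then obtain S where S: "R = [:- x, 1:] * ([:- x, 1:] * S)" by blast
    have "poly (pderiv R) x = 0" unfolding S by (simp only: pderiv_mult poly_add poly_mult) simp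
    then show False using assms by simp
  qed
  then have "B = mset_set (set_mset B)"
    by (intro multiset_eqI) (metis One_nat_def count_eq_zero_iff count_mset_set(1,3) finite_set_mset le_SucE le_zero_eq)
  then have "(\<Prod>x\<in>#B. [:- x, 1:]) = (\<Prod>l\<in>set_mset B. [:- l, 1:])"
    by (metis prod_unfold_prod_mset)
  then show ?thesis using B R0 by (intro exI[of _ "set_mset B"] exI[of _ "lead_coeff R"]) auto
qed

context qalg
begin

subsection \<open>Generators modulo the square of the radical\<close>

text \<open>For \<open>w\<close> in the radical this is its class in J/J^2.\<close>

definition lpart :: "'k coords \<Rightarrow> nat \<Rightarrow> 'k"
  where "lpart w = (\<lambda>i. if i \<in> {1..n} then w (ux i) else 0)"

lemma lin_lpart: "lin lpart"
  by (rule linI) (auto simp: lpart_def fext)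

lemma lpart_outside: "i \<notin> {1..n} \<Longrightarrow> lpart w i = 0"
  by (simp only: lpart_def if_False)

lemma F_2_iff: "v \<in> F 2 \<longleftrightarrow> v \<in> F 1 \<and> lpart v = 0"
proof
  assume v: "v \<in> F 1 \<and> lpart v = 0"
  have "v a = 0" if "deg a < 2" for a
  proof (cases "a \<in> M")
    case True
    show ?thesis
    proof (cases "deg a = 0")
      case False
      then have "deg a = 1" using that by simp
      then obtain i where "i \<in> {1..n}" "a = ux i" using deg_1_ux True by blast
      moreover have "lpart v i = 0" using v by (simp add: zero_fun_apply)
      ultimately show ?thesis by (simp add: lpart_def)
    qed (use v in \<open>simp add: F_def\<close>)
  qed (use v in \<open>simp add: F_def VM_def\<close>)
  then show "v \<in> F 2" using v by (simp add: F_def)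
qed (auto simp: F_def lpart_def fun_eq_iff zero_fun_apply)

text \<open>Nakayama: the kernel of \<open>g\<close> is a subalgebra containing the unit. If it
  covers J/J^2, products cover every layer of the radical filtration, and descending induction makes
  it everything.\<close>

lemma cder_zero_if_generators:
  assumes g: "cder g" and Y: "Y \<subseteq> VM" "\<And>w. w \<in> Y \<Longrightarrow> g w = 0"
    and span: "\<And>i. i \<in> {1..n} \<Longrightarrow> lpart (X i) \<in> fv.span (lpart ` Y)"
  shows "g v = 0"
proof -
  define B where "B = {v \<in> VM. g v = 0}"
  have B: "fv.subspace B" using VM_subspace cder_lin[OF g]
    by (auto simp: B_def fv.subspace_def lin_add lin_sc lin_0)
  have Bmul: "mul u v \<in> B" if "u \<in> B" "v \<in> B" for u v
    using that by (simp add: B_def cder_mul[OF g])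
  have Bun: "un \<in> B" by (simp add: B_def cder_un[OF g])
  have YB: "fv.span Y \<subseteq> B" using Y by (intro fv.span_minimal B) (auto simp: B_def)
  have "\<exists>b\<in>B. b \<in> F 1 \<and> X i - b \<in> F 2" if i: "i \<in> {1..n}" for i
  proof -
    have "lpart (X i) \<in> lpart ` fv.span Y"
      using span[OF i] fvp.linear_span_image[OF lin_lpart, of Y] by simp
    then obtain y where y: "y \<in> fv.span Y" "lpart y = lpart (X i)" by (auto simp del: fv.span_base)
    then have yB: "y \<in> B" using YB by blast
    \<comment> \<open>The constant term of \<open>y\<close> is in the kernel; subtracting it moves
      \<open>y\<close> into the radical without changing its linear part.\<close>
    define b where "b = y - sc (y 0) un"
    have bB: "b \<in> B" unfolding b_def by (intro fv.subspace_diff fv.subspace_scale B yB Bun)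
    have b1: "b \<in> F 1" using bB by (simp add: F_1_iff B_def) (simp add: b_def fapply ev_def)
    have "lpart un = 0"
      by (rule ext) (simp add: lpart_def ev_def zero_fun_apply, auto simp: fun_eq_iff ux_def zero_fun_apply)
    then have "lpart (X i - b) = 0"
      using y by (simp add: b_def lin_diff[OF lin_lpart] lin_sc[OF lin_lpart])
    then have "X i - b \<in> F 2" using F_diff[OF F_X[OF i] b1] F_2_iff by blast
    then show ?thesis using bB b1 by blast
  qed
  then obtain bx where bx: "\<And>i. i \<in> {1..n} \<Longrightarrow> bx i \<in> B \<and> bx i \<in> F 1 \<and> X i - bx i \<in> F 2" by metis
  have mono: "\<exists>b\<in>B. b \<in> F (deg a) \<and> ev a - b \<in> F (deg a + 1)" if "a \<in> M" for a
    using that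
  proof (induction "deg a" arbitrary: a rule: less_induct)
    case less
    show ?case
    proof (cases "a = 0")
      case True
      then show ?thesis using Bun by (intro bexI[of _ un]) (auto simp: F_0_VM)
    next
      case False
      then obtain i c where ic: "i \<in> {1..n}" "c \<in> M" "a = ux i + c" using M_decomp less by blast
      have dg: "deg a = 1 + deg c" using ic by (simp add: deg_add)
      then obtain b where b: "b \<in> B" "b \<in> F (deg c)" "ev c - b \<in> F (deg c + 1)"
        using less(1)[of c] ic by auto
      define g where "g = inverse (\<gamma> (ux i) c)"
      have e: "ev a = sc g (mul (X i) (ev c))"
        using X_mul_ev[of i c] ic less.prems \<gamma>_nz by (simp add: g_def)
      have "mul (X i - bx i) (ev c) \<in> F (2 + deg c)" "mul (bx i) (ev c - b) \<in> F (1 + (deg c + 1))"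
        using F_mul bx ic b F_ev[of c "deg c"] by blast+
      moreover have "2 + deg c = deg a + 1" "1 + (deg c + 1) = deg a + 1" using dg by simp_all
      ultimately have "mul (X i - bx i) (ev c) + mul (bx i) (ev c - b) \<in> F (deg a + 1)"
        by (intro F_add) (simp_all only:)
      then have "ev a - sc g (mul (bx i) b) \<in> F (deg a + 1)"
        using F_sc[of _ _ g] by (simp add: e mul_distribs flip: fv.scale_right_diff_distrib)
      moreover have "sc g (mul (bx i) b) \<in> F (deg a)"
        using F_mul[of "bx i" 1 b "deg c"] bx ic b dg F_sc by simp
      moreover have "sc g (mul (bx i) b) \<in> B"
        using bx ic b by (intro fv.subspace_scale B Bmul) auto
      ultimately show ?thesis by blast
    qed
  qed
  then obtain bm where bm: "\<And>a. a \<in> M \<Longrightarrow> bm a \<in> B \<and> ev a - bm a \<in> F (deg a + 1)" by metis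
  \<comment> \<open>Descending induction from \<open>Dmax\<close>: an element of \<open>B\<close>
    with the same leading coefficients is subtracted, and the remainder is one layer deeper.\<close>
  have "v \<in> F k \<Longrightarrow> v \<in> B" for v k
  proof (induction "Dmax - k" arbitrary: v k)
    case 0
    then show ?case using F_Dmax[of k v] fv.subspace_0[OF B] by auto
  next
    case (Suc d)
    define b where "b = (\<Sum>a\<in>M. sc (v a) (bm a))"
    have bB: "b \<in> B" unfolding b_def using bm by (intro fv.subspace_sum fv.subspace_scale B) auto
    have "sc (v a) (ev a - bm a) \<in> F (k + 1)" if "a \<in> M" for a
    proof (cases "deg a < k")
      case True
      then show ?thesis using Suc.prems by (simp add: F_def zero_fun_apply)
    next
      case False
      then show ?thesis using bm[OF that] F_mono[of "k + 1" "deg a + 1"] by (intro F_sc) auto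
    qed
    then have "(\<Sum>a\<in>M. sc (v a) (ev a - bm a)) \<in> F (k + 1)" by (intro F_sum)
    moreover have "(\<Sum>a\<in>M. sc (v a) (ev a - bm a)) = v - b"
      using VM_expand[OF F_VM[OF Suc.prems]] by (simp add: b_def fv.scale_right_diff_distrib sum_subtractf)
    ultimately have "v - b \<in> B" using Suc.hyps(1)[of "k + 1" "v - b"] Suc.hyps(2) by simp
    then have "(v - b) + b \<in> B" using fv.subspace_add[OF B] bB by blast
    then show ?case by simp
  qed
  from this[of "proj v" 0] have "proj v \<in> B" by (simp add: F_0_VM)
  then show ?thesis by (simp add: B_def cder_proj[OF g])
qed

subsection \<open>Tori in positive characteristic have dimension at most \<open>n\<close>\<close>

lemma cInn_sum: "(\<And>x. x \<in> S \<Longrightarrow> f x \<in> cInn) \<Longrightarrow> (\<lambda>v. \<Sum>x\<in>S. sc (c x) (f x v)) \<in> cInn"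
proof (induction S rule: infinite_finite_induct)
  case (insert x S)
  then show ?case using cInn_add[OF cInn_sc[of "f x" "c x"], of "\<lambda>v. \<Sum>x\<in>S. sc (c x) (f x v)"]
    by (simp add: plus_fun_def[where 'a = "'k coords"])
qed (use cInn_0 in \<open>simp_all flip: zero_fun_def\<close>)

lemma cder_pact:
  assumes t: "cder t" and p: "CHAR('k) > 0" and P: "P \<in> p_polys s"
  shows "cder (pact t P)"
proof -
  \<comment> \<open>Only p-power iterates of \<open>t\<close> are derivations, so iterates with
    coefficient zero are replaced by 0 before the sum is treated termwise.\<close>
  have e: "pact t P = (\<lambda>v. \<Sum>i\<le>degree P. sc (coeff P i) ((if coeff P i = 0 then 0 else t ^^ i) v))"
    by (rule ext) (auto simp: pact_def intro!: sum.cong)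
  have "cder (if coeff P i = 0 then 0 else t ^^ i)" for i
    using P cder_p_power[OF t p] by (auto simp: p_polys_def cder_zero)
  then show ?thesis unfolding e by (intro cder_sum)
qed

lemma pact_mod_inner:
  assumes f: "cder f" and g: "cder g" and fg: "f - g \<in> cInn" and p: "CHAR('k) > 0"
    and P: "P \<in> p_polys s"
  shows "pact f P - pact g P \<in> cInn"
proof -
  have e: "pact f P - pact g P =
      (\<lambda>v. \<Sum>i\<le>degree P. sc (coeff P i) ((if coeff P i = 0 then 0 else f ^^ i - g ^^ i) v))"
    by (rule ext) (auto simp: pact_def op_apply fv.scale_right_diff_distrib simp flip: sum_subtractf intro!: sum.cong)
  have "(if coeff P i = 0 then 0 else f ^^ i - g ^^ i) \<in> cInn" for i
    using P p_power_mod_inner[OF g f fg p] cInn_0 by (auto simp: p_polys_def)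
  then show ?thesis unfolding e by (intro cInn_sum)
qed

context
  fixes T :: "('a \<Rightarrow> 'a) set set"
  assumes p: "CHAR('k) > 0" and torus: "torus_char_p A T"
begin

definition T' :: "'k coords_map set"
  where "T' = {f. cder f \<and> cls f \<in> T}"

lemma T'_cder: "f \<in> T' \<Longrightarrow> cder f"
  by (simp add: T'_def)

lemma T'_cong: "f \<in> T' \<Longrightarrow> cder g \<Longrightarrow> g - f \<in> cInn \<Longrightarrow> g \<in> T'"
  using cls_eq_iff[of g f] by (simp add: T'_def)

lemma T'_bracket: "f \<in> T' \<Longrightarrow> g \<in> T' \<Longrightarrow> (\<lambda>v. f (g v) - g (f v)) \<in> cInn"
proof -
  assume fg: "f \<in> T'" "g \<in> T'"
  then have "cls f \<otimes>\<^bsub>HH1 A\<^esub> cls g = \<zero>\<^bsub>HH1 A\<^esub>"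
    using torus by (simp add: torus_char_p_def T'_def)
  then have "cls (\<lambda>v. f (g v) - g (f v)) = cls (\<lambda>v. 0)"
    using fg by (simp add: HH1_mult HH1_zero T'_def)
  then have "(\<lambda>v. f (g v) - g (f v)) - (\<lambda>v. 0) \<in> cInn"
    using fg by (subst cls_eq_iff[symmetric]) (auto simp: cder_bracket cder_0 T'_def)
  moreover have "(\<lambda>v. f (g v) - g (f v)) - (\<lambda>v. 0) = (\<lambda>v. f (g v) - g (f v))"
    by (rule ext) (simp add: op_apply)
  ultimately show ?thesis by simp
qed

lemma T'_p_power: "f \<in> T' \<Longrightarrow> f ^^ (CHAR('k) ^ j) \<in> T'"
proof (induction j)
  case (Suc j)
  then have "f ^^ (CHAR('k) ^ j) \<in> T'" by simp
  then have "(f ^^ (CHAR('k) ^ j)) ^^ CHAR('k) \<in> T'"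
    using torus HH1_p_power_cls[OF _ p] cder_p_power[OF _ p, of _ 1]
    by (force simp: torus_char_p_def restricted_subalgebra_def T'_def)
  then show ?case by (simp add: funpow_mult mult.commute)
qed (simp add: One_nat_def)

text \<open>The classes of P(t), for P with exponents p, p^2, and so on, form a restricted
  subalgebra containing the p-power of the class of \<open>t\<close>. Semisimplicity places that
  class in the smallest such subalgebra.\<close>

lemma T'_in_p_span:
  assumes t: "t \<in> T'"
  shows "\<exists>P\<in>p_polys 1. t - pact t P \<in> cInn"
proof -
  note ct = T'_cder[OF t]
  note lt = cder_lin[OF ct]
  have cp: "cder (pact t P)" if "P \<in> p_polys 1" for P using cder_pact[OF ct p that] .
  define S where "S = (\<lambda>P. cls (pact t P)) ` (p_polys 1 :: 'k poly set)"
  have vs: "Module.module (class_ring :: 'k ring) (HH1 A)"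
    using vectorspace_HH1 by (simp add: vectorspace_def)
  have sub: "LinearCombinations.submodule class_ring S (HH1 A)"
  proof (rule submodule.intro)
    show "\<zero>\<^bsub>HH1 A\<^esub> \<in> S"
    proof -
      have "pact t 0 = (\<lambda>v. 0)" by (rule ext) simp
      then show ?thesis using p_polys_0 unfolding S_def HH1_zero by (metis (no_types, lifting) image_eqI)
    qed
    fix x y assume "x \<in> S" "y \<in> S"
    then obtain P Q where PQ: "P \<in> p_polys 1" "Q \<in> p_polys 1" "x = cls (pact t P)" "y = cls (pact t Q)"
      unfolding S_def by blast
    have "pact t P + pact t Q = pact t (P + Q)" by (rule ext) (simp add: pact_add op_apply)
    then show "x \<oplus>\<^bsub>HH1 A\<^esub> y \<in> S"
      using PQ cp p_polys_add[OF PQ(1,2)] by (simp add: HH1_add S_def)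
  next
    fix c :: 'k and x assume "x \<in> S"
    then obtain P where P: "P \<in> p_polys 1" "x = cls (pact t P)" by (auto simp: S_def)
    have "(\<lambda>v. sc c (pact t P v)) = pact t (Polynomial.smult c P)" by (rule ext) (simp add: pact_smult)
    then show "c \<odot>\<^bsub>HH1 A\<^esub> x \<in> S"
      using P cp p_polys_smult[OF P(1), of c] by (simp add: HH1_smult S_def)
  qed (use cp in \<open>auto simp: vs HH1_carrier S_def\<close>)
  have br: "x \<otimes>\<^bsub>HH1 A\<^esub> y \<in> S" if xy: "x \<in> S" "y \<in> S" for x y
  proof -
    obtain P Q where PQ: "P \<in> p_polys 1" "Q \<in> p_polys 1" "x = cls (pact t P)" "y = cls (pact t Q)"
      using xy unfolding S_def by blast
    have "(\<lambda>v. pact t P (pact t Q v) - pact t Q (pact t P v)) = (\<lambda>v. 0)"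
      by (rule ext) (simp add: pact_mult[OF lt, symmetric] mult.commute)
    then have "x \<otimes>\<^bsub>HH1 A\<^esub> y = \<zero>\<^bsub>HH1 A\<^esub>" using PQ cp by (simp add: HH1_mult HH1_zero)
    then show ?thesis using submodule.zero_closed[OF sub] by simp
  qed
  have pw: "HH1_p_power A x \<in> S" if xS: "x \<in> S" for x
  proof -
    obtain P where P: "P \<in> p_polys 1" "x = cls (pact t P)" using xS unfolding S_def by blast
    have "HH1_p_power A x = cls (pact t (P ^ CHAR('k)))"
      using P cp by (simp add: HH1_p_power_cls[OF _ p] pact_power[OF lt])
    moreover have "P ^ CHAR('k) \<in> p_polys 1"
      using p_polys_mono[OF _ p_polys_power[OF p P(1), of 1], of 1] by simp
    ultimately show ?thesis by (simp add: S_def)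
  qed
  have rs: "restricted_subalgebra A S" unfolding restricted_subalgebra_def using sub br pw by blast
  have "HH1_p_power A (cls t) = cls (pact t (monom 1 (CHAR('k) ^ 1)))"
    unfolding HH1_p_power_cls[OF ct p] by (rule arg_cong[of _ _ cls], rule ext) (simp add: pact_monom)
  then have "HH1_p_power A (cls t) \<in> S"
    unfolding S_def using p_polys_monom[of 1 1 1] by (metis image_eqI order_refl)
  then have "restricted_span A {HH1_p_power A (cls t)} \<subseteq> S"
    using rs unfolding restricted_span_def by blast
  moreover have "cls t \<in> restricted_span A {HH1_p_power A (cls t)}"
    using torus t by (simp add: torus_char_p_def T'_def)
  ultimately obtain P where "P \<in> p_polys 1" "cls t = cls (pact t P)" unfolding S_def by blast
  then show ?thesis using cp ct by (auto simp: cls_eq_iff)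
qed

text \<open>Substitution: from t = P(t) and t = Q(t) modulo inner derivations follows t = P(Q(t)),
  and every exponent of P(Q) carries one more Frobenius power.\<close>

lemma T'_in_deep_p_span:
  assumes t: "t \<in> T'"
  shows "\<exists>P\<in>p_polys s. t - pact t P \<in> cInn"
proof (induction s)
  case 0
  have "pact t (monom 1 (CHAR('k) ^ 0)) = t" by (rule ext) (simp add: pact_monom One_nat_def)
  then show ?case using p_polys_monom[of 0 0 1] cInn_0 by (intro bexI[of _ "monom 1 (CHAR('k) ^ 0)"]) auto
next
  case (Suc s)
  note ct = T'_cder[OF t]
  obtain P where P: "P \<in> p_polys s" "t - pact t P \<in> cInn" using Suc by blast
  obtain Q where Q: "Q \<in> p_polys 1" "t - pact t Q \<in> cInn" using T'_in_p_span[OF t] by blast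
  define R where "R = (\<Sum>i\<le>degree P. Polynomial.smult (coeff P i) (Q ^ i))"
  have "R \<in> p_polys (Suc s)"
    unfolding R_def
  proof (rule p_polys_sum)
    fix i
    show "Polynomial.smult (coeff P i) (Q ^ i) \<in> p_polys (Suc s)"
    proof (cases "coeff P i = 0")
      case False
      then obtain j where j: "j \<ge> s" "i = CHAR('k) ^ j" using P by (auto simp: p_polys_def)
      then have "Q ^ i \<in> p_polys (1 + j)" using p_polys_power[OF p Q(1), of j] by simp
      then show ?thesis using p_polys_mono[of "Suc s" "1 + j"] j by (intro p_polys_smult) auto
    qed (simp add: p_polys_0)
  qed
  moreover have "pact t R = pact (pact t Q) P"
    by (rule ext) (simp add: R_def pact_sum pact_smult pact_power[OF cder_lin[OF ct]] pact_def[of "pact t Q"])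
  moreover have "pact t P - pact (pact t Q) P \<in> cInn"
    by (rule pact_mod_inner[OF ct cder_pact[OF ct p Q(1)] Q(2) p P(1)])
  then have "(t - pact t P) + (pact t P - pact (pact t Q) P) \<in> cInn" using P cInn_add by blast
  then have "t - pact (pact t Q) P \<in> cInn" by simp
  ultimately show ?case by (intro bexI[of _ R]) auto
qed

text \<open>The iterates t^(p^j) have \<open>card (M \<times> M)\<close> matrix entries each, so one
  more of them than that satisfy a linear relation. With s its lowest index and that coefficient
  scaled to 1, it becomes a separable equation for t^(p^s).\<close>

lemma separable_p_power:
  assumes t: "cder t"
  shows "\<exists>s. \<exists>R\<in>p_polys 0. coeff R 1 = 1 \<and> (\<forall>v. pact (t ^^ (CHAR('k) ^ s)) R v = 0)"
proof -
  define K where "K = card (M \<times> M)"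
  obtain b where b: "\<exists>j\<in>{..K}. b j \<noteq> 0"
    "\<forall>i\<in>M \<times> M. (\<Sum>j\<in>{..K}. b j * (t ^^ (CHAR('k) ^ j)) (ev (snd i)) (fst i)) = 0"
    using homogeneous_system_solution[of "M \<times> M" "{..K}" "\<lambda>j i. (t ^^ (CHAR('k) ^ j)) (ev (snd i)) (fst i)"]
      finite_M by (auto simp: K_def)
  have ctp: "cder (t ^^ (CHAR('k) ^ j))" for j by (rule cder_p_power[OF t p])
  have cs: "cder (\<lambda>v. \<Sum>j\<in>{..K}. sc (b j) ((t ^^ (CHAR('k) ^ j)) v))" (is "cder ?D")
    using ctp by (intro cder_sum)
  have "?D (ev a) = 0" if "a \<in> M" for a
  proof
    fix c
    show "?D (ev a) c = 0 c"
    proof (cases "c \<in> M")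
      case True
      then show ?thesis using b(2) that by (simp add: fapply)
    next
      case False
      then show ?thesis using cder_VM[OF cs, of "ev a"] by (simp add: VM_def zero_fun_apply)
    qed
  qed
  then have "?D (proj v) = 0" for v
    using lin_extend_proj[OF cder_lin[OF cs] cder_lin[OF cder_0]] by blast
  then have D0: "?D v = 0" for v using cder_proj[OF cs] by metis
  define s where "s = (LEAST j. b j \<noteq> 0)"
  obtain j0 where j0: "j0 \<le> K" "b j0 \<noteq> 0" using b by auto
  have bs: "b s \<noteq> 0" unfolding s_def by (rule LeastI[of _ j0]) (rule j0)
  have sn: "s \<le> K" using Least_le[of "\<lambda>j. b j \<noteq> 0" j0] j0 by (simp add: s_def)
  have lt: "b j = 0" if "j < s" for j using that not_less_Least by (auto simp: s_def)
  define R where "R = (\<Sum>j\<in>{s..K}. monom (b j / b s) (CHAR('k) ^ (j - s)))"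
  have "R \<in> p_polys 0" unfolding R_def by (intro p_polys_sum p_polys_monom) simp
  moreover have "coeff R 1 = 1"
  proof -
    have "CHAR('k) > 1" using prime_CHAR_semidom[OF p] prime_gt_1_nat by blast
    then have "coeff R 1 = (\<Sum>j\<in>{s..K}. if j = s then 1 else 0)"
      unfolding R_def coeff_sum using bs
      by (intro sum.cong) (auto simp: coeff_monom nat_power_eq_Suc_0_iff[folded One_nat_def])
    then show ?thesis using sn by simp
  qed
  moreover have "pact (t ^^ (CHAR('k) ^ s)) R v = 0" for v
  proof -
    have "pact (t ^^ (CHAR('k) ^ s)) R v = (\<Sum>j\<in>{s..K}. sc (b j / b s) ((t ^^ (CHAR('k) ^ j)) v))"
      unfolding R_def pact_sum pact_monom by (rule sum.cong) (auto simp: funpow_mult power_add[symmetric])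
    also have "\<dots> = (\<Sum>j\<in>{..K}. sc (b j / b s) ((t ^^ (CHAR('k) ^ j)) v))"
      by (rule sum.mono_neutral_left) (auto simp: lt)
    also have "\<dots> = sc (1 / b s) (?D v)" by (simp add: fv.scale_sum_right)
    finally show ?thesis using D0 by simp
  qed
  ultimately show ?thesis by blast
qed

text \<open>Since (ad h)^(p^j) = ad (h^(p^j)), R(h) = 0 gives R(ad h) u = 0. Writing R = X S, the
  element g = S(ad h) u is killed by ad h; S has constant term 1, so g differs from \<open>u\<close>
  by iterated brackets with \<open>h\<close>, which are inner. The last clause preserves commutation
  with operators treated earlier.\<close>

lemma commuting_correction:
  assumes h: "h \<in> T'" and u: "u \<in> T'"
    and R: "R \<in> p_polys 0" "coeff R 1 = 1" "\<And>v. pact h R v = 0"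
  shows "\<exists>g\<in>T'. u - g \<in> cInn \<and> (\<forall>v. g (h v) = h (g v)) \<and>
    (\<forall>f. lin f \<longrightarrow> (\<forall>v. f (h v) = h (f v)) \<longrightarrow> (\<forall>v. f (u v) = u (f v)) \<longrightarrow> (\<forall>v. f (g v) = g (f v)))"
proof -
  note lh = cder_lin[OF T'_cder[OF h]]
  define adh where "adh w = (\<lambda>v. h (w v) - w (h v))" for w
  define w where "w i = (adh ^^ i) u" for i
  have wS: "w (Suc i) = adh (w i)" and w0: "w 0 = u" for i by (simp_all add: w_def)
  have cw: "cder (w i)" for i
    by (induction i) (auto simp: w0 wS T'_cder u adh_def cder_bracket T'_cder[OF h])
  have winn: "w (Suc i) \<in> cInn" for i
  proof (induction i)
    case 0
    then show ?case using T'_bracket[OF h u] by (simp add: wS w0 adh_def)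
  next
    case (Suc i)
    then obtain b where b: "w (Suc i) = ad b" by (auto simp: cInn_def)
    show ?case unfolding wS[of "Suc i"] b adh_def cInn_bracket[OF T'_cder[OF h]] by (simp add: cInn_def)
  qed
  define N where "N = degree R"
  define g where "g = (\<lambda>v. \<Sum>i\<le>N. sc (coeff R (Suc i)) (w i v))"
  have cg: "cder g" unfolding g_def by (intro cder_sum cw)
  have "g - u \<in> cInn"
  proof -
    have e: "g - u = (\<lambda>v. \<Sum>i\<in>{1..N}. sc (coeff R (Suc i)) (w i v))"
    proof
      fix v
      have "g v = u v + (\<Sum>i\<in>{1..N}. sc (coeff R (Suc i)) (w i v))"
        using R(2) by (simp add: g_def sum.atMost_shift atLeast0AtMost[symmetric] sum.atLeast_Suc_atMost w0 One_nat_def)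
      then show "(g - u) v = (\<Sum>i\<in>{1..N}. sc (coeff R (Suc i)) (w i v))" by (simp add: op_apply)
    qed
    have "w i \<in> cInn" if "i \<in> {1..N}" for i using winn[of "i - 1"] that by simp
    then show ?thesis unfolding e by (intro cInn_sum)
  qed
  then have gT: "g \<in> T'" and ug: "u - g \<in> cInn"
    using T'_cong[OF u cg] cInn_neg[of "g - u"] by auto
  \<comment> \<open>Evaluation of \<open>w\<close> at \<open>v\<close> obeys a Leibniz rule with ad
    h on operators and \<open>h\<close> on vectors; its p-power form is the identity for (ad
    h)^(p^j).\<close>
  have wp: "w (CHAR('k) ^ j) v = (h ^^ (CHAR('k) ^ j)) (u v) - u ((h ^^ (CHAR('k) ^ j)) v)" for j v
    using leibniz_char[where B = "\<lambda>x y. x y" and ?f1.0 = adh and ?f2.0 = h, OF lh p, of j u v]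
    by (simp add: adh_def w_def)
  have R0: "coeff R 0 = 0" using R(1) p by (auto simp: p_polys_def)
  have lu: "lin u" using T'_cder[OF u] cder_lin by blast
  have "h (g v) - g (h v) = 0" for v
  proof -
    have "h (g v) - g (h v) = (\<Sum>i\<le>N. sc (coeff R (Suc i)) (w (Suc i) v))"
      by (simp add: g_def lin_sum[OF lh] lin_sc[OF lh] wS adh_def fv.scale_right_diff_distrib sum_subtractf)
    also have "\<dots> = (\<Sum>i\<le>Suc N. sc (coeff R i) (w i v))"
      unfolding sum.atMost_Suc_shift by (simp add: R0)
    also have "\<dots> = (\<Sum>i\<le>Suc N. sc (coeff R i) ((h ^^ i) (u v) - u ((h ^^ i) v)))"
    proof (rule sum.cong)
      fix i
      show "sc (coeff R i) (w i v) = sc (coeff R i) ((h ^^ i) (u v) - u ((h ^^ i) v))"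
        using R(1) wp[of _ v] by (cases "coeff R i = 0") (auto simp: p_polys_def)
    qed simp
    also have "\<dots> = pact h R (u v) - u (pact h R v)"
      by (simp add: pact_bound[of R "Suc N"] N_def fv.scale_right_diff_distrib sum_subtractf
          lin_sum[OF lu] lin_sc[OF lu] lin_add[OF lu])
    also have "\<dots> = 0" by (simp add: R(3) lin_0[OF lu])
    finally show ?thesis .
  qed
  then have gh: "g (h v) = h (g v)" for v by (metis eq_iff_diff_eq_0)
  have "f (g v) = g (f v)" if f: "lin f" "\<forall>v. f (h v) = h (f v)" "\<forall>v. f (u v) = u (f v)" for f v
  proof -
    have "f (w i v) = w i (f v)" for i v
      by (induction i arbitrary: v) (simp_all add: w0 wS adh_def f lin_diff[OF f(1)])
    then show ?thesis by (simp add: g_def lin_sum[OF f(1)] lin_sc[OF f(1)])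
  qed
  then show ?thesis using gT ug gh by blast
qed

text \<open>Induction invariant. Members of \<open>H\<close> commute and satisfy separable
  equations; each \<open>D i\<close> agrees modulo inner derivations with some \<open>g\<close> that
  inherits its eigenvectors from a member of \<open>H\<close>. The last clause, a representative
  commuting with \<open>H\<close> for every class of the torus, makes the next step
  possible.\<close>

definition commuting_lift :: "(nat \<Rightarrow> 'k coords \<Rightarrow> 'k coords) \<Rightarrow> nat \<Rightarrow>
    'k coords_map set \<Rightarrow> bool"
  where "commuting_lift D k H \<longleftrightarrow> finite H \<and> H \<subseteq> T' \<and> (\<forall>f\<in>H. \<forall>g\<in>H. \<forall>v. f (g v) = g (f v)) \<and>
    (\<forall>h\<in>H. \<exists>R\<in>p_polys 0. coeff R 1 = 1 \<and> (\<forall>v. pact h R v = 0)) \<and>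
    (\<forall>i<k. \<exists>g. cder g \<and> D i - g \<in> cInn \<and>
      (\<exists>h\<in>H. \<forall>w. (\<exists>l. h w = sc l w) \<longrightarrow> (\<exists>l. g w = sc l w))) \<and>
    (\<forall>t\<in>T'. \<exists>t'\<in>T'. t - t' \<in> cInn \<and> (\<forall>h\<in>H. \<forall>v. h (t' v) = t' (h v)))"

lemma commuting_liftD:
  assumes "commuting_lift D k H"
  shows "finite H" "H \<subseteq> T'" "\<forall>f\<in>H. \<forall>g\<in>H. \<forall>v. f (g v) = g (f v)"
    "\<forall>h\<in>H. \<exists>R\<in>p_polys 0. coeff R 1 = 1 \<and> (\<forall>v. pact h R v = 0)"
    "\<forall>i<k. \<exists>g. cder g \<and> D i - g \<in> cInn \<and>
      (\<exists>h\<in>H. \<forall>w. (\<exists>l. h w = sc l w) \<longrightarrow> (\<exists>l. g w = sc l w))"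
    "\<forall>t\<in>T'. \<exists>t'\<in>T'. t - t' \<in> cInn \<and> (\<forall>h\<in>H. \<forall>v. h (t' v) = t' (h v))"
  using assms unfolding commuting_lift_def by - (elim conjE, assumption)+

lemma ex_commuting_lift: "\<forall>i<k. D i \<in> T' \<Longrightarrow> \<exists>H. commuting_lift D k H"
proof (induction k)
  case 0
  have "\<exists>t'\<in>T'. t - t' \<in> cInn" if "t \<in> T'" for t
    by (rule bexI[OF _ that]) (simp add: cInn_0)
  then show ?case by (intro exI[of _ "{}"]) (simp add: commuting_lift_def)
next
  case (Suc k)
  have "\<forall>i<k. D i \<in> T'" using Suc.prems by simp
  then obtain H where "commuting_lift D k H" using Suc.IH by blast
  note H = commuting_liftD[OF this]
  obtain t where t: "t \<in> T'" "D k - t \<in> cInn" "\<forall>h\<in>H. \<forall>v. h (t v) = t (h v)"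
    using H(6) Suc.prems by blast
  obtain s R where R: "R \<in> p_polys 0" "coeff R 1 = 1" "\<forall>v. pact (t ^^ (CHAR('k) ^ s)) R v = 0"
    using separable_p_power[OF T'_cder[OF t(1)]] by blast
  \<comment> \<open>\<open>h\<close> and not \<open>t\<close> joins \<open>H\<close>, as only the
    p^s-th power is known to be diagonalisable. Nothing is lost: modulo inner derivations
    \<open>t\<close> is an additive polynomial in itself with exponents at least p^s, hence a
    polynomial in \<open>h\<close>.\<close>
  define h where "h = t ^^ (CHAR('k) ^ s)"
  have hT: "h \<in> T'" using T'_p_power[OF t(1)] by (simp add: h_def)
  have hH: "f (h v) = h (f v)" if "f \<in> H" for f v
  proof -
    have "f ((t ^^ i) v) = (t ^^ i) (f v)" for i
      by (induction i) (use t(3) that in auto)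
    then show ?thesis by (simp add: h_def)
  qed
  obtain P where P: "P \<in> p_polys s" "t - pact t P \<in> cInn" using T'_in_deep_p_span[OF t(1)] by blast
  have eig: "\<exists>l. pact t P w = sc l w" if w: "h w = sc l w" for l w
  proof -
    have lh: "lin h" using cder_lin[OF T'_cder[OF hT]] .
    have hp: "(h ^^ i) w = sc (l ^ i) w" for i
      by (induction i) (simp_all add: lin_sc[OF lh] w mult.commute)
    have "\<exists>m. sc (coeff P i) ((t ^^ i) w) = sc m w" for i
    proof (cases "coeff P i = 0")
      case True
      then show ?thesis by (intro exI[of _ 0]) simp
    next
      case False
      then obtain j where "j \<ge> s" "i = CHAR('k) ^ j" using P by (auto simp: p_polys_def)
      then have "t ^^ i = h ^^ (CHAR('k) ^ (j - s))" by (simp add: h_def funpow_mult power_add[symmetric])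
      then show ?thesis using hp by (intro exI[of _ "coeff P i * l ^ (CHAR('k) ^ (j - s))"]) simp
    qed
    then obtain m where "\<And>i. sc (coeff P i) ((t ^^ i) w) = sc (m i) w" by metis
    then have "pact t P w = sc (\<Sum>i\<le>degree P. m i) w" by (simp add: pact_def fv.scale_sum_left)
    then show ?thesis by blast
  qed
  have Dk: "D k - pact t P \<in> cInn"
    using cInn_add[OF t(2) P(2)] by simp
  let ?H = "insert h H"
  have c1: "\<exists>t'\<in>T'. u - t' \<in> cInn \<and> (\<forall>h\<in>?H. \<forall>v. h (t' v) = t' (h v))" if u: "u \<in> T'" for u
  proof -
    obtain u' where u': "u' \<in> T'" "u - u' \<in> cInn" "\<forall>h\<in>H. \<forall>v. h (u' v) = u' (h v)" using H(6) u by blast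
    obtain g where g: "g \<in> T'" "u' - g \<in> cInn" "\<forall>v. g (h v) = h (g v)"
      "\<forall>f. lin f \<longrightarrow> (\<forall>v. f (h v) = h (f v)) \<longrightarrow> (\<forall>v. f (u' v) = u' (f v)) \<longrightarrow> (\<forall>v. f (g v) = g (f v))"
      using commuting_correction[OF hT u'(1) R(1,2)] R(3) unfolding h_def by blast
    have "f (g v) = g (f v)" if "f \<in> H" for f v
      using g(4) hH[OF that] u'(3) that H(2) cder_lin T'_cder by blast
    moreover have "u - g \<in> cInn" using cInn_add[OF u'(2) g(2)] by simp
    ultimately show ?thesis using g by (intro bexI[of _ g]) auto
  qed
  have c2: "\<exists>g. cder g \<and> D i - g \<in> cInn \<and>
      (\<exists>h\<in>?H. \<forall>w. (\<exists>l. h w = sc l w) \<longrightarrow> (\<exists>l. g w = sc l w))" if "i < Suc k" for i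
  proof (cases "i = k")
    case True
    then show ?thesis using Dk eig cder_pact[OF T'_cder[OF t(1)] p P(1)] by blast
  next
    case False
    then have "i < k" using that by simp
    then obtain g h where "cder g" "D i - g \<in> cInn" "h \<in> H"
      "\<forall>w. (\<exists>l. h w = sc l w) \<longrightarrow> (\<exists>l. g w = sc l w)" using H(5) by blast
    then show ?thesis by (intro exI[of _ g] conjI bexI[of _ h]) simp_all
  qed
  have c3: "\<forall>f\<in>?H. \<forall>g\<in>?H. \<forall>v. f (g v) = g (f v)"
  proof (intro ballI allI)
    fix f g v assume "f \<in> ?H" "g \<in> ?H"
    then consider "f = g" | "f \<in> H" "g = h" | "f = h" "g \<in> H" | "f \<in> H" "g \<in> H" by blast
    then show "f (g v) = g (f v)"
    proof cases
      case 2
      then show ?thesis using hH[of f v] by simp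
    next
      case 3
      show ?thesis unfolding 3(1) by (rule hH[OF 3(2), symmetric])
    next
      case 4
      then show ?thesis using H(3) by blast
    qed simp
  qed
  have c4: "\<forall>h\<in>?H. \<exists>R\<in>p_polys 0. coeff R 1 = 1 \<and> (\<forall>v. pact h R v = 0)"
    using H(4) R unfolding h_def by blast
  have c5: "finite ?H" "?H \<subseteq> T'" using H(1,2) hT by simp_all
  show ?case
    unfolding commuting_lift_def
    by (intro exI[of _ ?H] conjI allI impI ballI)
      (rule c5 c1 c2 c3[rule_format] c4[rule_format]; assumption?)+
qed

lemma torus_char_p_dependent:
  assumes D: "\<And>i. i \<le> n \<Longrightarrow> cder (D i) \<and> cls (D i) \<in> T"
  shows "\<exists>c. (\<exists>i\<le>n. c i \<noteq> 0) \<and> (\<lambda>v. \<Sum>i\<le>n. sc (c i) (D i v)) \<in> cInn"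
proof -
  have "\<forall>i<Suc n. D i \<in> T'" using D by (simp add: T'_def)
  then obtain H where "commuting_lift D (Suc n) H" using ex_commuting_lift by blast
  note H = commuting_liftD[OF this]
  have cH: "cder h" if "h \<in> H" for h using H(2) that T'_cder by blast
  have diag: "\<exists>L. finite L \<and> (\<forall>v\<in>VM. pact h (\<Prod>l\<in>L. [:- l, 1:]) v = 0)" if hH: "h \<in> H" for h
  proof -
    obtain R where R: "R \<in> p_polys 0" "coeff R 1 = 1" "\<forall>v. pact h R v = 0" using H(4) hH by blast
    obtain L c where L: "finite L" "c \<noteq> 0" "R = Polynomial.smult c (\<Prod>l\<in>L. [:- l, 1:])"
      using separable_split[OF p_polys_pderiv[OF p R(1,2)]] by blast
    have "sc c (pact h (\<Prod>l\<in>L. [:- l, 1:]) v) = 0" for v using R(3) L by (simp add: pact_smult)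
    then have "pact h (\<Prod>l\<in>L. [:- l, 1:]) v = 0" for v using L(2) by simp
    then show ?thesis using L by blast
  qed
  define S where "S = {w \<in> VM. \<forall>h\<in>H. \<exists>l. h w = sc l w}"
  have spanS: "v \<in> fv.span S" if "v \<in> VM" for v
    unfolding S_def using H cH diag that
    by (intro common_eigenvector_decomposition VM_subspace) (auto simp: cder_lin cder_VM)
  \<comment> \<open>At most n common eigenvectors are kept, still spanning J/J^2.\<close>
  obtain S0 where S0: "S0 \<subseteq> S" "finite S0" "card S0 \<le> card {1..n}" "lpart ` S \<subseteq> fv.span (lpart ` S0)"
    using finite_spanning_subset[of "{1..n}" S lpart] lpart_outside by blast
  obtain g where g: "\<And>i. i \<le> n \<Longrightarrow> cder (g i) \<and> D i - g i \<in> cInn \<and>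
      (\<exists>h\<in>H. \<forall>w. (\<exists>l. h w = sc l w) \<longrightarrow> (\<exists>l. g i w = sc l w))"
    using H(5) unfolding less_Suc_eq_le by metis
  have "\<exists>l. g i w = sc l w" if iw: "i \<le> n" "w \<in> S" for i w
  proof -
    obtain h where h: "h \<in> H" "(\<exists>l. h w = sc l w) \<longrightarrow> (\<exists>l. g i w = sc l w)" using g[OF iw(1)] by blast
    then show ?thesis using iw by (simp add: S_def)
  qed
  then obtain \<mu> where \<mu>: "\<And>i w. i \<le> n \<Longrightarrow> w \<in> S \<Longrightarrow> g i w = sc (\<mu> i w) w" by metis
  \<comment> \<open>n + 1 unknowns against at most n equations, one for each chosen eigenvector. The
    resulting combination kills \<open>S0\<close> and therefore, by the Nakayama argument, the whole
    algebra.\<close>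
  obtain c where c: "\<exists>i\<in>{..n}. c i \<noteq> 0" "\<forall>w\<in>S0. (\<Sum>i\<in>{..n}. c i * \<mu> i w) = 0"
    using homogeneous_system_solution[of S0 "{..n}" \<mu>] S0 by auto
  define G where "G = (\<lambda>v. \<Sum>i\<le>n. sc (c i) (g i v))"
  have cG: "cder G" unfolding G_def using g by (intro cder_sum) auto
  have Gz: "G w = 0" if "w \<in> S0" for w
  proof -
    have "G w = (\<Sum>i\<le>n. sc (c i * \<mu> i w) w)"
      unfolding G_def using \<mu> S0(1) that by (intro sum.cong) auto
    also have "\<dots> = sc (\<Sum>i\<le>n. c i * \<mu> i w) w" by (rule fv.scale_sum_left[symmetric])
    finally show ?thesis using c(2) that by simp
  qed
  have lp: "lpart (X i) \<in> fv.span (lpart ` S0)" if "i \<in> {1..n}" for i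
  proof -
    have "lpart (X i) \<in> lpart ` fv.span S" using spanS[of "X i"] that by simp
    also have "\<dots> = fv.span (lpart ` S)" by (rule fvp.linear_span_image[OF lin_lpart, symmetric])
    also have "\<dots> \<subseteq> fv.span (lpart ` S0)" using S0(4) by (rule fv.span_minimal) simp
    finally show ?thesis .
  qed
  have "S0 \<subseteq> VM" using S0(1) unfolding S_def by blast
  then have "G v = 0" for v
    by (rule cder_zero_if_generators[OF cG]) (rule Gz, assumption, rule lp, assumption)
  then have "(\<lambda>v. \<Sum>i\<le>n. sc (c i) (D i v)) = (\<lambda>v. \<Sum>i\<le>n. sc (c i) ((D i - g i) v))"
    by (intro ext) (simp add: op_apply fv.scale_right_diff_distrib sum_subtractf G_def)
  moreover have "(\<lambda>v. \<Sum>i\<le>n. sc (c i) ((D i - g i) v)) \<in> cInn" using g by (intro cInn_sum) auto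
  ultimately show ?thesis using c(1) by (intro exI[of _ c]) auto
qed

end

end

context qcoord
begin

subsection \<open>Homogeneous components\<close>

definition hp :: "nat \<Rightarrow> 'k coords_map"
  where "hp k v = (\<lambda>a. if deg a = k then v a else 0)"

lemma lin_hp: "lin (hp k)"
  by (rule linI) (auto simp: hp_def fext)

lemma hp_VM [simp]: "v \<in> VM \<Longrightarrow> hp k v \<in> VM"
  by (auto simp: hp_def VM_def)

lemma hp_F: "v \<in> VM \<Longrightarrow> hp k v \<in> F k"
  by (auto simp: hp_def F_def VM_def)

lemma hp_idem [simp]: "hp k (hp k v) = hp k v"
  by (auto simp: hp_def)

lemma hp_zero: "v \<in> F l \<Longrightarrow> k < l \<Longrightarrow> hp k v = 0"
  by (auto simp: hp_def F_def fun_eq_iff zero_fun_apply)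

lemma F_minus_hp: "v \<in> F k \<Longrightarrow> v - hp k v \<in> F (k + 1)"
  by (auto simp: F_def hp_def VM_def minus_apply)

lemma F_Suc_iff: "v \<in> F k \<Longrightarrow> v \<in> F (k + 1) \<longleftrightarrow> hp k v = 0"
  using F_minus_hp[of v k] hp_zero[of v "k + 1" k] by auto

lemma mul_nonzero:
  assumes "mul u v d \<noteq> 0"
  shows "\<exists>a b. a + b = d \<and> u a \<noteq> 0 \<and> v b \<noteq> 0"
proof (rule ccontr)
  assume "\<not> ?thesis"
  then have "(if a + b = d then \<gamma> a b * u a * v b else 0) = 0" for a b by auto
  then have "mul u v d = 0" unfolding mul_def by (simp only: sum.neutral_const if_cancel)
  then show False using assms by simp
qed

lemma hp_mul: "hp (k + l) (mul (hp k u) (hp l v)) = mul (hp k u) (hp l v)"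
proof
  fix d
  show "hp (k + l) (mul (hp k u) (hp l v)) d = mul (hp k u) (hp l v) d"
  proof (cases "mul (hp k u) (hp l v) d = 0")
    case False
    then obtain a b where "a + b = d" "hp k u a \<noteq> 0" "hp l v b \<noteq> 0" using mul_nonzero by blast
    then have "deg d = k + l" by (auto simp: hp_def deg_add split: if_splits)
    then show ?thesis by (simp add: hp_def)
  qed (simp add: hp_def)
qed

lemma hp_X [simp]: "i \<in> {1..n} \<Longrightarrow> hp 1 (X i) = X i"
  by (auto simp: hp_def ev_def)

lemma hp_ad_X: "i \<in> {1..n} \<Longrightarrow> hp (k + 1) (ad (hp k b) (X i)) = ad (hp k b) (X i)"
  using hp_mul[of k 1 b "X i"] hp_mul[of 1 k "X i" b] by (simp add: ad_def lin_diff[OF lin_hp] add.commute)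

lemma ad_mem_F: "b \<in> F k \<Longrightarrow> v \<in> F l \<Longrightarrow> ad b v \<in> F (k + l)"
  unfolding ad_def using F_mul[of b k v l] F_mul[of v l b k] by (intro F_diff) (simp_all add: add.commute)

lemma lin_ad_left: "lin (\<lambda>b. ad b v)"
  by (rule linI) (simp_all add: ad_def mul_distribs fv.scale_right_diff_distrib)

lemma lin_ad_right: "lin (ad b)"
  by (rule cder_lin[OF cder_ad])

subsection \<open>Conjugation\<close>

definition unit_pair :: "'k coords \<Rightarrow> 'k coords \<Rightarrow> bool"
  where "unit_pair u u' \<longleftrightarrow> u \<in> VM \<and> u' \<in> VM \<and> mul u u' = un \<and> mul u' u = un"

definition cj :: "'k coords \<Rightarrow> 'k coords \<Rightarrow> 'k coords_map"
  where "cj u u' v = mul (mul u v) u'"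

definition cinner :: "'k coords_map set"
  where "cinner = {cj u u' | u u'. unit_pair u u'}"

lemma unit_pair_sym: "unit_pair u u' \<Longrightarrow> unit_pair u' u"
  by (auto simp: unit_pair_def)

lemma unit_pair_VM: "unit_pair u u' \<Longrightarrow> u \<in> VM" "unit_pair u u' \<Longrightarrow> u' \<in> VM"
  by (auto simp: unit_pair_def)

lemma unit_pair_mul: "unit_pair u u' \<Longrightarrow> unit_pair w w' \<Longrightarrow> unit_pair (mul u w) (mul w' u')"
proof -
  assume a: "unit_pair u u'" "unit_pair w w'"
  have "mul (mul u w) (mul w' u') = mul u (mul (mul w w') u')"
    "mul (mul w' u') (mul u w) = mul w' (mul (mul u' u) w)" by (simp_all only: mul_assoc)
  then show ?thesis using a by (simp add: unit_pair_def)
qed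

lemma unit_pair_one_minus: "a \<in> F 1 \<Longrightarrow> unit_pair (un - a) (geo a)"
  using one_minus_mul_geo geo_mul_one_minus by (simp add: unit_pair_def F_VM)

lemma unit_pair_un: "unit_pair un un"
  by (simp add: unit_pair_def)

lemma unit_pair_unique: "unit_pair u u' \<Longrightarrow> unit_pair u u'' \<Longrightarrow> u' = u''"
  unfolding unit_pair_def by (metis mul_assoc un_mul_VM mul_un_VM)

lemma cj_compose: "cj u u' (cj w w' v) = cj (mul u w) (mul w' u') v"
  by (simp add: cj_def mul_assoc)

lemma cj_un: "cj un un v = proj v"
  by (simp add: cj_def un_mul mul_un proj_VM)

lemma cj_inverse: "unit_pair u u' \<Longrightarrow> cj u u' (cj u' u v) = proj v"
  unfolding cj_compose by (simp add: unit_pair_def cj_un)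

lemma chom_cj:
  assumes "unit_pair u u'"
  shows "chom (cj u u')"
  unfolding chom_def
proof (intro conjI allI)
  show "lin (cj u u')" by (rule linI) (simp_all add: cj_def mul_distribs)
  show "cj u u' (mul v w) = mul (cj u u' v) (cj u u' w)" for v w
  proof -
    have e: "mul (cj u u' v) (cj u u' w) = mul (mul u v) (mul (mul u' u) (mul w u'))"
      by (simp only: cj_def mul_assoc)
    have h: "mul u' u = un" using assms by (simp add: unit_pair_def)
    show ?thesis unfolding e h by (simp add: cj_def mul_assoc)
  qed
qed (use assms in \<open>simp_all add: cj_def unit_pair_def\<close>)

text \<open>Scaling a unit does not change the conjugation, so units may be taken in \<open>1 + J\<close>.\<close>

lemma cinner_normalized:
  assumes "f \<in> cinner"
  shows "\<exists>a\<in>F 1. f = cj (un - a) (geo a)"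
proof -
  obtain u u' where u: "unit_pair u u'" "f = cj u u'" using assms by (auto simp: cinner_def)
  have "u 0 * u' 0 = 1" using u(1) mul_0_coeff[of u u'] by (simp add: unit_pair_def) (simp add: ev_def)
  then have u0: "u 0 \<noteq> 0" by auto
  define a where "a = un - sc (inverse (u 0)) u"
  have a: "a \<in> F 1" using u u0 by (simp add: F_1_iff unit_pair_def a_def) (simp add: fapply ev_def)
  have "unit_pair (sc (inverse (u 0)) u) (sc (u 0) u')"
    using u u0 by (simp add: unit_pair_def mul_distribs)
  then have "geo a = sc (u 0) u'"
    using unit_pair_one_minus[OF a] unit_pair_unique by (simp add: a_def)
  then have "f = cj (un - a) (geo a)"
    using u0 by (intro ext) (simp add: u cj_def a_def mul_distribs)
  then show ?thesis using a by blast
qed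

lemma cinner_one_minus: "a \<in> F 1 \<Longrightarrow> cj (un - a) (geo a) \<in> cinner"
  using unit_pair_one_minus by (auto simp: cinner_def)

lemma cinner_chom: "f \<in> cinner \<Longrightarrow> chom f"
  using chom_cj by (auto simp: cinner_def)

lemma cinner_compose: "f \<in> cinner \<Longrightarrow> g \<in> cinner \<Longrightarrow> (\<lambda>v. f (g v)) \<in> cinner"
  unfolding cinner_def using unit_pair_mul cj_compose by (auto; blast)

lemma cinner_inverse: "f \<in> cinner \<Longrightarrow> \<exists>g\<in>cinner. (\<forall>v. f (g v) = proj v) \<and> (\<forall>v. g (f v) = proj v)"
  unfolding cinner_def using cj_inverse unit_pair_sym by (auto; blast)

lemma cinner_proj: "proj \<in> cinner"
proof -
  have "proj = cj un un" by (rule ext) (simp add: cj_un)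
  then show ?thesis using unit_pair_un by (auto simp: cinner_def)
qed

lemma chom_unit_pair: "chom s \<Longrightarrow> unit_pair u u' \<Longrightarrow> unit_pair (s u) (s u')"
  by (simp add: unit_pair_def chom_VM chom_un flip: chom_mul)

lemma chom_cj_commute: "chom s \<Longrightarrow> s (cj u u' v) = cj (s u) (s u') (s v)"
  by (simp add: cj_def chom_mul)

lemma cinner_conjugate:
  assumes "f \<in> cinner" "chom s"
  shows "\<exists>g\<in>cinner. \<forall>v. s (f v) = g (s v)"
  using assms chom_unit_pair chom_cj_commute unfolding cinner_def by (auto; blast)

lemma cj_sub:
  assumes "unit_pair u u'" "v \<in> VM"
  shows "cj u u' v - v = mul (ad (u - un) v) u'"
proof -
  have "mul (mul v u) u' = v" using assms by (simp add: unit_pair_def mul_assoc)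
  moreover have "mul (ad (u - un) v) u' = mul (mul u v) u' - mul (mul v u) u'"
    using assms(2) by (simp add: ad_def mul_distribs)
  ultimately show ?thesis by (simp add: cj_def)
qed

text \<open>To first order, conjugation by 1 + a adds [a, y]. If \<open>a\<close> starts in degree
  k, replacing \<open>y\<close> by \<open>x_i\<close>, \<open>a\<close> by its lowest component and
  the right factor by 1 costs only terms of degree at least k + 2.\<close>

lemma cj_leading:
  assumes u: "unit_pair u u'" and k: "u - un \<in> F k" "1 \<le> k"
    and y: "y \<in> VM" "y - X i \<in> F 2" and i: "i \<in> {1..n}"
  shows "cj u u' y - y \<in> F (k + 1)" "hp (k + 1) (cj u u' y - y) = ad (hp k (u - un)) (X i)"
proof -
  define a where "a = u - un"
  have a: "a \<in> F k" "a \<in> VM" using k F_VM by (auto simp: a_def)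
  have y1: "y \<in> F 1"
    using F_add[OF F_mono[OF _ y(2), of 1] F_X[OF i]] by simp
  have d: "ad a y \<in> F (k + 1)" by (rule ad_mem_F[OF a(1) y1])
  show e: "cj u u' y - y \<in> F (k + 1)"
    unfolding cj_sub[OF u y(1)] using F_mul_left[OF d] by (simp add: a_def)
  have u'1: "u' - un \<in> F 1"
  proof -
    have "u - un \<in> F 1" using F_mono[OF k(2) k(1)] .
    then have "u 0 = 1" by (simp add: F_1_iff minus_apply) (simp add: ev_def)
    moreover have "u 0 * u' 0 = 1" using u mul_0_coeff[of u u'] by (simp add: unit_pair_def) (simp add: ev_def)
    ultimately show ?thesis using u by (simp add: F_1_iff unit_pair_def minus_apply) (simp add: ev_def)
  qed
  have "cj u u' y - y - ad (hp k a) (X i) =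
      mul (ad a y) (u' - un) + ad a (y - X i) + ad (a - hp k a) (X i)"
    unfolding cj_sub[OF u y(1)] a_def[symmetric]
    by (simp add: mul_distribs lin_diff[OF lin_ad_left] lin_diff[OF lin_ad_right])
  also have "\<dots> \<in> F (k + 2)"
  proof (intro F_add)
    show "mul (ad a y) (u' - un) \<in> F (k + 2)" using F_mul[OF d u'1] by (simp add: add.assoc)
    show "ad a (y - X i) \<in> F (k + 2)" by (rule ad_mem_F[OF a(1) y(2)])
    show "ad (a - hp k a) (X i) \<in> F (k + 2)"
      using ad_mem_F[OF F_minus_hp[OF a(1)] F_X[OF i]] by (simp add: add.assoc)
  qed
  finally have "hp (k + 1) (cj u u' y - y - ad (hp k a) (X i)) = 0" by (intro hp_zero) auto
  then have "hp (k + 1) (cj u u' y - y) = hp (k + 1) (ad (hp k a) (X i))"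
    by (simp add: lin_diff[OF lin_hp])
  then show "hp (k + 1) (cj u u' y - y) = ad (hp k (u - un)) (X i)"
    using hp_ad_X[OF i, of k a] by (simp add: a_def)
qed

text \<open>If the lowest component of u - 1 commutes with the generators, then 1 plus that
  component is a central unit. Dividing \<open>u\<close> by it keeps the conjugation and brings the
  unit one degree closer to 1.\<close>

lemma strip_central:
  assumes u: "unit_pair u u'" and k: "u - un \<in> F k" "1 \<le> k"
    and c: "\<And>i. i \<in> {1..n} \<Longrightarrow> ad (hp k (u - un)) (X i) = 0"
  shows "\<exists>w w'. unit_pair w w' \<and> w - un \<in> F (k + 1) \<and> cj w w' = cj u u'"
proof -
  define a where "a = u - un"
  define b where "b = - hp k a"
  have a: "a \<in> F k" "a \<in> VM" using k F_VM by (auto simp: a_def)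
  have bk: "b \<in> F k" unfolding b_def using a by (intro F_neg hp_F)
  then have b1: "b \<in> F 1" using F_mono[OF k(2)] by blast
  have central: "mul b v = mul v b" for v
    using central_if_commutes_X[of "hp k a" v] c
    by (simp add: b_def mul_distribs ad_def a_def)
  have p: "unit_pair (geo b) (un - b)" by (rule unit_pair_sym[OF unit_pair_one_minus[OF b1]])
  have triv: "cj (geo b) (un - b) v = proj v" for v
  proof -
    have "cj (geo b) (un - b) v = mul (mul (un - b) (geo b)) v"
      using central[of "mul (geo b) v"] by (simp add: cj_def mul_distribs mul_assoc un_mul mul_un proj_VM)
    then show ?thesis using one_minus_mul_geo[OF b1] by (simp add: un_mul)
  qed
  define w where "w = mul (geo b) u"
  have "cj w (mul u' (un - b)) v = cj u u' v" for v
    unfolding w_def cj_compose[symmetric] triv by (simp add: cj_def proj_VM)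
  moreover have "w - un = mul (geo b) (a - hp k a)"
  proof -
    have "u - (un - b) = a - hp k a" by (simp add: a_def b_def)
    then have "mul (geo b) (a - hp k a) = mul (geo b) u - mul (geo b) (un - b)"
      by (simp flip: mul_diff_right)
    then show ?thesis using geo_mul_one_minus[OF b1] by (simp add: w_def)
  qed
  then have "w - un \<in> F (k + 1)" using F_mul_right[OF F_minus_hp[OF a(1)]] by simp
  ultimately show ?thesis using unit_pair_mul[OF p u] by (auto simp: w_def)
qed

subsection \<open>A slice for simultaneous conjugation\<close>

text \<open>Tuples \<open>(y\<^sub>1, \<dots>, y\<^sub>n)\<close> with \<open>y\<^sub>i \<in> x\<^sub>i + J\<^sup>2\<close> are normalised degree by degree by conjugation with
  elements of \<open>1 + J\<close>, using a linear choice of preimages under \<open>b \<mapsto> ([b, x\<^sub>i])\<^sub>i\<close>.\<close>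

definition tuples :: "(nat \<Rightarrow> 'k coords) set"
  where "tuples = {y. \<forall>i\<in>{1..n}. y i \<in> VM \<and> y i - X i \<in> F 2}"

text \<open>Tuples are flattened to functions on pairs, so that the linear algebra of function
  spaces applies to them.\<close>

definition tup :: "nat \<Rightarrow> (nat \<Rightarrow> 'k coords) \<Rightarrow> nat \<times> (nat \<Rightarrow> nat) \<Rightarrow> 'k"
  where "tup k y = (\<lambda>(i, a). if i \<in> {1..n} then hp k (y i) a else 0)"

definition Lmap :: "'k coords \<Rightarrow> nat \<times> (nat \<Rightarrow> nat) \<Rightarrow> 'k"
  where "Lmap b = (\<lambda>(i, a). if i \<in> {1..n} then ad b (X i) a else 0)"

lemma lin_Lmap: "lin Lmap"
  by (rule linI) (auto simp: Lmap_def fun_eq_iff plus_fun_apply sc_apply lin_add[OF lin_ad_left] lin_sc[OF lin_ad_left])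

lemma Lmap_eq_0: "Lmap b = 0 \<longleftrightarrow> (\<forall>i\<in>{1..n}. ad b (X i) = 0)"
  by (auto simp: Lmap_def fun_eq_iff zero_fun_apply)

definition homog :: "nat \<Rightarrow> 'k coords set"
  where "homog k = {b \<in> VM. hp k b = b}"

lemma homog_subspace: "fv.subspace (homog k)"
  using VM_subspace by (auto simp: homog_def fv.subspace_def lin_add[OF lin_hp] lin_sc[OF lin_hp] lin_0[OF lin_hp])

lemma homog_F: "b \<in> homog k \<Longrightarrow> b \<in> F k"
  using hp_F[of b k] by (simp add: homog_def)

lemma hp_homog: "v \<in> VM \<Longrightarrow> hp k v \<in> homog k"
  by (simp add: homog_def)

text \<open>A fixed linear section of \<open>Lmap\<close> on degree k. \<open>Lmap\<close> after
  \<open>alp k\<close> is a projection onto the image of \<open>Lmap\<close> on that degree, and its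
  kernel is the complement defining the slice; linearity keeps the normalisation regular.\<close>

definition alp :: "nat \<Rightarrow> (nat \<times> (nat \<Rightarrow> nat) \<Rightarrow> 'k) \<Rightarrow> 'k coords"
  where "alp k = (SOME g. range g \<subseteq> homog k \<and> lin g \<and> (\<forall>v\<in>Lmap ` homog k. Lmap (g v) = v))"

lemma alp: "alp k t \<in> homog k" "lin (alp k)" "b \<in> homog k \<Longrightarrow> Lmap (alp k (Lmap b)) = Lmap b"
proof -
  have "\<exists>g. range g \<subseteq> homog k \<and> lin g \<and> (\<forall>v\<in>Lmap ` homog k. Lmap (g v) = v)"
    by (rule fvp.linear_exists_right_inverse_on[OF lin_Lmap homog_subspace])
  from someI_ex[OF this] have "range (alp k) \<subseteq> homog k \<and> lin (alp k) \<and> (\<forall>v\<in>Lmap ` homog k. Lmap (alp k v) = v)"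
    unfolding alp_def .
  then show "alp k t \<in> homog k" "lin (alp k)" "b \<in> homog k \<Longrightarrow> Lmap (alp k (Lmap b)) = Lmap b" by auto
qed

text \<open>The degree \<open>k + 1\<close> part of the tuple lies in the chosen complement of the
  directions \<open>([b, x_i])_i\<close> with \<open>b\<close> homogeneous of degree k.\<close>

definition slice_at :: "nat \<Rightarrow> (nat \<Rightarrow> 'k coords) \<Rightarrow> bool"
  where "slice_at k y \<longleftrightarrow> Lmap (alp k (tup (k + 1) y)) = 0"

definition nstep :: "nat \<Rightarrow> (nat \<Rightarrow> 'k coords) \<Rightarrow> nat \<Rightarrow> 'k coords"
  where "nstep k y = (\<lambda>i. cj (un - alp k (tup (k + 1) y)) (geo (alp k (tup (k + 1) y))) (y i))"

fun normalise :: "nat \<Rightarrow> (nat \<Rightarrow> 'k coords) \<Rightarrow> nat \<Rightarrow> 'k coords"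
  where "normalise 0 y = y" | "normalise (Suc k) y = nstep (Suc k) (normalise k y)"

lemma tup_cj:
  assumes u: "unit_pair u u'" and k: "u - un \<in> F k" "1 \<le> k" and y: "y \<in> tuples"
  shows "tup (k + 1) (\<lambda>i. cj u u' (y i)) = tup (k + 1) y + Lmap (hp k (u - un))"
    and "j < k \<Longrightarrow> tup (j + 1) (\<lambda>i. cj u u' (y i)) = tup (j + 1) y"
    and "(\<lambda>i. cj u u' (y i)) \<in> tuples"
proof -
  note L = cj_leading[OF u k, of "y _" _]
  have yi: "y i \<in> VM" "y i - X i \<in> F 2" if "i \<in> {1..n}" for i using y that by (auto simp: tuples_def)
  have "hp (k + 1) (cj u u' (y i)) = hp (k + 1) (y i) + ad (hp k (u - un)) (X i)" if i: "i \<in> {1..n}" for i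
    using cj_leading(2)[OF u k yi[OF i] i] by (simp add: lin_diff[OF lin_hp] algebra_simps)
  then show "tup (k + 1) (\<lambda>i. cj u u' (y i)) = tup (k + 1) y + Lmap (hp k (u - un))"
    by (auto simp: tup_def Lmap_def fun_eq_iff plus_fun_apply)
  have F1: "cj u u' (y i) - y i \<in> F (k + 1)" if i: "i \<in> {1..n}" for i
    by (rule cj_leading(1)[OF u k yi[OF i] i])
  then have "hp (j + 1) (cj u u' (y i)) = hp (j + 1) (y i)" if "j < k" "i \<in> {1..n}" for i j
    using hp_zero[OF F1[OF that(2)], of "j + 1"] that by (simp add: lin_diff[OF lin_hp])
  then show "j < k \<Longrightarrow> tup (j + 1) (\<lambda>i. cj u u' (y i)) = tup (j + 1) y"
    by (auto simp: tup_def fun_eq_iff)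
  have "cj u u' (y i) - X i \<in> F 2" if i: "i \<in> {1..n}" for i
    using F_add[OF F_mono[OF _ F1[OF i], of 2] yi(2)[OF i]] k(2) by simp
  then show "(\<lambda>i. cj u u' (y i)) \<in> tuples" by (auto simp: tuples_def cj_def)
qed

text \<open>Conjugation by 1 - a with \<open>a\<close> in degree k subtracts \<open>Lmap a\<close>
  in degree \<open>k + 1\<close> and changes nothing in lower degrees, so conditions already
  achieved persist.\<close>

lemma nstep_props:
  assumes y: "y \<in> tuples" and k: "1 \<le> k"
  shows "nstep k y \<in> tuples" "slice_at k (nstep k y)"
    "j < k \<Longrightarrow> slice_at j (nstep k y) \<longleftrightarrow> slice_at j y"
    "\<exists>u u'. unit_pair u u' \<and> u - un \<in> F 1 \<and> nstep k y = (\<lambda>i. cj u u' (y i))"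
proof -
  define a where "a = alp k (tup (k + 1) y)"
  have ah: "a \<in> homog k" by (simp add: a_def alp)
  have ak: "a \<in> F k" using homog_F[OF ah] .
  have a1: "a \<in> F 1" using F_mono[OF k ak] .
  have p: "unit_pair (un - a) (geo a)" by (rule unit_pair_one_minus[OF a1])
  have m: "un - a - un = - a" by simp
  have mk: "un - a - un \<in> F k" unfolding m by (rule F_neg[OF ak])
  have st: "nstep k y = (\<lambda>i. cj (un - a) (geo a) (y i))" by (simp add: nstep_def a_def)
  show "nstep k y \<in> tuples" unfolding st by (rule tup_cj(3)[OF p mk k y])
  have "hp k (- a) = - a" using ah fvp.linear_neg[OF lin_hp, of k a] by (simp add: homog_def)
  then have "tup (k + 1) (nstep k y) = tup (k + 1) y - Lmap a"
    unfolding st tup_cj(1)[OF p mk k y] m by (simp add: fvp.linear_neg[OF lin_Lmap])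
  then have "Lmap (alp k (tup (k + 1) (nstep k y))) = Lmap a - Lmap (alp k (Lmap a))"
    by (simp add: lin_diff[OF alp(2)] lin_diff[OF lin_Lmap] a_def)
  then show "slice_at k (nstep k y)" using alp(3)[OF ah] by (simp add: slice_at_def)
  show "j < k \<Longrightarrow> slice_at j (nstep k y) \<longleftrightarrow> slice_at j y"
    unfolding slice_at_def st using tup_cj(2)[OF p mk k y] by simp
  have "un - a - un \<in> F 1" unfolding m by (rule F_neg[OF a1])
  then show "\<exists>u u'. unit_pair u u' \<and> u - un \<in> F 1 \<and> nstep k y = (\<lambda>i. cj u u' (y i))"
    using p st by blast
qed

lemma normalise_props:
  assumes y: "y \<in> tuples"
  shows "normalise k y \<in> tuples" "\<forall>j\<in>{1..k}. slice_at j (normalise k y)"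
    "\<exists>u u'. unit_pair u u' \<and> u - un \<in> F 1 \<and> (\<forall>i\<in>{1..n}. normalise k y i = cj u u' (y i))"
proof -
  have "normalise k y \<in> tuples \<and> (\<forall>j\<in>{1..k}. slice_at j (normalise k y)) \<and>
    (\<exists>u u'. unit_pair u u' \<and> u - un \<in> F 1 \<and> (\<forall>i\<in>{1..n}. normalise k y i = cj u u' (y i)))"
  proof (induction k)
    case 0
    have "y i = cj un un (y i)" if "i \<in> {1..n}" for i
      using y that by (simp add: cj_un proj_VM tuples_def)
    then show ?case using y unit_pair_un by (auto intro!: exI[of _ un])
  next
    case (Suc k)
    then have z: "normalise k y \<in> tuples" by blast
    note S = nstep_props[OF z, of "Suc k"]
    obtain u u' where u: "unit_pair u u'" "u - un \<in> F 1" "\<forall>i\<in>{1..n}. normalise k y i = cj u u' (y i)"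
      using Suc by blast
    obtain w w' where w: "unit_pair w w'" "w - un \<in> F 1" "nstep (Suc k) (normalise k y) = (\<lambda>i. cj w w' (normalise k y i))"
      using S(4) by auto
    have e: "mul w u - un = (w - un) + mul w (u - un)" using unit_pair_VM[OF w(1)] by (simp add: mul_distribs)
    have "mul w u - un \<in> F 1" unfolding e by (rule F_add[OF w(2) F_mul_right[OF u(2)]])
    moreover have "\<forall>i\<in>{1..n}. normalise (Suc k) y i = cj (mul w u) (mul u' w') (y i)"
      using u w by (simp flip: cj_compose)
    moreover have "slice_at j (normalise (Suc k) y)" if "j \<in> {1..Suc k}" for j
      using that S(2,3) Suc by (cases "j = Suc k") auto
    ultimately show ?case using S(1) unit_pair_mul[OF w(1) u(1)] by auto
  qed
  then show "normalise k y \<in> tuples" "\<forall>j\<in>{1..k}. slice_at j (normalise k y)"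
    "\<exists>u u'. unit_pair u u' \<and> u - un \<in> F 1 \<and> (\<forall>i\<in>{1..n}. normalise k y i = cj u u' (y i))"
    by blast+
qed

text \<open>The conjugating unit is pushed towards 1. If it starts in degree k, the tuples differ in
  degree \<open>k + 1\<close> by an element of the image of \<open>Lmap\<close> that also lies in
  the complement; so it is zero, and the leading term is central and can be stripped. At depth
  \<open>Dmax\<close> the unit is 1.\<close>

lemma slice_unique:
  assumes y: "y \<in> tuples" "\<And>j. j \<in> {1..Dmax} \<Longrightarrow> slice_at j y"
    and z: "\<And>j. j \<in> {1..Dmax} \<Longrightarrow> slice_at j z"
    and u: "unit_pair u u'" "u - un \<in> F 1" "\<And>i. i \<in> {1..n} \<Longrightarrow> z i = cj u u' (y i)"
    and i: "i \<in> {1..n}"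
  shows "z i = y i"
proof -
  have "\<exists>w w'. unit_pair w w' \<and> w - un \<in> F k \<and> (\<forall>i\<in>{1..n}. z i = cj w w' (y i))"
    if "1 \<le> k" "k \<le> Dmax" for k
    using that
  proof (induction k rule: dec_induct)
    case base
    then show ?case using u by blast
  next
    case (step k)
    then obtain w w' where w: "unit_pair w w'" "w - un \<in> F k" "\<forall>i\<in>{1..n}. z i = cj w w' (y i)" by auto
    have k: "1 \<le> k" "k \<in> {1..Dmax}" using step by auto
    have "tup (k + 1) z = tup (k + 1) (\<lambda>i. cj w w' (y i))"
      unfolding tup_def using w(3) by (intro ext) (clarsimp cong: if_cong)
    also have "\<dots> = tup (k + 1) y + Lmap (hp k (w - un))" by (rule tup_cj(1)[OF w(1,2) k(1) y(1)])
    finally have "Lmap (alp k (tup (k + 1) z)) = Lmap (alp k (tup (k + 1) y)) + Lmap (alp k (Lmap (hp k (w - un))))"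
      by (simp add: lin_add[OF alp(2)] lin_add[OF lin_Lmap])
    moreover have "hp k (w - un) \<in> homog k" using F_VM[OF w(2)] by (rule hp_homog)
    ultimately have "Lmap (hp k (w - un)) = 0"
      using y(2)[OF k(2)] z[OF k(2)] alp(3) by (simp add: slice_at_def)
    then obtain v v' where "unit_pair v v'" "v - un \<in> F (k + 1)" "cj v v' = cj w w'"
      using strip_central[OF w(1,2) k(1)] by (auto simp: Lmap_eq_0)
    then show ?case using w(3) unfolding Suc_eq_plus1 by metis
  qed
  moreover have "1 \<le> Dmax" by (simp add: Dmax_def)
  ultimately obtain w w' where w: "unit_pair w w'" "w - un \<in> F Dmax" "z i = cj w w' (y i)"
    using i by blast
  then have "w = un" using F_Dmax[of Dmax "w - un"] by simp
  then have "w' = un" using w(1) un_mul_VM unfolding unit_pair_def by metis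
  then show ?thesis using w \<open>w = un\<close> y(1) i by (simp add: cj_un proj_VM tuples_def)
qed

text \<open>While the effect on generators is deeper than the leading commutator, that commutator is
  zero, so the leading term is central and can be stripped.\<close>

lemma cj_deep:
  assumes u: "unit_pair u u'" "u - un \<in> F 1" and c: "\<And>i. i \<in> {1..n} \<Longrightarrow> cj u u' (X i) - X i \<in> F (k + 1)"
    and k: "1 \<le> k"
  shows "\<exists>w w'. unit_pair w w' \<and> w - un \<in> F k \<and> cj w w' = cj u u'"
  using k c
proof (induction k rule: dec_induct)
  case base
  then show ?case using u by blast
next
  case (step k)
  have "\<And>i. i \<in> {1..n} \<Longrightarrow> cj u u' (X i) - X i \<in> F (k + 1)"
    using step.prems F_mono[of "k + 1" "Suc k + 1"] by simp
  then obtain w w' where w: "unit_pair w w'" "w - un \<in> F k" "cj w w' = cj u u'" using step.IH by blast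
  have "ad (hp k (w - un)) (X i) = 0" if i: "i \<in> {1..n}" for i
  proof -
    have "X i \<in> VM" "X i - X i \<in> F 2" using i by auto
    from cj_leading(2)[OF w(1,2) step.hyps(1) this i]
    have "ad (hp k (w - un)) (X i) = hp (k + 1) (cj u u' (X i) - X i)" using w(3) by simp
    also have "\<dots> = 0" using step.prems[OF i] by (intro hp_zero) auto
    finally show ?thesis .
  qed
  from strip_central[OF w(1,2) step.hyps(1) this] w(3) show ?case by (simp add: Suc_eq_plus1)
qed

text \<open>The layers J^k/J^(k+1) are spanned by products of k generators, so triviality on J/J^2
  propagates to all of them.\<close>

lemma chom_unipotent:
  assumes t: "chom t" and X: "\<And>i. i \<in> {1..n} \<Longrightarrow> t (X i) - X i \<in> F 2" and v: "v \<in> F k"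
  shows "t v - v \<in> F (k + 1)"
proof -
  note lt = chom_lin[OF t]
  have "t (ev a) - ev a \<in> F (deg a + 1)" if "a \<in> M" for a
    using that
  proof (induction "deg a" arbitrary: a rule: less_induct)
    case less
    show ?case
    proof (cases "a = 0")
      case True
      then show ?thesis by (simp add: chom_un[OF t])
    next
      case False
      then obtain i c where ic: "i \<in> {1..n}" "c \<in> M" "a = ux i + c" using M_decomp less by blast
      have dg: "deg a = 1 + deg c" using ic by (simp add: deg_add)
      then have IH: "t (ev c) - ev c \<in> F (deg c + 1)" using less(1)[of c] ic by auto
      define g where "g = inverse (\<gamma> (ux i) c)"
      have e: "ev a = sc g (mul (X i) (ev c))"
        using X_mul_ev[of i c] ic less.prems \<gamma>_nz by (simp add: g_def)
      have "t (ev a) - ev a = sc g (mul (t (X i) - X i) (t (ev c)) + mul (X i) (t (ev c) - ev c))"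
        by (simp add: e lin_sc[OF lt] chom_mul[OF t] mul_distribs fv.scale_right_diff_distrib fv.scale_right_distrib)
      moreover have "mul (t (X i) - X i) (t (ev c)) \<in> F (2 + deg c)"
        using F_mul[OF X[OF ic(1)] chom_F[OF t F_ev[of c "deg c"]]] ic by simp
      moreover have "mul (X i) (t (ev c) - ev c) \<in> F (1 + (deg c + 1))"
        using F_mul[OF F_X[OF ic(1)] IH] .
      moreover have "2 + deg c = deg a + 1" "1 + (deg c + 1) = deg a + 1" using dg by simp_all
      ultimately show ?thesis using F_sc F_add by metis
    qed
  qed
  moreover have "t v - v = (\<Sum>a\<in>M. sc (v a) (t (ev a) - ev a))"
  proof -
    have "t v = (\<Sum>a\<in>M. sc (v a) (t (ev a)))"
      by (subst VM_expand[OF F_VM[OF v]]) (simp add: lin_sum[OF lt] lin_sc[OF lt])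
    then show ?thesis using VM_expand[OF F_VM[OF v]] by (simp add: fv.scale_right_diff_distrib sum_subtractf)
  qed
  moreover have "sc (v a) (t (ev a) - ev a) \<in> F (k + 1)" if "a \<in> M" "t (ev a) - ev a \<in> F (deg a + 1)" for a
  proof (cases "deg a < k")
    case True
    then have "v a = 0" using v by (simp add: F_def)
    then show ?thesis by simp
  next
    case False
    then show ?thesis using F_mono[OF _ that(2), of "k + 1"] by (intro F_sc) auto
  qed
  ultimately show ?thesis by (auto intro!: F_sum)
qed

text \<open>Automorphisms acting trivially on \<open>J/J\<^sup>2\<close> form a unipotent group, so in characteristic other
  than \<open>2\<close> their images in \<open>Out\<close> are not involutions.\<close>

lemma unipotent_involution_inner:
  assumes s: "chom s" and X: "\<And>i. i \<in> {1..n} \<Longrightarrow> s (X i) - X i \<in> F 2"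
    and inv: "(\<lambda>v. s (s v)) \<in> cinner" and two: "(2 :: 'k) \<noteq> 0"
  shows "s \<in> cinner"
proof -
  \<comment> \<open>Composition with inner automorphisms pushes \<open>s\<close> towards the
    identity one layer at a time; at depth \<open>Dmax\<close> it fixes the generators.\<close>
  have "\<exists>\<nu>\<in>cinner. \<forall>i\<in>{1..n}. \<nu> (s (X i)) - X i \<in> F (k + 1)" if "1 \<le> k" for k
    using that
  proof (induction k rule: dec_induct)
    case base
    have "proj (s (X i)) - X i \<in> F (1 + 1)" if "i \<in> {1..n}" for i
      using X[OF that] by (simp add: proj_VM chom_VM[OF s])
    then show ?case using cinner_proj by blast
  next
    case (step k)
    then obtain \<nu> where \<nu>: "\<nu> \<in> cinner" "\<And>i. i \<in> {1..n} \<Longrightarrow> \<nu> (s (X i)) - X i \<in> F (k + 1)" by auto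
    define t where "t v = \<nu> (s v)" for v
    have ct: "chom t" unfolding t_def chom_def using cinner_chom[OF \<nu>(1)] s
      by (simp add: chom_lin lin_comp chom_VM chom_proj chom_mul chom_un)
    note lt = chom_lin[OF ct]
    have tX: "t (X i) - X i \<in> F (k + 1)" if "i \<in> {1..n}" for i using \<nu>(2)[OF that] by (simp add: t_def)
    have tX2: "t (X i) - X i \<in> F 2" if "i \<in> {1..n}" for i
      using F_mono[OF _ tX[OF that], of 2] step.hyps by simp
    obtain \<mu> where \<mu>: "\<mu> \<in> cinner" "\<And>v. s (\<nu> v) = \<mu> (s v)" using cinner_conjugate[OF \<nu>(1) s] by blast
    \<comment> \<open>Moving \<open>\<nu>\<close> past \<open>s\<close> costs another inner
      automorphism, so the square of the corrected map is still inner.\<close>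
    have "(\<lambda>v. t (t v)) = (\<lambda>v. \<nu> (\<mu> (s (s v))))" by (rule ext) (simp add: t_def \<mu>(2))
    also have "\<dots> \<in> cinner" using cinner_compose[OF \<nu>(1) cinner_compose[OF \<mu>(1) inv]] by simp
    finally obtain a where a: "a \<in> F 1" "(\<lambda>v. t (t v)) = cj (un - a) (geo a)" using cinner_normalized by blast
    have tt: "cj (un - a) (geo a) v = t (t v)" for v using a(2) by metis
    \<comment> \<open>With e = t - 1 one has t^2 - 1 = e^2 + 2 e, and e^2 is one layer deeper on
      generators. So twice the leading term of t - 1 is that of an inner automorphism.\<close>
    have sq: "t (t (X i)) - X i = (t (t (X i) - X i) - (t (X i) - X i)) + sc 2 (t (X i) - X i)"
      if "i \<in> {1..n}" for i
    proof -
      have "((a - b) - (b - c)) + sc 2 (b - c) = a - c" for a b c :: "'k coords"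
      proof
        fix x
        have "((a x - b x) - (b x - c x)) + 2 * (b x - c x) = a x - c x" by (simp add: algebra_simps)
        then show "(((a - b) - (b - c)) + sc 2 (b - c)) x = (a - c) x" by (simp only: fapply)
      qed
      then show ?thesis unfolding lin_diff[OF lt] by (rule sym)
    qed
    have sq1: "t (t (X i) - X i) - (t (X i) - X i) \<in> F (k + 1 + 1)" if "i \<in> {1..n}" for i
      by (rule chom_unipotent[OF ct tX2 tX[OF that]])
    have "t (t (X i)) - X i \<in> F (k + 1)" if "i \<in> {1..n}" for i
      unfolding sq[OF that] using F_mono[OF _ sq1[OF that], of "k + 1"] tX[OF that] by (intro F_add F_sc) auto
    then obtain w w' where w: "unit_pair w w'" "w - un \<in> F k" "cj w w' = cj (un - a) (geo a)"
      using cj_deep[OF unit_pair_one_minus[OF a(1)] _ _ step.hyps(1)] F_neg[OF a(1)] by (auto simp: tt)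
    \<comment> \<open>Half the leading term of the unit that induces t^2: its commutators are the
      leading terms of t - 1, and conjugation by 1 - b cancels them.\<close>
    define b where "b = sc (1 / 2) (hp k (w - un))"
    have bk: "b \<in> F k" unfolding b_def by (intro F_sc hp_F F_VM[OF w(2)])
    have hb: "hp k b = b" by (simp add: b_def lin_sc[OF lin_hp])
    have b1: "b \<in> F 1" using F_mono[OF step.hyps(1) bk] .
    have zeta: "hp (k + 1) (t (X i) - X i) = ad b (X i)" if i: "i \<in> {1..n}" for i
    proof -
      have "X i \<in> VM" "X i - X i \<in> F 2" using i by auto
      from cj_leading(2)[OF w(1,2) step.hyps(1) this i]
      have "ad (hp k (w - un)) (X i) = hp (k + 1) (t (t (X i)) - X i)" using w(3) tt by simp
      also have "\<dots> = sc 2 (hp (k + 1) (t (X i) - X i))"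
        unfolding sq[OF i] using hp_zero[OF sq1[OF i], of "k + 1"] by (simp add: lin_add[OF lin_hp] lin_sc[OF lin_hp])
      finally have "sc (1/2) (ad (hp k (w - un)) (X i)) = hp (k + 1) (t (X i) - X i)" using two by simp
      then show ?thesis by (simp add: b_def lin_sc[OF lin_ad_left])
    qed
    define \<kappa> where "\<kappa> = cj (un - b) (geo b)"
    have k': "\<kappa> \<in> cinner" unfolding \<kappa>_def by (rule cinner_one_minus[OF b1])
    have "\<kappa> (t (X i)) - X i \<in> F (Suc k + 1)" if i: "i \<in> {1..n}" for i
    proof -
      have m: "un - b - un = - b" by simp
      have mb: "un - b - un \<in> F k" unfolding m by (rule F_neg[OF bk])
      note L = cj_leading[OF unit_pair_one_minus[OF b1] mb step.hyps(1) chom_VM[OF ct] tX2[OF i] i]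
      have e: "\<kappa> (t (X i)) - X i = (\<kappa> (t (X i)) - t (X i)) + (t (X i) - X i)" by simp
      have L1: "\<kappa> (t (X i)) - t (X i) \<in> F (k + 1)" using L(1) by (simp only: \<kappa>_def)
      have L2: "hp (k + 1) (\<kappa> (t (X i)) - t (X i)) = - ad b (X i)"
        using L(2) hb by (simp only: \<kappa>_def m fvp.linear_neg[OF lin_hp] fvp.linear_neg[OF lin_ad_left])
      have "\<kappa> (t (X i)) - X i \<in> F (k + 1)"
        using F_add[OF L1 tX[OF i]] by (simp only: e[symmetric])
      moreover have "hp (k + 1) (\<kappa> (t (X i)) - X i) = 0"
        using lin_add[OF lin_hp, of "k + 1" "\<kappa> (t (X i)) - t (X i)" "t (X i) - X i"]
        by (simp only: e[symmetric] L2 zeta[OF i]) simp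
      ultimately show ?thesis using F_Suc_iff[of _ "k + 1"] by (simp only: Suc_eq_plus1)
    qed
    then show ?case using cinner_compose[OF k' \<nu>(1)] by (intro bexI[of _ "\<lambda>v. \<kappa> (\<nu> v)"]) (auto simp: t_def)
  qed
  moreover have "1 \<le> Dmax" by (simp add: Dmax_def)
  ultimately obtain \<nu> where \<nu>: "\<nu> \<in> cinner" "\<And>i. i \<in> {1..n} \<Longrightarrow> \<nu> (s (X i)) - X i \<in> F (Dmax + 1)" by blast
  obtain \<mu> where \<mu>: "\<mu> \<in> cinner" "\<And>v. \<mu> (\<nu> v) = proj v" using cinner_inverse[OF \<nu>(1)] by blast
  have "s (X i) = \<mu> (X i)" if "i \<in> {1..n}" for i
  proof -
    have "\<nu> (s (X i)) = X i" using F_Dmax[OF _ \<nu>(2)[OF that]] by simp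
    then show ?thesis using \<mu>(2)[of "s (X i)"] by (simp add: proj_VM chom_VM[OF s])
  qed
  then show ?thesis using chom_eqI[OF s cinner_chom[OF \<mu>(1)]] \<mu>(1) by simp
qed

end

section \<open>Inverse pairs of automorphisms, and the slice as an invariant of outer
  classes\<close>

context qcoord
begin

text \<open>The inverse is carried along explicitly, because the coordinate ring of
  \<open>Aut\<close> also contains its matrix entries and \<open>ytup\<close> uses both
  maps.\<close>

definition inv_pair :: "'k coords_map \<Rightarrow> 'k coords_map \<Rightarrow> bool"
  where "inv_pair s s' \<longleftrightarrow> chom s \<and> chom s' \<and> (\<forall>v. s (s' v) = proj v) \<and> (\<forall>v. s' (s v) = proj v)"

lemma inv_pair_sym: "inv_pair s s' \<Longrightarrow> inv_pair s' s"
  by (auto simp: inv_pair_def)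

lemma inv_pair_chom: "inv_pair s s' \<Longrightarrow> chom s" "inv_pair s s' \<Longrightarrow> chom s'"
  by (auto simp: inv_pair_def)

lemma chom_comp: "chom f \<Longrightarrow> chom g \<Longrightarrow> chom (\<lambda>v. f (g v))"
  unfolding chom_def by (simp add: lin_comp)

lemma chom_proj_map: "chom proj"
  using cinner_chom[OF cinner_proj] .

lemma inv_pair_comp: "inv_pair s s' \<Longrightarrow> inv_pair t t' \<Longrightarrow> inv_pair (\<lambda>v. s (t v)) (\<lambda>v. t' (s' v))"
  by (auto simp: inv_pair_def chom_comp chom_proj)

lemma inv_pair_proj: "inv_pair proj proj"
  by (simp add: inv_pair_def chom_proj_map proj_VM)

lemma inv_pair_unique: "inv_pair s s' \<Longrightarrow> inv_pair s s'' \<Longrightarrow> s' = s''"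
proof
  fix v assume s: "inv_pair s s'" "inv_pair s s''"
  have 1: "s (s'' v) = proj v" "s' (s (s'' v)) = proj (s'' v)" using s unfolding inv_pair_def by blast+
  have "s' v = s' (proj v)" using s by (simp add: inv_pair_def chom_proj)
  also have "\<dots> = proj (s'' v)" using 1 by simp
  also have "\<dots> = s'' v" using s by (simp add: inv_pair_def proj_VM chom_VM)
  finally show "s' v = s'' v" .
qed

lemma cinner_inv_pair: "f \<in> cinner \<Longrightarrow> \<exists>f'\<in>cinner. inv_pair f f'"
  using cinner_inverse cinner_chom by (auto simp: inv_pair_def; blast)

lemma cinner_X:
  assumes "f \<in> cinner" "i \<in> {1..n}"
  shows "f (X i) - X i \<in> F 2"
proof -
  obtain a where a: "a \<in> F 1" "f = cj (un - a) (geo a)" using cinner_normalized[OF assms(1)] by blast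
  have "un - a - un \<in> F 1" using F_neg[OF a(1)] by simp
  from cj_leading(1)[OF unit_pair_one_minus[OF a(1)] this, of "X i" i] show ?thesis
    using assms(2) a(2) by simp
qed

lemma cinner_F1:
  assumes "f \<in> cinner" "v \<in> F 1"
  shows "f v - v \<in> F 2"
  using chom_unipotent[OF cinner_chom[OF assms(1)] cinner_X[OF assms(1)] assms(2)] by simp

lemma F_2_ux: "v \<in> F 2 \<Longrightarrow> i \<in> {1..n} \<Longrightarrow> v (ux i) = 0"
  by (simp add: F_def)

lemma linear_expand:
  assumes "v \<in> F 1"
  shows "v - (\<Sum>j\<in>{1..n}. sc (v (ux j)) (X j)) \<in> F 2"
proof -
  let ?w = "v - (\<Sum>j\<in>{1..n}. sc (v (ux j)) (X j))"
  have w: "?w \<in> F 1" using assms by (intro F_diff F_sum F_sc) auto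
  have "?w a = 0" if "deg a < 2" for a
  proof (cases "a \<in> M")
    case True
    show ?thesis
    proof (cases "deg a = 0")
      case False
      then have "deg a = 1" using that by simp
      then obtain i where i: "i \<in> {1..n}" "a = ux i" using deg_1_ux True by blast
      have "(\<Sum>j\<in>{1..n}. sc (v (ux j)) (X j)) (ux i) = (\<Sum>j\<in>{1..n}. if j = i then v (ux i) else 0)"
        unfolding sum_fun_apply by (rule sum.cong) (auto simp: sc_apply ev_def dest: ux_inj)
      then show ?thesis using i by (simp add: minus_apply)
    qed (use w in \<open>simp add: F_def\<close>)
  qed (use w in \<open>simp add: F_def VM_def\<close>)
  then show ?thesis using w by (simp add: F_def)
qed

lemma linear_coeff_comp:
  assumes s: "chom s" and t: "chom t" and i: "i \<in> {1..n}" and j: "j \<in> {1..n}"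
  shows "s (t (X i)) (ux j) = (\<Sum>l\<in>{1..n}. t (X i) (ux l) * s (X l) (ux j))"
proof -
  note ls = chom_lin[OF s]
  have "t (X i) - (\<Sum>l\<in>{1..n}. sc (t (X i) (ux l)) (X l)) \<in> F 2"
    by (rule linear_expand[OF chom_X[OF t i]])
  from F_2_ux[OF chom_F[OF s this] j] show ?thesis
    by (simp add: lin_diff[OF ls] lin_sum[OF ls] lin_sc[OF ls] fapply)
qed

text \<open>The tuple \<open>\<sigma>(d\<^sup>-\<^sup>1 x\<^sub>i)\<close>, where \<open>d\<close> is the linear part of \<open>\<sigma>\<close>.\<close>

definition ytup :: "'k coords_map \<Rightarrow> 'k coords_map \<Rightarrow> nat \<Rightarrow> 'k coords"
  where "ytup s s' i = (\<Sum>j\<in>{1..n}. sc (s' (X i) (ux j)) (s (X j)))"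

lemma ytup_tuples:
  assumes "inv_pair s s'"
  shows "ytup s s' \<in> tuples"
proof -
  note s = inv_pair_chom[OF assms]
  note ls = chom_lin[OF s(1)]
  have "ytup s s' i - X i \<in> F 2" if i: "i \<in> {1..n}" for i
  proof -
    have "s' (X i) - (\<Sum>j\<in>{1..n}. sc (s' (X i) (ux j)) (X j)) \<in> F 2"
      by (rule linear_expand[OF chom_X[OF s(2) i]])
    from chom_F[OF s(1) this] have "s (s' (X i)) - ytup s s' i \<in> F 2"
      by (simp add: lin_diff[OF ls] lin_sum[OF ls] lin_sc[OF ls] ytup_def)
    moreover have "s (s' (X i)) = X i" using assms i by (simp add: inv_pair_def proj_VM)
    ultimately show ?thesis using F_neg[of "X i - ytup s s' i" 2] by simp
  qed
  then show ?thesis by (auto simp: tuples_def ytup_def chom_VM[OF s(1)] intro!: VM_sum)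
qed

lemma linear_coeff_inner_right:
  assumes "chom s" "f \<in> cinner" "i \<in> {1..n}" "j \<in> {1..n}"
  shows "s (f (X i)) (ux j) = s (X i) (ux j)"
proof -
  have "s (f (X i) - X i) \<in> F 2" by (rule chom_F[OF assms(1) cinner_X[OF assms(2,3)]])
  then have "s (f (X i) - X i) (ux j) = 0" using F_2_ux assms(4) by blast
  then show ?thesis by (simp add: lin_diff[OF chom_lin[OF assms(1)]] minus_apply)
qed

lemma linear_coeff_inner_left:
  assumes "chom s" "f \<in> cinner" "i \<in> {1..n}" "j \<in> {1..n}"
  shows "f (s (X i)) (ux j) = s (X i) (ux j)"
  using F_2_ux[OF cinner_F1[OF assms(2) chom_X[OF assms(1,3)]] assms(4)] by (simp add: minus_apply)

text \<open>Inner automorphisms are the identity on J/J^2, so the linear coefficients entering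
  \<open>ytup\<close> do not change and the tuple is merely transported by \<open>f\<close>.\<close>

lemma ytup_inner:
  assumes s: "inv_pair s s'" and f: "f \<in> cinner" "inv_pair f f'" "f' \<in> cinner" and i: "i \<in> {1..n}"
  shows "ytup (\<lambda>v. f (s v)) (\<lambda>v. s' (f' v)) i = f (ytup s s' i)"
  using linear_coeff_inner_right[OF inv_pair_chom(2)[OF s] f(3) i]
  by (simp add: ytup_def lin_sum[OF chom_lin[OF cinner_chom[OF f(1)]]] lin_sc[OF chom_lin[OF cinner_chom[OF f(1)]]])

definition sliced :: "'k coords_map \<Rightarrow> 'k coords_map \<Rightarrow> nat \<Rightarrow> 'k coords"
  where "sliced s s' = normalise Dmax (ytup s s')"

lemma sliced_conj:
  assumes "inv_pair s s'"
  shows "\<exists>f\<in>cinner. \<forall>i\<in>{1..n}. sliced s s' i = f (ytup s s' i)"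
proof -
  obtain u u' where "unit_pair u u'" "\<forall>i\<in>{1..n}. sliced s s' i = cj u u' (ytup s s' i)"
    using normalise_props(3)[OF ytup_tuples[OF assms]] unfolding sliced_def by metis
  then show ?thesis by (auto simp: cinner_def)
qed

text \<open>The two normalised tuples are conjugate and both lie in the slice, so uniqueness
  identifies them. This is what makes slice coordinates functions on \<open>Out\<close>.\<close>

lemma sliced_inner:
  assumes s: "inv_pair s s'" and f: "f \<in> cinner" "inv_pair f f'" "f' \<in> cinner" and i: "i \<in> {1..n}"
  shows "sliced (\<lambda>v. f (s v)) (\<lambda>v. s' (f' v)) i = sliced s s' i"
proof -
  let ?t = "\<lambda>v. f (s v)" and ?t' = "\<lambda>v. s' (f' v)"
  have t: "inv_pair ?t ?t'" by (rule inv_pair_comp[OF f(2) s])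
  obtain g where g: "g \<in> cinner" "\<And>i. i \<in> {1..n} \<Longrightarrow> sliced s s' i = g (ytup s s' i)" using sliced_conj[OF s] by blast
  obtain h where h: "h \<in> cinner" "\<And>i. i \<in> {1..n} \<Longrightarrow> sliced ?t ?t' i = h (ytup ?t ?t' i)" using sliced_conj[OF t] by blast
  obtain g' where g': "g' \<in> cinner" "inv_pair g g'" using cinner_inv_pair[OF g(1)] by blast
  have yVM: "ytup s s' i \<in> VM" if "i \<in> {1..n}" for i using ytup_tuples[OF s] that by (simp add: tuples_def)
  have e: "sliced ?t ?t' i = h (f (g' (sliced s s' i)))" if i: "i \<in> {1..n}" for i
  proof -
    have "g' (g (ytup s s' i)) = ytup s s' i" using g'(2) yVM[OF i] by (simp add: inv_pair_def proj_VM)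
    then show ?thesis using h(2)[OF i] ytup_inner[OF s f i] g(2)[OF i] by simp
  qed
  have "(\<lambda>v. h (f (g' v))) \<in> cinner" using cinner_compose[OF h(1) cinner_compose[OF f(1) g'(1)]] .
  then obtain a where a: "a \<in> F 1" "(\<lambda>v. h (f (g' v))) = cj (un - a) (geo a)" using cinner_normalized by blast
  have m: "un - a - un \<in> F 1" using F_neg[OF a(1)] by simp
  show ?thesis
  proof (rule slice_unique[OF _ _ _ unit_pair_one_minus[OF a(1)] m _ i])
    show "sliced s s' \<in> tuples" unfolding sliced_def by (rule normalise_props(1)[OF ytup_tuples[OF s]])
    show "slice_at j (sliced s s')" if "j \<in> {1..Dmax}" for j
      using normalise_props(2)[OF ytup_tuples[OF s]] that unfolding sliced_def by blast
    show "slice_at j (sliced ?t ?t')" if "j \<in> {1..Dmax}" for j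
      using normalise_props(2)[OF ytup_tuples[OF t]] that unfolding sliced_def by blast
    show "sliced ?t ?t' i = cj (un - a) (geo a) (sliced s s' i)" if "i \<in> {1..n}" for i
      using e[OF that] a(2) by metis
  qed
qed

lemma geo_0: "geo 0 = un"
  using geo_mul_one_minus[of 0] by simp

lemma hp_X_zero: "j \<in> {1..n} \<Longrightarrow> 1 < k \<Longrightarrow> hp k (X j) = 0"
  by (rule ext) (auto simp: hp_def ev_def zero_fun_apply)

text \<open>Generators have no component above degree 1, so every correction \<open>alp\<close> is
  zero.\<close>

lemma normalise_X:
  assumes "\<And>i. i \<in> {1..n} \<Longrightarrow> y i = X i" "i \<in> {1..n}"
  shows "normalise k y i = X i"
  using assms(2)
proof (induction k arbitrary: i)
  case (Suc k)
  have "tup (Suc k + 1) (normalise k y) = 0"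
  proof
    fix x :: "nat \<times> (nat \<Rightarrow> nat)"
    obtain j a where x: "x = (j, a)" by (cases x)
    have "hp (Suc k + 1) (X j) = 0" if "j \<in> {1..n}"
      using that by (simp add: hp_X_zero)
    then show "tup (Suc k + 1) (normalise k y) x = 0 x"
      using Suc.IH by (simp add: x tup_def zero_fun_apply)
  qed
  then show ?case using Suc by (simp add: nstep_def lin_0[OF alp(2)] geo_0 cj_un proj_VM)
qed (use assms in simp)

end

context qalg
begin

subsection \<open>Automorphisms in coordinates\<close>

abbreviation AA :: "('a \<Rightarrow> 'a) set"
  where "AA \<equiv> automorphisms A"

lemma ring_hom_A:
  "\<sigma> \<in> Ring.ring_hom A A \<Longrightarrow> x \<in> carrier A \<Longrightarrow> y \<in> carrier A \<Longrightarrow> \<sigma> (x \<otimes>\<^bsub>A\<^esub> y) = \<sigma> x \<otimes>\<^bsub>A\<^esub> \<sigma> y"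
  "\<sigma> \<in> Ring.ring_hom A A \<Longrightarrow> \<sigma> \<one>\<^bsub>A\<^esub> = \<one>\<^bsub>A\<^esub>"
  by (auto simp: Ring.ring_hom_def)

lemma chom_up:
  assumes r: "\<sigma> \<in> Ring.ring_hom A A" and m: "\<sigma> \<in> LinearCombinations.module_hom class_ring A A"
  shows "chom (up \<sigma>)"
proof -
  have c: "\<sigma> x \<in> carrier A" if "x \<in> carrier A" for x
    using m that by (auto simp: LinearCombinations.module_hom_def)
  have "up \<sigma> (mul u v) = mul (up \<sigma> u) (up \<sigma> v)" for u v
  proof -
    have "ve (mul u v) = ve (proj u) \<otimes>\<^bsub>A\<^esub> ve (proj v)" by (rule co_eqI) (auto simp: A_simps)
    then have "co (\<sigma> (ve (mul u v))) = mul (co (\<sigma> (ve (proj u)))) (co (\<sigma> (ve (proj v))))"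
      by (simp add: ring_hom_A[OF r] A_simps c)
    then show ?thesis by (simp add: up_def)
  qed
  moreover have "ve un = \<one>\<^bsub>A\<^esub>" by (rule co_eqI) (auto simp: A_simps)
  then have "up \<sigma> un = un" by (simp add: up_def proj_VM ring_hom_A[OF r] co_one)
  ultimately show ?thesis using up_module_hom[OF m] by (simp add: chom_def)
qed

lemma low_ring_hom: "chom s \<Longrightarrow> low s \<in> Ring.ring_hom A A"
  by (auto simp: Ring.ring_hom_def chom_VM A_simps chom_mul lin_add[OF chom_lin] chom_un intro!: co_eqI)

lemma low_Bij:
  assumes "inv_pair s s'"
  shows "low s \<in> Bij (carrier A)"
proof -
  have "bij_betw (low s) (carrier A) (carrier A)"
    by (rule bij_betwI[of _ _ _ "low s'"]) (use assms in \<open>auto simp: inv_pair_def chom_VM proj_VM\<close>)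
  then show ?thesis by (simp add: Bij_def)
qed

lemma low_AA:
  assumes s: "inv_pair s s'"
  shows "low s \<in> AA"
proof -
  note c = inv_pair_chom(1)[OF s]
  show ?thesis
    unfolding automorphisms_def
    by (intro IntI low_Bij[OF s] low_ring_hom[OF c] low_module_hom chom_lin[OF c] chom_VM[OF c])
qed

lemma BijGroup_inv_low:
  assumes s: "inv_pair s s'"
  shows "inv\<^bsub>BijGroup (carrier A)\<^esub> (low s) = low s'"
proof (rule group.inv_equality[OF group_BijGroup])
  have "compose (carrier A) (low s') (low s) = (\<lambda>x\<in>carrier A. x)"
    unfolding compose_def by (rule restrict_ext) (use s in \<open>auto simp: inv_pair_def chom_VM proj_VM\<close>)
  then show "low s' \<otimes>\<^bsub>BijGroup (carrier A)\<^esub> low s = \<one>\<^bsub>BijGroup (carrier A)\<^esub>"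
    using low_Bij[OF s] low_Bij[OF inv_pair_sym[OF s]] by (simp add: BijGroup_def)
qed (use low_Bij[OF s] low_Bij[OF inv_pair_sym[OF s]] in \<open>simp_all add: BijGroup_def\<close>)

definition upi :: "('a \<Rightarrow> 'a) \<Rightarrow> 'k coords_map"
  where "upi \<sigma> = up (inv\<^bsub>BijGroup (carrier A)\<^esub> \<sigma>)"

lemma up_low_chom: "chom s \<Longrightarrow> up (low s) = s"
  by (rule up_low) (auto simp: chom_VM chom_proj)

lemma upi_low: "inv_pair s s' \<Longrightarrow> upi (low s) = s'"
  by (simp add: upi_def BijGroup_inv_low up_low_chom inv_pair_chom)

lemma AA_up:
  assumes "\<sigma> \<in> AA"
  shows "inv_pair (up \<sigma>) (upi \<sigma>)" "low (up \<sigma>) = \<sigma>"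
proof -
  from assms have b: "\<sigma> \<in> Bij (carrier A)" and r: "\<sigma> \<in> Ring.ring_hom A A"
    and m: "\<sigma> \<in> LinearCombinations.module_hom class_ring A A" by (auto simp: automorphisms_def)
  have c: "\<sigma> x \<in> carrier A" if "x \<in> carrier A" for x
    using m that by (auto simp: LinearCombinations.module_hom_def)
  have ext: "\<sigma> \<in> extensional (carrier A)" and bij: "bij_betw \<sigma> (carrier A) (carrier A)"
    using b by (auto simp: Bij_def)
  show l: "low (up \<sigma>) = \<sigma>" by (rule low_up[OF ext c])
  define \<tau> where "\<tau> = (\<lambda>x\<in>carrier A. inv_into (carrier A) \<sigma> x)"
  have \<tau>c: "\<tau> x \<in> carrier A" if "x \<in> carrier A" for x
    using bij_betw_apply[OF bij_betw_inv_into[OF bij] that] that by (simp add: \<tau>_def)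
  have st: "\<sigma> (\<tau> x) = x" if "x \<in> carrier A" for x
    using bij_betw_inv_into_right[OF bij that] that by (simp add: \<tau>_def)
  have ts: "\<tau> (\<sigma> x) = x" if "x \<in> carrier A" for x
    using bij_betw_inv_into_left[OF bij that] c[OF that] by (simp add: \<tau>_def)
  have inj: "\<tau> x = y" if "x \<in> carrier A" "y \<in> carrier A" "x = \<sigma> y" for x y
    using ts[OF that(2)] that(3) by simp
  have \<sigma>m: "\<sigma> (x \<oplus>\<^bsub>A\<^esub> y) = \<sigma> x \<oplus>\<^bsub>A\<^esub> \<sigma> y" "\<sigma> (k \<odot>\<^bsub>A\<^esub> x) = k \<odot>\<^bsub>A\<^esub> \<sigma> x"
    if "x \<in> carrier A" "y \<in> carrier A" for x y k
    using m that by (auto simp: LinearCombinations.module_hom_def)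
  have rt: "\<tau> \<in> Ring.ring_hom A A"
    unfolding Ring.ring_hom_def
    by (auto intro!: inj simp: \<tau>c A_simps ring_hom_A[OF r] \<sigma>m st)
  have mt: "\<tau> \<in> LinearCombinations.module_hom class_ring A A"
    unfolding LinearCombinations.module_hom_def
    by (auto intro!: inj simp: \<tau>c A_simps \<sigma>m(1) \<sigma>m(2)[OF _ \<tau>c] st)
  have "inv_pair (up \<sigma>) (up \<tau>)"
    using chom_up[OF r m] chom_up[OF rt mt] by (simp add: inv_pair_def up_def c \<tau>c st ts proj_VM)
  moreover from this have "upi \<sigma> = up \<tau>" using upi_low l by metis
  ultimately show "inv_pair (up \<sigma>) (upi \<sigma>)" by simp
qed

lemma AA_eq: "AA = low ` {s. \<exists>s'. inv_pair s s'}"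
  using AA_up low_AA by (force simp: image_iff)

lemma Aut_carrier [simp]: "carrier (Aut A) = AA"
  by (simp add: Aut_def Let_def)

lemma Aut_mult:
  assumes "inv_pair s s'" "inv_pair t t'"
  shows "low s \<otimes>\<^bsub>Aut A\<^esub> low t = low (\<lambda>v. s (t v))"
proof -
  have "compose (carrier A) (low s) (low t) = low (\<lambda>v. s (t v))"
    unfolding compose_def low_def[of "\<lambda>v. s (t v)"]
    by (rule restrict_ext) (use assms in \<open>simp add: inv_pair_def chom_VM\<close>)
  then show ?thesis
    using low_Bij[OF assms(1)] low_Bij[OF assms(2)] by (simp add: Aut_def Let_def BijGroup_def)
qed

lemma Aut_one: "\<one>\<^bsub>Aut A\<^esub> = low proj"
  unfolding Aut_def Let_def BijGroup_def low_def
  by (simp, rule restrict_ext) (simp add: proj_VM)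

lemma group_Aut: "group (Aut A)"
proof (rule groupI)
  fix x y assume "x \<in> carrier (Aut A)" "y \<in> carrier (Aut A)"
  then obtain s s' t t' where "x = low s" "inv_pair s s'" "y = low t" "inv_pair t t'" by (auto simp: AA_eq)
  then show "x \<otimes>\<^bsub>Aut A\<^esub> y \<in> carrier (Aut A)" using inv_pair_comp by (auto simp: Aut_mult intro!: low_AA)
next
  show "\<one>\<^bsub>Aut A\<^esub> \<in> carrier (Aut A)" using low_AA[OF inv_pair_proj] by (simp add: Aut_one)
next
  fix x y z assume "x \<in> carrier (Aut A)" "y \<in> carrier (Aut A)" "z \<in> carrier (Aut A)"
  then obtain s s' t t' r r' where "x = low s" "inv_pair s s'" "y = low t" "inv_pair t t'" "z = low r" "inv_pair r r'"
    by (auto simp: AA_eq)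
  then show "x \<otimes>\<^bsub>Aut A\<^esub> y \<otimes>\<^bsub>Aut A\<^esub> z = x \<otimes>\<^bsub>Aut A\<^esub> (y \<otimes>\<^bsub>Aut A\<^esub> z)"
    using Aut_mult[OF inv_pair_comp[of s s' t t'], of r r'] Aut_mult[OF _ inv_pair_comp[of t t' r r'], of s s']
    by (simp add: Aut_mult)
next
  fix x assume "x \<in> carrier (Aut A)"
  then obtain s s' where s: "x = low s" "inv_pair s s'" by (auto simp: AA_eq)
  then show "\<one>\<^bsub>Aut A\<^esub> \<otimes>\<^bsub>Aut A\<^esub> x = x"
    using Aut_mult[OF inv_pair_proj s(2)] by (simp add: Aut_one proj_VM chom_VM[OF inv_pair_chom(1)])
  have "low s' \<otimes>\<^bsub>Aut A\<^esub> x = \<one>\<^bsub>Aut A\<^esub>"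
    using s Aut_mult[OF inv_pair_sym[OF s(2)] s(2)] by (simp add: Aut_one inv_pair_def)
  then show "\<exists>y\<in>carrier (Aut A). y \<otimes>\<^bsub>Aut A\<^esub> x = \<one>\<^bsub>Aut A\<^esub>"
    using low_AA[OF inv_pair_sym[OF s(2)]] by auto
qed

lemma Aut_inv:
  assumes s: "inv_pair s s'"
  shows "inv\<^bsub>Aut A\<^esub> (low s) = low s'"
  using Aut_mult[OF inv_pair_sym[OF s] s] low_AA[OF s] low_AA[OF inv_pair_sym[OF s]] s
  by (intro group.inv_equality[OF group_Aut]) (simp_all add: Aut_one inv_pair_def)

lemma inner_automorphisms_eq: "inner_automorphisms A = low ` cinner"
proof -
  interpret A: ring A by (rule ring_A)
  have 1: "unit_pair (co u) (co (inv\<^bsub>A\<^esub> u))" "inv\<^bsub>A\<^esub> u \<in> carrier A" if "u \<in> Units A" for u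
  proof -
    show c: "inv\<^bsub>A\<^esub> u \<in> carrier A" using that by simp
    have uc: "u \<in> carrier A" using that by (rule A.Units_closed)
    have "co (u \<otimes>\<^bsub>A\<^esub> inv\<^bsub>A\<^esub> u) = un" "co (inv\<^bsub>A\<^esub> u \<otimes>\<^bsub>A\<^esub> u) = un" using that by (simp_all add: co_one)
    then show "unit_pair (co u) (co (inv\<^bsub>A\<^esub> u))"
      unfolding unit_pair_def co_mult[OF uc c] co_mult[OF c uc] using uc c by simp
  qed
  have 2: "(\<lambda>x\<in>carrier A. u \<otimes>\<^bsub>A\<^esub> x \<otimes>\<^bsub>A\<^esub> inv\<^bsub>A\<^esub> u) = low (cj (co u) (co (inv\<^bsub>A\<^esub> u)))" if "u \<in> Units A" for u
    unfolding low_def by (rule restrict_ext, rule co_eqI) (use A.Units_closed[OF that] 1(2)[OF that] in \<open>auto simp: A_simps cj_def\<close>)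
  have 3: "ve u \<in> Units A \<and> inv\<^bsub>A\<^esub> (ve u) = ve u'" if u: "unit_pair u u'" for u u'
  proof -
    have e: "ve u' \<otimes>\<^bsub>A\<^esub> ve u = \<one>\<^bsub>A\<^esub>" "ve u \<otimes>\<^bsub>A\<^esub> ve u' = \<one>\<^bsub>A\<^esub>"
      using u by (auto simp: unit_pair_def A_simps intro!: co_eqI)
    have c: "ve u \<in> carrier A" "ve u' \<in> carrier A" using u by (auto simp: unit_pair_def)
    have "ve u \<in> Units A" unfolding Units_def using e c by blast
    moreover have "inv\<^bsub>A\<^esub> (ve u) = ve u'" using A.inv_char[OF c e(2,1)] .
    ultimately show ?thesis by simp
  qed
  show ?thesis
  proof (intro equalityI subsetI)
    fix x assume "x \<in> inner_automorphisms A"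
    then obtain u where u: "u \<in> Units A" "x = (\<lambda>x\<in>carrier A. u \<otimes>\<^bsub>A\<^esub> x \<otimes>\<^bsub>A\<^esub> inv\<^bsub>A\<^esub> u)"
      by (auto simp: inner_automorphisms_def)
    then show "x \<in> low ` cinner" using 2 1 unfolding cinner_def by blast
  next
    fix x assume "x \<in> low ` cinner"
    then obtain u u' where u: "unit_pair u u'" "x = low (cj u u')" by (auto simp: cinner_def)
    then have "x = (\<lambda>x\<in>carrier A. ve u \<otimes>\<^bsub>A\<^esub> x \<otimes>\<^bsub>A\<^esub> inv\<^bsub>A\<^esub> (ve u))"
      using 2[of "ve u"] 3[OF u(1)] by (simp add: unit_pair_VM[OF u(1)])
    then show "x \<in> inner_automorphisms A" using 3[OF u(1)] unfolding inner_automorphisms_def by blast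
  qed
qed

lemma inner_AA: "f \<in> cinner \<Longrightarrow> low f \<in> AA"
  using cinner_inv_pair low_AA by blast

lemma inner_normal: "inner_automorphisms A \<lhd> Aut A"
proof -
  interpret G: group "Aut A" by (rule group_Aut)
  have sub: "subgroup (inner_automorphisms A) (Aut A)"
  proof (rule G.subgroupI)
    show "inner_automorphisms A \<subseteq> carrier (Aut A)" using inner_AA by (auto simp: inner_automorphisms_eq)
    show "inner_automorphisms A \<noteq> {}" using cinner_proj by (auto simp: inner_automorphisms_eq)
  next
    fix x assume "x \<in> inner_automorphisms A"
    then obtain f where f: "x = low f" "f \<in> cinner" unfolding inner_automorphisms_eq by blast
    obtain f' where "f' \<in> cinner" "inv_pair f f'" using cinner_inv_pair[OF f(2)] by blast
    note f = f this
    show "inv\<^bsub>Aut A\<^esub> x \<in> inner_automorphisms A"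
      unfolding f(1) Aut_inv[OF f(4)] inner_automorphisms_eq using f(3) by (rule imageI)
  next
    fix x y assume "x \<in> inner_automorphisms A" "y \<in> inner_automorphisms A"
    then obtain f g where fg: "x = low f" "f \<in> cinner" "y = low g" "g \<in> cinner"
      unfolding inner_automorphisms_eq by blast
    moreover obtain f' g' where "inv_pair f f'" "inv_pair g g'"
      using cinner_inv_pair[OF fg(2)] cinner_inv_pair[OF fg(4)] by blast
    ultimately show "x \<otimes>\<^bsub>Aut A\<^esub> y \<in> inner_automorphisms A"
      using cinner_compose by (simp add: Aut_mult inner_automorphisms_eq)
  qed
  show ?thesis
    unfolding G.normal_inv_iff
  proof (intro conjI sub ballI)
    fix x h assume "x \<in> carrier (Aut A)" "h \<in> inner_automorphisms A"
    then obtain s s' f f' where *: "x = low s" "inv_pair s s'" "h = low f" "f \<in> cinner" "inv_pair f f'"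
      using cinner_inv_pair unfolding inner_automorphisms_eq AA_eq Aut_carrier by blast
    obtain g where g: "g \<in> cinner" "\<And>v. s (f v) = g (s v)"
      using cinner_conjugate[OF *(4) inv_pair_chom(1)[OF *(2)]] by blast
    have "x \<otimes>\<^bsub>Aut A\<^esub> h \<otimes>\<^bsub>Aut A\<^esub> inv\<^bsub>Aut A\<^esub> x = low (\<lambda>v. s (f (s' v)))"
      unfolding *(1,3) Aut_inv[OF *(2)] Aut_mult[OF *(2,5)]
      by (rule Aut_mult[OF inv_pair_comp[OF *(2,5)] inv_pair_sym[OF *(2)]])
    also have "(\<lambda>v. s (f (s' v))) = g"
      using *(2) chom_proj[OF cinner_chom[OF g(1)]] by (auto simp: g(2) inv_pair_def)
    finally show "x \<otimes>\<^bsub>Aut A\<^esub> h \<otimes>\<^bsub>Aut A\<^esub> inv\<^bsub>Aut A\<^esub> x \<in> inner_automorphisms A"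
      using g(1) by (simp add: inner_automorphisms_eq)
  qed
qed

subsection \<open>Regular functions and point derivations\<close>

text \<open>Members of the coordinate ring are extensional on \<open>AA\<close>; hiding the
  restriction allows functions to be combined pointwise.\<close>

definition regf :: "(('a \<Rightarrow> 'a) \<Rightarrow> 'k) \<Rightarrow> bool"
  where "regf G \<longleftrightarrow> restrict G AA \<in> regular (Aut A)"

lemma regf_cong: "(\<And>\<sigma>. \<sigma> \<in> AA \<Longrightarrow> G \<sigma> = H \<sigma>) \<Longrightarrow> regf G \<longleftrightarrow> regf H"
  unfolding regf_def by (metis restrict_ext)

lemma Aut_regular:
  "regular (Aut A) = generated_functions AA
    ({\<lambda>\<sigma>. l (\<sigma> a) | l a. l \<in> dual_space A \<and> a \<in> carrier A} \<union>
     {\<lambda>\<sigma>. l ((inv\<^bsub>BijGroup (carrier A)\<^esub> \<sigma>) a) | l a. l \<in> dual_space A \<and> a \<in> carrier A})"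
  by (simp add: Aut_def Let_def)

lemma regf_const [simp]: "regf (\<lambda>_. c)"
  by (simp add: regf_def Aut_def Let_def generated_functions.const)

lemma regf_add: "regf G \<Longrightarrow> regf H \<Longrightarrow> regf (\<lambda>\<sigma>. G \<sigma> + H \<sigma>)"
proof -
  assume "regf G" "regf H"
  then have "(\<lambda>\<sigma>\<in>AA. restrict G AA \<sigma> + restrict H AA \<sigma>) \<in> regular (Aut A)"
    unfolding regf_def Aut_regular by (rule generated_functions.add)
  also have "(\<lambda>\<sigma>\<in>AA. restrict G AA \<sigma> + restrict H AA \<sigma>) = (\<lambda>\<sigma>\<in>AA. G \<sigma> + H \<sigma>)" by (rule restrict_ext) simp
  finally show ?thesis unfolding regf_def .
qed

lemma regf_mult: "regf G \<Longrightarrow> regf H \<Longrightarrow> regf (\<lambda>\<sigma>. G \<sigma> * H \<sigma>)"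
proof -
  assume "regf G" "regf H"
  then have "(\<lambda>\<sigma>\<in>AA. restrict G AA \<sigma> * restrict H AA \<sigma>) \<in> regular (Aut A)"
    unfolding regf_def Aut_regular by (rule generated_functions.mult)
  also have "(\<lambda>\<sigma>\<in>AA. restrict G AA \<sigma> * restrict H AA \<sigma>) = (\<lambda>\<sigma>\<in>AA. G \<sigma> * H \<sigma>)" by (rule restrict_ext) simp
  finally show ?thesis unfolding regf_def .
qed

lemma regf_diff: "regf G \<Longrightarrow> regf H \<Longrightarrow> regf (\<lambda>\<sigma>. G \<sigma> - H \<sigma>)"
  using regf_add[of G "\<lambda>\<sigma>. - 1 * H \<sigma>"] regf_mult[OF regf_const, of H "- 1"] by simp

lemma regf_sum: "(\<And>x. x \<in> S \<Longrightarrow> regf (G x)) \<Longrightarrow> regf (\<lambda>\<sigma>. \<Sum>x\<in>S. G x \<sigma>)"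
  by (induction S rule: infinite_finite_induct) (auto simp: regf_add)

lemma regf_prod: "(\<And>x. x \<in> S \<Longrightarrow> regf (G x)) \<Longrightarrow> regf (\<lambda>\<sigma>. \<Prod>x\<in>S. G x \<sigma>)"
  by (induction S rule: infinite_finite_induct) (auto simp: regf_mult)

lemma coordinate_dual: "(\<lambda>x\<in>carrier A. co x a) \<in> dual_space A"
  by (auto simp: dual_space_def A_simps fapply)

lemma regf_up: "regf (\<lambda>\<sigma>. up \<sigma> v a)" and regf_upi: "regf (\<lambda>\<sigma>. upi \<sigma> v a)"
proof -
  define l where "l = (\<lambda>x\<in>carrier A. co x a)"
  have c: "\<sigma> x \<in> carrier A" if "\<sigma> \<in> AA" "x \<in> carrier A" for \<sigma> x
    using that by (auto simp: automorphisms_def LinearCombinations.module_hom_def)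
  have c': "(inv\<^bsub>BijGroup (carrier A)\<^esub> \<sigma>) x \<in> carrier A" if \<sigma>: "\<sigma> \<in> AA" and x: "x \<in> carrier A" for \<sigma> x
  proof -
    obtain s s' where s: "\<sigma> = low s" "inv_pair s s'" using \<sigma> unfolding AA_eq by blast
    then show ?thesis using c[OF low_AA[OF inv_pair_sym[OF s(2)]] x] by (simp add: BijGroup_inv_low)
  qed
  have "restrict (\<lambda>\<sigma>. l (\<sigma> (ve (proj v)))) AA \<in> regular (Aut A)"
    unfolding Aut_regular
    by (rule generated_functions.gen) (use coordinate_dual[of a] ve_closed[OF VM_proj, of v] in \<open>unfold l_def, blast\<close>)
  then show "regf (\<lambda>\<sigma>. up \<sigma> v a)"
    unfolding regf_def by (rule back_subst[of "\<lambda>x. x \<in> regular (Aut A)"])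
      (rule restrict_ext, simp add: l_def up_def c)
  have "restrict (\<lambda>\<sigma>. l ((inv\<^bsub>BijGroup (carrier A)\<^esub> \<sigma>) (ve (proj v)))) AA \<in> regular (Aut A)"
    unfolding Aut_regular
    by (rule generated_functions.gen) (use coordinate_dual[of a] ve_closed[OF VM_proj, of v] in \<open>unfold l_def, blast\<close>)
  then show "regf (\<lambda>\<sigma>. upi \<sigma> v a)"
    unfolding regf_def by (rule back_subst[of "\<lambda>x. x \<in> regular (Aut A)"])
      (rule restrict_ext, simp add: l_def upi_def up_def c')
qed

definition regv :: "(('a \<Rightarrow> 'a) \<Rightarrow> 'k coords) \<Rightarrow> bool"
  where "regv Y \<longleftrightarrow> (\<forall>a. regf (\<lambda>\<sigma>. Y \<sigma> a))"

lemma regv_const [simp]: "regv (\<lambda>_. v)"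
  by (simp add: regv_def)

lemma regv_diff: "regv Y \<Longrightarrow> regv Z \<Longrightarrow> regv (\<lambda>\<sigma>. Y \<sigma> - Z \<sigma>)"
  by (simp add: regv_def fapply regf_diff)

lemma regv_sum: "(\<And>x. x \<in> S \<Longrightarrow> regv (Y x)) \<Longrightarrow> regv (\<lambda>\<sigma>. \<Sum>x\<in>S. Y x \<sigma>)"
  by (simp add: regv_def fapply regf_sum)

lemma regv_sc: "regf G \<Longrightarrow> regv Y \<Longrightarrow> regv (\<lambda>\<sigma>. sc (G \<sigma>) (Y \<sigma>))"
  by (simp add: regv_def fapply regf_mult)

lemma regv_mul:
  assumes "regv Y" "regv Z"
  shows "regv (\<lambda>\<sigma>. mul (Y \<sigma>) (Z \<sigma>))"
  unfolding regv_def
proof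
  fix c
  have "regf (\<lambda>\<sigma>. if a + b = c then \<gamma> a b * Y \<sigma> a * Z \<sigma> b else 0)" for a b
    using assms regf_mult[OF regf_mult[OF regf_const]] by (cases "a + b = c") (auto simp: regv_def)
  then show "regf (\<lambda>\<sigma>. mul (Y \<sigma>) (Z \<sigma>) c)"
    by (cases "c \<in> M") (auto simp: mul_def intro!: regf_sum)
qed

lemma regv_up: "regv (\<lambda>\<sigma>. up \<sigma> v)"
  by (simp add: regv_def regf_up)

lemma regv_pw: "regv Y \<Longrightarrow> regv (\<lambda>\<sigma>. pw (Y \<sigma>) k)"
  by (induction k) (auto simp: regv_mul)

lemma regv_geo: "regv Y \<Longrightarrow> regv (\<lambda>\<sigma>. geo (Y \<sigma>))"
  unfolding geo_def by (intro regv_sum regv_pw)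

text \<open>Finite support reduces \<open>L\<close> to finitely many unit vectors, so its value is a
  finite combination of the regular coordinates of \<open>t\<close>.\<close>

lemma regv_linear:
  fixes t :: "('a \<Rightarrow> 'a) \<Rightarrow> 'x \<Rightarrow> 'k"
  assumes L: "lin L" and J: "finite J" "\<And>\<sigma> x. \<sigma> \<in> AA \<Longrightarrow> x \<notin> J \<Longrightarrow> t \<sigma> x = 0"
    and t: "\<And>x. regf (\<lambda>\<sigma>. t \<sigma> x)"
  shows "regv (\<lambda>\<sigma>. L (t \<sigma>))"
proof -
  define e where "e x = (\<lambda>y. if y = x then 1 else (0::'k))" for x :: 'x
  have "L (t \<sigma>) = (\<Sum>x\<in>J. sc (t \<sigma> x) (L (e x)))" if \<sigma>: "\<sigma> \<in> AA" for \<sigma>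
  proof -
    have "t \<sigma> = (\<Sum>x\<in>J. sc (t \<sigma> x) (e x))"
    proof
      fix y
      have "(\<Sum>x\<in>J. sc (t \<sigma> x) (e x)) y = (\<Sum>x\<in>J. if y = x then t \<sigma> x else 0)"
        unfolding sum_fun_apply by (rule sum.cong) (auto simp: e_def sc_apply)
      then show "t \<sigma> y = (\<Sum>x\<in>J. sc (t \<sigma> x) (e x)) y" using J \<sigma> by simp
    qed
    then have "L (t \<sigma>) = L (\<Sum>x\<in>J. sc (t \<sigma> x) (e x))" by (rule arg_cong)
    also have "\<dots> = (\<Sum>x\<in>J. sc (t \<sigma> x) (L (e x)))" by (simp only: lin_sum[OF L] lin_sc[OF L])
    finally show ?thesis .
  qed
  moreover have "regv (\<lambda>\<sigma>. \<Sum>x\<in>J. sc (t \<sigma> x) (L (e x)))"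
    by (intro regv_sum regv_sc t regv_const)
  ultimately show ?thesis
    unfolding regv_def using regf_cong[of "\<lambda>\<sigma>. L (t \<sigma>) _" "\<lambda>\<sigma>. (\<Sum>x\<in>J. sc (t \<sigma> x) (L (e x))) _"] by simp
qed

definition ytA :: "('a \<Rightarrow> 'a) \<Rightarrow> nat \<Rightarrow> 'k coords"
  where "ytA \<sigma> = ytup (up \<sigma>) (upi \<sigma>)"

lemma ytA_tuples: "\<sigma> \<in> AA \<Longrightarrow> ytA \<sigma> \<in> tuples"
  unfolding ytA_def by (rule ytup_tuples[OF AA_up(1)])

lemma regv_ytA: "regv (\<lambda>\<sigma>. ytA \<sigma> i)"
  unfolding ytA_def ytup_def by (intro regv_sum regv_sc regf_upi regv_up)

definition stepA :: "nat \<Rightarrow> ('a \<Rightarrow> 'a) \<Rightarrow> 'k coords"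
  where "stepA k \<sigma> = alp (Suc k) (tup (Suc k + 1) (normalise k (ytA \<sigma>)))"

lemma normalise_stepA: "normalise (Suc k) (ytA \<sigma>) i = cj (un - stepA k \<sigma>) (geo (stepA k \<sigma>)) (normalise k (ytA \<sigma>) i)"
  by (simp add: nstep_def stepA_def)

text \<open>Each step is polynomial in the tuple: \<open>alp\<close> is linear, and the inverse of 1
  - a is the finite series \<open>geo a\<close>.\<close>

lemma regv_normalise:
  shows "(\<forall>i\<in>{1..n}. regv (\<lambda>\<sigma>. normalise k (ytA \<sigma>) i)) \<and> (\<forall>j<k. regv (stepA j))"
proof (induction k)
  case (Suc k)
  have "regv (stepA k)"
    unfolding stepA_def
  proof (rule regv_linear[OF alp(2), of "{1..n} \<times> M"])
    fix \<sigma> and x :: "nat \<times> (nat \<Rightarrow> nat)" assume \<sigma>: "\<sigma> \<in> AA" "x \<notin> {1..n} \<times> M"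
    have "normalise k (ytA \<sigma>) i \<in> VM" if "i \<in> {1..n}" for i
      using normalise_props(1)[OF ytA_tuples[OF \<sigma>(1)], of k] that by (simp add: tuples_def)
    then show "tup (Suc k + 1) (normalise k (ytA \<sigma>)) x = 0"
      using \<sigma>(2) by (cases x) (auto simp: tup_def hp_def VM_def)
  next
    fix x :: "nat \<times> (nat \<Rightarrow> nat)"
    obtain i a where x: "x = (i, a)" by (cases x)
    show "regf (\<lambda>\<sigma>. tup (Suc k + 1) (normalise k (ytA \<sigma>)) x)"
      using Suc by (cases "i \<in> {1..n}"; cases "deg a = Suc k + 1") (auto simp: x tup_def hp_def regv_def)
  qed (simp add: finite_M)
  then show ?case
    using Suc by (auto simp del: normalise.simps simp: normalise_stepA cj_def less_Suc_eq
        intro!: regv_mul regv_diff regv_geo)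
qed (simp add: regv_ytA)

context
  fixes \<delta> :: "(('a \<Rightarrow> 'a) \<Rightarrow> 'k) \<Rightarrow> 'k"
  assumes \<delta>: "\<delta> \<in> lie_algebra (Aut A)"
begin

definition dl :: "(('a \<Rightarrow> 'a) \<Rightarrow> 'k) \<Rightarrow> 'k"
  where "dl G = \<delta> (restrict G AA)"

lemma dl_cong: "(\<And>\<sigma>. \<sigma> \<in> AA \<Longrightarrow> G \<sigma> = H \<sigma>) \<Longrightarrow> dl G = dl H"
  unfolding dl_def by (metis restrict_ext)

lemma low_proj_AA: "low proj \<in> AA"
  by (rule low_AA[OF inv_pair_proj])

lemma dl_add: "regf G \<Longrightarrow> regf H \<Longrightarrow> dl (\<lambda>\<sigma>. G \<sigma> + H \<sigma>) = dl G + dl H"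
proof -
  assume r: "regf G" "regf H"
  have "\<delta> (\<lambda>\<sigma>\<in>carrier (Aut A). restrict G AA \<sigma> + restrict H AA \<sigma>) = dl G + dl H"
    using \<delta> r unfolding lie_algebra_def regf_def dl_def by blast
  moreover have "(\<lambda>\<sigma>\<in>AA. restrict G AA \<sigma> + restrict H AA \<sigma>) = (\<lambda>\<sigma>\<in>AA. G \<sigma> + H \<sigma>)" by (rule restrict_ext) simp
  ultimately show ?thesis by (simp add: dl_def)
qed

lemma dl_cmult: "regf G \<Longrightarrow> dl (\<lambda>\<sigma>. c * G \<sigma>) = c * dl G"
proof -
  assume r: "regf G"
  have "\<delta> (\<lambda>\<sigma>\<in>carrier (Aut A). c * restrict G AA \<sigma>) = c * dl G"
    using \<delta> r unfolding lie_algebra_def regf_def dl_def by blast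
  moreover have "(\<lambda>\<sigma>\<in>AA. c * restrict G AA \<sigma>) = (\<lambda>\<sigma>\<in>AA. c * G \<sigma>)" by (rule restrict_ext) simp
  ultimately show ?thesis by (simp add: dl_def)
qed

lemma dl_mult: "regf G \<Longrightarrow> regf H \<Longrightarrow> dl (\<lambda>\<sigma>. G \<sigma> * H \<sigma>) = dl G * H (low proj) + G (low proj) * dl H"
proof -
  assume r: "regf G" "regf H"
  have "\<delta> (\<lambda>\<sigma>\<in>carrier (Aut A). restrict G AA \<sigma> * restrict H AA \<sigma>) =
      \<delta> (restrict G AA) * restrict H AA \<one>\<^bsub>Aut A\<^esub> + restrict G AA \<one>\<^bsub>Aut A\<^esub> * \<delta> (restrict H AA)"
    using \<delta> r unfolding lie_algebra_def regf_def by blast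
  moreover have "(\<lambda>\<sigma>\<in>AA. restrict G AA \<sigma> * restrict H AA \<sigma>) = (\<lambda>\<sigma>\<in>AA. G \<sigma> * H \<sigma>)" by (rule restrict_ext) simp
  ultimately show ?thesis using low_proj_AA by (simp add: dl_def Aut_one)
qed

lemma dl_const: "dl (\<lambda>_. c) = 0"
proof -
  have "dl (\<lambda>_. 1 * 1) = dl (\<lambda>_. 1) * 1 + 1 * dl (\<lambda>_. 1)" by (rule dl_mult) simp_all
  then have "dl (\<lambda>_. 1) = dl (\<lambda>_. 1) + dl (\<lambda>_. 1)" by (simp only: mult_1 mult_1_right)
  then have "dl (\<lambda>_. 1) = 0" by (simp only: add_cancel_right_right)
  then show ?thesis using dl_cmult[OF regf_const, of c 1] by simp
qed

lemma dl_sum: "(\<And>x. x \<in> S \<Longrightarrow> regf (G x)) \<Longrightarrow> dl (\<lambda>\<sigma>. \<Sum>x\<in>S. G x \<sigma>) = (\<Sum>x\<in>S. dl (G x))"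
  by (induction S rule: infinite_finite_induct) (auto simp: dl_const dl_add regf_sum)

text \<open>The derivative at the identity in the direction \<open>\<delta>\<close>, taken
  coordinate by coordinate.\<close>

definition dv :: "(('a \<Rightarrow> 'a) \<Rightarrow> 'k coords) \<Rightarrow> 'k coords"
  where "dv Y = (\<lambda>a. dl (\<lambda>\<sigma>. Y \<sigma> a))"

lemma dv_cong: "(\<And>\<sigma>. \<sigma> \<in> AA \<Longrightarrow> Y \<sigma> = Z \<sigma>) \<Longrightarrow> dv Y = dv Z"
  unfolding dv_def by (intro ext dl_cong) simp

lemma dv_const: "dv (\<lambda>_. v) = 0"
  by (rule ext) (simp add: dv_def dl_const zero_fun_apply)

lemma dv_sum: "(\<And>x. x \<in> S \<Longrightarrow> regv (Y x)) \<Longrightarrow> dv (\<lambda>\<sigma>. \<Sum>x\<in>S. Y x \<sigma>) = (\<Sum>x\<in>S. dv (Y x))"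
  by (rule ext) (simp add: dv_def fapply dl_sum regv_def)

lemma dv_diff: "regv Y \<Longrightarrow> regv Z \<Longrightarrow> dv (\<lambda>\<sigma>. Y \<sigma> - Z \<sigma>) = dv Y - dv Z"
proof
  fix a assume r: "regv Y" "regv Z"
  have "dl (\<lambda>\<sigma>. Y \<sigma> a + - 1 * Z \<sigma> a) = dl (\<lambda>\<sigma>. Y \<sigma> a) + - 1 * dl (\<lambda>\<sigma>. Z \<sigma> a)"
    using r regf_mult[OF regf_const, of "\<lambda>\<sigma>. Z \<sigma> a" "- 1"]
    by (subst dl_add) (simp_all only: regv_def dl_cmult)
  then show "dv (\<lambda>\<sigma>. Y \<sigma> - Z \<sigma>) a = (dv Y - dv Z) a" by (simp add: dv_def fapply)
qed

lemma dv_sc: "regf G \<Longrightarrow> regv Y \<Longrightarrow> dv (\<lambda>\<sigma>. sc (G \<sigma>) (Y \<sigma>)) = sc (dl G) (Y (low proj)) + sc (G (low proj)) (dv Y)"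
  by (rule ext) (simp add: dv_def fapply dl_mult regv_def)

lemma dv_mul:
  assumes "regv Y" "regv Z"
  shows "dv (\<lambda>\<sigma>. mul (Y \<sigma>) (Z \<sigma>)) = mul (dv Y) (Z (low proj)) + mul (Y (low proj)) (dv Z)"
proof
  fix c
  have r: "regf (\<lambda>\<sigma>. \<gamma> a b * Y \<sigma> a)" "regf (\<lambda>\<sigma>. Z \<sigma> b)" "regf (\<lambda>\<sigma>. Y \<sigma> a)" for a b
    using assms regf_mult[OF regf_const] by (auto simp: regv_def)
  have r': "regf (\<lambda>\<sigma>. if a + b = c then \<gamma> a b * Y \<sigma> a * Z \<sigma> b else 0)" for a b
    using regf_mult[OF r(1,2)] by (cases "a + b = c") auto
  have *: "dl (\<lambda>\<sigma>. if a + b = c then \<gamma> a b * Y \<sigma> a * Z \<sigma> b else 0) =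
      (if a + b = c then \<gamma> a b * dv Y a * Z (low proj) b else 0) +
      (if a + b = c then \<gamma> a b * Y (low proj) a * dv Z b else 0)" for a b
    by (cases "a + b = c") (simp_all add: dl_const dl_mult[OF r(1,2)] dl_cmult[OF r(3)] dv_def)
  show "dv (\<lambda>\<sigma>. mul (Y \<sigma>) (Z \<sigma>)) c = (mul (dv Y) (Z (low proj)) + mul (Y (low proj)) (dv Z)) c"
  proof (cases "c \<in> M")
    case True
    have "dl (\<lambda>\<sigma>. \<Sum>a\<in>M. \<Sum>b\<in>M. if a + b = c then \<gamma> a b * Y \<sigma> a * Z \<sigma> b else 0) =
      (\<Sum>a\<in>M. \<Sum>b\<in>M. (if a + b = c then \<gamma> a b * dv Y a * Z (low proj) b else 0) +
        (if a + b = c then \<gamma> a b * Y (low proj) a * dv Z b else 0))"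
      by (subst dl_sum, intro regf_sum r', intro sum.cong refl, subst dl_sum, rule r') (simp add: *)
    moreover have "dv (\<lambda>\<sigma>. mul (Y \<sigma>) (Z \<sigma>)) c = dl (\<lambda>\<sigma>. mul (Y \<sigma>) (Z \<sigma>) c)" by (simp only: dv_def)
    ultimately show ?thesis using True by (simp add: mul_def plus_fun_apply sum.distrib)
  next
    case False
    have "dv (\<lambda>\<sigma>. mul (Y \<sigma>) (Z \<sigma>)) c = dl (\<lambda>\<sigma>. mul (Y \<sigma>) (Z \<sigma>) c)" by (simp only: dv_def)
    then show ?thesis using False by (simp add: mul_def plus_fun_apply dl_const)
  qed
qed

lemma up_low_proj: "up (low proj) = proj" "upi (low proj) = proj"
  by (simp_all add: up_low_chom chom_proj_map upi_low[OF inv_pair_proj])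

lemma ytA_proj: "i \<in> {1..n} \<Longrightarrow> ytA (low proj) i = X i"
proof -
  assume i: "i \<in> {1..n}"
  have "(\<Sum>j\<in>{1..n}. sc (X i (ux j)) (X j)) = (\<Sum>j\<in>{1..n}. if j = i then X i else 0)"
    by (rule sum.cong) (auto simp: ev_def dest: ux_inj)
  then show ?thesis using i by (simp add: ytA_def up_low_proj ytup_def proj_VM)
qed

text \<open>At the identity the tuple is \<open>(x_i)\<close>, already normalised, so each
  correction \<open>a\<close> vanishes there. To first order a step therefore subtracts the
  commutator of \<open>dv a\<close> with \<open>x_i\<close>.\<close>

lemma dv_normalise:
  "\<exists>b. \<forall>i\<in>{1..n}. dv (\<lambda>\<sigma>. normalise k (ytA \<sigma>) i) = dv (\<lambda>\<sigma>. ytA \<sigma> i) - ad b (X i)"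
proof (induction k)
  case 0
  have "ad 0 v = 0" for v by (simp add: ad_def)
  then show ?case by (intro exI[of _ 0]) simp
next
  case (Suc k)
  then obtain b where b: "\<And>i. i \<in> {1..n} \<Longrightarrow> dv (\<lambda>\<sigma>. normalise k (ytA \<sigma>) i) = dv (\<lambda>\<sigma>. ytA \<sigma> i) - ad b (X i)" by blast
  define a where "a = stepA k"
  have ra: "regv a" using regv_normalise[of "Suc k"] by (simp add: a_def)
  have a0: "a (low proj) = 0"
  proof -
    have "tup (Suc k + 1) (normalise k (ytA (low proj))) = 0"
    proof
      fix x :: "nat \<times> (nat \<Rightarrow> nat)"
      obtain j c where x: "x = (j, c)" by (cases x)
      have "hp (Suc k + 1) (X j) = 0" if "j \<in> {1..n}"
        using that by (simp add: hp_X_zero)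
      then show "tup (Suc k + 1) (normalise k (ytA (low proj))) x = 0 x"
        using normalise_X[OF ytA_proj] by (simp add: x tup_def zero_fun_apply)
    qed
    then show ?thesis by (simp add: a_def stepA_def lin_0[OF alp(2)])
  qed
  have "dv (\<lambda>\<sigma>. normalise (Suc k) (ytA \<sigma>) i) = dv (\<lambda>\<sigma>. ytA \<sigma> i) - ad (b + dv a) (X i)" if i: "i \<in> {1..n}" for i
  proof -
    define y where "y \<sigma> = normalise k (ytA \<sigma>) i" for \<sigma>
    define z where "z \<sigma> = normalise (Suc k) (ytA \<sigma>) i" for \<sigma>
    have ry: "regv y" and rz: "regv z"
      using regv_normalise[of k] regv_normalise[of "Suc k"] i unfolding y_def[abs_def] z_def[abs_def] by blast+
    have y0: "y (low proj) = X i" and z0: "z (low proj) = X i"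
      using normalise_X[OF ytA_proj i] by (simp_all add: y_def z_def del: normalise.simps)
    have VMs: "y \<sigma> \<in> VM" "z \<sigma> \<in> VM" if "\<sigma> \<in> AA" for \<sigma>
      using normalise_props(1)[OF ytA_tuples[OF that]] i unfolding tuples_def y_def z_def by blast+
    \<comment> \<open>Multiplying by 1 - a clears the inverse, so the product rule applies without
      differentiating \<open>geo\<close>.\<close>
    have "mul (z \<sigma>) (un - a \<sigma>) = mul (un - a \<sigma>) (y \<sigma>)" if \<sigma>: "\<sigma> \<in> AA" for \<sigma>
    proof -
      have "a \<sigma> \<in> F 1" unfolding a_def stepA_def using F_mono[OF _ homog_F[OF alp(1)], of 1 "Suc k"] by simp
      then have "mul (geo (a \<sigma>)) (un - a \<sigma>) = un" by (rule geo_mul_one_minus)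
      moreover have "z \<sigma> = mul (mul (un - a \<sigma>) (y \<sigma>)) (geo (a \<sigma>))"
        unfolding z_def y_def a_def normalise_stepA cj_def ..
      ultimately show ?thesis by (simp add: mul_assoc mul_un)
    qed
    then have e: "dv (\<lambda>\<sigma>. mul (z \<sigma>) (un - a \<sigma>)) = dv (\<lambda>\<sigma>. mul (un - a \<sigma>) (y \<sigma>))" by (rule dv_cong)
    have r1: "regv (\<lambda>\<sigma>. un - a \<sigma>)" by (intro regv_diff regv_const ra)
    have d1: "dv (\<lambda>\<sigma>. un - a \<sigma>) = - dv a" using dv_diff[OF regv_const ra, of un] by (simp add: dv_const)
    have "proj (dv z) - mul (X i) (dv a) = proj (dv y) - mul (dv a) (X i)"
      using e[unfolded dv_mul[OF rz r1] dv_mul[OF r1 ry] d1 y0 z0 a0] by (simp add: mul_distribs mul_un un_mul)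
    moreover have "proj (dv y) = dv y" "proj (dv z) = dv z"
    proof -
      have "dv w = proj (dv w)" if "\<And>\<sigma>. \<sigma> \<in> AA \<Longrightarrow> w \<sigma> \<in> VM" for w
      proof
        fix c
        show "dv w c = proj (dv w) c"
        proof (cases "c \<in> M")
          case False
          then have "dv w c = dl (\<lambda>_. 0)" unfolding dv_def using that by (intro dl_cong) (simp add: VM_def)
          then show ?thesis using False by (simp add: dl_const proj_def)
        qed (simp add: proj_def)
      qed
      then show "proj (dv y) = dv y" "proj (dv z) = dv z" using VMs by metis+
    qed
    ultimately have "dv z = dv y - ad (dv a) (X i)" by (simp add: ad_def algebra_simps)
    then have "dv z = dv (\<lambda>\<sigma>. ytA \<sigma> i) - ad b (X i) - ad (dv a) (X i)" using b[OF i] by (simp add: y_def[abs_def])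
    then show ?thesis unfolding z_def[abs_def] lin_add[OF lin_ad_left] by (simp only: diff_diff_eq)
  qed
  then show ?case by blast
qed

text \<open>The differential of \<open>Aut(A) \<rightarrow> Out(A)\<close> has kernel \<open>Inn\<close>: the sliced coordinates and the linear part
  are regular functions on \<open>Out(A)\<close> which separate tangent directions modulo inner derivations.\<close>

lemma inner_if_kills_invariants:
  assumes f: "cder f" and df: "\<And>v. v \<in> VM \<Longrightarrow> dv (\<lambda>\<sigma>. up \<sigma> v) = f v"
    and kill: "\<And>i a. i \<in> {1..n} \<Longrightarrow> dl (\<lambda>\<sigma>. sliced (up \<sigma>) (upi \<sigma>) i a) = 0"
    and kill_linear: "\<And>i j. i \<in> {1..n} \<Longrightarrow> j \<in> {1..n} \<Longrightarrow> dl (\<lambda>\<sigma>. up \<sigma> (X i) (ux j)) = 0"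
  shows "f \<in> cInn"
proof -
  obtain b where b: "\<And>i. i \<in> {1..n} \<Longrightarrow> dv (\<lambda>\<sigma>. normalise Dmax (ytA \<sigma>) i) = dv (\<lambda>\<sigma>. ytA \<sigma> i) - ad b (X i)"
    using dv_normalise by blast
  have "f (X i) = ad b (X i)" if i: "i \<in> {1..n}" for i
  proof -
    define d where "d j = dl (\<lambda>\<sigma>. upi \<sigma> (X i) (ux j))" for j
    have "dv (\<lambda>\<sigma>. normalise Dmax (ytA \<sigma>) i) = 0"
      using kill[OF i] by (intro ext) (simp add: dv_def zero_fun_apply sliced_def ytA_def)
    then have 1: "dv (\<lambda>\<sigma>. ytA \<sigma> i) = ad b (X i)" using b[OF i] by simp
    have "dv (\<lambda>\<sigma>. ytA \<sigma> i) = (\<Sum>j\<in>{1..n}. dv (\<lambda>\<sigma>. sc (upi \<sigma> (X i) (ux j)) (up \<sigma> (X j))))"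
      unfolding ytA_def ytup_def by (rule dv_sum) (intro regv_sc regf_upi regv_up)
    also have "\<dots> = (\<Sum>j\<in>{1..n}. sc (d j) (X j) + (if j = i then f (X i) else 0))"
    proof (rule sum.cong)
      fix j assume j: "j \<in> {1..n}"
      have "dv (\<lambda>\<sigma>. sc (upi \<sigma> (X i) (ux j)) (up \<sigma> (X j))) = sc (d j) (X j) + sc (X i (ux j)) (f (X j))"
        using i j df[of "X j"] by (simp add: dv_sc[OF regf_upi regv_up] up_low_proj proj_VM d_def)
      also have "sc (X i (ux j)) (f (X j)) = (if j = i then f (X i) else 0)"
        by (auto simp: ev_def dest: ux_inj)
      finally show "dv (\<lambda>\<sigma>. sc (upi \<sigma> (X i) (ux j)) (up \<sigma> (X j))) = sc (d j) (X j) + (if j = i then f (X i) else 0)" .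
    qed simp
    also have "\<dots> = (\<Sum>j\<in>{1..n}. sc (d j) (X j)) + f (X i)"
      using i by (simp add: sum.distrib)
    finally have 2: "(\<Sum>j\<in>{1..n}. sc (d j) (X j)) + f (X i) = ad b (X i)" using 1 by simp
    \<comment> \<open>Compare coefficients of \<open>x_l\<close>: \<open>f (X i)\<close> has none
      because the linear coefficients are killed, and a commutator with \<open>x_i\<close> lies in
      J^2.\<close>
    have "d l = 0" if l: "l \<in> {1..n}" for l
    proof -
      have "f (X i) (ux l) = 0"
        using kill_linear[OF i l] df[of "X i"] i by (simp add: dv_def fun_eq_iff)
      moreover have "ad b (X i) (ux l) = 0"
        using F_2_ux[OF _ l, of "ad b (X i)"] ad_F[OF F_X[OF i], of b] by simp
      moreover have "(\<Sum>j\<in>{1..n}. sc (d j) (X j)) (ux l) = (\<Sum>j\<in>{1..n}. if j = l then d l else 0)"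
        unfolding sum_fun_apply by (rule sum.cong) (auto simp: sc_apply ev_def dest: ux_inj)
      ultimately show ?thesis using fun_cong[OF 2, of "ux l"] l by (simp add: plus_fun_apply)
    qed
    then have "(\<Sum>j\<in>{1..n}. sc (d j) (X j)) = 0" by simp
    then show ?thesis using 2 by simp
  qed
  then have "f = ad b" by (rule cder_eqI[OF f cder_ad])
  then show ?thesis by (simp add: cInn_def)
qed

end

end

section \<open>Auxiliary facts on groups, diagonal matrices and point derivations\<close>

lemma group_cong:
  assumes "group G" "carrier H = carrier G" "mult H = mult G" "one H = one G"
  shows "group H"
  using assms unfolding group_def group_axioms_def Group.monoid_def Units_def by simp

lemma det_diagonal_mat:
  assumes "M \<in> carrier_mat r r" "diagonal_mat M"
  shows "det M = (\<Prod>i<r. M $$ (i, i))"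
proof -
  have "upper_triangular M" using assms by (auto simp: diagonal_mat_def upper_triangular_def)
  then have "det M = prod_list (diag_mat M)" using det_upper_triangular assms by blast
  also have "\<dots> = (\<Prod>i\<leftarrow>[0..<r]. M $$ (i, i))" using assms by (simp add: diag_mat_def)
  also have "\<dots> = (\<Prod>i<r. M $$ (i, i))"
    by (simp add: prod.distinct_set_conv_list[symmetric] atLeast0LessThan)
  finally show ?thesis .
qed

lemma det_invertible_mat:
  fixes M :: "'a::field mat"
  assumes M: "M \<in> carrier_mat r r" "invertible_mat M"
  shows "det M \<noteq> 0"
proof -
  obtain N where N: "M * N = 1\<^sub>m r" "N * M = 1\<^sub>m (dim_row N)"
    using M by (auto simp: invertible_mat_def inverts_mat_def)
  then have "N \<in> carrier_mat r r"
    using M(1) by (metis carrier_matI carrier_matD(2) index_mult_mat(3) index_one_mat(3))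
  then have "det M * det N = 1" using det_mult[OF M(1)] N(1) by (metis det_one)
  then show ?thesis by auto
qed

lemma generated_functions_extensional: "f \<in> generated_functions X S \<Longrightarrow> f \<in> extensional X"
  by (induction rule: generated_functions.induct) (rule restrict_extensional)+

lemma lie_algebra_sum:
  assumes cmult: "\<And>f c. f \<in> regular G \<Longrightarrow> (\<lambda>x\<in>carrier G. c * f x) \<in> regular G"
    and add: "\<And>f g. f \<in> regular G \<Longrightarrow> g \<in> regular G \<Longrightarrow> (\<lambda>x\<in>carrier G. f x + g x) \<in> regular G"
    and mult: "\<And>f g. f \<in> regular G \<Longrightarrow> g \<in> regular G \<Longrightarrow> (\<lambda>x\<in>carrier G. f x * g x) \<in> regular G"
    and \<delta>: "\<And>i. i \<in> I \<Longrightarrow> \<delta> i \<in> lie_algebra G"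
  shows "(\<lambda>f\<in>regular G. \<Sum>i\<in>I. c i * \<delta> i f) \<in> lie_algebra G"
  unfolding lie_algebra_def
proof (intro CollectI IntI conjI allI ballI)
  have \<delta>1: "\<delta> i (\<lambda>x\<in>carrier G. b * f x) = b * \<delta> i f" if "i \<in> I" "f \<in> regular G" for i b f
    using \<delta>[OF that(1)] that(2) unfolding lie_algebra_def by blast
  have \<delta>2: "\<delta> i (\<lambda>x\<in>carrier G. f x + g x) = \<delta> i f + \<delta> i g"
      "\<delta> i (\<lambda>x\<in>carrier G. f x * g x) = \<delta> i f * g \<one>\<^bsub>G\<^esub> + f \<one>\<^bsub>G\<^esub> * \<delta> i g"
    if "i \<in> I" "f \<in> regular G" "g \<in> regular G" for i f g
    using \<delta>[OF that(1)] that(2,3) unfolding lie_algebra_def by blast+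
  let ?d = "\<lambda>f\<in>regular G. \<Sum>i\<in>I. c i * \<delta> i f"
  show "?d (\<lambda>x\<in>carrier G. b * f x) = b * ?d f" if "f \<in> regular G" for b f
    using that \<delta>1 cmult by (simp add: sum_distrib_left mult.left_commute)
  fix f g assume fg: "f \<in> regular G" "g \<in> regular G"
  show "?d (\<lambda>x\<in>carrier G. f x + g x) = ?d f + ?d g"
    using fg \<delta>2(1) add by (simp add: distrib_left sum.distrib)
  show "?d (\<lambda>x\<in>carrier G. f x * g x) = ?d f * g \<one>\<^bsub>G\<^esub> + f \<one>\<^bsub>G\<^esub> * ?d g"
    using fg \<delta>2(2) mult
    by (simp add: distrib_left sum.distrib sum_distrib_left sum_distrib_right mult.assoc mult.left_commute)
qed (rule restrict_extensional)

context qalg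
begin

subsection \<open>The group of outer automorphisms\<close>

lemma Out_simps:
  "carrier (Out A) = carrier (Aut A Mod inner_automorphisms A)"
  "mult (Out A) = mult (Aut A Mod inner_automorphisms A)"
  "one (Out A) = one (Aut A Mod inner_automorphisms A)"
  by (simp_all add: Out_def Let_def)

lemma Out_carrier: "carrier (Out A) = out_class A ` AA"
  by (auto simp: Out_simps FactGroup_def RCOSETS_def out_class_def)

lemma group_Out: "group (Out A)"
  by (rule group_cong[OF normal.factorgroup_is_group[OF inner_normal]]) (simp_all add: Out_simps)

lemma inner_subgroup: "subgroup (inner_automorphisms A) (Aut A)"
  by (rule normal_imp_subgroup[OF inner_normal])

lemma Out_mult:
  assumes "\<sigma> \<in> AA" "\<tau> \<in> AA"
  shows "out_class A \<sigma> \<otimes>\<^bsub>Out A\<^esub> out_class A \<tau> = out_class A (\<sigma> \<otimes>\<^bsub>Aut A\<^esub> \<tau>)"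
  using normal.rcos_sum[OF inner_normal] assms by (simp add: Out_simps FactGroup_def out_class_def)

lemma Out_one: "\<one>\<^bsub>Out A\<^esub> = out_class A (low proj)"
  using group.coset_mult_one[OF group_Aut subgroup.subset[OF inner_subgroup]]
  by (simp add: Out_simps FactGroup_def out_class_def Aut_one)

lemma Aut_mult_up: "\<sigma> \<in> AA \<Longrightarrow> \<tau> \<in> AA \<Longrightarrow> \<sigma> \<otimes>\<^bsub>Aut A\<^esub> \<tau> = low (\<lambda>v. up \<sigma> (up \<tau> v))"
  using Aut_mult[OF AA_up(1) AA_up(1), of \<sigma> \<tau>] AA_up(2) by metis

lemma Aut_mult_closed: "\<sigma> \<in> AA \<Longrightarrow> \<tau> \<in> AA \<Longrightarrow> \<sigma> \<otimes>\<^bsub>Aut A\<^esub> \<tau> \<in> AA"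
  using group.is_monoid[OF group_Aut] monoid.m_closed by fastforce

lemma up_chom: "\<sigma> \<in> AA \<Longrightarrow> chom (up \<sigma>)"
  using AA_up(1) inv_pair_chom by blast

lemma up_mult: "\<sigma> \<in> AA \<Longrightarrow> \<tau> \<in> AA \<Longrightarrow> up (\<sigma> \<otimes>\<^bsub>Aut A\<^esub> \<tau>) = (\<lambda>v. up \<sigma> (up \<tau> v))"
  by (simp add: Aut_mult_up up_low_chom chom_comp up_chom)

lemma out_class_eq_iff:
  assumes \<sigma>: "\<sigma> \<in> AA" and \<tau>: "\<tau> \<in> AA"
  shows "out_class A \<sigma> = out_class A \<tau> \<longleftrightarrow> (\<exists>f\<in>cinner. up \<sigma> = (\<lambda>v. f (up \<tau> v)))"
proof
  assume "out_class A \<sigma> = out_class A \<tau>"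
  moreover have "\<sigma> \<in> out_class A \<sigma>"
    unfolding out_class_def using group.rcos_self[OF group_Aut _ inner_subgroup] \<sigma> by simp
  ultimately obtain f where f: "f \<in> cinner" "\<sigma> = low f \<otimes>\<^bsub>Aut A\<^esub> \<tau>"
    by (auto simp: out_class_def r_coset_def inner_automorphisms_eq)
  then have "up \<sigma> = (\<lambda>v. f (up \<tau> v))"
    using up_mult[OF inner_AA[OF f(1)] \<tau>] by (simp add: up_low_chom cinner_chom)
  then show "\<exists>f\<in>cinner. up \<sigma> = (\<lambda>v. f (up \<tau> v))" using f(1) by blast
next
  assume "\<exists>f\<in>cinner. up \<sigma> = (\<lambda>v. f (up \<tau> v))"
  then obtain f where f: "f \<in> cinner" "up \<sigma> = (\<lambda>v. f (up \<tau> v))" by blast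
  have "\<sigma> = low (up \<sigma>)" using AA_up(2)[OF \<sigma>] by simp
  also have "\<dots> = low f \<otimes>\<^bsub>Aut A\<^esub> \<tau>"
    using Aut_mult_up[OF inner_AA[OF f(1)] \<tau>] f by (simp add: up_low_chom cinner_chom)
  finally have "\<sigma> = low f \<otimes>\<^bsub>Aut A\<^esub> \<tau>" .
  then have "\<sigma> \<in> out_class A \<tau>"
    unfolding out_class_def r_coset_def inner_automorphisms_eq using f(1) by blast
  then show "out_class A \<sigma> = out_class A \<tau>"
    using group.repr_independence[OF group_Aut _ _ inner_subgroup, of \<sigma> \<tau>] \<tau> by (simp add: out_class_def)
qed

lemma out_class_one_iff:
  assumes "\<sigma> \<in> AA"
  shows "out_class A \<sigma> = \<one>\<^bsub>Out A\<^esub> \<longleftrightarrow> up \<sigma> \<in> cinner"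
proof -
  have "(\<lambda>v. f (proj v)) = f" if "f \<in> cinner" for f using chom_proj[OF cinner_chom[OF that]] by auto
  then show ?thesis
    using out_class_eq_iff[OF assms low_AA[OF inv_pair_proj]]
    by (auto simp: Out_one up_low_chom chom_proj_map)
qed

definition invf :: "(('a \<Rightarrow> 'a) \<Rightarrow> 'k) \<Rightarrow> bool"
  where "invf G \<longleftrightarrow> regf G \<and> (\<forall>\<sigma>\<in>AA. \<forall>\<tau>\<in>AA. out_class A \<sigma> = out_class A \<tau> \<longrightarrow> G \<sigma> = G \<tau>)"

text \<open>The function induced on \<open>Out\<close> by an invariant \<open>G\<close>;
  \<open>invf G\<close> makes the choice of representative harmless.\<close>

definition outf :: "(('a \<Rightarrow> 'a) \<Rightarrow> 'k) \<Rightarrow> ('a \<Rightarrow> 'a) set \<Rightarrow> 'k"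
  where "outf G = (\<lambda>c\<in>carrier (Out A). G (SOME \<sigma>. \<sigma> \<in> AA \<and> out_class A \<sigma> = c))"

lemma outf_out_class: "invf G \<Longrightarrow> \<sigma> \<in> AA \<Longrightarrow> outf G (out_class A \<sigma>) = G \<sigma>"
proof -
  assume G: "invf G" and \<sigma>: "\<sigma> \<in> AA"
  then have "\<exists>\<tau>. \<tau> \<in> AA \<and> out_class A \<tau> = out_class A \<sigma>" by blast
  from someI_ex[OF this] have "G (SOME \<tau>. \<tau> \<in> AA \<and> out_class A \<tau> = out_class A \<sigma>) = G \<sigma>"
    using G \<sigma> unfolding invf_def by blast
  moreover have "out_class A \<sigma> \<in> carrier (Out A)" using \<sigma> by (simp add: Out_carrier)
  ultimately show ?thesis by (simp only: outf_def restrict_apply')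
qed

lemma Out_regular_iff:
  "f \<in> regular (Out A) \<longleftrightarrow> f \<in> extensional (carrier (Out A)) \<and> regf (\<lambda>\<sigma>. f (out_class A \<sigma>))"
  by (simp add: Out_def Let_def regf_def compose_def)

lemma outf_regular:
  assumes G: "invf G"
  shows "outf G \<in> regular (Out A)"
proof -
  have "regf (\<lambda>\<sigma>. outf G (out_class A \<sigma>)) \<longleftrightarrow> regf G"
    by (rule regf_cong) (rule outf_out_class[OF G])
  moreover have "regf G" using G by (simp only: invf_def)
  moreover have "outf G \<in> extensional (carrier (Out A))" unfolding outf_def by (rule restrict_extensional)
  ultimately show ?thesis unfolding Out_regular_iff by blast
qed

lemma upi_inner:
  assumes \<sigma>: "\<sigma> \<in> AA" and \<tau>: "\<tau> \<in> AA" and e: "out_class A \<sigma> = out_class A \<tau>"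
  shows "\<exists>f\<in>cinner. \<exists>f'\<in>cinner. inv_pair f f' \<and> up \<sigma> = (\<lambda>v. f (up \<tau> v)) \<and> upi \<sigma> = (\<lambda>v. upi \<tau> (f' v))"
proof -
  obtain f where f: "f \<in> cinner" "up \<sigma> = (\<lambda>v. f (up \<tau> v))" using out_class_eq_iff[OF \<sigma> \<tau>] e by blast
  obtain f' where f': "f' \<in> cinner" "inv_pair f f'" using cinner_inv_pair[OF f(1)] by blast
  have "inv_pair (up \<sigma>) (\<lambda>v. upi \<tau> (f' v))"
    unfolding f(2) by (rule inv_pair_comp[OF f'(2) AA_up(1)[OF \<tau>]])
  then have "upi \<sigma> = (\<lambda>v. upi \<tau> (f' v))" using inv_pair_unique[OF AA_up(1)[OF \<sigma>]] by blast
  then show ?thesis using f f' by blast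
qed

lemma invf_sliced:
  assumes i: "i \<in> {1..n}"
  shows "invf (\<lambda>\<sigma>. sliced (up \<sigma>) (upi \<sigma>) i a)"
  unfolding invf_def
proof (intro conjI ballI impI)
  show "regf (\<lambda>\<sigma>. sliced (up \<sigma>) (upi \<sigma>) i a)"
    using regv_normalise[of Dmax] i unfolding sliced_def ytA_def[symmetric] regv_def by blast
  fix \<sigma> \<tau> assume st: "\<sigma> \<in> AA" "\<tau> \<in> AA" "out_class A \<sigma> = out_class A \<tau>"
  then obtain f f' where "f \<in> cinner" "f' \<in> cinner" "inv_pair f f'" "up \<sigma> = (\<lambda>v. f (up \<tau> v))" "upi \<sigma> = (\<lambda>v. upi \<tau> (f' v))"
    using upi_inner by blast
  then show "sliced (up \<sigma>) (upi \<sigma>) i a = sliced (up \<tau>) (upi \<tau>) i a"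
    using sliced_inner[OF AA_up(1)[OF st(2)] _ _ _ i] by simp
qed

lemma invf_up:
  assumes "i \<in> {1..n}" "j \<in> {1..n}"
  shows "invf (\<lambda>\<sigma>. up \<sigma> (X i) (ux j))"
  unfolding invf_def
proof (intro conjI ballI impI)
  fix \<sigma> \<tau> assume st: "\<sigma> \<in> AA" "\<tau> \<in> AA" "out_class A \<sigma> = out_class A \<tau>"
  then obtain f where "f \<in> cinner" "up \<sigma> = (\<lambda>v. f (up \<tau> v))" using out_class_eq_iff by blast
  then show "up \<sigma> (X i) (ux j) = up \<tau> (X i) (ux j)"
    using linear_coeff_inner_left[OF up_chom[OF st(2)] _ assms] by simp
qed (rule regf_up)

lemma invf_upi:
  assumes "i \<in> {1..n}" "j \<in> {1..n}"
  shows "invf (\<lambda>\<sigma>. upi \<sigma> (X i) (ux j))"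
  unfolding invf_def
proof (intro conjI ballI impI)
  fix \<sigma> \<tau> assume st: "\<sigma> \<in> AA" "\<tau> \<in> AA" "out_class A \<sigma> = out_class A \<tau>"
  then obtain f' where "f' \<in> cinner" "upi \<sigma> = (\<lambda>v. upi \<tau> (f' v))" using upi_inner by blast
  then show "upi \<sigma> (X i) (ux j) = upi \<tau> (X i) (ux j)"
    using linear_coeff_inner_right[OF inv_pair_chom(2)[OF AA_up(1)[OF st(2)]] _ assms] by simp
qed (rule regf_upi)

lemma tangent_dv:
  assumes "tangent_derivation A \<delta> D"
  shows "dv \<delta> (\<lambda>\<sigma>. up \<sigma> v) = up D v"
proof
  fix a
  have \<delta>: "\<delta> \<in> lie_algebra (Aut A)" and D: "D \<in> derivations A" using assms by (auto simp: tangent_derivation_def)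
  define l where "l = (\<lambda>x\<in>carrier A. co x a)"
  have "l \<in> dual_space A" unfolding l_def by (rule coordinate_dual)
  then have "\<delta> (\<lambda>\<sigma>\<in>carrier (Aut A). l (\<sigma> (ve (proj v)))) = l (D (ve (proj v)))"
    using assms by (simp add: tangent_derivation_def)
  moreover have "D (ve (proj v)) \<in> carrier A"
    using D by (auto simp: derivations_def LinearCombinations.module_hom_def)
  moreover have "(\<lambda>\<sigma>\<in>AA. l (\<sigma> (ve (proj v)))) = (\<lambda>\<sigma>\<in>AA. up \<sigma> v a)"
  proof (rule restrict_ext)
    fix \<sigma> assume "\<sigma> \<in> AA"
    then have "\<sigma> (ve (proj v)) \<in> carrier A" by (auto simp: automorphisms_def LinearCombinations.module_hom_def)
    then show "l (\<sigma> (ve (proj v))) = up \<sigma> v a" by (simp add: l_def up_def)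
  qed
  ultimately have "\<delta> (\<lambda>\<sigma>\<in>AA. up \<sigma> v a) = l (D (ve (proj v)))" by simp
  also have "\<dots> = co (D (ve (proj v))) a" unfolding l_def by (rule restrict_apply') fact
  finally have "\<delta> (\<lambda>\<sigma>\<in>AA. up \<sigma> v a) = co (D (ve (proj v))) a" .
  then show "dv \<delta> (\<lambda>\<sigma>. up \<sigma> v) a = up D v a" unfolding dv_def[OF \<delta>] dl_def[OF \<delta>] by (simp only: up_def)
qed

text \<open>Invariant functions descend to \<open>Out\<close>, so a vanishing differential kills the
  slice coordinates and the linear coefficients.\<close>

lemma out_differential_zero_imp_inner:
  assumes t: "tangent_derivation A \<delta> D" and z: "\<And>f. f \<in> regular (Out A) \<Longrightarrow> out_differential A \<delta> f = 0"
  shows "up D \<in> cInn"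
proof -
  have \<delta>: "\<delta> \<in> lie_algebra (Aut A)" and D: "D \<in> derivations A" using t by (auto simp: tangent_derivation_def)
  have kill: "dl \<delta> G = 0" if G: "invf G" for G
  proof -
    have "out_differential A \<delta> (outf G) = \<delta> (\<lambda>\<sigma>\<in>AA. outf G (out_class A \<sigma>))"
      using outf_regular[OF G] by (simp add: out_differential_def compose_def)
    also have "(\<lambda>\<sigma>\<in>AA. outf G (out_class A \<sigma>)) = restrict G AA"
      by (rule restrict_ext) (simp add: outf_out_class[OF G])
    finally show ?thesis using z[OF outf_regular[OF G]] unfolding dl_def[OF \<delta>] by metis
  qed
  show ?thesis
    by (rule inner_if_kills_invariants[OF \<delta> up_derivations(1)[OF D] tangent_dv[OF t]])
      (intro kill invf_sliced invf_up; assumption)+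
qed

lemma regular_Out_const: "(\<lambda>x\<in>carrier (Out A). c) \<in> regular (Out A)"
  using regf_cong[of "\<lambda>\<sigma>. (\<lambda>x\<in>carrier (Out A). c) (out_class A \<sigma>)" "\<lambda>_. c"]
  by (auto simp: Out_regular_iff Out_carrier)

lemma regular_Out_add:
  "f \<in> regular (Out A) \<Longrightarrow> g \<in> regular (Out A) \<Longrightarrow> (\<lambda>x\<in>carrier (Out A). f x + g x) \<in> regular (Out A)"
  using regf_cong[of "\<lambda>\<sigma>. (\<lambda>x\<in>carrier (Out A). f x + g x) (out_class A \<sigma>)" "\<lambda>\<sigma>. f (out_class A \<sigma>) + g (out_class A \<sigma>)"]
  by (auto simp: Out_regular_iff Out_carrier regf_add)

lemma regular_Out_mult:
  "f \<in> regular (Out A) \<Longrightarrow> g \<in> regular (Out A) \<Longrightarrow> (\<lambda>x\<in>carrier (Out A). f x * g x) \<in> regular (Out A)"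
  using regf_cong[of "\<lambda>\<sigma>. (\<lambda>x\<in>carrier (Out A). f x * g x) (out_class A \<sigma>)" "\<lambda>\<sigma>. f (out_class A \<sigma>) * g (out_class A \<sigma>)"]
  by (auto simp: Out_regular_iff Out_carrier regf_mult)

lemma regular_Out_cmult:
  "f \<in> regular (Out A) \<Longrightarrow> (\<lambda>x\<in>carrier (Out A). c * f x) \<in> regular (Out A)"
  using regf_cong[of "\<lambda>\<sigma>. (\<lambda>x\<in>carrier (Out A). c * f x) (out_class A \<sigma>)" "\<lambda>\<sigma>. c * f (out_class A \<sigma>)"]
  by (auto simp: Out_regular_iff Out_carrier intro: regf_mult[OF regf_const])

subsection \<open>Point derivations on tori\<close>

context
  fixes H :: "('a \<Rightarrow> 'a) set set" and r :: nat and \<phi> :: "('a \<Rightarrow> 'a) set \<Rightarrow> 'k mat"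
  assumes H: "subgroup H (Out A)"
    and \<phi>: "\<phi> \<in> iso (alg_subgroup (Out A) H) (diagonal_group r)"
    and reg: "\<And>f. f \<in> extensional (carrier (diagonal_group r)) \<Longrightarrow>
      f \<in> regular (diagonal_group r) \<longleftrightarrow> compose H f \<phi> \<in> (\<lambda>f. restrict f H) ` regular (Out A)"
begin

abbreviation DG :: "'k mat set"
  where "DG \<equiv> carrier (diagonal_group r)"

lemma DG: "DG = {M \<in> carrier_mat r r. diagonal_mat M \<and> invertible_mat M}"
  by (simp add: diagonal_group_def Let_def)

lemma phi_bij: "bij_betw \<phi> H DG"
  using \<phi> by (simp add: iso_def alg_subgroup_def)

lemma phi_mult: "x \<in> H \<Longrightarrow> y \<in> H \<Longrightarrow> \<phi> (x \<otimes>\<^bsub>Out A\<^esub> y) = \<phi> x * \<phi> y"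
  using \<phi> by (simp add: iso_def hom_def alg_subgroup_def diagonal_group_def Let_def)

lemma phi_DG: "x \<in> H \<Longrightarrow> \<phi> x \<in> DG"
  using phi_bij by (auto dest: bij_betw_apply)

text \<open>Regular functions on \<open>H\<close> are restrictions from \<open>Out\<close>, so the
  coordinates of the diagonal group extend to functions on all of \<open>Out\<close>.\<close>

lemma regular_lift:
  assumes "g \<in> regular (diagonal_group r)"
  shows "\<exists>f\<in>regular (Out A). \<forall>x\<in>H. f x = g (\<phi> x)"
proof -
  have "g \<in> extensional DG"
    using assms generated_functions_extensional by (force simp: diagonal_group_def Let_def)
  then have "compose H g \<phi> \<in> (\<lambda>f. restrict f H) ` regular (Out A)" using reg assms by blast
  then obtain f where f: "f \<in> regular (Out A)" "compose H g \<phi> = restrict f H" by blast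
  have "f x = g (\<phi> x)" if "x \<in> H" for x
    using fun_cong[OF f(2), of x] that by (simp add: compose_def)
  then show ?thesis using f(1) by blast
qed

lemma regular_push:
  assumes "f \<in> regular (Out A)"
  shows "(\<lambda>M\<in>DG. f (inv_into H \<phi> M)) \<in> regular (diagonal_group r)"
proof -
  have "compose H (\<lambda>M\<in>DG. f (inv_into H \<phi> M)) \<phi> = restrict f H"
    unfolding compose_def using phi_DG bij_betw_inv_into_left[OF phi_bij] by (intro restrict_ext) simp
  then have "compose H (\<lambda>M\<in>DG. f (inv_into H \<phi> M)) \<phi> \<in> (\<lambda>f. restrict f H) ` regular (Out A)"
    using assms by (metis image_eqI)
  moreover have "(\<lambda>M\<in>DG. f (inv_into H \<phi> M)) \<in> extensional DG" by simp
  ultimately show ?thesis using reg by blast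
qed

lemma diagonal_regular:
  "regular (diagonal_group r) = generated_functions DG
    ({\<lambda>M. M $$ (i, j) | i j. i < r \<and> j < r} \<union> {\<lambda>M. inverse (det M)})"
  by (simp add: diagonal_group_def Let_def)

lemma ex_diag_lift: "\<exists>Fd. \<forall>j<r. Fd j \<in> regular (Out A) \<and> (\<forall>x\<in>H. Fd j x = \<phi> x $$ (j, j))"
proof -
  have "\<exists>f\<in>regular (Out A). \<forall>x\<in>H. f x = \<phi> x $$ (j, j)" if "j < r" for j
  proof -
    have "restrict (\<lambda>M. M $$ (j, j)) DG \<in> regular (diagonal_group r)"
      unfolding diagonal_regular by (rule generated_functions.gen) (use that in blast)
    from regular_lift[OF this] show ?thesis using phi_DG by auto
  qed
  then show ?thesis by metis
qed

text \<open>A point derivation tangent to \<open>H\<close> sees only values on \<open>H\<close> and,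
  by the product rule, only generators of the coordinate ring. Off-diagonal entries vanish on
  \<open>H\<close>, and the inverse determinant is controlled by its product with the determinant.
  So r numbers determine a tangent vector.\<close>

lemma lie_vanishing:
  assumes d: "d \<in> lie_subalgebra_of (Out A) H"
    and Fd: "\<And>j. j < r \<Longrightarrow> Fd j \<in> regular (Out A)" "\<And>j x. j < r \<Longrightarrow> x \<in> H \<Longrightarrow> Fd j x = \<phi> x $$ (j, j)"
      "\<And>j. j < r \<Longrightarrow> d (Fd j) = 0"
    and f: "f \<in> regular (Out A)"
  shows "d f = 0"
proof -
  let ?C = "carrier (Out A)" and ?R = "regular (Out A)"
  have dadd: "d (\<lambda>x\<in>?C. f x + g x) = d f + d g" and dmult: "d (\<lambda>x\<in>?C. f x * g x) = d f * g \<one>\<^bsub>Out A\<^esub> + f \<one>\<^bsub>Out A\<^esub> * d g"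
    if "f \<in> ?R" "g \<in> ?R" for f g
    using d that unfolding lie_subalgebra_of_def lie_algebra_def by blast+
  have dsc: "d (\<lambda>x\<in>?C. c * f x) = c * d f" if "f \<in> ?R" for f c
    using d that unfolding lie_subalgebra_of_def lie_algebra_def by blast
  have dvan: "d f = 0" if "f \<in> ?R" "\<And>x. x \<in> H \<Longrightarrow> f x = 0" for f
    using d that unfolding lie_subalgebra_of_def by blast
  have HC: "x \<in> ?C" if "x \<in> H" for x using subgroup.subset[OF H] that by blast
  have one: "\<one>\<^bsub>Out A\<^esub> \<in> H" using subgroup.one_closed[OF H] .
  have deq: "d f = d g" if "f \<in> ?R" "g \<in> ?R" "\<And>x. x \<in> H \<Longrightarrow> f x = g x" for f g
  proof -
    have g': "(\<lambda>x\<in>?C. - 1 * g x) \<in> ?R" by (rule regular_Out_cmult[OF that(2)])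
    have "d (\<lambda>x\<in>?C. f x + (\<lambda>x\<in>?C. - 1 * g x) x) = 0"
      by (rule dvan[OF regular_Out_add[OF that(1) g']]) (simp add: HC that(3))
    then show ?thesis unfolding dadd[OF that(1) g'] dsc[OF that(2)] by simp
  qed
  have d1: "d (\<lambda>x\<in>?C. c) = 0" for c
  proof -
    have oneC: "\<one>\<^bsub>Out A\<^esub> \<in> ?C" using HC one by blast
    let ?u = "\<lambda>x\<in>?C. 1 :: 'k"
    have u: "?u \<in> ?R" by (rule regular_Out_const)
    have "(\<lambda>x\<in>?C. ?u x * ?u x) = ?u" by (rule restrict_ext) simp
    then have "d ?u = d ?u + d ?u" using dmult[OF u u] oneC by (simp only: restrict_apply' mult_1 mult_1_right)
    then have "d ?u = 0" by (simp only: add_cancel_right_right)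
    moreover have "(\<lambda>x\<in>?C. c * ?u x) = (\<lambda>x\<in>?C. c)" by (rule restrict_ext) simp
    ultimately show ?thesis using dsc[OF u, of c] by simp
  qed
  \<comment> \<open>For \<open>k = r\<close> this is a lift of the determinant that is killed by
    \<open>d\<close>.\<close>
  have prod: "\<exists>p\<in>?R. d p = 0 \<and> (\<forall>x\<in>H. p x = (\<Prod>j<k. \<phi> x $$ (j, j)))" if "k \<le> r" for k
    using that
  proof (induction k)
    case 0
    show ?case by (rule bexI[OF _ regular_Out_const[of 1]], intro conjI d1 ballI) (simp only: HC lessThan_0 prod.empty restrict_apply')
  next
    case (Suc k)
    then obtain p where p: "p \<in> ?R" "d p = 0" "\<forall>x\<in>H. p x = (\<Prod>j<k. \<phi> x $$ (j, j))" by auto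
    have Fk: "Fd k \<in> ?R" "d (Fd k) = 0" "\<And>x. x \<in> H \<Longrightarrow> Fd k x = \<phi> x $$ (k, k)" using Fd Suc.prems by auto
    have "d (\<lambda>x\<in>?C. p x * Fd k x) = 0" using dmult[OF p(1) Fk(1)] p(2) Fk(2) by simp
    moreover have "\<forall>x\<in>H. (\<lambda>x\<in>?C. p x * Fd k x) x = (\<Prod>j<Suc k. \<phi> x $$ (j, j))"
      using p(3) Fk(3) HC by simp
    ultimately show ?case using regular_Out_mult[OF p(1) Fk(1)] by blast
  qed
  \<comment> \<open>Stated for all lifts \<open>f\<close> of \<open>g\<close>, so that the
    hypothesis applies to whichever lifts are chosen for the parts of a sum or product.\<close>
  have main: "\<forall>f\<in>?R. (\<forall>x\<in>H. f x = g (\<phi> x)) \<longrightarrow> d f = 0"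
    if "g \<in> generated_functions DG ({\<lambda>M. M $$ (i, j) | i j. i < r \<and> j < r} \<union> {\<lambda>M. inverse (det M)})" for g
    using that
  proof (induction rule: generated_functions.induct)
    case (const c)
    show ?case
    proof (intro ballI impI)
      fix f assume f: "f \<in> ?R" "\<forall>x\<in>H. f x = (\<lambda>x\<in>DG. c) (\<phi> x)"
      then have "d f = d (\<lambda>x\<in>?C. c)" by (intro deq regular_Out_const) (simp_all add: phi_DG HC)
      then show "d f = 0" by (simp only: d1)
    qed
  next
    case (gen g)
    show ?case
    proof (intro ballI impI)
      fix f assume f: "f \<in> ?R" "\<forall>x\<in>H. f x = restrict g DG (\<phi> x)"
      then have fg: "f x = g (\<phi> x)" if "x \<in> H" for x using that by (simp add: phi_DG)
      from gen consider i j where "g = (\<lambda>M. M $$ (i, j))" "i < r" "j < r" | "g = (\<lambda>M. inverse (det M))" by blast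
      then show "d f = 0"
      proof cases
        case 1
        show ?thesis
        proof (cases "i = j")
          case True
          have "d f = d (Fd j)" using 1 True Fd fg by (intro deq f(1)) auto
          then show ?thesis using Fd(3) 1 by simp
        next
          case False
          show ?thesis
          proof (rule dvan[OF f(1)])
            fix x assume "x \<in> H"
            then have "\<phi> x \<in> carrier_mat r r" "diagonal_mat (\<phi> x)" using phi_DG[of x] unfolding DG by auto
            then show "f x = 0" using fg[OF \<open>x \<in> H\<close>] 1 False by (auto simp: diagonal_mat_def)
          qed
        qed
      next
        case 2
        obtain p where p: "p \<in> ?R" "d p = 0" "\<And>x. x \<in> H \<Longrightarrow> p x = (\<Prod>j<r. \<phi> x $$ (j, j))" using prod[of r] by blast
        have fp: "f x * p x = 1" if "x \<in> H" for x
        proof -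
          have *: "\<phi> x \<in> carrier_mat r r" "diagonal_mat (\<phi> x)" "invertible_mat (\<phi> x)"
            using phi_DG[OF that] unfolding DG by auto
          then have "det (\<phi> x) \<noteq> 0" using det_invertible_mat[OF *(1,3)] by simp
          then show ?thesis using fg[OF that] p(3)[OF that] det_diagonal_mat[OF *(1,2)] 2 by simp
        qed
        have "d (\<lambda>x\<in>?C. f x * p x) = d (\<lambda>x\<in>?C. 1)"
          by (intro deq regular_Out_mult f(1) p(1) regular_Out_const) (simp add: HC fp)
        then have "d f * p \<one>\<^bsub>Out A\<^esub> = 0" unfolding dmult[OF f(1) p(1)] d1 p(2) by simp
        moreover have "p \<one>\<^bsub>Out A\<^esub> \<noteq> 0" using fp[OF one] by auto
        ultimately show ?thesis by simp
      qed
    qed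
  next
    case (add g1 g2)
    obtain f1 where f1: "f1 \<in> ?R" "\<forall>x\<in>H. f1 x = g1 (\<phi> x)" using regular_lift[of g1] add.hyps unfolding diagonal_regular by blast
    obtain f2 where f2: "f2 \<in> ?R" "\<forall>x\<in>H. f2 x = g2 (\<phi> x)" using regular_lift[of g2] add.hyps unfolding diagonal_regular by blast
    have z: "d f1 = 0" "d f2 = 0" using add.IH f1 f2 by blast+
    show ?case
    proof (intro ballI impI)
      fix f assume f: "f \<in> ?R" "\<forall>x\<in>H. f x = (\<lambda>x\<in>DG. g1 x + g2 x) (\<phi> x)"
      have "d f = d (\<lambda>x\<in>?C. f1 x + f2 x)"
        using f f1 f2 by (intro deq regular_Out_add) (simp_all add: phi_DG HC)
      then show "d f = 0" by (simp add: dadd f1 f2 z)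
    qed
  next
    case (mult g1 g2)
    obtain f1 where f1: "f1 \<in> ?R" "\<forall>x\<in>H. f1 x = g1 (\<phi> x)" using regular_lift[of g1] mult.hyps unfolding diagonal_regular by blast
    obtain f2 where f2: "f2 \<in> ?R" "\<forall>x\<in>H. f2 x = g2 (\<phi> x)" using regular_lift[of g2] mult.hyps unfolding diagonal_regular by blast
    have z: "d f1 = 0" "d f2 = 0" using mult.IH f1 f2 by blast+
    show ?case
    proof (intro ballI impI)
      fix f assume f: "f \<in> ?R" "\<forall>x\<in>H. f x = (\<lambda>x\<in>DG. g1 x * g2 x) (\<phi> x)"
      have "d f = d (\<lambda>x\<in>?C. f1 x * f2 x)"
        using f f1 f2 by (intro deq regular_Out_mult) (simp_all add: phi_DG HC)
      then show "d f = 0" by (simp add: dmult f1 f2 z)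
    qed
  qed
  have "(\<lambda>M\<in>DG. f (inv_into H \<phi> M)) \<in> regular (diagonal_group r)" by (rule regular_push[OF f])
  moreover have "\<forall>x\<in>H. f x = (\<lambda>M\<in>DG. f (inv_into H \<phi> M)) (\<phi> x)"
    using phi_DG bij_betw_inv_into_left[OF phi_bij] by simp
  ultimately show ?thesis using main f unfolding diagonal_regular by blast
qed

subsection \<open>Involutions bound the rank of a torus\<close>

text \<open>The action of the automorphism on J/J^2. Inner automorphisms act trivially there, so it
  depends on the outer class only.\<close>

definition Lin :: "('a \<Rightarrow> 'a) \<Rightarrow> (nat \<Rightarrow> 'k) \<Rightarrow> nat \<Rightarrow> 'k"
  where "Lin \<sigma> v = (\<lambda>j. if j \<in> {1..n} then \<Sum>i\<in>{1..n}. up \<sigma> (X i) (ux j) * v i else 0)"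

definition V1 :: "(nat \<Rightarrow> 'k) set"
  where "V1 = {v. \<forall>i. i \<notin> {1..n} \<longrightarrow> v i = 0}"

lemma lin_Lin: "lin (Lin \<sigma>)"
  by (rule linI) (auto simp: Lin_def fext distrib_left sum.distrib sum_distrib_left intro!: sum.cong)

lemma Lin_V1: "Lin \<sigma> v \<in> V1"
  by (auto simp: Lin_def V1_def)

lemma V1_subspace: "fv.subspace V1"
  by (auto simp: V1_def fv.subspace_def fapply)

lemma Lin_out_class:
  assumes "\<sigma> \<in> AA" "\<tau> \<in> AA" "out_class A \<sigma> = out_class A \<tau>"
  shows "Lin \<sigma> = Lin \<tau>"
proof (intro ext)
  fix v j
  have "up \<sigma> (X i) (ux j) = up \<tau> (X i) (ux j)" if "i \<in> {1..n}" "j \<in> {1..n}" for i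
    using invf_up[OF that] assms unfolding invf_def by blast
  then have "j \<in> {1..n} \<Longrightarrow> (\<Sum>i\<in>{1..n}. up \<sigma> (X i) (ux j) * v i) = (\<Sum>i\<in>{1..n}. up \<tau> (X i) (ux j) * v i)"
    by (intro sum.cong refl) (simp only:)
  then show "Lin \<sigma> v j = Lin \<tau> v j" unfolding Lin_def by presburger
qed

lemma Lin_mult:
  assumes \<sigma>: "\<sigma> \<in> AA" and \<tau>: "\<tau> \<in> AA"
  shows "Lin (\<sigma> \<otimes>\<^bsub>Aut A\<^esub> \<tau>) v = Lin \<sigma> (Lin \<tau> v)"
proof
  fix j
  show "Lin (\<sigma> \<otimes>\<^bsub>Aut A\<^esub> \<tau>) v j = Lin \<sigma> (Lin \<tau> v) j"
  proof (cases "j \<in> {1..n}")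
    case True
    have "up \<sigma> (up \<tau> (X i)) (ux j) = (\<Sum>l\<in>{1..n}. up \<sigma> (X l) (ux j) * up \<tau> (X i) (ux l))" if i: "i \<in> {1..n}" for i
      using linear_coeff_comp[OF up_chom[OF \<sigma>] up_chom[OF \<tau>] i True] by (simp add: mult.commute)
    then have "(\<Sum>i\<in>{1..n}. up \<sigma> (up \<tau> (X i)) (ux j) * v i) =
        (\<Sum>i\<in>{1..n}. \<Sum>l\<in>{1..n}. up \<sigma> (X l) (ux j) * (up \<tau> (X i) (ux l) * v i))"
      by (intro sum.cong refl) (simp add: sum_distrib_right mult.assoc)
    also have "\<dots> = (\<Sum>l\<in>{1..n}. up \<sigma> (X l) (ux j) * Lin \<tau> v l)"
      by (subst sum.swap) (simp add: Lin_def sum_distrib_left)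
    finally show ?thesis using True by (simp add: Lin_def[of \<sigma>] Lin_def[of "\<sigma> \<otimes>\<^bsub>Aut A\<^esub> \<tau>"] up_mult[OF \<sigma> \<tau>])
  next
    case False
    then show ?thesis by (simp only: Lin_def if_False)
  qed
qed

lemma Lin_one:
  assumes "v \<in> V1"
  shows "Lin (low proj) v = v"
proof
  fix j
  have "(\<Sum>i\<in>{1..n}. X i (ux j) * v i) = (\<Sum>i\<in>{1..n}. if i = j then v j else 0)"
    by (rule sum.cong) (auto simp: ev_def dest: ux_inj)
  then show "Lin (low proj) v j = v j"
    using assms by (auto simp: Lin_def V1_def up_low_chom chom_proj_map proj_VM)
qed

text \<open>Diagonal sign matrices indexed by the positions of the entries -1; multiplication
  becomes symmetric difference.\<close>

definition sign_mat :: "nat set \<Rightarrow> 'k mat"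
  where "sign_mat B = mat_diag r (\<lambda>i. if i \<in> B then - 1 else 1)"

lemma sign_mat_mult: "sign_mat B * sign_mat C = sign_mat (B - C \<union> (C - B))"
  unfolding sign_mat_def mat_diag_diag by (rule arg_cong[of _ _ "mat_diag r"]) auto

lemma sign_mat_empty: "sign_mat {} = 1\<^sub>m r"
  by (simp add: sign_mat_def)

lemma sign_mat_DG: "sign_mat B \<in> DG"
proof -
  have c: "sign_mat B \<in> carrier_mat r r" by (simp add: sign_mat_def)
  have "sign_mat B * sign_mat B = 1\<^sub>m r" by (simp add: sign_mat_mult sign_mat_empty)
  then have "invertible_mat (sign_mat B)"
    using c unfolding invertible_mat_def inverts_mat_def by (intro conjI exI[of _ "sign_mat B"]) auto
  moreover have "diagonal_mat (sign_mat B)" by (auto simp: diagonal_mat_def sign_mat_def mat_diag_def)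
  ultimately show ?thesis using c by (simp add: DG)
qed

text \<open>Pigeonhole: \<open>2 ^ r\<close> sign matrices against at most \<open>2 ^ n\<close> sign
  patterns on a spanning set of at most n joint eigenvectors in J/J^2. Two with the same pattern
  have a product acting trivially on J/J^2 whose square is inner; it is then inner itself.\<close>

lemma torus_rank_le:
  assumes two: "(2 :: 'k) \<noteq> 0"
  shows "r \<le> n"
proof (rule ccontr)
  assume "\<not> r \<le> n"
  then have rn: "n < r" by simp
  interpret O: group "Out A" by (rule group_Out)
  define h where "h B = inv_into H \<phi> (sign_mat B)" for B
  have hH: "h B \<in> H" and ph: "\<phi> (h B) = sign_mat B" for B
    using sign_mat_DG[of B] phi_bij by (auto simp: h_def bij_betw_def inv_into_into f_inv_into_f)
  have phi_inj: "x = y" if "x \<in> H" "y \<in> H" "\<phi> x = \<phi> y" for x y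
    using phi_bij that by (auto simp: bij_betw_def dest: inj_onD)
  have hmult: "h B \<otimes>\<^bsub>Out A\<^esub> h C = h (B - C \<union> (C - B))" for B C
    by (rule phi_inj) (simp_all add: hH subgroup.m_closed[OF H] phi_mult ph sign_mat_mult)
  have one: "\<one>\<^bsub>Out A\<^esub> \<in> H" using subgroup.one_closed[OF H] .
  have h0: "h {} = \<one>\<^bsub>Out A\<^esub>"
  proof -
    have "h {} \<otimes>\<^bsub>Out A\<^esub> h {} = h {}" by (simp add: hmult)
    then show ?thesis using hH[of "{}"] subgroup.subset[OF H] O.l_cancel_one' by (metis subsetD)
  qed
  have "\<exists>\<sigma>. \<sigma> \<in> AA \<and> out_class A \<sigma> = h B" for B
    using hH[of B] subgroup.subset[OF H] unfolding Out_carrier by blast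
  then obtain \<sigma> where \<sigma>: "\<And>B. \<sigma> B \<in> AA" "\<And>B. out_class A (\<sigma> B) = h B" by metis
  define E where "E B = Lin (\<sigma> B)" for B
  have EE: "E B (E C v) = E (B - C \<union> (C - B)) v" for B C v
  proof -
    have "out_class A (\<sigma> B \<otimes>\<^bsub>Aut A\<^esub> \<sigma> C) = out_class A (\<sigma> (B - C \<union> (C - B)))"
      using \<sigma> hmult by (simp flip: Out_mult)
    then have "Lin (\<sigma> B \<otimes>\<^bsub>Aut A\<^esub> \<sigma> C) = E (B - C \<union> (C - B))"
      unfolding E_def by (intro Lin_out_class Aut_mult_closed \<sigma>)
    then show ?thesis using Lin_mult[OF \<sigma>(1) \<sigma>(1)] by (metis E_def)
  qed
  have E0: "E {} v = v" if "v \<in> V1" for v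
  proof -
    have "E {} = Lin (low proj)" unfolding E_def
      using \<sigma>(2)[of "{}"] h0 Out_one by (intro Lin_out_class \<sigma> low_AA[OF inv_pair_proj]) simp
    then show ?thesis using Lin_one[OF that] by simp
  qed
  have comm: "E B (E C v) = E C (E B v)" for B C v unfolding EE by (simp add: Un_commute)
  have sq: "E B (E B v) = v" if "v \<in> V1" for B v unfolding EE using E0[OF that] by simp
  define S where "S = {w \<in> V1. \<forall>f\<in>E ` Pow {..<r}. \<exists>l. f w = sc l w}"
  have diag: "\<exists>L. finite L \<and> (\<forall>v\<in>V1. pact f (\<Prod>l\<in>L. [:- l, 1:]) v = 0)" if f: "f \<in> E ` Pow {..<r}" for f
  proof -
    obtain B where B: "f = E B" using f by blast
    have lf: "lin f" by (simp add: B E_def lin_Lin)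
    have "(1 :: 'k) \<noteq> - 1" using two by (metis add.right_inverse one_add_one)
    then have "(\<Prod>l\<in>{1, - 1}. [:- l, 1:]) = [:- 1, 1:] * [:- (- 1), 1 :: 'k:]" by simp
    moreover have "pact f ([:- 1, 1:] * [:- (- 1), 1:]) v = 0" if "v \<in> V1" for v
      unfolding pact_mult[OF lf] pact_linear_factor[OF lf]
      using sq[OF that, of B] by (simp add: B[symmetric] lin_diff[OF lf] lin_add[OF lf] lin_sc[OF lf])
    ultimately show ?thesis by (intro exI[of _ "{1, - 1}"]) (simp only: finite.intros, simp)
  qed
  have spanS: "v \<in> fv.span S" if "v \<in> V1" for v
    unfolding S_def
    by (rule common_eigenvector_decomposition) (use comm diag that in \<open>auto simp: E_def lin_Lin V1_subspace Lin_V1\<close>)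
  obtain S0 where S0: "S0 \<subseteq> S" "finite S0" "card S0 \<le> n" "S \<subseteq> fv.span S0"
    using finite_spanning_subset[of "{1..n}" S "\<lambda>x. x"] by (auto simp: S_def V1_def)
  have spanS0: "v \<in> fv.span S0" if "v \<in> V1" for v
    using spanS[OF that] fv.span_minimal[OF S0(4) fv.subspace_span] by blast
  have "\<exists>l\<in>{1, - 1}. E B w = sc l w" if B: "B \<subseteq> {..<r}" and w: "w \<in> S0" for B w
  proof (cases "w = 0")
    case True
    then have "E B w = sc 1 w" by (simp add: E_def lin_0[OF lin_Lin])
    then show ?thesis by blast
  next
    case False
    have wV: "w \<in> V1" using w S0(1) by (auto simp: S_def)
    have "w \<in> S" "E B \<in> E ` Pow {..<r}" using w S0(1) B by auto
    then obtain l where l: "E B w = sc l w" unfolding S_def by blast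
    have "sc (l * l) w = w" using sq[OF wV, of B] l by (simp add: E_def lin_sc[OF lin_Lin])
    then have "sc (l * l - 1) w = 0" by (simp add: fv.scale_left_diff_distrib)
    then have "l * l = 1" using False by simp
    then have "l = 1 \<or> l = - 1" by (simp add: square_eq_1_iff)
    then show ?thesis using l by auto
  qed
  then obtain l where l: "\<And>B w. B \<subseteq> {..<r} \<Longrightarrow> w \<in> S0 \<Longrightarrow> l B w \<in> {1, - 1} \<and> E B w = sc (l B w) w" by metis
  have "\<not> inj_on (\<lambda>B. \<lambda>w\<in>S0. l B w) (Pow {..<r})"
  proof
    assume "inj_on (\<lambda>B. \<lambda>w\<in>S0. l B w) (Pow {..<r})"
    moreover have "(\<lambda>B. \<lambda>w\<in>S0. l B w) ` Pow {..<r} \<subseteq> S0 \<rightarrow>\<^sub>E {1, - 1}"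
      using l by (intro image_subsetI restrict_PiE_iff[THEN iffD2] ballI) simp_all
    moreover have "finite (S0 \<rightarrow>\<^sub>E {1, - 1 :: 'k})" using S0(2) by (intro finite_PiE) auto
    ultimately have "card (Pow {..<r}) \<le> card (S0 \<rightarrow>\<^sub>E {1, - 1 :: 'k})" by (rule card_inj_on_le)
    also have "\<dots> = card {1, - 1 :: 'k} ^ card S0" using S0(2) by (rule card_funcsetE)
    also have "\<dots> \<le> 2 ^ card S0" by (intro power_mono) (auto simp: card_insert_if)
    also have "\<dots> \<le> 2 ^ n" using S0(3) by simp
    finally have "(2::nat) ^ r \<le> 2 ^ n" by (simp add: card_Pow)
    then show False using rn by simp
  qed
  then obtain B C where BC: "B \<subseteq> {..<r}" "C \<subseteq> {..<r}" "B \<noteq> C" "(\<lambda>w\<in>S0. l B w) = (\<lambda>w\<in>S0. l C w)"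
    by (auto simp: inj_on_def)
  \<comment> \<open>\<open>h K\<close> is the product of \<open>h B\<close> and \<open>h C\<close>,
    which agree on the eigenvectors and square to the identity.\<close>
  define K where "K = B - C \<union> (C - B)"
  have K: "K \<subseteq> {..<r}" "K \<noteq> {}" using BC by (auto simp: K_def)
  have "E B w = E C w" if "w \<in> S0" for w
    using fun_cong[OF BC(4), of w] l[OF BC(1) that] l[OF BC(2) that] that by simp
  then have "E B v = E C v" if "v \<in> fv.span S0" for v
    using fvp.linear_eq_on_span[of "E B" "E C" S0 v] that by (simp add: E_def lin_Lin)
  then have "E K v = v" if "v \<in> V1" for v
    using EE[of B C v] sq[OF that, of B] spanS0[OF that] spanS0[OF Lin_V1, of "\<sigma> C" v]
    by (simp add: K_def E_def)
  then have EK: "Lin (\<sigma> K) v = v" if "v \<in> V1" for v using that by (simp add: E_def)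
  define s where "s = up (\<sigma> K)"
  have cs: "chom s" unfolding s_def by (rule up_chom[OF \<sigma>(1)])
  have sX: "s (X i) - X i \<in> F 2" if i: "i \<in> {1..n}" for i
  proof -
    have 1: "s (X i) - (\<Sum>j\<in>{1..n}. sc (s (X i) (ux j)) (X j)) \<in> F 2"
      by (rule linear_expand[OF chom_X[OF cs i]])
    have "s (X i) (ux j) = (if j = i then 1 else 0)" if j: "j \<in> {1..n}" for j
    proof -
      define e where "e = (\<lambda>l. if l = i then 1 else (0::'k))"
      have "e \<in> V1" using i by (auto simp: e_def V1_def)
      then have "Lin (\<sigma> K) e j = e j" using EK by simp
      moreover have "Lin (\<sigma> K) e j = (\<Sum>l\<in>{1..n}. if l = i then s (X i) (ux j) else 0)"
        unfolding Lin_def if_P[OF j] by (intro sum.cong refl) (auto simp: e_def s_def)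
      ultimately show ?thesis using i by (simp add: e_def)
    qed
    then have "(\<Sum>j\<in>{1..n}. sc (s (X i) (ux j)) (X j)) = (\<Sum>j\<in>{1..n}. if j = i then X i else 0)"
      by (intro sum.cong) auto
    then show ?thesis using 1 i by simp
  qed
  have "out_class A (\<sigma> K \<otimes>\<^bsub>Aut A\<^esub> \<sigma> K) = \<one>\<^bsub>Out A\<^esub>"
    using hmult[of K K] h0 \<sigma> by (simp flip: Out_mult)
  then have "(\<lambda>v. s (s v)) \<in> cinner"
    using out_class_one_iff[OF Aut_mult_closed[OF \<sigma>(1) \<sigma>(1)]] up_mult[OF \<sigma>(1) \<sigma>(1)] by (simp add: s_def)
  from unipotent_involution_inner[OF cs sX this two] have "s \<in> cinner" by blast
  then have "h K = h {}" using out_class_one_iff[OF \<sigma>(1), of K] \<sigma>(2)[of K] h0 by (simp add: s_def)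
  then have e: "sign_mat K = sign_mat {}" using ph by metis
  obtain i where i: "i \<in> K" "i < r" using K by auto
  then have "sign_mat K $$ (i, i) = sign_mat {} $$ (i, i)" using e by simp
  then have "(- 1 :: 'k) = 1" using i by (simp add: sign_mat_def mat_diag_def)
  then show False using two by (metis add.right_inverse one_add_one)
qed

end

subsection \<open>Tori in characteristic zero have rank at most \<open>n\<close>\<close>

lemma dual_sum:
  assumes l: "l \<in> dual_space A" and v: "\<And>i. i \<in> I \<Longrightarrow> v i \<in> VM"
  shows "l (ve (\<Sum>i\<in>I. sc (c i) (v i))) = (\<Sum>i\<in>I. c i * l (ve (v i)))"
proof -
  have lA: "l (b \<odot>\<^bsub>A\<^esub> x) = b * l x" "l (x \<oplus>\<^bsub>A\<^esub> y) = l x + l y" if "x \<in> carrier A" "y \<in> carrier A" for b x y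
    using l that unfolding dual_space_def by blast+
  have V0: "0 \<in> VM" by (simp add: VM_def fapply)
  have l0: "l (ve 0) = 0"
  proof -
    have "ve 0 = 0 \<odot>\<^bsub>A\<^esub> ve 0" by (rule co_eqI) (simp_all add: A_simps V0)
    then have "l (ve 0) = 0 * l (ve 0)" using lA(1)[of "ve 0" "ve 0" 0] V0 by simp
    then show ?thesis by simp
  qed
  have scV: "sc b w \<in> VM" if "w \<in> VM" for b w using that by (simp add: VM_def fapply)
  have lsc: "l (ve (sc b w)) = b * l (ve w)" if "w \<in> VM" for b w
  proof -
    have "ve (sc b w) = b \<odot>\<^bsub>A\<^esub> ve w" by (rule co_eqI) (simp_all add: A_simps that scV)
    then show ?thesis using lA(1)[of "ve w" "ve w" b] that by simp
  qed
  have ladd: "l (ve (u + w)) = l (ve u) + l (ve w)" if "u \<in> VM" "w \<in> VM" for u w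
  proof -
    have "ve (u + w) = ve u \<oplus>\<^bsub>A\<^esub> ve w" by (rule co_eqI) (simp_all add: A_simps that)
    then show ?thesis using lA(2)[of "ve u" "ve w"] that by simp
  qed
  have "(\<Sum>i\<in>I. sc (c i) (v i)) \<in> VM \<and> l (ve (\<Sum>i\<in>I. sc (c i) (v i))) = (\<Sum>i\<in>I. c i * l (ve (v i)))"
    using v
  proof (induction I rule: infinite_finite_induct)
    case (insert i I)
    then show ?case using scV[of "v i" "c i"] by (simp add: ladd lsc)
  qed (simp_all add: l0)
  then show ?thesis by blast
qed

lemma regular_Aut_closed:
  "f \<in> regular (Aut A) \<Longrightarrow> (\<lambda>x\<in>AA. c * f x) \<in> regular (Aut A)"
  "f \<in> regular (Aut A) \<Longrightarrow> g \<in> regular (Aut A) \<Longrightarrow> (\<lambda>x\<in>AA. f x + g x) \<in> regular (Aut A)"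
  "f \<in> regular (Aut A) \<Longrightarrow> g \<in> regular (Aut A) \<Longrightarrow> (\<lambda>x\<in>AA. f x * g x) \<in> regular (Aut A)"
proof -
  assume f: "f \<in> regular (Aut A)"
  have "(\<lambda>x\<in>AA. (\<lambda>x\<in>AA. c) x * f x) \<in> regular (Aut A)"
    using f unfolding Aut_regular by (intro generated_functions.mult generated_functions.const)
  moreover have "(\<lambda>x\<in>AA. (\<lambda>x\<in>AA. c) x * f x) = (\<lambda>x\<in>AA. c * f x)" by (rule restrict_ext) simp
  ultimately show "(\<lambda>x\<in>AA. c * f x) \<in> regular (Aut A)" by metis
next
  show "f \<in> regular (Aut A) \<Longrightarrow> g \<in> regular (Aut A) \<Longrightarrow> (\<lambda>x\<in>AA. f x + g x) \<in> regular (Aut A)"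
    "f \<in> regular (Aut A) \<Longrightarrow> g \<in> regular (Aut A) \<Longrightarrow> (\<lambda>x\<in>AA. f x * g x) \<in> regular (Aut A)"
    unfolding Aut_regular by (rule generated_functions.add generated_functions.mult; assumption)+
qed

text \<open>The tangent vector and its derivation are kept together, because linear combinations
  have to be formed of both at once.\<close>

definition lie_rep :: "('a \<Rightarrow> 'a) set set \<Rightarrow> ((('a \<Rightarrow> 'a) \<Rightarrow> 'k) \<Rightarrow> 'k) \<Rightarrow>
    'k coords_map \<Rightarrow> bool"
  where "lie_rep H \<delta> g \<longleftrightarrow> cder g \<and> tangent_derivation A \<delta> (low g) \<and>
    out_differential A \<delta> \<in> lie_subalgebra_of (Out A) H"

lemma lie_in_HH1_eq: "lie_in_HH1 A H = cls ` {g. \<exists>\<delta>. lie_rep H \<delta> g}"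
proof (intro equalityI subsetI)
  fix x assume "x \<in> lie_in_HH1 A H"
  then obtain D \<delta> where D: "x = inner_derivations A +>\<^bsub>Der A\<^esub> D" "tangent_derivation A \<delta> D"
    "out_differential A \<delta> \<in> lie_subalgebra_of (Out A) H" unfolding lie_in_HH1_def by blast
  then have "D \<in> derivations A" by (simp add: tangent_derivation_def)
  then have "cder (up D)" "low (up D) = D" using up_derivations by blast+
  then show "x \<in> cls ` {g. \<exists>\<delta>. lie_rep H \<delta> g}"
    using D by (intro image_eqI[of _ _ "up D"]) (auto simp: cls_def lie_rep_def)
next
  fix x assume "x \<in> cls ` {g. \<exists>\<delta>. lie_rep H \<delta> g}"
  then show "x \<in> lie_in_HH1 A H" unfolding lie_in_HH1_def lie_rep_def cls_def by blast
qed

lemma lie_rep_sum: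
  assumes \<delta>: "\<And>i. i \<in> I \<Longrightarrow> lie_rep H (\<delta> i) (g i)"
  shows "lie_rep H (\<lambda>G\<in>regular (Aut A). \<Sum>i\<in>I. c i * \<delta> i G) (\<lambda>v. \<Sum>i\<in>I. sc (c i) (g i v))"
    and "f \<in> regular (Out A) \<Longrightarrow> out_differential A (\<lambda>G\<in>regular (Aut A). \<Sum>i\<in>I. c i * \<delta> i G) f
      = (\<Sum>i\<in>I. c i * out_differential A (\<delta> i) f)"
proof -
  let ?d = "\<lambda>G\<in>regular (Aut A). \<Sum>i\<in>I. c i * \<delta> i G" and ?g = "\<lambda>v. \<Sum>i\<in>I. sc (c i) (g i v)"
  have pull: "compose AA f (out_class A) \<in> regular (Aut A)" if "f \<in> regular (Out A)" for f
    using that by (simp add: Out_def Let_def)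
  then show od: "out_differential A ?d f = (\<Sum>i\<in>I. c i * out_differential A (\<delta> i) f)" if "f \<in> regular (Out A)" for f
    using that by (simp add: out_differential_def)
  have cg: "cder (g i)" "tangent_derivation A (\<delta> i) (low (g i))" "out_differential A (\<delta> i) \<in> lie_subalgebra_of (Out A) H" if "i \<in> I" for i
    using \<delta>[OF that] by (simp_all add: lie_rep_def)
  have 1: "cder ?g" by (rule cder_sum) (rule cg)
  have 2: "?d \<in> lie_algebra (Aut A)"
    by (rule lie_algebra_sum) (use regular_Aut_closed cg in \<open>auto simp: tangent_derivation_def\<close>)
  have 3: "?d (\<lambda>\<sigma>\<in>AA. l (\<sigma> a)) = l (low ?g a)" if l: "l \<in> dual_space A" and a: "a \<in> carrier A" for l a
  proof -
    have "restrict (\<lambda>\<sigma>. l (\<sigma> a)) AA \<in> regular (Aut A)"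
      unfolding Aut_regular by (rule generated_functions.gen) (use l a in blast)
    then have "?d (\<lambda>\<sigma>\<in>AA. l (\<sigma> a)) = (\<Sum>i\<in>I. c i * \<delta> i (\<lambda>\<sigma>\<in>AA. l (\<sigma> a)))" by (rule restrict_apply')
    also have "\<dots> = (\<Sum>i\<in>I. c i * l (ve (g i (co a))))"
      using cg(2) l a by (intro sum.cong refl) (simp add: tangent_derivation_def)
    also have "\<dots> = l (ve (?g (co a)))" using dual_sum[OF l, of I "\<lambda>i. g i (co a)" c] cg(1) cder_VM by simp
    finally show ?thesis using a by simp
  qed
  have od': "out_differential A ?d = (\<lambda>f\<in>regular (Out A). \<Sum>i\<in>I. c i * out_differential A (\<delta> i) f)"
    by (rule extensionalityI[of _ "regular (Out A)"]) (simp_all only: od restrict_apply', simp_all add: out_differential_def)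
  have "out_differential A ?d \<in> lie_algebra (Out A)"
    unfolding od'
    by (rule lie_algebra_sum) (use regular_Out_cmult regular_Out_add regular_Out_mult cg in \<open>auto simp: lie_subalgebra_of_def\<close>)
  moreover have "out_differential A ?d f = 0" if "f \<in> regular (Out A)" "\<forall>x\<in>H. f x = 0" for f
    unfolding od[OF that(1)] using cg(3) that by (intro sum.neutral) (simp add: lie_subalgebra_of_def)
  ultimately have "out_differential A ?d \<in> lie_subalgebra_of (Out A) H" by (simp add: lie_subalgebra_of_def)
  moreover have "tangent_derivation A ?d (low ?g)"
    unfolding tangent_derivation_def
    by (intro conjI 2 low_derivations[OF 1] ballI) (unfold Aut_carrier, rule 3)
  ultimately show "lie_rep H ?d ?g" using 1 by (simp only: lie_rep_def simp_thms)
qed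

lemma lie_in_HH1_submodule: "LinearCombinations.submodule class_ring (lie_in_HH1 A H) (HH1 A)"
proof -
  interpret V: vectorspace "class_ring :: 'k ring" "HH1 A" by (rule vectorspace_HH1)
  \<comment> \<open>Combinations of length 0, 2 and 1 give zero, sums and scalar multiples.\<close>
  have comb: "cls (\<lambda>v. \<Sum>i<N. sc (c i) (g i v)) \<in> lie_in_HH1 A H"
    if "\<And>i. i < N \<Longrightarrow> lie_rep H (\<delta> i) (g i)" for N :: nat and c g \<delta>
    using lie_rep_sum(1)[of "{..<N}" H \<delta> g c] that unfolding lie_in_HH1_eq by blast
  have "lie_in_HH1 A H \<subseteq> carrier (HH1 A)"
    unfolding lie_in_HH1_eq HH1_carrier by (auto simp: lie_rep_def)
  moreover have "\<zero>\<^bsub>HH1 A\<^esub> \<in> lie_in_HH1 A H"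
    using comb[of 0] by (simp add: HH1_zero zero_fun_def)
  moreover have "x \<oplus>\<^bsub>HH1 A\<^esub> y \<in> lie_in_HH1 A H" if xy: "x \<in> lie_in_HH1 A H" "y \<in> lie_in_HH1 A H" for x y
  proof -
    obtain f d g e where fg: "x = cls f" "lie_rep H d f" "y = cls g" "lie_rep H e g"
      using xy unfolding lie_in_HH1_eq by blast
    have "(\<lambda>v. \<Sum>i<2. sc 1 (if i = (0::nat) then f v else g v)) = f + g"
      by (rule ext) (simp add: numeral_2_eq_2 op_apply)
    moreover have "cls (\<lambda>v. \<Sum>i<2. sc 1 ((if i = (0::nat) then f else g) v)) \<in> lie_in_HH1 A H"
      by (rule comb[of 2 "\<lambda>i. if i = 0 then d else e"]) (auto simp: fg)
    ultimately have "cls (f + g) \<in> lie_in_HH1 A H" by (simp only: if_distribR)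
    then show ?thesis using fg by (simp add: HH1_add lie_rep_def)
  qed
  moreover have "c \<odot>\<^bsub>HH1 A\<^esub> x \<in> lie_in_HH1 A H" if x: "x \<in> lie_in_HH1 A H" for c x
  proof -
    obtain f d where f: "x = cls f" "lie_rep H d f" using x unfolding lie_in_HH1_eq by blast
    have "cls (\<lambda>v. \<Sum>i<Suc 0. sc c (f v)) \<in> lie_in_HH1 A H"
      using comb[of "Suc 0" "\<lambda>_. d" "\<lambda>_. f" "\<lambda>_. c"] f by simp
    then show ?thesis using f by (simp add: HH1_smult lie_rep_def)
  qed
  ultimately show ?thesis
    by (intro submodule.intro) (simp_all add: V.module_axioms)
qed

text \<open>There is one equation for each of the \<open>r \<le> n\<close> diagonal coordinates
  lifted to \<open>Out\<close>. A nontrivial combination of n + 1 tangent vectors solves all of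
  them; its differential on \<open>Out\<close> is then zero and its derivation inner.\<close>

lemma torus_char_0_dependent:
  assumes two: "(2 :: 'k) \<noteq> 0" and T: "torus_char_0 A T"
  shows "LinearCombinations.submodule class_ring T (HH1 A)"
    and "(\<And>i. i \<le> n \<Longrightarrow> cder (f i) \<and> cls (f i) \<in> T) \<Longrightarrow>
      \<exists>c. (\<exists>i\<le>n. c i \<noteq> 0) \<and> (\<lambda>v. \<Sum>i\<le>n. sc (c i) (f i v)) \<in> cInn"
proof -
  obtain H r where Hr: "closed_subgroup H (Out A)"
    "alg_group_isomorphic (alg_subgroup (Out A) H) (diagonal_group r :: ('k mat, 'k) alg_group)"
    and TH: "T = lie_in_HH1 A H" using T unfolding torus_char_0_def by blast
  show "LinearCombinations.submodule class_ring T (HH1 A)" unfolding TH by (rule lie_in_HH1_submodule)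
  assume f: "\<And>i. i \<le> n \<Longrightarrow> cder (f i) \<and> cls (f i) \<in> T"
  have H: "subgroup H (Out A)" using Hr(1) by (simp add: closed_subgroup_def)
  obtain \<phi> where \<phi>: "\<phi> \<in> iso (alg_subgroup (Out A) H) (diagonal_group r :: ('k mat, 'k) alg_group)"
    and reg: "\<And>f. f \<in> extensional (carrier (diagonal_group r)) \<Longrightarrow>
      f \<in> regular (diagonal_group r) \<longleftrightarrow> compose H f \<phi> \<in> (\<lambda>f. restrict f H) ` regular (Out A)"
    using Hr(2) unfolding alg_group_isomorphic_def by (auto simp: alg_subgroup_def)
  obtain Fd where Fd: "\<And>j. j < r \<Longrightarrow> Fd j \<in> regular (Out A)" "\<And>j x. j < r \<Longrightarrow> x \<in> H \<Longrightarrow> Fd j x = \<phi> x $$ (j, j)"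
    using ex_diag_lift[OF H \<phi> reg] by blast
  have rn: "r \<le> n" by (rule torus_rank_le[OF H \<phi> reg two])
  have "\<exists>g \<delta>. i \<le> n \<longrightarrow> lie_rep H \<delta> g \<and> f i - g \<in> cInn" for i
  proof (cases "i \<le> n")
    case True
    then obtain g \<delta> where g: "lie_rep H \<delta> g" "cls (f i) = cls g" using f[OF True] unfolding TH lie_in_HH1_eq by blast
    then have "f i - g \<in> cInn" using f[OF True] cls_eq_iff[of "f i" g] by (simp add: lie_rep_def)
    then show ?thesis using g by blast
  qed blast
  then obtain g \<delta> where g: "\<And>i. i \<le> n \<Longrightarrow> lie_rep H (\<delta> i) (g i)" "\<And>i. i \<le> n \<Longrightarrow> f i - g i \<in> cInn" by metis
  obtain c where c: "\<exists>i\<in>{..n}. c i \<noteq> 0" "\<And>j. j < r \<Longrightarrow> (\<Sum>i\<in>{..n}. c i * out_differential A (\<delta> i) (Fd j)) = 0"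
    using homogeneous_system_solution[of "{..<r}" "{..n}" "\<lambda>i j. out_differential A (\<delta> i) (Fd j)"] rn by auto
  let ?d = "\<lambda>G\<in>regular (Aut A). \<Sum>i\<le>n. c i * \<delta> i G" and ?g = "\<lambda>v. \<Sum>i\<le>n. sc (c i) (g i v)"
  have rep: "lie_rep H ?d ?g" by (rule lie_rep_sum(1)) (simp add: g)
  have od: "out_differential A ?d h = (\<Sum>i\<le>n. c i * out_differential A (\<delta> i) h)" if "h \<in> regular (Out A)" for h
    by (rule lie_rep_sum(2)[OF _ that, where H = H and g = g]) (simp add: g)
  have dH: "out_differential A ?d \<in> lie_subalgebra_of (Out A) H" using rep unfolding lie_rep_def by blast
  have dF: "out_differential A ?d (Fd j) = 0" if "j < r" for j
    unfolding od[OF Fd(1)[OF that]] by (rule c(2)[OF that])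
  have z: "out_differential A ?d h = 0" if h: "h \<in> regular (Out A)" for h
    by (rule lie_vanishing[OF H \<phi> reg dH Fd dF h])
  have cg: "cder ?g" "tangent_derivation A ?d (low ?g)" using rep by (simp_all add: lie_rep_def)
  have "up (low ?g) \<in> cInn" by (rule out_differential_zero_imp_inner[OF cg(2) z])
  moreover have "up (low ?g) = ?g" by (rule up_low) (rule cder_VM[OF cg(1)], rule cder_proj[OF cg(1)])
  ultimately have gI: "?g \<in> cInn" by simp
  have "(\<lambda>v. \<Sum>i\<le>n. sc (c i) ((f i - g i) v)) \<in> cInn" by (rule cInn_sum) (simp add: g)
  then have "(\<lambda>v. \<Sum>i\<le>n. sc (c i) ((f i - g i) v)) + ?g \<in> cInn" using gI by (rule cInn_add)
  moreover have "(\<lambda>v. \<Sum>i\<le>n. sc (c i) ((f i - g i) v)) + ?g = (\<lambda>v. \<Sum>i\<le>n. sc (c i) (f i v))"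
    by (rule ext) (simp add: op_apply fv.scale_right_diff_distrib sum_subtractf)
  ultimately have "(\<lambda>v. \<Sum>i\<le>n. sc (c i) (f i v)) \<in> cInn" by simp
  then show "\<exists>c. (\<exists>i\<le>n. c i \<noteq> 0) \<and> (\<lambda>v. \<Sum>i\<le>n. sc (c i) (f i v)) \<in> cInn"
    using c(1) by auto
qed

end

subsection \<open>The derivative of a Laurent polynomial at \<open>1\<close>\<close>

text \<open>\<open>f\<close> equals \<open>p / s^k\<close> on the multiplicative group; its value at
  0 stays free.\<close>

definition laurent_rep :: "('b::field \<Rightarrow> 'b) \<Rightarrow> 'b poly \<Rightarrow> nat \<Rightarrow> bool"
  where "laurent_rep f p k \<longleftrightarrow> (\<forall>s. s \<noteq> 0 \<longrightarrow> f s * s ^ k = poly p s)"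

definition laurent :: "('b::field \<Rightarrow> 'b) \<Rightarrow> bool"
  where "laurent f \<longleftrightarrow> (\<exists>p k. laurent_rep f p k)"

text \<open>The derivative of \<open>p / s^k\<close> at s = 1. Over an infinite field it depends on
  \<open>f\<close> alone.\<close>

definition laurent_deriv :: "('b::field \<Rightarrow> 'b) \<Rightarrow> 'b"
  where "laurent_deriv f = (THE d. \<exists>p k. laurent_rep f p k \<and> d = poly (pderiv p) 1 - of_nat k * poly p 1)"

lemma laurent_rep_add:
  assumes "laurent_rep f p k" "laurent_rep g q l"
  shows "laurent_rep (\<lambda>s. f s + g s) (p * monom 1 l + q * monom 1 k) (k + l)"
  unfolding laurent_rep_def
proof (intro allI impI)
  fix s :: 'a assume "s \<noteq> 0"
  then have "f s * s ^ k = poly p s" "g s * s ^ l = poly q s" using assms by (auto simp: laurent_rep_def)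
  then show "(f s + g s) * s ^ (k + l) = poly (p * monom 1 l + q * monom 1 k) s"
    by (simp add: poly_monom power_add algebra_simps flip: mult.assoc)
qed

lemma laurent_rep_mult:
  assumes "laurent_rep f p k" "laurent_rep g q l"
  shows "laurent_rep (\<lambda>s. f s * g s) (p * q) (k + l)"
  unfolding laurent_rep_def
proof (intro allI impI)
  fix s :: 'a assume "s \<noteq> 0"
  then have "f s * s ^ k = poly p s" "g s * s ^ l = poly q s" using assms by (auto simp: laurent_rep_def)
  then have "(f s * s ^ k) * (g s * s ^ l) = poly p s * poly q s" by simp
  then show "f s * g s * s ^ (k + l) = poly (p * q) s" by (simp add: power_add mult.assoc mult.left_commute)
qed

lemma laurent_rep_const: "laurent_rep (\<lambda>s. c) [:c:] 0"
  and laurent_rep_id: "laurent_rep (\<lambda>s. s) [:0, 1:] 0"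
  and laurent_rep_inverse: "laurent_rep inverse 1 1"
  by (simp_all add: laurent_rep_def)

lemma laurent_rep_power: "laurent_rep (\<lambda>s. s ^ j) (monom 1 j) 0"
  by (simp add: laurent_rep_def poly_monom)

lemma laurent_rep_cong: "laurent_rep f p k \<Longrightarrow> (\<And>s. s \<noteq> 0 \<Longrightarrow> f s = g s) \<Longrightarrow> laurent_rep g p k"
  by (simp add: laurent_rep_def)

lemma laurent_closure:
  "laurent (\<lambda>s. c)" "laurent (\<lambda>s. s)" "laurent inverse"
  "laurent f \<Longrightarrow> laurent g \<Longrightarrow> laurent (\<lambda>s. f s + g s)"
  "laurent f \<Longrightarrow> laurent g \<Longrightarrow> laurent (\<lambda>s. f s * g s)"
  "laurent f \<Longrightarrow> (\<And>s. s \<noteq> 0 \<Longrightarrow> f s = h s) \<Longrightarrow> laurent h"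
  unfolding laurent_def
  by (blast intro: laurent_rep_const laurent_rep_id laurent_rep_inverse laurent_rep_add laurent_rep_mult
      laurent_rep_cong)+

text \<open>Two representations give p s^l = q s^k at infinitely many points, hence as polynomials;
  differentiating this identity at 1 shows that the values agree.\<close>

lemma laurent_deriv_eq:
  assumes inf: "infinite (UNIV :: 'b::field set)" and f: "laurent_rep (f :: 'b \<Rightarrow> 'b) p k"
  shows "laurent_deriv f = poly (pderiv p) 1 - of_nat k * poly p 1"
  unfolding laurent_deriv_def
proof (rule the_equality)
  show "\<exists>q l. laurent_rep f q l \<and> poly (pderiv p) 1 - of_nat k * poly p 1 = poly (pderiv q) 1 - of_nat l * poly q 1"
    using f by blast
next
  fix d assume "\<exists>q l. laurent_rep f q l \<and> d = poly (pderiv q) 1 - of_nat l * poly q 1"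
  then obtain q l where g: "laurent_rep f q l" and d: "d = poly (pderiv q) 1 - of_nat l * poly q 1" by blast
  have "poly (p * monom 1 l - q * monom 1 k) s = 0" if "s \<noteq> 0" for s
  proof -
    have "f s * s ^ k = poly p s" "f s * s ^ l = poly q s" using f g that by (auto simp: laurent_rep_def)
    then have "poly p s * s ^ l = f s * s ^ k * s ^ l" "poly q s * s ^ k = f s * s ^ l * s ^ k" by simp_all
    then have "poly p s * s ^ l = poly q s * s ^ k" by (simp only: mult.assoc mult.commute[of "s ^ l" "s ^ k"])
    then show ?thesis by (simp only: poly_diff poly_mult poly_monom mult_1 diff_self)
  qed
  then have "UNIV - {0} \<subseteq> {s. poly (p * monom 1 l - q * monom 1 k) s = 0}" by auto
  moreover have "infinite (UNIV - {0 :: 'b})" using inf by simp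
  ultimately have "infinite {s. poly (p * monom 1 l - q * monom 1 k) s = 0}" by (metis finite_subset)
  then have "p * monom 1 l - q * monom 1 k = 0" using poly_roots_finite by blast
  then have e: "p * monom 1 l = q * monom 1 k" by simp
  have "poly (p * monom 1 l) 1 = poly (q * monom 1 k) 1" using e by simp
  then have 1: "poly p 1 = poly q 1" by (simp add: poly_monom)
  have "poly (pderiv (p * monom 1 l)) 1 = poly (pderiv (q * monom 1 k)) 1" using e by simp
  then have "poly (pderiv p) 1 + of_nat l * poly p 1 = poly (pderiv q) 1 + of_nat k * poly q 1"
    by (simp add: pderiv_mult pderiv_monom poly_monom algebra_simps)
  then show "d = poly (pderiv p) 1 - of_nat k * poly p 1" unfolding d 1 by (simp add: algebra_simps)
qed

context
  assumes inf: "infinite (UNIV :: 'b::field set)"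
begin

lemma laurent_deriv_add:
  assumes "laurent (f :: 'b \<Rightarrow> 'b)" "laurent g"
  shows "laurent_deriv (\<lambda>s. f s + g s) = laurent_deriv f + laurent_deriv g"
proof -
  obtain p k q l where r: "laurent_rep f p k" "laurent_rep g q l" using assms by (auto simp: laurent_def)
  show ?thesis
    unfolding laurent_deriv_eq[OF inf laurent_rep_add[OF r]] laurent_deriv_eq[OF inf r(1)] laurent_deriv_eq[OF inf r(2)]
    by (simp add: pderiv_add pderiv_mult pderiv_monom poly_monom algebra_simps)
qed

lemma laurent_deriv_mult:
  assumes "laurent (f :: 'b \<Rightarrow> 'b)" "laurent g"
  shows "laurent_deriv (\<lambda>s. f s * g s) = laurent_deriv f * g 1 + f 1 * laurent_deriv g"
proof -
  obtain p k q l where r: "laurent_rep f p k" "laurent_rep g q l" using assms by (auto simp: laurent_def)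
  then have "f 1 = poly p 1" "g 1 = poly q 1" by (auto simp: laurent_rep_def dest: spec[of _ 1])
  then show ?thesis
    unfolding laurent_deriv_eq[OF inf laurent_rep_mult[OF r]] laurent_deriv_eq[OF inf r(1)] laurent_deriv_eq[OF inf r(2)]
    by (simp add: pderiv_mult algebra_simps)
qed

lemma laurent_deriv_const: "laurent_deriv (\<lambda>s. c :: 'b) = 0"
  by (simp add: laurent_deriv_eq[OF inf laurent_rep_const] pderiv_pCons)

lemma laurent_deriv_cmult: "laurent f \<Longrightarrow> laurent_deriv (\<lambda>s. c * f s) = c * laurent_deriv (f :: 'b \<Rightarrow> 'b)"
  using laurent_deriv_mult[OF laurent_closure(1), of f c] by (simp add: laurent_deriv_const)

lemma laurent_deriv_power: "laurent_deriv (\<lambda>s :: 'b. s ^ k) = of_nat k"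
  by (simp add: laurent_deriv_eq[OF inf laurent_rep_power] pderiv_monom poly_monom)

lemma laurent_deriv_cong:
  assumes "laurent (f :: 'b \<Rightarrow> 'b)" "\<And>s. s \<noteq> 0 \<Longrightarrow> f s = g s"
  shows "laurent_deriv f = laurent_deriv g"
proof -
  obtain p k where f: "laurent_rep f p k" using assms(1) unfolding laurent_def by blast
  have g: "laurent_rep g p k" by (rule laurent_rep_cong[OF f assms(2)])
  show ?thesis unfolding laurent_deriv_eq[OF inf f] laurent_deriv_eq[OF inf g] ..
qed

lemma laurent_sum:
  assumes "\<And>x. x \<in> S \<Longrightarrow> laurent (f x :: 'b \<Rightarrow> 'b)"
  shows "laurent (\<lambda>s. \<Sum>x\<in>S. f x s)" and "laurent_deriv (\<lambda>s. \<Sum>x\<in>S. f x s) = (\<Sum>x\<in>S. laurent_deriv (f x))"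
proof -
  have "laurent (\<lambda>s. \<Sum>x\<in>S. f x s) \<and> laurent_deriv (\<lambda>s. \<Sum>x\<in>S. f x s) = (\<Sum>x\<in>S. laurent_deriv (f x))"
    using assms
  proof (induction S rule: infinite_finite_induct)
    case (insert x S)
    then show ?case by (simp add: laurent_closure(4) laurent_deriv_add)
  qed (simp_all add: laurent_closure(1) laurent_deriv_const)
  then show "laurent (\<lambda>s. \<Sum>x\<in>S. f x s)" "laurent_deriv (\<lambda>s. \<Sum>x\<in>S. f x s) = (\<Sum>x\<in>S. laurent_deriv (f x))" by blast+
qed

end

context qcoord
begin

subsection \<open>The standard torus of automorphisms\<close>

text \<open>The character by which the automorphism \<open>x_i -> t_i x_i\<close> acts on the
  monomial \<open>x^a\<close>.\<close>

definition pm :: "(nat \<Rightarrow> 'k) \<Rightarrow> 'k coords"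
  where "pm t a = (\<Prod>i\<in>{1..n}. t i ^ a i)"

definition tor :: "(nat \<Rightarrow> 'k) \<Rightarrow> 'k coords_map"
  where "tor t v = (\<lambda>a. pm t a * proj v a)"

definition nz :: "(nat \<Rightarrow> 'k) \<Rightarrow> bool"
  where "nz t \<longleftrightarrow> (\<forall>i\<in>{1..n}. t i \<noteq> 0)"

lemma pm_add: "pm t (a + b) = pm t a * pm t b"
  by (simp add: pm_def plus_fun_apply power_add prod.distrib)

lemma pm_ux: "i \<in> {1..n} \<Longrightarrow> pm t (ux i) = t i"
proof -
  assume i: "i \<in> {1..n}"
  have "pm t (ux i) = (\<Prod>j\<in>{1..n}. if i = j then t j else 1)"
    unfolding pm_def by (rule prod.cong) (auto simp: ux_def)
  then show ?thesis using i by simp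
qed

lemma pm_0: "pm t 0 = 1"
  by (simp add: pm_def zero_fun_apply)

lemma chom_tor: "chom (tor t)"
  unfolding chom_def
proof (intro conjI allI)
  show "lin (tor t)" by (rule linI) (auto simp: tor_def proj_def fext algebra_simps)
  show "tor t v \<in> VM" for v by (auto simp: tor_def VM_def proj_def)
  show "tor t (proj v) = tor t v" for v by (simp add: tor_def proj_VM)
  show "tor t un = un" unfolding tor_def by (rule ext) (simp add: proj_VM, simp add: ev_def pm_0)
  fix u v
  show "tor t (mul u v) = mul (tor t u) (tor t v)"
  proof
    fix d
    show "tor t (mul u v) d = mul (tor t u) (tor t v) d"
    proof (cases "d \<in> M")
      case True
      have "pm t d * (\<Sum>a\<in>M. \<Sum>b\<in>M. if a + b = d then \<gamma> a b * u a * v b else 0) =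
        (\<Sum>a\<in>M. \<Sum>b\<in>M. if a + b = d then \<gamma> a b * tor t u a * tor t v b else 0)"
        unfolding sum_distrib_left
        by (intro sum.cong refl) (auto simp: tor_def proj_def pm_add)
      moreover have "tor t (mul u v) d = pm t d * mul u v d" by (simp add: tor_def)
      ultimately show ?thesis using True by (simp add: mul_def)
    qed (simp add: tor_def[of t "mul u v"], simp add: mul_def)
  qed
qed

lemma tor_X: "i \<in> {1..n} \<Longrightarrow> tor t (X i) = sc (t i) (X i)"
  unfolding tor_def by (rule ext) (auto simp: proj_VM fapply, auto simp: ev_def pm_ux)

lemma tor_comp: "tor t (tor \<mu> v) = tor (\<lambda>i. t i * \<mu> i) v"
  by (rule ext) (auto simp: tor_def proj_def pm_def power_mult_distrib prod.distrib)

lemma tor_eqI: "(\<And>i. i \<in> {1..n} \<Longrightarrow> t i = \<mu> i) \<Longrightarrow> tor t = tor \<mu>"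
  by (rule chom_eqI[OF chom_tor chom_tor]) (simp add: tor_X)

lemma tor_1: "(\<And>i. i \<in> {1..n} \<Longrightarrow> t i = 1) \<Longrightarrow> tor t = proj"
  by (rule chom_eqI[OF chom_tor chom_proj_map]) (simp add: tor_X proj_VM)

lemma inv_pair_tor: "nz t \<Longrightarrow> inv_pair (tor t) (tor (\<lambda>i. inverse (t i)))"
proof -
  assume l: "nz t"
  have "tor (\<lambda>i. t i * inverse (t i)) = proj" "tor (\<lambda>i. inverse (t i) * t i) = proj"
    by (rule tor_1, use l in \<open>simp add: nz_def\<close>)+
  then show ?thesis by (simp add: inv_pair_def chom_tor tor_comp)
qed

lemma nz_inverse: "nz t \<Longrightarrow> nz (\<lambda>i. inverse (t i))"
  and nz_mult: "nz t \<Longrightarrow> nz \<mu> \<Longrightarrow> nz (\<lambda>i. t i * \<mu> i)"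
  and nz_1: "nz (\<lambda>i. 1)"
  by (auto simp: nz_def)

lemma X_ux: "i \<in> {1..n} \<Longrightarrow> X i (ux j) = (if i = j then 1 else 0)"
  by (auto simp: ev_def dest: ux_inj)

lemma sliced_tor:
  assumes "nz t" "i \<in> {1..n}"
  shows "sliced (tor t) (tor (\<lambda>i. inverse (t i))) i = X i"
  unfolding sliced_def
proof (rule normalise_X[OF _ assms(2)])
  fix i assume i: "i \<in> {1..n}"
  have "ytup (tor t) (tor (\<lambda>i. inverse (t i))) i = (\<Sum>j\<in>{1..n}. if i = j then X i else 0)"
    unfolding ytup_def
    using i assms(1) by (intro sum.cong refl) (auto simp: tor_X X_ux sc_apply nz_def)
  then show "ytup (tor t) (tor (\<lambda>i. inverse (t i))) i = X i" using i by simp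
qed

text \<open>With diagonal linear part, \<open>ytup\<close> only rescales the images of the
  generators. If its normal form is \<open>(x_i)\<close>, the normalising inner automorphism turns
  \<open>s\<close> into \<open>x_i -> t_i x_i\<close>.\<close>

lemma tor_if_sliced:
  assumes s: "inv_pair s s'" and sl: "\<And>i. i \<in> {1..n} \<Longrightarrow> sliced s s' i = X i"
    and off: "\<And>i j. i \<in> {1..n} \<Longrightarrow> j \<in> {1..n} \<Longrightarrow> i \<noteq> j \<Longrightarrow> s (X i) (ux j) = 0"
  shows "\<exists>f\<in>cinner. \<exists>t. nz t \<and> tor t = (\<lambda>v. f (s v))"
proof -
  define t where "t i = s (X i) (ux i)" for i
  note cs = inv_pair_chom[OF s]
  have e: "t i * s' (X i) (ux j) = (if i = j then 1 else 0)" if ij: "i \<in> {1..n}" "j \<in> {1..n}" for i j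
  proof -
    have "s' (s (X i)) = X i" using s ij by (simp add: inv_pair_def proj_VM)
    then have "(if i = j then 1 else 0) = (\<Sum>l\<in>{1..n}. s (X i) (ux l) * s' (X l) (ux j))"
      using linear_coeff_comp[OF cs(2,1) ij] X_ux[OF ij(1), of j] by simp
    also have "\<dots> = (\<Sum>l\<in>{1..n}. if i = l then t i * s' (X i) (ux j) else 0)"
      using off ij by (intro sum.cong refl) (auto simp: t_def)
    finally show ?thesis using ij by simp
  qed
  have nz: "nz t" unfolding nz_def using e by force
  obtain f where f: "f \<in> cinner" "\<And>i. i \<in> {1..n} \<Longrightarrow> sliced s s' i = f (ytup s s' i)" using sliced_conj[OF s] by blast
  note cf = cinner_chom[OF f(1)]
  have "tor t (X i) = f (s (X i))" if i: "i \<in> {1..n}" for i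
  proof -
    have "ytup s s' i = (\<Sum>j\<in>{1..n}. if i = j then sc (s' (X i) (ux i)) (s (X i)) else 0)"
      unfolding ytup_def
    proof (intro sum.cong refl)
      fix j assume j: "j \<in> {1..n}"
      show "sc (s' (X i) (ux j)) (s (X j)) = (if i = j then sc (s' (X i) (ux i)) (s (X i)) else 0)"
        using e[OF i j] nz i by (auto simp: nz_def)
    qed
    then have y: "ytup s s' i = sc (s' (X i) (ux i)) (s (X i))" using i by simp
    have "X i = f (ytup s s' i)" using f(2)[OF i] sl[OF i] by metis
    then have "X i = sc (s' (X i) (ux i)) (f (s (X i)))" unfolding y lin_sc[OF chom_lin[OF cf]] .
    then have "sc (t i) (X i) = sc (t i) (sc (s' (X i) (ux i)) (f (s (X i))))" by (rule arg_cong)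
    then have "sc (t i) (X i) = sc (t i * s' (X i) (ux i)) (f (s (X i)))" unfolding fv.scale_scale .
    then show ?thesis using e[OF i i] i by (simp add: tor_X)
  qed
  then have "tor t = (\<lambda>v. f (s v))" by (rule chom_eqI[OF chom_tor chom_comp[OF cf cs(1)]])
  then show ?thesis using f(1) nz by blast
qed

end

context qalg
begin

abbreviation tcl :: "(nat \<Rightarrow> 'k) \<Rightarrow> ('a \<Rightarrow> 'a) set"
  where "tcl t \<equiv> out_class A (low (tor t))"

definition HT :: "('a \<Rightarrow> 'a) set set"
  where "HT = tcl ` {t. nz t}"

lemma tor_AA: "nz t \<Longrightarrow> low (tor t) \<in> AA"
  by (rule low_AA[OF inv_pair_tor])

lemma up_tor: "up (low (tor t)) = tor t"
  by (rule up_low_chom[OF chom_tor])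

lemma upi_tor: "nz t \<Longrightarrow> upi (low (tor t)) = tor (\<lambda>i. inverse (t i))"
  by (rule upi_low[OF inv_pair_tor])

lemma tcl_Out: "nz t \<Longrightarrow> tcl t \<in> carrier (Out A)"
  using tor_AA by (simp add: Out_carrier)

lemma tcl_mult: "nz t \<Longrightarrow> nz \<mu> \<Longrightarrow> tcl t \<otimes>\<^bsub>Out A\<^esub> tcl \<mu> = tcl (\<lambda>i. t i * \<mu> i)"
  using Out_mult[OF tor_AA tor_AA, of t \<mu>] Aut_mult[OF inv_pair_tor inv_pair_tor, of t \<mu>]
  by (simp add: tor_comp)

lemma HT_subgroup: "subgroup HT (Out A)"
proof -
  interpret O: group "Out A" by (rule group_Out)
  show ?thesis
  proof (rule O.subgroupI)
    show "HT \<subseteq> carrier (Out A)" using tcl_Out by (auto simp: HT_def)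
    show "HT \<noteq> {}" using nz_1 by (auto simp: HT_def)
  next
    fix c assume "c \<in> HT"
    then obtain t where l: "nz t" "c = tcl t" by (auto simp: HT_def)
    have "tor (\<lambda>i. inverse (t i) * t i) = proj" by (rule tor_1) (use l in \<open>simp add: nz_def\<close>)
    then have "tcl (\<lambda>i. inverse (t i)) \<otimes>\<^bsub>Out A\<^esub> c = \<one>\<^bsub>Out A\<^esub>"
      by (simp add: l tcl_mult nz_inverse Out_one)
    then have "inv\<^bsub>Out A\<^esub> c = tcl (\<lambda>i. inverse (t i))"
      using l by (intro O.inv_equality) (simp_all add: tcl_Out nz_inverse)
    then show "inv\<^bsub>Out A\<^esub> c \<in> HT" using nz_inverse[OF l(1)] by (auto simp: HT_def)
  next
    fix c d assume "c \<in> HT" "d \<in> HT"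
    then show "c \<otimes>\<^bsub>Out A\<^esub> d \<in> HT" using nz_mult by (auto simp: HT_def tcl_mult)
  qed
qed

lemma invf_diff_const: "invf G \<Longrightarrow> invf (\<lambda>\<sigma>. G \<sigma> - c)"
  using regf_diff[OF _ regf_const, of G c] unfolding invf_def by metis

text \<open>Two families of equations cut out the diagonal classes: slice coordinates equal to those
  of \<open>(x_i)\<close>, and vanishing off-diagonal linear coefficients. Both are given by
  invariant functions.\<close>

lemma HT_closed: "closed_subgroup HT (Out A)"
proof -
  define S where "S = {outf (\<lambda>\<sigma>. sliced (up \<sigma>) (upi \<sigma>) i a - X i a) | i a. i \<in> {1..n}} \<union>
    {outf (\<lambda>\<sigma>. up \<sigma> (X i) (ux j)) | i j. i \<in> {1..n} \<and> j \<in> {1..n} \<and> i \<noteq> j}"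
  note inv1 = invf_diff_const[OF invf_sliced] and inv2 = invf_up
  have "S \<subseteq> regular (Out A)"
    unfolding S_def using outf_regular[OF inv1] outf_regular[OF inv2] by blast
  moreover have "HT = {c \<in> carrier (Out A). \<forall>f\<in>S. f c = 0}"
  proof (intro equalityI subsetI)
    fix c assume "c \<in> HT"
    then obtain t where l: "nz t" "c = tcl t" by (auto simp: HT_def)
    have "f c = 0" if "f \<in> S" for f
    proof -
      from that consider i a where "i \<in> {1..n}" "f = outf (\<lambda>\<sigma>. sliced (up \<sigma>) (upi \<sigma>) i a - X i a)"
        | i j where "i \<in> {1..n}" "j \<in> {1..n}" "i \<noteq> j" "f = outf (\<lambda>\<sigma>. up \<sigma> (X i) (ux j))"
        unfolding S_def by blast
      then show ?thesis
      proof cases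
        case 1
        then show ?thesis
          unfolding 1(2) l(2) outf_out_class[OF inv1[OF 1(1)] tor_AA[OF l(1)]]
          by (simp add: up_tor upi_tor[OF l(1)] sliced_tor[OF l(1)])
      next
        case 2
        show ?thesis
          unfolding 2(4) l(2) outf_out_class[OF inv2[OF 2(1,2)] tor_AA[OF l(1)]]
          using 2(3) by (simp add: up_tor tor_X[OF 2(1)] sc_apply X_ux[OF 2(1)])
      qed
    qed
    then show "c \<in> {c \<in> carrier (Out A). \<forall>f\<in>S. f c = 0}" using tcl_Out[OF l(1)] l(2) by simp
  next
    fix c assume c: "c \<in> {c \<in> carrier (Out A). \<forall>f\<in>S. f c = 0}"
    then obtain \<sigma> where \<sigma>: "\<sigma> \<in> AA" "c = out_class A \<sigma>" by (auto simp: Out_carrier)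
    have "sliced (up \<sigma>) (upi \<sigma>) i = X i" if i: "i \<in> {1..n}" for i
    proof
      fix a
      have "outf (\<lambda>\<sigma>. sliced (up \<sigma>) (upi \<sigma>) i a - X i a) c = 0" using c i unfolding S_def by blast
      then show "sliced (up \<sigma>) (upi \<sigma>) i a = X i a"
        unfolding \<sigma>(2) outf_out_class[OF inv1[OF i] \<sigma>(1)] by simp
    qed
    moreover have "up \<sigma> (X i) (ux j) = 0" if ij: "i \<in> {1..n}" "j \<in> {1..n}" "i \<noteq> j" for i j
    proof -
      have "outf (\<lambda>\<sigma>. up \<sigma> (X i) (ux j)) c = 0" using c ij unfolding S_def by blast
      then show ?thesis unfolding \<sigma>(2) outf_out_class[OF inv2[OF ij(1,2)] \<sigma>(1)] .
    qed
    ultimately obtain f t where f: "f \<in> cinner" "nz t" "tor t = (\<lambda>v. f (up \<sigma> v))"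
      using tor_if_sliced[OF AA_up(1)[OF \<sigma>(1)]] by blast
    then have "tcl t = c"
      using out_class_eq_iff[OF tor_AA[OF f(2)] \<sigma>(1)] unfolding \<sigma>(2) up_tor by blast
    then show "c \<in> HT" using f(2) by (auto simp: HT_def)
  qed
  ultimately show ?thesis unfolding closed_subgroup_def using HT_subgroup by blast
qed

subsection \<open>Regular functions on the standard torus\<close>

lemma dual_tor:
  assumes l: "l \<in> dual_space A" and x: "x \<in> carrier A"
  shows "l (low (tor t) x) = (\<Sum>b\<in>M. (co x b * l (ve (ev b))) * pm t b)"
proof -
  have "tor t (co x) = (\<Sum>b\<in>M. sc (tor t (co x) b) (ev b))" by (rule VM_expand[OF chom_VM[OF chom_tor]])
  then have "l (ve (tor t (co x))) = (\<Sum>b\<in>M. tor t (co x) b * l (ve (ev b)))"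
    using dual_sum[OF l, of M ev "tor t (co x)"] by simp
  then show ?thesis using x by (simp add: tor_def proj_VM mult.assoc mult.commute mult.left_commute)
qed

text \<open>On the torus, matrix entries of an automorphism and of its inverse are combinations of
  monomials in the \<open>t_i\<close> and in their inverses. The principle serves twice: for
  functions on diagonal matrices and for Laurent polynomials along a one-parameter subgroup.\<close>

lemma regular_tor_induct:
  fixes P :: "((nat \<Rightarrow> 'k) \<Rightarrow> 'k) \<Rightarrow> bool"
  assumes cong: "\<And>f g. P f \<Longrightarrow> (\<And>t. nz t \<Longrightarrow> f t = g t) \<Longrightarrow> P g"
    and const: "\<And>c. P (\<lambda>_. c)"
    and add: "\<And>f g. P f \<Longrightarrow> P g \<Longrightarrow> P (\<lambda>t. f t + g t)"
    and mult: "\<And>f g. P f \<Longrightarrow> P g \<Longrightarrow> P (\<lambda>t. f t * g t)"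
    and coord: "\<And>i. i \<in> {1..n} \<Longrightarrow> P (\<lambda>t. t i)"
    and coord_inverse: "\<And>i. i \<in> {1..n} \<Longrightarrow> P (\<lambda>t. inverse (t i))"
    and G: "G \<in> regular (Aut A)"
  shows "P (\<lambda>t. G (low (tor t)))"
proof -
  have pow: "P (\<lambda>t. f t ^ k)" if "P f" for f k
    by (induction k) (auto intro: const mult that)
  have Psum: "P (\<lambda>t. \<Sum>x\<in>S. f x t)" if "\<And>x. x \<in> S \<Longrightarrow> P (f x)" for f and S :: "(nat \<Rightarrow> nat) set"
    using that by (induction S rule: infinite_finite_induct) (auto intro: const add)
  have Pprod: "P (\<lambda>t. \<Prod>x\<in>S. f x t)" if "\<And>x. x \<in> S \<Longrightarrow> P (f x)" for f and S :: "nat set"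
    using that by (induction S rule: infinite_finite_induct) (auto intro: const mult)
  have Ppm: "P (\<lambda>t. pm t b)" "P (\<lambda>t. pm (\<lambda>i. inverse (t i)) b)" for b
    unfolding pm_def by (intro Pprod pow coord coord_inverse; assumption)+
  show ?thesis
    using G unfolding Aut_regular
  proof (induction rule: generated_functions.induct)
    case (const c)
    show ?case by (rule cong[OF assms(2)[of c]]) (simp add: tor_AA)
  next
    case (add f g)
    show ?case by (rule cong[OF assms(3)[OF add.IH]]) (simp add: tor_AA)
  next
    case (mult f g)
    show ?case by (rule cong[OF assms(4)[OF mult.IH]]) (simp add: tor_AA)
  next
    case (gen f)
    then consider l x where "l \<in> dual_space A" "x \<in> carrier A" "f = (\<lambda>\<sigma>. l (\<sigma> x))"
      | l x where "l \<in> dual_space A" "x \<in> carrier A" "f = (\<lambda>\<sigma>. l ((inv\<^bsub>BijGroup (carrier A)\<^esub> \<sigma>) x))"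
      by blast
    then show ?case
    proof cases
      case 1
      have "P (\<lambda>t. \<Sum>b\<in>M. (co x b * l (ve (ev b))) * pm t b)" by (intro Psum assms(4) assms(2) Ppm)
      then show ?thesis
        by (rule cong) (simp add: 1(3) tor_AA dual_tor[OF 1(1,2)] del: low_apply)
    next
      case 2
      have "P (\<lambda>t. \<Sum>b\<in>M. (co x b * l (ve (ev b))) * pm (\<lambda>i. inverse (t i)) b)" by (intro Psum assms(4) assms(2) Ppm)
      then show ?thesis
        by (rule cong) (simp add: 2(3) tor_AA BijGroup_inv_low[OF inv_pair_tor] dual_tor[OF 2(1,2)] del: low_apply)
    qed
  qed
qed

abbreviation D\<^sub>n :: "'k mat set"
  where "D\<^sub>n \<equiv> carrier (diagonal_group n)"

abbreviation RD :: "('k mat \<Rightarrow> 'k) set"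
  where "RD \<equiv> regular (diagonal_group n)"

text \<open>Matrix indices start at 0 and the variables at 1, hence \<open>Suc\<close>.\<close>

definition dm :: "(nat \<Rightarrow> 'k) \<Rightarrow> 'k mat"
  where "dm t = mat_diag n (\<lambda>i. t (Suc i))"

lemma Dn_eq: "D\<^sub>n = {M \<in> carrier_mat n n. diagonal_mat M \<and> invertible_mat M}"
  by (simp add: diagonal_group_def Let_def)

lemma RD_eq: "RD = generated_functions D\<^sub>n ({\<lambda>M. M $$ (i, j) | i j. i < n \<and> j < n} \<union> {\<lambda>M. inverse (det M)})"
  by (simp add: diagonal_group_def Let_def)

lemma dm_carrier: "dm t \<in> carrier_mat n n" "diagonal_mat (dm t)"
  by (auto simp: dm_def mat_diag_def diagonal_mat_def)

lemma dm_mult: "dm s * dm t = dm (\<lambda>i. s i * t i)"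
  by (simp add: dm_def)

lemma dm_Dn: "nz t \<Longrightarrow> dm t \<in> D\<^sub>n"
proof -
  assume l: "nz t"
  have one: "dm \<mu> = 1\<^sub>m n" if "\<And>i. i \<in> {1..n} \<Longrightarrow> \<mu> i = 1" for \<mu>
    by (rule eq_matI) (auto simp: dm_def mat_diag_def that)
  have "dm t * dm (\<lambda>i. inverse (t i)) = 1\<^sub>m n" "dm (\<lambda>i. inverse (t i)) * dm t = 1\<^sub>m n"
    unfolding dm_mult by (rule one, use l in \<open>simp add: nz_def\<close>)+
  then have "invertible_mat (dm t)"
    unfolding invertible_mat_def inverts_mat_def
    by (intro conjI exI[of _ "dm (\<lambda>i. inverse (t i))"]) (simp_all add: dm_def mat_diag_def)
  then show ?thesis using dm_carrier by (simp add: Dn_eq)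
qed

lemma Dn_dm: "N \<in> D\<^sub>n \<Longrightarrow> \<exists>t. nz t \<and> N = dm t"
proof -
  assume "N \<in> D\<^sub>n"
  then have N: "N \<in> carrier_mat n n" "diagonal_mat N" "invertible_mat N" by (auto simp: Dn_eq)
  define t where "t i = N $$ (i - 1, i - 1)" for i
  have "N = dm t" using N(1,2) by (intro eq_matI) (auto simp: dm_def mat_diag_def t_def diagonal_mat_def)
  moreover have "N $$ (i, i) \<noteq> 0" if "i < n" for i
    using det_invertible_mat[OF N(1,3)] det_diagonal_mat[OF N(1,2)] that by auto
  then have "nz t" by (auto simp: nz_def t_def)
  ultimately show ?thesis by blast
qed

lemma det_dm: "det (dm t) = (\<Prod>i\<in>{1..n}. t i)"
proof -
  have "det (dm t) = (\<Prod>i<n. t (Suc i))"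
    unfolding det_diagonal_mat[OF dm_carrier] by (rule prod.cong) (auto simp: dm_def mat_diag_def)
  also have "\<dots> = (\<Prod>i\<in>{1..n}. t i)"
    by (rule prod.reindex_bij_witness[of _ "\<lambda>i. i - 1" Suc]) auto
  finally show ?thesis .
qed

lemma regular_tor_diagonal:
  assumes "G \<in> regular (Aut A)"
  shows "\<exists>g\<in>RD. \<forall>t. nz t \<longrightarrow> G (low (tor t)) = g (dm t)"
proof (rule regular_tor_induct[OF _ _ _ _ _ _ assms, where P = "\<lambda>f. \<exists>g\<in>RD. \<forall>t. nz t \<longrightarrow> f t = g (dm t)"])
  show "\<exists>g\<in>RD. \<forall>t. nz t \<longrightarrow> f' t = g (dm t)"
    if "\<exists>g\<in>RD. \<forall>t. nz t \<longrightarrow> f t = g (dm t)" "\<And>t. nz t \<Longrightarrow> f t = f' t" for f f'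
    using that by metis
  show const: "\<exists>g\<in>RD. \<forall>t. nz t \<longrightarrow> c = g (dm t)" for c
  proof -
    have "(\<lambda>x\<in>D\<^sub>n. c) \<in> RD" unfolding RD_eq by (rule generated_functions.const)
    then show ?thesis using dm_Dn by (intro bexI) auto
  qed
  show "\<exists>g\<in>RD. \<forall>t. nz t \<longrightarrow> f t + f' t = g (dm t)"
    if f: "\<exists>g\<in>RD. \<forall>t. nz t \<longrightarrow> f t = g (dm t)" "\<exists>g\<in>RD. \<forall>t. nz t \<longrightarrow> f' t = g (dm t)" for f f'
  proof -
    obtain g g' where g: "g \<in> RD" "\<And>t. nz t \<Longrightarrow> f t = g (dm t)" "g' \<in> RD" "\<And>t. nz t \<Longrightarrow> f' t = g' (dm t)"
      using f by blast
    have "(\<lambda>M\<in>D\<^sub>n. g M + g' M) \<in> RD" using g(1,3) unfolding RD_eq by (rule generated_functions.add)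
    then show ?thesis using g(2,4) dm_Dn by (intro bexI) auto
  qed
  show mult: "\<exists>g\<in>RD. \<forall>t. nz t \<longrightarrow> f t * f' t = g (dm t)"
    if f: "\<exists>g\<in>RD. \<forall>t. nz t \<longrightarrow> f t = g (dm t)" "\<exists>g\<in>RD. \<forall>t. nz t \<longrightarrow> f' t = g (dm t)" for f f'
  proof -
    obtain g g' where g: "g \<in> RD" "\<And>t. nz t \<Longrightarrow> f t = g (dm t)" "g' \<in> RD" "\<And>t. nz t \<Longrightarrow> f' t = g' (dm t)"
      using f by blast
    have "(\<lambda>M\<in>D\<^sub>n. g M * g' M) \<in> RD" using g(1,3) unfolding RD_eq by (rule generated_functions.mult)
    then show ?thesis using g(2,4) dm_Dn by (intro bexI) auto
  qed
  show coord: "\<exists>g\<in>RD. \<forall>t. nz t \<longrightarrow> t i = g (dm t)" if i: "i \<in> {1..n}" for i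
  proof -
    have "restrict (\<lambda>M. M $$ (i - 1, i - 1)) D\<^sub>n \<in> RD"
      unfolding RD_eq
    proof (rule generated_functions.gen)
      have "i - 1 < n" using i by auto
      then show "(\<lambda>M. M $$ (i - 1, i - 1)) \<in> {\<lambda>M. M $$ (i, j) | i j. i < n \<and> j < n} \<union> {\<lambda>M. inverse (det M)}" by blast
    qed
    then show ?thesis using dm_Dn i by (intro bexI) (auto simp: dm_def mat_diag_def)
  qed
  \<comment> \<open>The generators contain only the inverse determinant; the inverse of one entry is
    that times the product of the other entries.\<close>
  show "\<exists>g\<in>RD. \<forall>t. nz t \<longrightarrow> inverse (t i) = g (dm t)" if i: "i \<in> {1..n}" for i
  proof -
    have "restrict (\<lambda>M. inverse (det M)) D\<^sub>n \<in> RD"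
      unfolding RD_eq by (rule generated_functions.gen) blast
    then have 1: "\<exists>g\<in>RD. \<forall>t. nz t \<longrightarrow> inverse (\<Prod>i\<in>{1..n}. t i) = g (dm t)"
      using dm_Dn by (intro bexI) (auto simp: det_dm)
    have 2: "\<exists>g\<in>RD. \<forall>t. nz t \<longrightarrow> (\<Prod>j\<in>J. t j) = g (dm t)" if "J \<subseteq> {1..n}" for J
      using finite_subset[OF that finite_atLeastAtMost] that
    proof (induction J rule: finite_induct)
      case empty
      then show ?case using const[of 1] by simp
    next
      case (insert j J)
      then show ?case using mult[OF coord[of j]] by simp
    qed
    have "inverse (\<Prod>i\<in>{1..n}. t i) * (\<Prod>j\<in>{1..n} - {i}. t j) = inverse (t i)" if "nz t" for t
    proof -
      have "(\<Prod>j\<in>{1..n} - {i}. t j) \<noteq> 0" using that by (auto simp: nz_def)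
      then show ?thesis using prod.remove[of "{1..n}" i t] i by (simp add: field_simps)
    qed
    then show ?thesis using mult[OF 1 2[of "{1..n} - {i}"]] by auto
  qed
qed

text \<open>Linear coefficients are unchanged by inner automorphisms, so the diagonal ones can be
  read off from an outer class.\<close>

definition diag_coord :: "('a \<Rightarrow> 'a) set \<Rightarrow> 'k mat"
  where "diag_coord c = dm (\<lambda>i. outf (\<lambda>\<sigma>. up \<sigma> (X i) (ux i)) c)"

lemma diag_coord_tcl:
  assumes l: "nz t"
  shows "diag_coord (tcl t) = dm t"
proof -
  have "outf (\<lambda>\<sigma>. up \<sigma> (X i) (ux i)) (tcl t) = t i" if i: "i \<in> {1..n}" for i
    unfolding outf_out_class[OF invf_up[OF i i] tor_AA[OF l]]
    by (simp add: up_tor tor_X[OF i] sc_apply X_ux[OF i])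
  then show ?thesis unfolding diag_coord_def dm_def mat_diag_def by (intro eq_matI) auto
qed

lemma dm_inj: "dm t = dm \<mu> \<Longrightarrow> tcl t = tcl \<mu>"
proof -
  assume e: "dm t = dm \<mu>"
  have "t i = \<mu> i" if "i \<in> {1..n}" for i
  proof -
    have "dm t $$ (i - 1, i - 1) = dm \<mu> $$ (i - 1, i - 1)" using e by simp
    then show ?thesis using that by (auto simp: dm_def mat_diag_def)
  qed
  then show ?thesis using tor_eqI by metis
qed

lemma diag_coord_iso: "diag_coord \<in> iso (alg_subgroup (Out A) HT) (diagonal_group n)"
proof -
  have "bij_betw diag_coord HT D\<^sub>n"
    unfolding bij_betw_def
  proof
    show "inj_on diag_coord HT"
      by (rule inj_onI) (unfold HT_def, elim imageE CollectE, simp only: diag_coord_tcl, rule dm_inj)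
    show "diag_coord ` HT = D\<^sub>n"
      using Dn_dm dm_Dn by (force simp: HT_def image_iff diag_coord_tcl)
  qed
  moreover have "diag_coord (c \<otimes>\<^bsub>Out A\<^esub> d) = diag_coord c * diag_coord d" "diag_coord c \<in> D\<^sub>n"
    if "c \<in> HT" "d \<in> HT" for c d
    using that by (auto simp: HT_def tcl_mult diag_coord_tcl nz_mult dm_mult dm_Dn)
  ultimately show ?thesis
    by (auto simp: iso_def hom_def alg_subgroup_def) (auto simp: diagonal_group_def Let_def)
qed

lemma diagonal_regular_lift:
  assumes "g \<in> RD"
  shows "\<exists>f\<in>regular (Out A). \<forall>c\<in>HT. f c = g (diag_coord c)"
  using assms unfolding RD_eq
proof (induction rule: generated_functions.induct)
  case (const b)
  have "\<forall>c\<in>HT. (\<lambda>x\<in>carrier (Out A). b) c = (\<lambda>x\<in>D\<^sub>n. b) (diag_coord c)"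
    by (auto simp: HT_def tcl_Out diag_coord_tcl dm_Dn)
  then show ?case using regular_Out_const by blast
next
  case (add g1 g2)
  then obtain f1 f2 where f: "f1 \<in> regular (Out A)" "\<forall>c\<in>HT. f1 c = g1 (diag_coord c)"
    "f2 \<in> regular (Out A)" "\<forall>c\<in>HT. f2 c = g2 (diag_coord c)" by blast
  have "\<forall>c\<in>HT. (\<lambda>x\<in>carrier (Out A). f1 x + f2 x) c = (\<lambda>x\<in>D\<^sub>n. g1 x + g2 x) (diag_coord c)"
    using f(2,4) by (auto simp: HT_def tcl_Out diag_coord_tcl dm_Dn)
  then show ?case using regular_Out_add[OF f(1,3)] by blast
next
  case (mult g1 g2)
  then obtain f1 f2 where f: "f1 \<in> regular (Out A)" "\<forall>c\<in>HT. f1 c = g1 (diag_coord c)"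
    "f2 \<in> regular (Out A)" "\<forall>c\<in>HT. f2 c = g2 (diag_coord c)" by blast
  have "\<forall>c\<in>HT. (\<lambda>x\<in>carrier (Out A). f1 x * f2 x) c = (\<lambda>x\<in>D\<^sub>n. g1 x * g2 x) (diag_coord c)"
    using f(2,4) by (auto simp: HT_def tcl_Out diag_coord_tcl dm_Dn)
  then show ?case using regular_Out_mult[OF f(1,3)] by blast
next
  case (gen g)
  then consider i j where "g = (\<lambda>M. M $$ (i, j))" "i < n" "j < n" | "g = (\<lambda>M. inverse (det M))" by blast
  then show ?case
  proof cases
    case 1
    show ?thesis
    proof (cases "i = j")
      case True
      have i: "Suc i \<in> {1..n}" using 1 by simp
      have "\<forall>c\<in>HT. outf (\<lambda>\<sigma>. up \<sigma> (X (Suc i)) (ux (Suc i))) c = restrict g D\<^sub>n (diag_coord c)"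
      proof
        fix c assume "c \<in> HT"
        then obtain t where t: "nz t" "c = tcl t" by (auto simp: HT_def)
        have "outf (\<lambda>\<sigma>. up \<sigma> (X (Suc i)) (ux (Suc i))) c = t (Suc i)"
          unfolding t(2) outf_out_class[OF invf_up[OF i i] tor_AA[OF t(1)]] up_tor tor_X[OF i] sc_apply X_ux[OF i] by simp
        then show "outf (\<lambda>\<sigma>. up \<sigma> (X (Suc i)) (ux (Suc i))) c = restrict g D\<^sub>n (diag_coord c)"
          using 1 True t dm_Dn by (simp add: diag_coord_tcl) (simp add: dm_def mat_diag_def)
      qed
      then show ?thesis using outf_regular[OF invf_up[OF i i]] by blast
    next
      case False
      have "\<forall>c\<in>HT. (\<lambda>x\<in>carrier (Out A). 0) c = restrict g D\<^sub>n (diag_coord c)"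
        using 1 False by (auto simp: HT_def tcl_Out diag_coord_tcl dm_Dn) (simp add: dm_def mat_diag_def)
      then show ?thesis using regular_Out_const by blast
    qed
  next
    case 2
    \<comment> \<open>The inverse determinant is lifted through the diagonal linear coefficients of
      the inverse automorphism.\<close>
    define G where "G \<sigma> = (\<Prod>i\<in>{1..n}. upi \<sigma> (X i) (ux i))" for \<sigma>
    have G: "invf G"
      unfolding invf_def
    proof (intro conjI ballI impI)
      show "regf G" unfolding G_def by (intro regf_prod regf_upi)
      fix \<sigma> \<tau> assume st: "\<sigma> \<in> AA" "\<tau> \<in> AA" "out_class A \<sigma> = out_class A \<tau>"
      have "upi \<sigma> (X i) (ux i) = upi \<tau> (X i) (ux i)" if "i \<in> {1..n}" for i
        using invf_upi[OF that that] st unfolding invf_def by blast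
      then show "G \<sigma> = G \<tau>" unfolding G_def by (intro prod.cong refl)
    qed
    have "G (low (tor t)) = inverse (det (dm t))" if l: "nz t" for t
    proof -
      have "G (low (tor t)) = (\<Prod>i\<in>{1..n}. inverse (t i))"
        unfolding G_def by (rule prod.cong) (auto simp: upi_tor[OF l] tor_X sc_apply X_ux)
      also have "\<dots> = inverse (det (dm t))" unfolding det_dm using prod_dividef[of "\<lambda>_. 1" t "{1..n}"] by (simp add: divide_inverse)
      finally show ?thesis .
    qed
    then have "\<forall>c\<in>HT. outf G c = restrict g D\<^sub>n (diag_coord c)"
      using 2 by (auto simp: HT_def diag_coord_tcl dm_Dn outf_out_class[OF G tor_AA])
    then show ?thesis using outf_regular[OF G] by blast
  qed
qed

lemma HT_isomorphic: "alg_group_isomorphic (alg_subgroup (Out A) HT) (diagonal_group n :: ('k mat, 'k) alg_group)"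
  unfolding alg_group_isomorphic_def
proof (intro bexI[OF _ diag_coord_iso] ballI)
  fix f :: "'k mat \<Rightarrow> 'k" assume ext: "f \<in> extensional D\<^sub>n"
  have "f \<in> RD \<longleftrightarrow> compose HT f diag_coord \<in> (\<lambda>h. restrict h HT) ` regular (Out A)"
  proof
    assume "f \<in> RD"
    then obtain h where h: "h \<in> regular (Out A)" "\<forall>c\<in>HT. h c = f (diag_coord c)" using diagonal_regular_lift by blast
    then have "compose HT f diag_coord = restrict h HT" unfolding compose_def by (intro restrict_ext) simp
    then show "compose HT f diag_coord \<in> (\<lambda>h. restrict h HT) ` regular (Out A)" using h(1) by blast
  next
    assume "compose HT f diag_coord \<in> (\<lambda>h. restrict h HT) ` regular (Out A)"
    then obtain h where h: "h \<in> regular (Out A)" "compose HT f diag_coord = restrict h HT" by blast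
    have fh: "f (diag_coord c) = h c" if "c \<in> HT" for c
      using fun_cong[OF h(2), of c] that by (simp add: compose_def)
    have "compose AA h (out_class A) \<in> regular (Aut A)" using h(1) by (simp add: Out_def Let_def)
    from regular_tor_diagonal[OF this] obtain g
      where g: "g \<in> RD" "\<And>t. nz t \<Longrightarrow> compose AA h (out_class A) (low (tor t)) = g (dm t)" by blast
    have "f N = g N" if N: "N \<in> D\<^sub>n" for N
    proof -
      obtain t where l: "nz t" "N = dm t" using Dn_dm[OF N] by blast
      then have "f N = h (tcl t)" using fh[of "tcl t"] by (auto simp: diag_coord_tcl HT_def)
      also have "\<dots> = g N" using g(2)[OF l(1)] l by (simp add: compose_def tor_AA)
      finally show ?thesis .
    qed
    moreover have "g \<in> extensional D\<^sub>n" using g(1) unfolding RD_eq by (rule generated_functions_extensional)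
    ultimately have "f = g" using ext by (intro extensionalityI) auto
    then show "f \<in> RD" using g(1) by simp
  qed
  then show "f \<in> RD \<longleftrightarrow> compose (carrier (alg_subgroup (Out A) HT)) f diag_coord \<in> regular (alg_subgroup (Out A) HT)"
    by (simp add: alg_subgroup_def)
qed

subsection \<open>The Lie algebra of the standard torus\<close>

lemma out_differential_lie:
  assumes \<delta>: "\<delta> \<in> lie_algebra (Aut A)"
  shows "out_differential A \<delta> \<in> lie_algebra (Out A)"
proof -
  let ?p = "\<lambda>f. compose AA f (out_class A)"
  have pull: "?p f \<in> regular (Aut A)" if "f \<in> regular (Out A)" for f
    using that by (simp add: Out_def Let_def)
  have d: "\<delta> (\<lambda>x\<in>AA. c * f x) = c * \<delta> f" "\<delta> (\<lambda>x\<in>AA. f x + g x) = \<delta> f + \<delta> g"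
    "\<delta> (\<lambda>x\<in>AA. f x * g x) = \<delta> f * g (low proj) + f (low proj) * \<delta> g"
    if "f \<in> regular (Aut A)" "g \<in> regular (Aut A)" for f g c
    using \<delta> that unfolding lie_algebra_def Aut_carrier Aut_one by blast+
  have e: "?p (\<lambda>x\<in>carrier (Out A). c * f x) = (\<lambda>x\<in>AA. c * ?p f x)"
    "?p (\<lambda>x\<in>carrier (Out A). f x + g x) = (\<lambda>x\<in>AA. ?p f x + ?p g x)"
    "?p (\<lambda>x\<in>carrier (Out A). f x * g x) = (\<lambda>x\<in>AA. ?p f x * ?p g x)" for f g :: "('a \<Rightarrow> 'a) set \<Rightarrow> 'k" and c
    unfolding compose_def by (rule restrict_ext, simp add: Out_carrier)+
  have one: "?p f (low proj) = f \<one>\<^bsub>Out A\<^esub>" for f :: "('a \<Rightarrow> 'a) set \<Rightarrow> 'k"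
    by (simp add: compose_def low_AA[OF inv_pair_proj] Out_one)
  have od: "out_differential A \<delta> f = \<delta> (?p f)" if "f \<in> regular (Out A)" for f
    using that by (simp add: out_differential_def)
  show ?thesis
    unfolding lie_algebra_def
  proof (intro CollectI IntI conjI allI ballI)
    show "out_differential A \<delta> \<in> extensional (regular (Out A))"
      unfolding out_differential_def by (rule restrict_extensional)
    show "out_differential A \<delta> (\<lambda>x\<in>carrier (Out A). c * f x) = c * out_differential A \<delta> f"
      if "f \<in> regular (Out A)" for c f
      unfolding od[OF that] od[OF regular_Out_cmult[OF that]] e by (rule d(1)[OF pull pull]) fact+
    fix f g assume fg: "f \<in> regular (Out A)" "g \<in> regular (Out A)"
    show "out_differential A \<delta> (\<lambda>x\<in>carrier (Out A). f x + g x) = out_differential A \<delta> f + out_differential A \<delta> g"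
      unfolding od[OF fg(1)] od[OF fg(2)] od[OF regular_Out_add[OF fg]] e by (rule d(2)[OF pull[OF fg(1)] pull[OF fg(2)]])
    show "out_differential A \<delta> (\<lambda>x\<in>carrier (Out A). f x * g x) =
        out_differential A \<delta> f * g \<one>\<^bsub>Out A\<^esub> + f \<one>\<^bsub>Out A\<^esub> * out_differential A \<delta> g"
      unfolding od[OF fg(1)] od[OF fg(2)] od[OF regular_Out_mult[OF fg]] e one[symmetric]
      by (rule d(3)[OF pull[OF fg(1)] pull[OF fg(2)]])
  qed
qed

text \<open>The tangent vector is differentiation at s = 1 along the subgroup scaling
  \<open>x_i\<close> by s, on which regular functions are Laurent polynomials. The factor
  \<open>s ^ b i\<close> on \<open>x^b\<close> has derivative \<open>b i\<close>, the eigenvalue of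
  \<open>dg (unit_fun i)\<close>. Characteristic zero supplies the infinite field.\<close>

lemma dg_lie_rep:
  assumes char: "CHAR('k) = 0" and i: "i \<in> {1..n}"
  shows "\<exists>\<delta>. lie_rep HT \<delta> (dg (unit_fun i))"
proof -
  have inf: "infinite (UNIV :: 'k set)" using char finite_imp_CHAR_pos[where 'a = 'k] by auto
  define \<Lambda> where "\<Lambda> s = (\<lambda>j. if j = i then s else 1 :: 'k)" for s
  have nz\<Lambda>: "nz (\<Lambda> s)" if "s \<noteq> 0" for s using that by (auto simp: nz_def \<Lambda>_def)
  define pt where "pt s = low (tor (\<Lambda> s))" for s
  have pt: "pt s \<in> AA" if "s \<noteq> 0" for s unfolding pt_def by (rule tor_AA[OF nz\<Lambda>[OF that]])
  have pt1: "pt 1 = low proj" unfolding pt_def by (subst tor_1) (auto simp: \<Lambda>_def)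
  have L: "laurent (\<lambda>s. G (pt s))" if G: "G \<in> regular (Aut A)" for G
  proof -
    have "laurent (\<lambda>s. (\<lambda>t. G (low (tor t))) (\<Lambda> s))"
    proof (rule regular_tor_induct[OF _ _ _ _ _ _ G, where P = "\<lambda>f. laurent (\<lambda>s. f (\<Lambda> s))"])
      show "laurent (\<lambda>s. \<Lambda> s j)" for j unfolding \<Lambda>_def by (cases "j = i") (simp_all add: laurent_closure)
      show "laurent (\<lambda>s. inverse (\<Lambda> s j))" for j unfolding \<Lambda>_def by (cases "j = i") (simp_all add: laurent_closure)
      show "laurent (\<lambda>s. g (\<Lambda> s))" if "laurent (\<lambda>s. f (\<Lambda> s))" "\<And>t. nz t \<Longrightarrow> f t = g t" for f g
        using that(1) by (rule laurent_closure(6)) (simp add: that(2) nz\<Lambda>)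
    qed (rule laurent_closure; assumption)+
    then show ?thesis by (simp only: pt_def)
  qed
  define \<delta> where "\<delta> = (\<lambda>G\<in>regular (Aut A). laurent_deriv (\<lambda>s. G (pt s)))"
  have \<delta>: "\<delta> G = laurent_deriv (\<lambda>s. G (pt s))" if "G \<in> regular (Aut A)" for G using that by (simp add: \<delta>_def)
  have cut: "laurent_deriv (\<lambda>s. (\<lambda>x\<in>AA. f x) (pt s)) = laurent_deriv (\<lambda>s. f (pt s))"
    if "laurent (\<lambda>s. f (pt s))" for f
    by (rule laurent_deriv_cong[OF inf that, symmetric]) (simp add: pt)
  have lie: "\<delta> \<in> lie_algebra (Aut A)"
    unfolding lie_algebra_def Aut_carrier Aut_one
  proof (intro CollectI IntI conjI allI ballI)
    show "\<delta> \<in> extensional (regular (Aut A))" unfolding \<delta>_def by (rule restrict_extensional)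
    show "\<delta> (\<lambda>x\<in>AA. c * f x) = c * \<delta> f" if f: "f \<in> regular (Aut A)" for c f
      unfolding \<delta>[OF f] \<delta>[OF regular_Aut_closed(1)[OF f]]
      by (subst cut) (simp_all add: laurent_closure L f laurent_deriv_cmult[OF inf])
    fix f g assume f: "f \<in> regular (Aut A)" and g: "g \<in> regular (Aut A)"
    show "\<delta> (\<lambda>x\<in>AA. f x + g x) = \<delta> f + \<delta> g"
      unfolding \<delta>[OF f] \<delta>[OF g] \<delta>[OF regular_Aut_closed(2)[OF f g]]
      by (subst cut) (simp_all add: laurent_closure L f g laurent_deriv_add[OF inf])
    show "\<delta> (\<lambda>x\<in>AA. f x * g x) = \<delta> f * g (low proj) + f (low proj) * \<delta> g"
      unfolding \<delta>[OF f] \<delta>[OF g] \<delta>[OF regular_Aut_closed(3)[OF f g]]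
      by (subst cut) (simp_all add: laurent_closure L f g laurent_deriv_mult[OF inf] pt1)
  qed
  have tangent: "\<delta> (\<lambda>\<sigma>\<in>AA. l (\<sigma> x)) = l (low (dg (unit_fun i)) x)" if l: "l \<in> dual_space A" and x: "x \<in> carrier A" for l x
  proof -
    define c where "c b = co x b * l (ve (ev b))" for b
    have "restrict (\<lambda>\<sigma>. l (\<sigma> x)) AA \<in> regular (Aut A)"
      unfolding Aut_regular by (rule generated_functions.gen) (use l x in blast)
    note 1 = \<delta>[OF this] and 2 = L[OF this]
    have pmL: "pm (\<Lambda> s) b = s ^ b i" for s b
    proof -
      have "pm (\<Lambda> s) b = (\<Prod>j\<in>{1..n}. if j = i then s ^ b i else 1)"
        unfolding pm_def by (rule prod.cong) (auto simp: \<Lambda>_def)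
      then show ?thesis using i by simp
    qed
    have lp: "laurent (\<lambda>s::'k. s ^ k)" for k using laurent_rep_power unfolding laurent_def by blast
    have "laurent_deriv (\<lambda>s. (\<lambda>\<sigma>\<in>AA. l (\<sigma> x)) (pt s)) = laurent_deriv (\<lambda>s. \<Sum>b\<in>M. c b * s ^ b i)"
    proof (rule laurent_deriv_cong[OF inf 2])
      fix s :: 'k assume "s \<noteq> 0"
      then have "(\<lambda>\<sigma>\<in>AA. l (\<sigma> x)) (pt s) = l (pt s x)" using pt by simp
      also have "\<dots> = (\<Sum>b\<in>M. c b * s ^ b i)" unfolding pt_def dual_tor[OF l x] pmL c_def ..
      finally show "(\<lambda>\<sigma>\<in>AA. l (\<sigma> x)) (pt s) = (\<Sum>b\<in>M. c b * s ^ b i)" .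
    qed
    also have "\<dots> = (\<Sum>b\<in>M. laurent_deriv (\<lambda>s. c b * s ^ b i))"
      by (rule laurent_sum(2)[OF inf]) (rule laurent_closure(5)[OF laurent_closure(1) lp])
    also have "\<dots> = (\<Sum>b\<in>M. c b * of_nat (b i))"
      by (intro sum.cong refl) (simp add: laurent_deriv_cmult[OF inf lp] laurent_deriv_power[OF inf])
    also have "\<dots> = l (low (dg (unit_fun i)) x)"
    proof -
      have w: "wt (unit_fun i) b = of_nat (b i)" for b
      proof -
        have "wt (unit_fun i) b = (\<Sum>j\<in>{1..n}. if j = i then of_nat (b i) else 0)"
          unfolding wt_def by (rule sum.cong) (auto simp: unit_fun_def)
        then show ?thesis using i by simp
      qed
      have "dg (unit_fun i) (co x) = (\<Sum>b\<in>M. sc (dg (unit_fun i) (co x) b) (ev b))"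
        by (rule VM_expand[OF cder_VM[OF cder_dg]])
      then have "l (ve (dg (unit_fun i) (co x))) = (\<Sum>b\<in>M. dg (unit_fun i) (co x) b * l (ve (ev b)))"
        using dual_sum[OF l, of M ev "dg (unit_fun i) (co x)"] by simp
      then show ?thesis using x by (simp add: dg_def w proj_VM c_def mult.assoc mult.commute mult.left_commute)
    qed
    finally show ?thesis using 1 by simp
  qed
  have "out_differential A \<delta> f = 0" if f: "f \<in> regular (Out A)" "\<forall>x\<in>HT. f x = 0" for f
  proof -
    have r: "compose AA f (out_class A) \<in> regular (Aut A)" using f(1) by (simp add: Out_def Let_def)
    have "out_differential A \<delta> f = laurent_deriv (\<lambda>s. compose AA f (out_class A) (pt s))"
      using f(1) \<delta>[OF r] by (simp add: out_differential_def)
    also have "\<dots> = laurent_deriv (\<lambda>s. 0)"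
    proof (rule laurent_deriv_cong[OF inf L[OF r]])
      fix s :: 'k assume s: "s \<noteq> 0"
      have "out_class A (pt s) \<in> HT" unfolding pt_def HT_def using nz\<Lambda>[OF s] by blast
      then show "compose AA f (out_class A) (pt s) = 0" using f(2) pt[OF s] by (simp add: compose_def)
    qed
    finally show ?thesis by (simp add: laurent_deriv_const[OF inf])
  qed
  then have "out_differential A \<delta> \<in> lie_subalgebra_of (Out A) HT"
    unfolding lie_subalgebra_of_def using out_differential_lie[OF lie] by blast
  moreover have "tangent_derivation A \<delta> (low (dg (unit_fun i)))"
    unfolding tangent_derivation_def Aut_carrier
    by (intro conjI lie low_derivations[OF cder_dg] ballI tangent)
  ultimately show ?thesis unfolding lie_rep_def using cder_dg by blast
qed

lemma torus_char_0_HT: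
  assumes char: "CHAR('k) = 0"
  shows "torus_char_0 A (lie_in_HH1 A HT)" and "cls (dg c) \<in> lie_in_HH1 A HT"
proof -
  show "torus_char_0 A (lie_in_HH1 A HT)"
    unfolding torus_char_0_def using HT_closed HT_isomorphic by blast
  have "cls (\<lambda>v. \<Sum>i\<in>{1..n}. sc (c i) (dg (unit_fun i) v)) \<in> lie_in_HH1 A HT"
  proof (rule cls_sum_mem[OF lie_in_HH1_submodule finite_atLeastAtMost])
    fix i assume "i \<in> {1..n}"
    then show "cder (dg (unit_fun i)) \<and> cls (dg (unit_fun i)) \<in> lie_in_HH1 A HT"
      using dg_lie_rep[OF char] cder_dg unfolding lie_in_HH1_eq by blast
  qed
  moreover have "dg (\<lambda>j. \<Sum>i\<in>{1..n}. c i * unit_fun i j) = dg c"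
  proof (intro ext)
    fix v a
    have "(\<Sum>i\<in>{1..n}. c i * unit_fun i j) = c j" if "j \<in> {1..n}" for j
    proof -
      have "(\<Sum>i\<in>{1..n}. c i * unit_fun i j) = (\<Sum>i\<in>{1..n}. if j = i then c j else 0)"
        by (rule sum.cong) (auto simp: unit_fun_def)
      then show ?thesis using that by simp
    qed
    then have "wt (\<lambda>j. \<Sum>i\<in>{1..n}. c i * unit_fun i j) a = wt c a" unfolding wt_def by (intro sum.cong refl) simp
    then show "dg (\<lambda>j. \<Sum>i\<in>{1..n}. c i * unit_fun i j) v a = dg c v a" by (simp add: dg_def)
  qed
  ultimately show "cls (dg c) \<in> lie_in_HH1 A HT" by (simp only: dg_sum)
qed

end

section \<open>The quotient of the free algebra\<close>

abbreviation W :: "nat list \<Rightarrow> 'k::field \<Rightarrow> fword \<Rightarrow>\<^sub>0 'k"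
  where "W w \<equiv> Poly_Mapping.single (FWord w)"

lemma W_mult: "W u c * W v d = W (u @ v) (c * d)"
  by (simp add: mult_single plus_fword_def)

lemma W_Nil_mult: "W [] c * Poly_Mapping.single w d = Poly_Mapping.single w (c * d)"
  by (cases w) (simp add: W_mult)

lemma single_0_W: "Poly_Mapping.single 0 c = W [] c"
  by (simp add: zero_fword_def)

lemma one_W: "1 = W [] 1"
  by (metis single_one zero_fword_def)

lemma free_gen_power: "free_gen i ^ k = W (replicate k i) 1"
  by (induction k) (simp_all add: one_W free_gen_def W_mult)

lemma poly_mapping_expand: "f = (\<Sum>w\<in>Poly_Mapping.keys f. Poly_Mapping.single w (Poly_Mapping.lookup f w))"
proof (rule poly_mapping_eqI)
  fix k
  have "Poly_Mapping.lookup (\<Sum>w\<in>Poly_Mapping.keys f. Poly_Mapping.single w (Poly_Mapping.lookup f w)) k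
      = (\<Sum>w\<in>Poly_Mapping.keys f. if w = k then Poly_Mapping.lookup f k else 0)"
    unfolding lookup_sum by (rule sum.cong) (auto simp: lookup_single when_def)
  then show "Poly_Mapping.lookup f k = Poly_Mapping.lookup (\<Sum>w\<in>Poly_Mapping.keys f. Poly_Mapping.single w (Poly_Mapping.lookup f w)) k"
    by (simp add: in_keys_iff)
qed

lemma free_algebra_simps [simp]:
  "mult (free_algebra n) = (*)" "one (free_algebra n) = 1" "zero (free_algebra n) = 0" "add (free_algebra n) = (+)"
  "smult (free_algebra n) c f = W [] c * f"
  by (simp_all add: free_algebra_def single_0_W)

lemma free_algebra_carrier: "f \<in> carrier (free_algebra n) \<longleftrightarrow> (\<forall>w\<in>Poly_Mapping.keys f. set (letters w) \<subseteq> {1..n})"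
  by (simp add: free_algebra_def)

lemma W_carrier: "set w \<subseteq> {1..n} \<Longrightarrow> W w c \<in> carrier (free_algebra n)"
  by (simp add: free_algebra_carrier)

lemma free_algebra_closed:
  assumes "f \<in> carrier (free_algebra n)" "g \<in> carrier (free_algebra n)"
  shows "f + g \<in> carrier (free_algebra n)" "f * g \<in> carrier (free_algebra n)" "- f \<in> carrier (free_algebra n)"
    "f - g \<in> carrier (free_algebra n)"
proof -
  show "f + g \<in> carrier (free_algebra n)" "- f \<in> carrier (free_algebra n)" "f - g \<in> carrier (free_algebra n)"
    using assms keys_add[of f g] keys_diff[of f g] unfolding free_algebra_carrier by (auto; blast)+
  have "set (letters w) \<subseteq> {1..n}" if w: "w \<in> Poly_Mapping.keys (f * g)" for w
  proof -
    obtain u v where "u \<in> Poly_Mapping.keys f" "v \<in> Poly_Mapping.keys g" "w = u + v" using keys_mult[of f g] w by blast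
    then show ?thesis using assms unfolding free_algebra_carrier by (auto simp: plus_fword_def)
  qed
  then show "f * g \<in> carrier (free_algebra n)" unfolding free_algebra_carrier by blast
qed

lemma free_algebra_zero: "0 \<in> carrier (free_algebra n)"
  and free_algebra_one: "1 \<in> carrier (free_algebra n)"
  by (simp add: free_algebra_carrier) (simp add: one_W W_carrier)

lemma free_algebra_sum: "(\<And>x. x \<in> S \<Longrightarrow> f x \<in> carrier (free_algebra n)) \<Longrightarrow> sum f S \<in> carrier (free_algebra n)"
  by (induction S rule: infinite_finite_induct) (simp_all add: free_algebra_zero free_algebra_closed(1))

lemma ring_free_algebra: "ring (free_algebra n :: ('k::field, fword \<Rightarrow>\<^sub>0 'k) module)"
proof (rule ringI)
  show "abelian_group (free_algebra n :: ('k, fword \<Rightarrow>\<^sub>0 'k) module)"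
  proof (rule abelian_groupI)
    fix x :: "fword \<Rightarrow>\<^sub>0 'k" assume "x \<in> carrier (free_algebra n)"
    then show "\<exists>y\<in>carrier (free_algebra n). y \<oplus>\<^bsub>free_algebra n\<^esub> x = \<zero>\<^bsub>free_algebra n\<^esub>"
      by (intro bexI[of _ "- x"]) (simp_all add: free_algebra_closed)
  qed (simp_all add: free_algebra_closed free_algebra_zero add_ac)
  show "Group.monoid (free_algebra n :: ('k, fword \<Rightarrow>\<^sub>0 'k) module)"
    by (rule monoidI) (simp_all add: free_algebra_closed free_algebra_one mult.assoc)
qed (simp_all add: algebra_simps)

lemma free_algebra_a_inv: "f \<in> carrier (free_algebra n) \<Longrightarrow> \<ominus>\<^bsub>free_algebra n\<^esub> f = - (f :: fword \<Rightarrow>\<^sub>0 'k::field)"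
  using abelian_group.minus_equality[OF ring.is_abelian_group[OF ring_free_algebra], of n "- f" f]
  by (simp add: free_algebra_closed)

lemma free_algebra_a_minus:
  "f \<in> carrier (free_algebra n) \<Longrightarrow> g \<in> carrier (free_algebra n) \<Longrightarrow> f \<ominus>\<^bsub>free_algebra n\<^esub> g = f - (g :: fword \<Rightarrow>\<^sub>0 'k::field)"
  by (simp add: a_minus_def free_algebra_a_inv)

text \<open>Sorting \<open>x^a x^b\<close> moves each of the \<open>a j\<close> letters
  \<open>x_j\<close> past each of the \<open>b i\<close> letters \<open>x_i\<close> with i < j, and
  every exchange \<open>x_j x_i = q_ij^(-1) x_i x_j\<close> contributes one factor.\<close>

definition quantum_bichar :: "nat \<Rightarrow> (nat \<Rightarrow> nat \<Rightarrow> 'k::field) \<Rightarrow> (nat \<Rightarrow> nat) \<Rightarrow> 'k coords"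
  where "quantum_bichar n q a b = (\<Prod>j\<in>{1..n}. \<Prod>i\<in>{1..<j}. inverse (q i j) ^ (a j * b i))"

locale qci =
  fixes n :: nat and m :: "nat \<Rightarrow> nat" and q :: "nat \<Rightarrow> nat \<Rightarrow> 'k::alg_closed_field"
  assumes exponents: "\<And>i. i \<in> {1..n} \<Longrightarrow> m i \<ge> 2"
    and q_nz: "\<And>i j. 1 \<le> i \<Longrightarrow> i < j \<Longrightarrow> j \<le> n \<Longrightarrow> q i j \<noteq> 0"
begin

sublocale qcoord n m "quantum_bichar n q"
proof
  show "quantum_bichar n q a b \<noteq> 0" for a b using q_nz by (auto simp: quantum_bichar_def)
qed (simp_all add: exponents quantum_bichar_def plus_fun_apply distrib_left distrib_right power_add prod.distrib)

abbreviation FA :: "('k, fword \<Rightarrow>\<^sub>0 'k) module"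
  where "FA \<equiv> free_algebra n"

abbreviation I :: "(fword \<Rightarrow>\<^sub>0 'k) set"
  where "I \<equiv> Idl\<^bsub>FA\<^esub> (qci_relations n m q)"

lemma bichar_ux:
  assumes "i \<in> {1..n}"
  shows "quantum_bichar n q (ux i) b = (\<Prod>l\<in>{1..<i}. inverse (q l i) ^ b l)"
proof -
  have "quantum_bichar n q (ux i) b = (\<Prod>j\<in>{1..n}. if j = i then \<Prod>l\<in>{1..<i}. inverse (q l i) ^ b l else 1)"
    unfolding quantum_bichar_def by (rule prod.cong) (auto simp: ux_def)
  then show ?thesis using assms by simp
qed

primrec mw :: "nat list \<Rightarrow> 'k coords"
  where "mw [] = un" | "mw (i # w) = mul (X i) (mw w)"

lemma mw_VM [simp]: "mw w \<in> VM"
  by (cases w) simp_all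

lemma mw_append: "mw (u @ v) = mul (mw u) (mw v)"
  by (induction u) (simp_all add: mul_assoc)

text \<open>The evaluation homomorphism from the free algebra to the coordinate model; its kernel on
  \<open>FA\<close> will be the defining ideal.\<close>

definition cmap :: "(fword \<Rightarrow>\<^sub>0 'k) \<Rightarrow> 'k coords"
  where "cmap f = (\<Sum>w\<in>Poly_Mapping.keys f. sc (Poly_Mapping.lookup f w) (mw (letters w)))"

lemma cmap_superset:
  assumes "finite S" "Poly_Mapping.keys f \<subseteq> S"
  shows "cmap f = (\<Sum>w\<in>S. sc (Poly_Mapping.lookup f w) (mw (letters w)))"
  unfolding cmap_def by (rule sum.mono_neutral_left) (use assms in \<open>auto simp: in_keys_iff\<close>)

lemma cmap_VM: "cmap f \<in> VM"
  unfolding cmap_def by (intro VM_sum) simp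

lemma cmap_add: "cmap (f + g) = cmap f + cmap g"
proof -
  let ?S = "Poly_Mapping.keys f \<union> Poly_Mapping.keys g"
  have "finite ?S" by simp
  note s = cmap_superset[OF this]
  show ?thesis
    using s[of "f + g"] s[of f] s[of g] keys_add[of f g]
    by (simp add: lookup_add fv.scale_left_distrib sum.distrib)
qed

lemma cmap_0: "cmap 0 = 0"
  by (simp add: cmap_def)

lemma cmap_W: "cmap (W w c) = sc c (mw w)"
  using cmap_superset[of "{FWord w}" "W w c"] by (simp add: lookup_single)

lemma cmap_sum: "cmap (sum f S) = (\<Sum>x\<in>S. cmap (f x))"
  by (induction S rule: infinite_finite_induct) (simp_all add: cmap_0 cmap_add)

lemma cmap_single: "cmap (Poly_Mapping.single w c) = sc c (mw (letters w))"
  using cmap_W[of "letters w" c] by simp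

lemma cmap_mult: "cmap (f * g) = mul (cmap f) (cmap g)"
proof -
  have "f * g = (\<Sum>u\<in>Poly_Mapping.keys f. \<Sum>v\<in>Poly_Mapping.keys g.
      Poly_Mapping.single (u + v) (Poly_Mapping.lookup f u * Poly_Mapping.lookup g v))"
    by (subst poly_mapping_expand[of f], subst poly_mapping_expand[of g]) (simp only: sum_product mult_single)
  then have "cmap (f * g) = (\<Sum>u\<in>Poly_Mapping.keys f. \<Sum>v\<in>Poly_Mapping.keys g.
      sc (Poly_Mapping.lookup f u * Poly_Mapping.lookup g v) (mul (mw (letters u)) (mw (letters v))))"
    by (simp only: cmap_sum cmap_single plus_fword_def mw_append fword.sel)
  moreover have "mul (cmap f) (cmap g) = (\<Sum>u\<in>Poly_Mapping.keys f. \<Sum>v\<in>Poly_Mapping.keys g.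
      sc (Poly_Mapping.lookup f u * Poly_Mapping.lookup g v) (mul (mw (letters u)) (mw (letters v))))"
    unfolding cmap_def mul_sum_left unfolding mul_sum_right
    by (intro sum.cong refl) (simp add: mul_sc_left mul_sc_right mult.commute)
  ultimately show ?thesis by simp
qed

lemma cmap_minus: "cmap (- f) = - cmap f"
  using cmap_add[of f "- f"] cmap_0 by (simp add: eq_neg_iff_add_eq_0 add.commute)

lemma cmap_diff: "cmap (f - g) = cmap f - cmap g"
  using cmap_add[of f "- g"] cmap_minus[of g] by simp

text \<open>No letter smaller than \<open>k\<close> occurs in the monomial, so nothing is exchanged
  and the bicharacter contributes 1.\<close>

lemma mw_replicate:
  assumes k: "k \<in> {1..n}" and w: "mw w = ev b" and b: "\<And>i. i < k \<Longrightarrow> b i = 0"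
    and M: "(\<lambda>j. b j + (if j = k then r else 0)) \<in> M"
  shows "mw (replicate r k @ w) = ev (\<lambda>j. b j + (if j = k then r else 0))"
  using M
proof (induction r)
  case (Suc r)
  define c where "c = (\<lambda>j. b j + (if j = k then r else 0))"
  have e: "(\<lambda>j. b j + (if j = k then Suc r else 0)) = ux k + c"
    by (rule ext) (simp add: c_def ux_def plus_fun_apply)
  have M': "ux k + c \<in> M" using Suc.prems unfolding e .
  then have "c \<in> M" using M_addD by blast
  then have "mw (replicate r k @ w) = ev c" using Suc.IH unfolding c_def by blast
  moreover have "quantum_bichar n q (ux k) c = 1"
    unfolding bichar_ux[OF k] by (rule prod.neutral) (auto simp: c_def b)
  ultimately show ?case unfolding e using X_mul_ev[OF M'] by simp
qed (simp add: w)

definition oword :: "(nat \<Rightarrow> nat) \<Rightarrow> nat list"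
  where "oword a = concat (map (\<lambda>l. replicate (a l) l) [1..<Suc n])"

lemma set_segment: "set (concat (map (\<lambda>l. replicate (a l) l) [i..<j])) \<subseteq> {i..<j}"
  by auto

lemma oword_letters: "set (oword a) \<subseteq> {1..n}"
  using set_segment[of a 1 "Suc n"] unfolding oword_def by (simp add: atLeastLessThanSuc_atLeastAtMost)

lemma mw_oword:
  assumes a: "a \<in> M"
  shows "mw (oword a) = ev a"
proof -
  have "mw (concat (map (\<lambda>l. replicate (a l) l) [k..<Suc n])) = ev (\<lambda>j. if k \<le> j then a j else 0)"
    if "1 \<le> k" "k \<le> Suc n" for k
    using that(2,1)
  proof (induction k rule: inc_induct)
    case base
    have "(\<lambda>j. if Suc n \<le> j then a j else 0) = 0"
      using a by (auto simp: M_def zero_fun_apply fun_eq_iff)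
    then show ?case by simp
  next
    case (step k)
    have e: "(\<lambda>j. (if Suc k \<le> j then a j else 0) + (if j = k then a k else 0)) = (\<lambda>j. if k \<le> j then a j else 0)"
      by (auto simp: fun_eq_iff)
    have M: "(\<lambda>j. if k \<le> j then a j else 0) \<in> M" using a by (fastforce simp: M_def)
    have "mw (replicate (a k) k @ concat (map (\<lambda>l. replicate (a l) l) [Suc k..<Suc n])) = ev (\<lambda>j. if k \<le> j then a j else 0)"
      using mw_replicate[of k _ "\<lambda>j. if Suc k \<le> j then a j else 0" "a k", unfolded e] step M by simp
    moreover have "[k..<Suc n] = k # [Suc k..<Suc n]" using step by (simp add: upt_conv_Cons)
    ultimately show ?case by simp
  qed
  from this[of 1] have "mw (oword a) = ev (\<lambda>j. if 1 \<le> j then a j else 0)" unfolding oword_def by simp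
  also have "(\<lambda>j. if 1 \<le> j then a j else 0) = a" using a by (auto simp: M_def fun_eq_iff not_le)
  finally show ?thesis .
qed

subsection \<open>The defining ideal\<close>

lemma relations_carrier: "qci_relations n m q \<subseteq> carrier FA"
proof -
  have g: "free_gen i \<in> carrier FA" if "1 \<le> i" "i \<le> n" for i
    unfolding free_gen_def by (rule W_carrier) (use that in simp)
  show ?thesis
    unfolding qci_relations_def
    by (auto simp: free_gen_power intro!: W_carrier free_algebra_closed g)
qed

lemma ideal_I: "ideal I FA"
  by (rule ring.genideal_ideal[OF ring_free_algebra relations_carrier])

lemma I_carrier: "f \<in> I \<Longrightarrow> f \<in> carrier FA"
  using ideal.axioms(1)[OF ideal_I] additive_subgroup.a_subset by blast

lemma I_relation: "r \<in> qci_relations n m q \<Longrightarrow> r \<in> I"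
  using ring.genideal_self[OF ring_free_algebra relations_carrier] by blast

lemma I_zero: "0 \<in> I"
  using additive_subgroup.zero_closed[OF ideal.axioms(1)[OF ideal_I]] by simp

lemma I_add: "f \<in> I \<Longrightarrow> g \<in> I \<Longrightarrow> f + g \<in> I"
  using additive_subgroup.a_closed[OF ideal.axioms(1)[OF ideal_I]] by simp

lemma I_mult_left: "f \<in> carrier FA \<Longrightarrow> g \<in> I \<Longrightarrow> f * g \<in> I"
  using ideal.I_l_closed[OF ideal_I] by simp

lemma I_mult_right: "f \<in> carrier FA \<Longrightarrow> g \<in> I \<Longrightarrow> g * f \<in> I"
  using ideal.I_r_closed[OF ideal_I] by simp

lemma I_sum: "(\<And>x. x \<in> S \<Longrightarrow> f x \<in> I) \<Longrightarrow> sum f S \<in> I"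
  by (induction S rule: infinite_finite_induct) (simp_all add: I_zero I_add)

lemma cmap_relations:
  assumes "r \<in> qci_relations n m q"
  shows "cmap r = 0"
proof -
  from assms consider i where "i \<in> {1..n}" "r = free_gen i ^ m i"
    | i j where "1 \<le> i" "i < j" "j \<le> n" "r = free_gen i * free_gen j - W [] (q i j) * (free_gen j * free_gen i)"
    unfolding qci_relations_def by auto
  then show ?thesis
  proof cases
    case 1
    obtain r' where r': "m i = Suc r'" using exponents[OF 1(1)] by (cases "m i") auto
    define c where "c = (\<lambda>j. 0 + (if j = i then r' else 0))"
    have cM: "c \<in> M" using 1 r' exponents by (force simp: c_def M_def)
    have "mw (replicate r' i @ []) = ev c"
      unfolding c_def by (rule mw_replicate[OF 1(1)]) (use cM in \<open>simp_all add: c_def zero_fun_def\<close>)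
    moreover have "ux i + c \<notin> M" using 1 r' by (auto simp: M_def c_def ux_def plus_fun_apply)
    ultimately have "mw (replicate (m i) i) = 0" using 1 cM by (simp add: r' mul_ev)
    then show ?thesis by (simp add: 1 free_gen_power cmap_W)
  next
    case 2
    have ij: "i \<in> {1..n}" "j \<in> {1..n}" using 2 by auto
    have "quantum_bichar n q (ux i) (ux j) = 1"
      unfolding bichar_ux[OF ij(1)] by (rule prod.neutral) (use 2 in \<open>auto simp: ux_def\<close>)
    moreover have "quantum_bichar n q (ux j) (ux i) = inverse (q i j)"
    proof -
      have "quantum_bichar n q (ux j) (ux i) = (\<Prod>l\<in>{1..<j}. if l = i then inverse (q i j) else 1)"
        unfolding bichar_ux[OF ij(2)] by (rule prod.cong) (auto simp: ux_def)
      then show ?thesis using 2 by simp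
    qed
    moreover have "cmap r = mul (X i) (X j) - sc (q i j) (mul (X j) (X i))"
      unfolding 2(4) free_gen_def W_mult cmap_diff cmap_W
      using ij by (simp add: mul_distribs)
    ultimately show ?thesis
      using ij q_nz[OF 2(1-3)] by (simp add: mul_ev add.commute)
  qed
qed

lemma cmap_I:
  assumes "f \<in> I"
  shows "cmap f = 0"
proof -
  let ?K = "{f \<in> carrier FA. cmap f = 0}"
  have "ideal ?K FA"
  proof (rule idealI[OF ring_free_algebra])
    show "subgroup ?K (add_monoid FA)"
    proof (rule subgroup.intro)
      fix x assume "x \<in> ?K"
      then show "inv\<^bsub>add_monoid FA\<^esub> x \<in> ?K"
        using free_algebra_a_inv[of x n] free_algebra_closed(3)[of x n x] by (simp add: a_inv_def cmap_minus)
    qed (auto simp: free_algebra_closed free_algebra_zero cmap_add cmap_0)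
  qed (auto simp: free_algebra_closed cmap_mult)
  moreover have "qci_relations n m q \<subseteq> ?K" using relations_carrier cmap_relations by blast
  ultimately have "I \<subseteq> ?K" by (rule ring.genideal_minimal[OF ring_free_algebra])
  then show ?thesis using assms by blast
qed

definition cg :: "(fword \<Rightarrow>\<^sub>0 'k) \<Rightarrow> (fword \<Rightarrow>\<^sub>0 'k) \<Rightarrow> bool"
  where "cg f g \<longleftrightarrow> f - g \<in> I"

lemma cg_refl [simp]: "cg f f"
  by (simp add: cg_def I_zero)

lemma cg_trans: "cg f g \<Longrightarrow> cg g h \<Longrightarrow> cg f h"
  using I_add[of "f - g" "g - h"] by (simp add: cg_def)

lemma cg_mult_left: "h \<in> carrier FA \<Longrightarrow> cg f g \<Longrightarrow> cg (h * f) (h * g)"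
  using I_mult_left[of h "f - g"] by (simp add: cg_def right_diff_distrib)

lemma cg_sum: "(\<And>x. x \<in> S \<Longrightarrow> cg (f x) (g x)) \<Longrightarrow> cg (sum f S) (sum g S)"
  using I_sum[of S "\<lambda>x. f x - g x"] by (simp add: cg_def sum_subtractf)

text \<open>The letter is moved right past smaller ones, one at a time; the defining relation
  multiplied by \<open>- inverse (q l i)\<close> is the rule rewriting \<open>x_i x_l\<close> to a
  multiple of \<open>x_l x_i\<close>.\<close>

lemma straighten:
  assumes i: "i \<in> {1..n}" and u: "set u \<subseteq> {1..<i}" and v: "set v \<subseteq> {1..n}"
  shows "cg (W (i # u @ v) 1) (W (u @ i # v) (\<Prod>l\<leftarrow>u. inverse (q l i)))"
  using u
proof (induction u)
  case (Cons l u)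
  have l: "1 \<le> l" "l < i" "i \<le> n" and u: "set u \<subseteq> {1..<i}" using Cons.prems i by auto
  have un: "set u \<subseteq> {1..n}" using u i by force
  let ?r = "free_gen l * free_gen i - q l i \<odot>\<^bsub>FA\<^esub> (free_gen i * free_gen l)" and ?c = "inverse (q l i)"
  let ?p = "\<Prod>l\<leftarrow>u. inverse (q l i)"
  have "?r \<in> I" by (rule I_relation) (use l in \<open>unfold qci_relations_def, blast\<close>)
  then have "W [] (- ?c) * ?r * W (u @ v) 1 \<in> I"
    by (intro I_mult_right[OF W_carrier] I_mult_left[OF W_carrier]) (use un v in auto)
  moreover have "W [] (- ?c) * ?r * W (u @ v) 1 = W (i # l # u @ v) 1 - W (l # i # u @ v) ?c"
    using q_nz[OF l]
    by (simp add: free_gen_def W_mult right_diff_distrib left_diff_distrib single_uminus)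
  ultimately have 1: "cg (W (i # l # u @ v) 1) (W (l # i # u @ v) ?c)" by (simp only: cg_def)
  have "cg (W [l] ?c * W (i # u @ v) 1) (W [l] ?c * W (u @ i # v) ?p)"
    by (rule cg_mult_left[OF W_carrier Cons.IH[OF u]]) (use l in auto)
  then have "cg (W (l # i # u @ v) ?c) (W (l # u @ i # v) (?c * ?p))" by (simp add: W_mult)
  from cg_trans[OF 1 this] show ?case by simp
qed simp

text \<open>The linear section of \<open>cmap\<close> given by sorted words.\<close>

definition N :: "'k coords \<Rightarrow> fword \<Rightarrow>\<^sub>0 'k"
  where "N v = (\<Sum>a\<in>M. W (oword a) (v a))"

lemma N_carrier: "N v \<in> carrier FA"
  unfolding N_def by (intro free_algebra_sum W_carrier oword_letters)

lemma N_sc: "N (sc c v) = W [] c * N v"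
  by (simp add: N_def fapply sum_distrib_left W_mult)

lemma N_add: "N (u + v) = N u + N v"
  by (simp add: N_def fapply single_add sum.distrib)

lemma N_0: "N 0 = 0"
  by (simp add: N_def fapply)

lemma N_sum: "N (sum f S) = (\<Sum>x\<in>S. N (f x))"
  by (induction S rule: infinite_finite_induct) (simp_all add: N_0 N_add)

lemma N_ev:
  assumes "a \<in> M"
  shows "N (ev a) = W (oword a) 1"
proof -
  have "N (ev a) = (\<Sum>b\<in>M. if b = a then W (oword a) 1 else 0)"
    unfolding N_def by (rule sum.cong) (auto simp: ev_def)
  then show ?thesis using assms finite_M by simp
qed

lemma cmap_N:
  assumes "v \<in> VM"
  shows "cmap (N v) = v"
proof -
  have "cmap (N v) = (\<Sum>a\<in>M. sc (v a) (ev a))"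
    unfolding N_def cmap_sum by (rule sum.cong) (auto simp: cmap_W mw_oword)
  then show ?thesis using VM_expand[OF assms] by simp
qed

lemma prod_list_segments: "(\<Prod>l\<leftarrow>concat (map (\<lambda>l. replicate (a l) l) xs). f l) = (\<Prod>l\<leftarrow>xs. f l ^ a l :: 'k)"
  by (induction xs) (simp_all add: prod_list_replicate map_replicate)

text \<open>The new letter is sorted into place. If its exponent stays below \<open>m i\<close> the
  result is a normal form; otherwise the word contains the factor \<open>x_i^(m i)\<close> and lies
  in the ideal, matching the zero product in the model.\<close>

lemma generator_step:
  assumes i: "i \<in> {1..n}" and a: "a \<in> M"
  shows "cg (W (i # oword a) 1) (N (mul (X i) (ev a)))"
proof -
  let ?s = "\<lambda>a j k. concat (map (\<lambda>l. replicate (a l) l) [j..<k])"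
  let ?u = "?s a 1 i" and ?v = "?s a (Suc i) (Suc n)"
  have split: "oword b = ?s b 1 i @ replicate (b i) i @ ?s b (Suc i) (Suc n)" for b
  proof -
    have "[1..<Suc n] = [1..<i] @ i # [Suc i..<Suc n]"
      using i upt_add_eq_append[of 1 i "Suc n - i"] by (simp add: upt_conv_Cons)
    then show ?thesis by (simp add: oword_def)
  qed
  have u: "set ?u \<subseteq> {1..<i}" by (rule set_segment)
  have v': "set ?v \<subseteq> {1..n}" using set_segment[of a "Suc i" "Suc n"] i by auto
  then have v: "set (replicate (a i) i @ ?v) \<subseteq> {1..n}" using i by auto
  have "(\<Prod>l\<leftarrow>?u. inverse (q l i)) = quantum_bichar n q (ux i) a"
    unfolding prod_list_segments bichar_ux[OF i]
    using prod.distinct_set_conv_list[of "[1..<i]" "\<lambda>l. inverse (q l i) ^ a l"] by simp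
  then have 1: "cg (W (i # oword a) 1) (W (?u @ replicate (Suc (a i)) i @ ?v) (quantum_bichar n q (ux i) a))"
    using straighten[OF i u v] split[of a] by simp
  show ?thesis
  proof (cases "ux i + a \<in> M")
    case True
    have "?s (ux i + a) 1 i = ?u" "?s (ux i + a) (Suc i) (Suc n) = ?v"
      by (rule arg_cong[of _ _ concat], rule map_cong, simp_all add: ux_def plus_fun_apply del: upt_Suc)+
    then have "oword (ux i + a) = ?u @ replicate (Suc (a i)) i @ ?v"
      unfolding split[of "ux i + a"] by (simp only:) (simp add: ux_def plus_fun_apply plus_1_eq_Suc del: upt_Suc)
    then show ?thesis
      using 1 True by (simp add: X_mul_ev N_sc N_ev W_mult)
  next
    case False
    have "\<not> Suc (a i) < m i"
    proof
      assume "Suc (a i) < m i"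
      then have "ux i + a \<in> M" using a i by (auto simp: M_def ux_def plus_fun_apply plus_1_eq_Suc)
      then show False using False by blast
    qed
    moreover have "a i < m i" using a i by (simp add: M_def)
    ultimately have mi: "Suc (a i) = m i" by simp
    have "free_gen i ^ m i \<in> I" by (rule I_relation) (use i in \<open>auto simp: qci_relations_def\<close>)
    then have "W ?u (quantum_bichar n q (ux i) a) * free_gen i ^ m i * W ?v 1 \<in> I"
      using u v' i by (intro I_mult_right[OF W_carrier] I_mult_left[OF W_carrier]) auto
    then have "W (?u @ replicate (Suc (a i)) i @ ?v) (quantum_bichar n q (ux i) a) \<in> I"
      by (simp add: free_gen_power W_mult mi del: replicate_Suc)
    then have "cg (W (?u @ replicate (Suc (a i)) i @ ?v) (quantum_bichar n q (ux i) a)) 0" by (simp add: cg_def)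
    from cg_trans[OF 1 this] show ?thesis using i a False by (simp add: mul_ev N_0)
  qed
qed

lemma word_normal_form: "set w \<subseteq> {1..n} \<Longrightarrow> cg (W w 1) (N (mw w))"
proof (induction w)
  case Nil
  have "oword 0 = []" by (simp add: oword_def zero_fun_apply)
  then show ?case by (simp add: N_ev)
next
  case (Cons i w)
  then have i: "i \<in> {1..n}" by simp
  define v where "v = mw w"
  have 1: "cg (W [i] 1 * W w 1) (W [i] 1 * N v)"
    unfolding v_def by (rule cg_mult_left[OF W_carrier Cons.IH]) (use Cons.prems in auto)
  have 2: "W [i] 1 * N v = (\<Sum>a\<in>M. W [] (v a) * W (i # oword a) 1)"
    by (simp add: N_def sum_distrib_left W_mult)
  have 3: "cg (\<Sum>a\<in>M. W [] (v a) * W (i # oword a) 1) (\<Sum>a\<in>M. W [] (v a) * N (mul (X i) (ev a)))"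
    by (intro cg_sum cg_mult_left W_carrier generator_step[OF i]) auto
  have 4: "(\<Sum>a\<in>M. W [] (v a) * N (mul (X i) (ev a))) = N (mul (X i) v)"
  proof -
    have "mul (X i) v = mul (X i) (\<Sum>a\<in>M. sc (v a) (ev a))" using VM_expand[of v] by (simp add: v_def)
    then show ?thesis by (simp add: mul_sum_right mul_sc_right N_sum N_sc)
  qed
  have "cg (W [i] 1 * W w 1) (N (mul (X i) v))" by (rule cg_trans[OF 1 3[folded 2, unfolded 4]])
  then show ?case by (simp add: W_mult v_def)
qed

lemma normal_form:
  assumes "f \<in> carrier FA"
  shows "cg f (N (cmap f))"
proof -
  let ?c = "Poly_Mapping.lookup f"
  have f: "f = (\<Sum>w\<in>Poly_Mapping.keys f. W [] (?c w) * W (letters w) 1)"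
    using poly_mapping_expand[of f] by (simp add: W_Nil_mult)
  have "cg (\<Sum>w\<in>Poly_Mapping.keys f. W [] (?c w) * W (letters w) 1) (\<Sum>w\<in>Poly_Mapping.keys f. W [] (?c w) * N (mw (letters w)))"
    by (intro cg_sum cg_mult_left W_carrier word_normal_form) (use assms in \<open>auto simp: free_algebra_carrier\<close>)
  then show ?thesis using f by (simp add: cmap_def N_sum N_sc)
qed

text \<open>The relations evaluate to zero, and conversely every element is congruent to the normal
  form of its value. So the monomials in \<open>M\<close> form a basis of the quotient.\<close>

lemma cg_iff_cmap:
  assumes "f \<in> carrier FA" "g \<in> carrier FA"
  shows "f - g \<in> I \<longleftrightarrow> cmap f = cmap g"
proof
  show "f - g \<in> I \<Longrightarrow> cmap f = cmap g" using cmap_I[of "f - g"] by (simp add: cmap_diff)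
  assume "cmap f = cmap g"
  then have "cg (f - g) 0"
    using normal_form[OF free_algebra_closed(4)[OF assms]] by (simp add: cmap_diff N_0)
  then show "f - g \<in> I" by (simp add: cg_def)
qed

subsection \<open>The coordinate map\<close>

abbreviation QA :: "('k, (fword \<Rightarrow>\<^sub>0 'k) set) module"
  where "QA \<equiv> quantum_complete_intersection n m q"

abbreviation qc :: "(fword \<Rightarrow>\<^sub>0 'k) \<Rightarrow> (fword \<Rightarrow>\<^sub>0 'k) set"
  where "qc f \<equiv> I +>\<^bsub>FA\<^esub> f"

text \<open>Evaluation at an arbitrary member of the coset, well defined because \<open>cmap\<close>
  vanishes on the ideal.\<close>

definition cco :: "(fword \<Rightarrow>\<^sub>0 'k) set \<Rightarrow> 'k coords"
  where "cco Z = cmap (SOME f. f \<in> Z)"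

lemma qc_eq: "qc f = {h + f | h. h \<in> I}"
  by (auto simp: a_r_coset_def r_coset_def)

lemma qc_eq_iff: "f \<in> carrier FA \<Longrightarrow> g \<in> carrier FA \<Longrightarrow> qc f = qc g \<longleftrightarrow> cmap f = cmap g"
  using ring.quotient_eq_iff_same_a_r_cos[OF ring_free_algebra ideal_I, of f g]
  by (simp add: free_algebra_a_minus cg_iff_cmap)

lemma cco_qc: "cco (qc f) = cmap f"
proof -
  have "0 + f \<in> qc f" using I_zero unfolding qc_eq by blast
  then have "(SOME g. g \<in> qc f) \<in> qc f" by (rule someI)
  then obtain h where "h \<in> I" "(SOME g. g \<in> qc f) = h + f" unfolding qc_eq by blast
  then show ?thesis by (simp add: cco_def cmap_add cmap_I)
qed

lemma QA_carrier: "carrier QA = qc ` carrier FA"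
  by (auto simp: quantum_complete_intersection_def quot_alg_def FactRing_def A_RCOSETS_def RCOSETS_def a_r_coset_def)

lemma QA_ops:
  assumes "f \<in> carrier FA" "g \<in> carrier FA"
  shows "qc f \<oplus>\<^bsub>QA\<^esub> qc g = qc (f + g)" "qc f \<otimes>\<^bsub>QA\<^esub> qc g = qc (f * g)" "c \<odot>\<^bsub>QA\<^esub> qc f = qc (W [] c * f)"
proof -
  show "qc f \<oplus>\<^bsub>QA\<^esub> qc g = qc (f + g)"
    using ideal.a_rcos_sum[OF ideal_I assms] by (simp add: quantum_complete_intersection_def quot_alg_def FactRing_def)
  show "qc f \<otimes>\<^bsub>QA\<^esub> qc g = qc (f * g)"
    using ideal.rcoset_mult_add[OF ideal_I assms] by (simp add: quantum_complete_intersection_def quot_alg_def FactRing_def)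
  have "qc (W [] c * x) = qc (W [] c * f)" if x: "x \<in> qc f" for x
  proof -
    obtain h where h: "h \<in> I" "x = h + f" using x unfolding qc_eq by blast
    have "cmap (W [] c * x) = cmap (W [] c * f)" using h cmap_I by (simp add: cmap_mult cmap_add)
    then show ?thesis
      using h assms I_carrier by (subst qc_eq_iff) (auto intro!: free_algebra_closed W_carrier)
  qed
  moreover have "qc f \<noteq> {}" using I_zero unfolding qc_eq by blast
  ultimately have "(\<Union>x\<in>qc f. qc (W [] c * x)) = qc (W [] c * f)" by blast
  then show "c \<odot>\<^bsub>QA\<^esub> qc f = qc (W [] c * f)"
    by (simp add: quantum_complete_intersection_def quot_alg_def)
qed

lemma QA_one: "\<one>\<^bsub>QA\<^esub> = qc 1" and QA_zero: "\<zero>\<^bsub>QA\<^esub> = qc 0"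
  by (simp_all add: quantum_complete_intersection_def quot_alg_def FactRing_def qc_eq)

lemma qalg_QA: "qalg n m (quantum_bichar n q) QA cco"
proof
  show "inj_on cco (carrier QA)"
    unfolding QA_carrier by (rule inj_onI) (elim imageE, simp only: cco_qc qc_eq_iff)
  show "cco ` carrier QA = VM"
  proof (intro equalityI subsetI)
    show "v \<in> VM" if "v \<in> cco ` carrier QA" for v
      using that by (auto simp: QA_carrier cco_qc cmap_VM)
    show "v \<in> cco ` carrier QA" if "v \<in> VM" for v
    proof -
      have "cco (qc (N v)) = v" by (simp only: cco_qc cmap_N[OF that])
      then show ?thesis unfolding QA_carrier using N_carrier by (metis imageI)
    qed
  qed
  fix x y c assume "x \<in> carrier QA"
  then obtain f where f: "x = qc f" "f \<in> carrier FA" by (auto simp: QA_carrier)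
  have cf: "W [] c * f \<in> carrier FA" using f by (intro free_algebra_closed W_carrier) auto
  show "c \<odot>\<^bsub>QA\<^esub> x \<in> carrier QA" "cco (c \<odot>\<^bsub>QA\<^esub> x) = sc c (cco x)"
    unfolding f(1) QA_ops(3)[OF f(2) f(2)] using cf by (simp_all add: QA_carrier cco_qc cmap_mult cmap_W mul_distribs proj_VM cmap_VM)
  assume "y \<in> carrier QA"
  then obtain g where g: "y = qc g" "g \<in> carrier FA" by (auto simp: QA_carrier)
  note fg = free_algebra_closed[OF f(2) g(2)]
  show "x \<oplus>\<^bsub>QA\<^esub> y \<in> carrier QA" "x \<otimes>\<^bsub>QA\<^esub> y \<in> carrier QA" "cco (x \<oplus>\<^bsub>QA\<^esub> y) = cco x + cco y"
      "cco (x \<otimes>\<^bsub>QA\<^esub> y) = mul (cco x) (cco y)"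
    unfolding f(1) g(1) QA_ops[OF f(2) g(2)] using fg by (simp_all add: QA_carrier cco_qc cmap_add cmap_mult)
next
  show "\<zero>\<^bsub>QA\<^esub> \<in> carrier QA" "\<one>\<^bsub>QA\<^esub> \<in> carrier QA"
    unfolding QA_zero QA_one QA_carrier using free_algebra_zero free_algebra_one by blast+
  show "cco \<zero>\<^bsub>QA\<^esub> = 0" "cco \<one>\<^bsub>QA\<^esub> = un"
    unfolding QA_zero QA_one cco_qc by (simp_all add: cmap_0) (simp add: one_W cmap_W)
qed

end

text \<open>Both characteristics deliver the same two facts, dependence of n + 1 representatives
  modulo inner derivations and a torus containing all diagonal classes, and the dimension count is
  common to them. The bound \<open>m i \<ge> 2\<close> keeps each \<open>x_i\<close> nonzero; for
  \<open>m i = 1\<close> the generator would vanish and not contribute to the rank.\<close>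

theorem corollary5p8:
  fixes n :: nat
    and m :: "nat \<Rightarrow> nat"
    and q :: "nat \<Rightarrow> nat \<Rightarrow> 'k::alg_closed_field"
  assumes "\<And>i. 1 \<le> i \<Longrightarrow> i \<le> n \<Longrightarrow> m i \<ge> 2"
    and "\<And>i j. 1 \<le> i \<Longrightarrow> i < j \<Longrightarrow> j \<le> n \<Longrightarrow> q i j \<noteq> 0"
  shows "mt_rank_HH1 (quantum_complete_intersection n m q) = n"
proof -
  interpret C: qci n m q by standard (use assms in auto)
  interpret Q: qalg n m "quantum_bichar n q" "quantum_complete_intersection n m q" C.cco by (rule C.qalg_QA)
  let ?A = "quantum_complete_intersection n m q"
  let ?dim = "\<lambda>T. vectorspace.dim class_ring (HH1 ?A\<lparr>carrier := T\<rparr>)"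
  have torus: "LinearCombinations.submodule class_ring T (HH1 ?A) \<and>
      (\<forall>f. (\<forall>i. i \<le> n \<longrightarrow> C.cder (f i) \<and> Q.cls (f i) \<in> T) \<longrightarrow>
        (\<exists>c. (\<exists>i\<le>n. c i \<noteq> 0) \<and> (\<lambda>v. \<Sum>i\<le>n. sc (c i) (f i v)) \<in> Q.cInn))" if T: "HH1_torus ?A T" for T
  proof (cases "CHAR('k) = 0")
    case True
    have "(2 :: 'k) \<noteq> 0" using of_nat_eq_0_iff_char_dvd[of 2, where 'a = 'k] True by simp
    then show ?thesis using Q.torus_char_0_dependent[of T] T True unfolding HH1_torus_def by auto
  next
    case False
    then have t: "torus_char_p ?A T" using T unfolding HH1_torus_def by simp
    then have "LinearCombinations.submodule class_ring T (HH1 ?A)"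
      unfolding torus_char_p_def restricted_subalgebra_def by blast
    then show ?thesis using Q.torus_char_p_dependent[OF _ t] False by auto
  qed
  have le: "?dim T \<le> n" if "HH1_torus ?A T" for T
    by (rule Q.dim_HH1_subspace(1)) (use torus[OF that] in blast)+
  have "\<exists>T. HH1_torus ?A T \<and> (\<forall>c. Q.cls (Q.dg c) \<in> T)"
  proof (cases "CHAR('k) = 0")
    case True
    then show ?thesis using Q.torus_char_0_HT unfolding HH1_torus_def by auto
  next
    case False
    then show ?thesis using Q.dg_torus unfolding HH1_torus_def by auto
  qed
  then obtain T where T: "HH1_torus ?A T" "\<And>c. Q.cls (Q.dg c) \<in> T" by blast
  have dim: "?dim T = n" by (rule Q.dim_HH1_subspace(2)[OF _ _ T(2)]) (use torus[OF T(1)] in blast)+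
  have "finite {?dim T | T. HH1_torus ?A T}"
    by (rule finite_subset[of _ "{..n}"]) (use le in auto)
  moreover have "n \<in> {?dim T | T. HH1_torus ?A T}"
    by (intro CollectI exI[of _ T] conjI T(1)) (rule dim[symmetric])
  ultimately show ?thesis
    unfolding mt_rank_HH1_def using le by (intro Max_eqI) blast+
qed

end
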